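(* Let $Y$ be a simply connected, locally compact absolute neighborhood retract with exactly one end. If there exists an infinite cyclic group $J$ acting as covering transformations on $Y$ and generated by a coaxial homeomorphism $j$, then $Y$ has semistable and pro-free fundamental pro-group at infinity.
   Context: All spaces (including orbit spaces of actions by covering transformations) are separable and metrizable. A group acts on $Y$ by (as) covering transformations if it acts freely and the quotient map onto the orbit space is a covering projection. Coaxial: let $j:Y\to Y$ be a homeomorphism of a simply connected locally compact ANR generating an infinite cyclic group $J=\langle j\rangle$ acting by covering transformations. Write $J\cdot D=\bigcup_{m\in\mathbb{Z}}j^m(D)$. Then $j$ is coaxial if for every compact $C\subseteq Y$ there is a larger compact $D\subseteq Y$ such that every loop in $Y-J\cdot D$ contracts (is null-homotopic) in $Y-C$. Fundamental pro-group at infinity: let $\{C_n\}$ be an expanding sequence of compact sets exhausting $Y$, and $\omega:[0,\infty)\to Y$ a proper ray parametrized so that $\omega([n,n+1])\subseteq Y-C_n$. The fundamental pro-group of $Y$ at infinity based at $\omega$ is the inverse sequence $\{\pi_1(Y-C_n,\omega(n))\}$ with bonding homomorphisms induced by inclusion followed by change of base point along the segments of $\omega$; up to pro-isomorphism it is independent of $\{C_n\}$, and in the semistable one-ended case it is also independent of $\omega$. Two inverse sequences of groups are pro-isomorphic if, after passing to subsequences, they fit into a commuting ladder diagram of homomorphisms going alternately between them. An inverse sequence of groups is semistable if it is pro-isomorphic to a sequence whose bonding maps are epimorphisms, and pro-free if it is pro-isomorphic to an inverse sequence of free groups. *)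

theory Defs
  imports "HOL-Analysis.Analysis" "HOL-Algebra.Group_Action" "HOL-Algebra.Elementary_Groups"
begin

section \<open>Absolute neighbourhood retracts and ends\<close>

text \<open>
  Absolute neighbourhood retracts for the class of separable metrizable spaces.  The library's
  \<^const>\<open>ANR\<close> only tests subsets of Euclidean spaces, whereas here infinite-dimensional
  spaces are allowed.  A separable metrizable space has at most continuum many points, so every such
  ambient space \<open>Z\<close> is homeomorphic to a topology carried by the type
  \<^typ>\<open>nat \<Rightarrow> real\<close> (also, to a subspace of the countable power of the real line).  Thus
  nothing is lost by letting \<open>Z\<close> range over topologies on this single type.
\<close>

definition ANR_space :: "'a topology \<Rightarrow> bool" where
  "ANR_space X \<longleftrightarrow>
     metrizable_space X \<and> separable_space X \<and>
     (\<forall>(Z :: (nat \<Rightarrow> real) topology) f.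
        metrizable_space Z \<and> separable_space Z \<and>
        embedding_map X Z f \<and> closedin Z (f ` topspace X) \<longrightarrow>
        (\<exists>U. openin Z U \<and> f ` topspace X \<subseteq> U \<and>
             (f ` topspace X) retract_of_space (subtopology Z U)))"

text \<open>
  The ends of \<open>Y\<close>: the inverse limit, over all compact \<open>C \<subseteq> Y\<close>, of the sets of components of
  \<open>Y - C\<close>.  The value of an end on \<open>C\<close> never has compact closure \<open>K\<close> in \<open>Y\<close>, since its value
  on \<open>C \<union> K\<close> would be a nonempty subset of \<open>K\<close> missing \<open>K\<close>.
\<close>

definition ends :: "'a::topological_space set \<Rightarrow> ('a set \<Rightarrow> 'a set) set" where
  "ends Y = {e \<in> (\<Pi>\<^sub>E C\<in>{C. compact C \<and> C \<subseteq> Y}. components (Y - C)).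
     \<forall>C D. compact C \<and> compact D \<and> C \<subseteq> D \<and> D \<subseteq> Y \<longrightarrow> e D \<subseteq> e C}"

section \<open>Covering transformations\<close>

text \<open>The analogue of \<^const>\<open>covering_space\<close> for abstract topologies.\<close>

definition covering_projection :: "'a topology \<Rightarrow> ('a \<Rightarrow> 'b) \<Rightarrow> 'b topology \<Rightarrow> bool" where
  "covering_projection E p B \<longleftrightarrow>
     continuous_map E B p \<and> p ` topspace E = topspace B \<and>
     (\<forall>b\<in>topspace B. \<exists>U. b \<in> U \<and> openin B U \<and>
        (\<exists>\<V>. \<Union>\<V> = {x \<in> topspace E. p x \<in> U} \<and>
             (\<forall>V\<in>\<V>. openin E V) \<and>
             pairwise disjnt \<V> \<and>
             (\<forall>V\<in>\<V>. homeomorphic_map (subtopology E V) (subtopology B U) p)))"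

definition orbit_space ::
    "('g, 'm) monoid_scheme \<Rightarrow> 'a::topological_space set \<Rightarrow> ('g \<Rightarrow> 'a \<Rightarrow> 'a) \<Rightarrow> 'a set topology" where
  "orbit_space G Y \<phi> =
     topology (\<lambda>U. U \<subseteq> orbits G Y \<phi> \<and> openin (top_of_set Y) {y \<in> Y. orbit G \<phi> y \<in> U})"

lemma openin_orbit_space:
  "openin (orbit_space G Y \<phi>) U \<longleftrightarrow>
     U \<subseteq> orbits G Y \<phi> \<and> openin (top_of_set Y) {y \<in> Y. orbit G \<phi> y \<in> U}"
proof -
  have "istopology (\<lambda>U. U \<subseteq> orbits G Y \<phi> \<and> openin (top_of_set Y) {y \<in> Y. orbit G \<phi> y \<in> U})"
    unfolding istopology_def
  proof (intro conjI allI impI)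
    fix S T
    assume S: "S \<subseteq> orbits G Y \<phi> \<and> openin (top_of_set Y) {y \<in> Y. orbit G \<phi> y \<in> S}"
      and T: "T \<subseteq> orbits G Y \<phi> \<and> openin (top_of_set Y) {y \<in> Y. orbit G \<phi> y \<in> T}"
    have "{y \<in> Y. orbit G \<phi> y \<in> S \<inter> T} = {y \<in> Y. orbit G \<phi> y \<in> S} \<inter> {y \<in> Y. orbit G \<phi> y \<in> T}"
      by blast
    then show "openin (top_of_set Y) {y \<in> Y. orbit G \<phi> y \<in> S \<inter> T}"
      using S T by (simp add: openin_Int)
    show "S \<inter> T \<subseteq> orbits G Y \<phi>"
      using S by blast
  next
    fix \<K>
    assume K: "\<forall>S\<in>\<K>. S \<subseteq> orbits G Y \<phi> \<and> openin (top_of_set Y) {y \<in> Y. orbit G \<phi> y \<in> S}"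
    have "{y \<in> Y. orbit G \<phi> y \<in> \<Union>\<K>} = (\<Union>S\<in>\<K>. {y \<in> Y. orbit G \<phi> y \<in> S})"
      by blast
    then show "openin (top_of_set Y) {y \<in> Y. orbit G \<phi> y \<in> \<Union>\<K>}"
      using K by (simp only:) (blast intro: openin_Union)
    show "\<Union>\<K> \<subseteq> orbits G Y \<phi>"
      using K by blast
  qed
  then show ?thesis
    by (simp add: orbit_space_def topology_inverse')
qed

text \<open>
  By the standing convention that all spaces, orbit spaces included, are separable and metrizable,
  these properties of the orbit space are part of the notion.
\<close>

definition acts_by_covering_transformations ::
    "('g, 'm) monoid_scheme \<Rightarrow> 'a::topological_space set \<Rightarrow> ('g \<Rightarrow> 'a \<Rightarrow> 'a) \<Rightarrow> bool" where
  "acts_by_covering_transformations G Y \<phi> \<longleftrightarrow>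
     group_action G Y \<phi> \<and>
     (\<forall>g\<in>carrier G. homeomorphic_map (top_of_set Y) (top_of_set Y) (\<phi> g)) \<and>
     (\<forall>g\<in>carrier G. \<forall>y\<in>Y. \<phi> g y = y \<longrightarrow> g = \<one>\<^bsub>G\<^esub>) \<and>
     metrizable_space (orbit_space G Y \<phi>) \<and> separable_space (orbit_space G Y \<phi>) \<and>
     covering_projection (top_of_set Y) (orbit G \<phi>) (orbit_space G Y \<phi>)"

text \<open>
  The group generated by a self-bijection \<open>j\<close> of \<open>Y\<close>.  Elements of \<^term>\<open>BijGroup Y\<close> are
  extensional functions, hence the restriction.
\<close>

definition group_generated_by :: "'a set \<Rightarrow> ('a \<Rightarrow> 'a) \<Rightarrow> ('a \<Rightarrow> 'a) monoid" where
  "group_generated_by Y j = subgroup_generated (BijGroup Y) {restrict j Y}"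

definition translates :: "('a \<Rightarrow> 'a) monoid \<Rightarrow> 'a set \<Rightarrow> 'a set" where
  "translates J D = (\<Union>g\<in>carrier J. g ` D)"

definition coaxial :: "'a::topological_space set \<Rightarrow> ('a \<Rightarrow> 'a) \<Rightarrow> bool" where
  "coaxial Y j \<longleftrightarrow>
     (\<forall>C. compact C \<and> C \<subseteq> Y \<longrightarrow>
        (\<exists>D. compact D \<and> C \<subseteq> D \<and> D \<subseteq> Y \<and>
          (\<forall>p. path p \<and> pathfinish p = pathstart p \<and>
               path_image p \<subseteq> Y - translates (group_generated_by Y j) D \<longrightarrow>
               (\<exists>a. homotopic_loops (Y - C) p (\<lambda>_. a)))))"

section \<open>Inverse sequences of groups\<close>

definition inverse_sequence :: "(nat \<Rightarrow> 'g monoid) \<Rightarrow> (nat \<Rightarrow> 'g \<Rightarrow> 'g) \<Rightarrow> bool" where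
  "inverse_sequence G f \<longleftrightarrow> (\<forall>n. group (G n) \<and> f n \<in> hom (G (Suc n)) (G n))"

text \<open>For \<open>m \<le> n\<close>, the composite \<open>f m \<circ> \<dots> \<circ> f (n - 1)\<close> from the \<open>n\<close>-th to the \<open>m\<close>-th group.\<close>

definition bonding :: "(nat \<Rightarrow> 'g \<Rightarrow> 'g) \<Rightarrow> nat \<Rightarrow> nat \<Rightarrow> 'g \<Rightarrow> 'g" where
  "bonding f m n = foldr (\<lambda>i h. f i \<circ> h) [m..<n] id"

definition pro_isomorphic ::
    "(nat \<Rightarrow> 'g monoid) \<Rightarrow> (nat \<Rightarrow> 'g \<Rightarrow> 'g) \<Rightarrow> (nat \<Rightarrow> 'h monoid) \<Rightarrow> (nat \<Rightarrow> 'h \<Rightarrow> 'h) \<Rightarrow> bool" where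
  "pro_isomorphic G f H h \<longleftrightarrow>
     inverse_sequence G f \<and> inverse_sequence H h \<and>
     (\<exists>a b :: nat \<Rightarrow> nat. \<exists>u d. strict_mono a \<and> strict_mono b \<and>
        (\<forall>n. u n \<in> hom (H (b n)) (G (a n)) \<and>
             d n \<in> hom (G (a (Suc n))) (H (b n)) \<and>
             (\<forall>x\<in>carrier (G (a (Suc n))). u n (d n x) = bonding f (a n) (a (Suc n)) x) \<and>
             (\<forall>y\<in>carrier (H (b (Suc n))). d n (u (Suc n) y) = bonding h (b n) (b (Suc n)) y)))"

text \<open>
  HOL cannot quantify over the type carrying the comparison sequence \<open>H\<close>, but it suffices to use the
  element type \<open>'g\<close> of \<open>G\<close> itself.  Given a ladder to a sequence \<open>H\<close> over any type, replace each
  \<open>H (b n)\<close> by the image of \<open>d n\<close>; this is again a ladder, surjectivity of bonding maps and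
  freeness (Nielsen-Schreier) are preserved, and each new group injects as a set into \<open>'g\<close>.
\<close>

definition semistable :: "(nat \<Rightarrow> 'g monoid) \<Rightarrow> (nat \<Rightarrow> 'g \<Rightarrow> 'g) \<Rightarrow> bool" where
  "semistable G f \<longleftrightarrow>
     (\<exists>(H :: nat \<Rightarrow> 'g monoid) h. pro_isomorphic G f H h \<and> (\<forall>n. h n \<in> epi (H (Suc n)) (H n)))"

text \<open>A word is a list of letters \<open>(x, True)\<close>, standing for \<open>x\<close>, and \<open>(x, False)\<close>, standing for its inverse.\<close>

primrec word_value :: "('g, 'm) monoid_scheme \<Rightarrow> ('g \<times> bool) list \<Rightarrow> 'g" where
  "word_value G [] = \<one>\<^bsub>G\<^esub>"
| "word_value G (l # w) = (if snd l then fst l else inv\<^bsub>G\<^esub> (fst l)) \<otimes>\<^bsub>G\<^esub> word_value G w"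

definition reduced_word :: "('g \<times> bool) list \<Rightarrow> bool" where
  "reduced_word w \<longleftrightarrow> successively (\<lambda>k l. \<not> (fst k = fst l \<and> snd k \<noteq> snd l)) w"

definition free_basis :: "('g, 'm) monoid_scheme \<Rightarrow> 'g set \<Rightarrow> bool" where
  "free_basis G S \<longleftrightarrow> S \<subseteq> carrier G \<and>
     (\<forall>g\<in>carrier G. \<exists>!w. fst ` set w \<subseteq> S \<and> reduced_word w \<and> word_value G w = g)"

definition free_group :: "('g, 'm) monoid_scheme \<Rightarrow> bool" where
  "free_group G \<longleftrightarrow> group G \<and> (\<exists>S. free_basis G S)"

definition pro_free :: "(nat \<Rightarrow> 'g monoid) \<Rightarrow> (nat \<Rightarrow> 'g \<Rightarrow> 'g) \<Rightarrow> bool" where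
  "pro_free G f \<longleftrightarrow>
     (\<exists>(H :: nat \<Rightarrow> 'g monoid) h. pro_isomorphic G f H h \<and> (\<forall>n. free_group (H n)))"

section \<open>The fundamental pro-group at infinity\<close>

definition fundamental_group :: "'a::topological_space set \<Rightarrow> 'a \<Rightarrow> (real \<Rightarrow> 'a) set monoid" where
  "fundamental_group S x =
     \<lparr>carrier = {{q. homotopic_paths S p q} | p.
         path p \<and> path_image p \<subseteq> S \<and> pathstart p = x \<and> pathfinish p = x},
      mult = (\<lambda>A B. {r. \<exists>p\<in>A. \<exists>q\<in>B. homotopic_paths S (p +++ q) r}),
      one = {q. homotopic_paths S (\<lambda>_. x) q}\<rparr>"

text \<open>
  An expanding sequence of compact sets exhausting \<open>Y\<close>.  Exhausting means that every compact subset is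
  eventually swallowed, as is the case when each term lies in the interior of the next one and their
  union is \<open>Y\<close>; the bare condition that the union is \<open>Y\<close> would not make the pro-group well-defined.
\<close>

definition compact_exhaustion :: "'a::topological_space set \<Rightarrow> (nat \<Rightarrow> 'a set) \<Rightarrow> bool" where
  "compact_exhaustion Y C \<longleftrightarrow>
     (\<forall>n. compact (C n) \<and> C n \<subseteq> Y \<and> C n \<subseteq> C (Suc n)) \<and>
     (\<forall>K. compact K \<and> K \<subseteq> Y \<longrightarrow> (\<exists>n. K \<subseteq> C n))"

definition proper_ray :: "'a::topological_space set \<Rightarrow> (real \<Rightarrow> 'a) \<Rightarrow> bool" where
  "proper_ray Y \<omega> \<longleftrightarrow>
     continuous_on {0..} \<omega> \<and> \<omega> ` {0..} \<subseteq> Y \<and>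
     (\<forall>K. compact K \<and> K \<subseteq> Y \<longrightarrow> compact {t \<in> {0..}. \<omega> t \<in> K})"

definition adapted_ray :: "'a::topological_space set \<Rightarrow> (nat \<Rightarrow> 'a set) \<Rightarrow> (real \<Rightarrow> 'a) \<Rightarrow> bool" where
  "adapted_ray Y C \<omega> \<longleftrightarrow>
     proper_ray Y \<omega> \<and> (\<forall>n. \<omega> ` {real n..real (Suc n)} \<subseteq> Y - C n)"

definition pi1_at_infinity ::
    "'a::topological_space set \<Rightarrow> (nat \<Rightarrow> 'a set) \<Rightarrow> (real \<Rightarrow> 'a) \<Rightarrow> nat \<Rightarrow> (real \<Rightarrow> 'a) set monoid" where
  "pi1_at_infinity Y C \<omega> n = fundamental_group (Y - C n) (\<omega> (real n))"

definition ray_segment :: "(real \<Rightarrow> 'a) \<Rightarrow> nat \<Rightarrow> real \<Rightarrow> 'a" where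
  "ray_segment \<omega> n = (\<lambda>t. \<omega> (real n + t))"

definition pi1_at_infinity_bond ::
    "'a::topological_space set \<Rightarrow> (nat \<Rightarrow> 'a set) \<Rightarrow> (real \<Rightarrow> 'a) \<Rightarrow> nat \<Rightarrow>
       (real \<Rightarrow> 'a) set \<Rightarrow> (real \<Rightarrow> 'a) set" where
  "pi1_at_infinity_bond Y C \<omega> n A =
     {r. \<exists>p\<in>A. homotopic_paths (Y - C n)
                 (ray_segment \<omega> n +++ p +++ reversepath (ray_segment \<omega> n)) r}"

definition semistable_pi1_at_infinity :: "'a::topological_space set \<Rightarrow> bool" where
  "semistable_pi1_at_infinity Y \<longleftrightarrow>
     (\<forall>C \<omega>. compact_exhaustion Y C \<and> adapted_ray Y C \<omega> \<longrightarrow>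
        semistable (pi1_at_infinity Y C \<omega>) (pi1_at_infinity_bond Y C \<omega>))"

definition pro_free_pi1_at_infinity :: "'a::topological_space set \<Rightarrow> bool" where
  "pro_free_pi1_at_infinity Y \<longleftrightarrow>
     (\<forall>C \<omega>. compact_exhaustion Y C \<and> adapted_ray Y C \<omega> \<longrightarrow>
        pro_free (pi1_at_infinity Y C \<omega>) (pi1_at_infinity_bond Y C \<omega>))"

end

theory Submission
  imports Defs "HOL-Algebra.Multiplicative_Group"
begin

text \<open>Fix a compact set \<open>C\<close>.  By coaxiality there is a compact \<open>D\<close> such that loops off \<open>J \<cdot> D\<close> contract off \<open>C\<close>.
  Since \<open>Y\<close> has one end, some power of \<open>j\<close> preserves every deep component of \<open>Y - J \<cdot> D\<close>, so that a
  loop lying above all translates \<open>j\<^sup>m D\<close> with \<open>m \<le> N\<close> can be pushed along the powers of \<open>j\<close> until it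
  contracts off \<open>C\<close>; likewise for a loop below all translates with \<open>m \<ge> - N\<close>.  These two open parts \<open>A\<close> and
  \<open>B\<close> of \<open>Y\<close> cover the complement of a compact set \<open>E\<close>.  As in van Kampen's theorem, a loop in \<open>A \<union> B\<close> is
  determined in \<open>\<pi>\<^sub>1(Y - C)\<close> by the sequence of components of \<open>A \<inter> B\<close> through which it changes sides, so
  \<open>\<pi>\<^sub>1(Y - E) \<rightarrow> \<pi>\<^sub>1(Y - C)\<close> factors through a free group; this gives pro-freeness.  Its generators
  are represented by loops that go from a base point to such a component in \<open>A\<close> and return in \<open>B\<close>, and
  these can be chosen outside any given compact set; this gives the Mittag-Leffler condition, hence
  semistability.\<close>

section \<open>Homotopy of paths in arbitrary spaces\<close>

text \<open>Loops in \<open>A\<close> and in \<open>B\<close> die only in the larger set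
  \<open>Y - C\<close>, and \<open>A \<inter> B\<close> need not be connected, so van Kampen's
  theorem does not compute the groups themselves. For pro-groups a factorization is enough, and
  bundles provide it. The component in which a path changes sides is a locally constant function on
  \<open>A \<inter> B\<close>, hence the transition function of a principal bundle with free
  structure group. Its holonomy depends only on the homotopy class of the path, so no reduction of
  words has to be followed through a homotopy. A homomorphism into the fundamental group of
  \<open>Y - C\<close> carries this bundle to one with an explicit section along each loop, and
  comparing sections computes the image of the holonomy. Generators can be represented far out only
  if every component of \<open>A \<inter> B\<close> reaches outside the orbit of every compact set.
  Components that are bounded modulo the action are therefore added to the removed orbit. The
  remaining ones are numbered by natural numbers at every stage, so a single free group serves all
  stages.\<close>

lemma homotopic_paths_compose_unit_interval:
  assumes g: "path g" "path_image g \<subseteq> S"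
    and a: "path a" "path_image a \<subseteq> {0..1::real}" and b: "path b" "path_image b \<subseteq> {0..1}"
    and e: "pathstart a = pathstart b" "pathfinish a = pathfinish b"
  shows "homotopic_paths S (g \<circ> a) (g \<circ> b)"
proof -
  \<comment> \<open>Reparametrisations with equal end points are homotopic already in the parameter
    interval. The unit, inverse and subdivision laws below are instances with piecewise linear
    \<open>a\<close> and \<open>b\<close>.\<close>
  have "simply_connected {0..1::real}"
    by (simp add: convex_imp_simply_connected)
  then have "homotopic_paths {0..1::real} a b"
    using a b e by (simp add: simply_connected_eq_homotopic_paths)
  then show ?thesis
    by (rule homotopic_paths_continuous_image) (use g in \<open>auto simp: path_def path_image_def\<close>)
qed

lemma homotopic_paths_right_const:
  assumes "path p" "path_image p \<subseteq> S" "x = pathfinish p"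
  shows "homotopic_paths S (p +++ (\<lambda>_. x)) p"
proof -
  have "homotopic_paths S (p \<circ> (linepath 0 1 +++ linepath 1 1)) (p \<circ> linepath 0 1)"
    by (rule homotopic_paths_compose_unit_interval)
      (use assms in \<open>auto simp: path_image_join closed_segment_eq_real_ivl\<close>)
  moreover have "p \<circ> linepath 0 1 = p" "p \<circ> linepath 1 1 = (\<lambda>_. x)"
    using assms(3) by (auto simp: linepath_def fun_eq_iff pathfinish_def)
  ultimately show ?thesis
    by (simp add: path_compose_join)
qed

lemma homotopic_paths_left_const:
  assumes "path p" "path_image p \<subseteq> S" "x = pathstart p"
  shows "homotopic_paths S ((\<lambda>_. x) +++ p) p"
proof -
  have "homotopic_paths S (p \<circ> (linepath 0 0 +++ linepath 0 1)) (p \<circ> linepath 0 1)"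
    by (rule homotopic_paths_compose_unit_interval)
      (use assms in \<open>auto simp: path_image_join closed_segment_eq_real_ivl\<close>)
  moreover have "p \<circ> linepath 0 1 = p" "p \<circ> linepath 0 0 = (\<lambda>_. x)"
    using assms(3) by (auto simp: linepath_def fun_eq_iff pathstart_def)
  ultimately show ?thesis
    by (simp add: path_compose_join)
qed

lemma homotopic_paths_right_inverse:
  assumes "path p" "path_image p \<subseteq> S" "x = pathstart p"
  shows "homotopic_paths S (p +++ reversepath p) (\<lambda>_. x)"
proof -
  have "homotopic_paths S (p \<circ> (linepath 0 1 +++ linepath 1 0)) (p \<circ> linepath 0 0)"
    by (rule homotopic_paths_compose_unit_interval)
      (use assms in \<open>auto simp: path_image_join closed_segment_eq_real_ivl\<close>)
  moreover have "p \<circ> linepath 0 1 = p" "p \<circ> linepath 0 0 = (\<lambda>_. x)" "p \<circ> linepath 1 0 = reversepath p"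
    using assms(3) by (auto simp: linepath_def fun_eq_iff pathstart_def reversepath_def)
  ultimately show ?thesis
    by (simp add: path_compose_join)
qed

lemma homotopic_paths_left_inverse:
  assumes "path p" "path_image p \<subseteq> S" "x = pathfinish p"
  shows "homotopic_paths S (reversepath p +++ p) (\<lambda>_. x)"
  using homotopic_paths_right_inverse[of "reversepath p" S x] assms by simp

text \<open>The library's \<^const>\<open>subpath\<close> is restricted to normed vector spaces.\<close>

definition restrict_path :: "real \<Rightarrow> real \<Rightarrow> (real \<Rightarrow> 'a) \<Rightarrow> real \<Rightarrow> 'a" where
  "restrict_path s t p = p \<circ> linepath s t"

lemma restrict_path_same: "restrict_path s s p = (\<lambda>_. p s)"
  by (auto simp: restrict_path_def linepath_def fun_eq_iff algebra_simps)

lemma restrict_path_0_1 [simp]: "restrict_path 0 1 p = p"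
  by (auto simp: restrict_path_def linepath_def fun_eq_iff)

lemma homotopic_paths_join_restrict_path:
  assumes "path g" "path_image g \<subseteq> S" "u \<in> {0..1}" "v \<in> {0..1}" "w \<in> {0..1}"
  shows "homotopic_paths S (restrict_path u v g +++ restrict_path v w g) (restrict_path u w g)"
proof -
  have "homotopic_paths S (g \<circ> (linepath u v +++ linepath v w)) (g \<circ> linepath u w)"
    by (rule homotopic_paths_compose_unit_interval)
      (use assms in \<open>auto simp: path_image_join closed_segment_eq_real_ivl split: if_splits\<close>)
  then show ?thesis
    by (simp add: path_compose_join restrict_path_def)
qed

lemma path_const [simp]: "path (\<lambda>_. a)"
  by (simp add: path_def)

lemma path_image_const [simp]: "path_image (\<lambda>_. a) = {a}"
  by (auto simp: path_image_def)

lemma pathstart_const [simp]: "pathstart (\<lambda>_. a) = a"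
  by (simp add: pathstart_def)

lemma pathfinish_const [simp]: "pathfinish (\<lambda>_. a) = a"
  by (simp add: pathfinish_def)

lemma reversepath_const [simp]: "reversepath (\<lambda>_. a) = (\<lambda>_. a)"
  by (simp add: reversepath_def)

text \<open>The connecting path is the trace of the base point; both sides are the images of two paths in the
  unit square with the same end points.\<close>

lemma homotopic_loops_imp_conjugate:
  assumes "homotopic_loops S p q"
  obtains c where "path c" "path_image c \<subseteq> S" "pathstart c = pathstart p" "pathfinish c = pathstart q"
    "homotopic_paths S p (c +++ (q +++ reversepath c))"
proof -
  let ?Q = "{0..1::real} \<times> {0..1::real}"
  obtain h where h: "continuous_on ?Q h" "h \<in> ?Q \<rightarrow> S"
    "\<And>x. x \<in> {0..1} \<Longrightarrow> h (0, x) = p x" "\<And>x. x \<in> {0..1} \<Longrightarrow> h (1, x) = q x"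
    "\<And>t. t \<in> {0..1} \<Longrightarrow> h (t, 1) = h (t, 0)"
    using assms unfolding homotopic_loops pathstart_def pathfinish_def by auto
  let ?a = "linepath (0::real, 0::real) (0, 1)"
  let ?b1 = "linepath (0::real, 0::real) (1, 0)" and ?b2 = "linepath (1::real, 0::real) (1, 1)"
    and ?b3 = "linepath (1::real, 1::real) (0, 1)"
  let ?c = "h \<circ> ?b1"
  have cQ: "convex ?Q"
    by (intro convex_Times) auto
  then have seg: "path_image (linepath x y) \<subseteq> ?Q" if "x \<in> ?Q" "y \<in> ?Q" for x y
    by (metis that closed_segment_subset path_image_linepath)
  have "homotopic_paths ?Q ?a (?b1 +++ (?b2 +++ ?b3))"
    using convex_imp_simply_connected[OF cQ, unfolded simply_connected_eq_homotopic_paths, THEN conjunct2,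
      rule_format, of ?a "?b1 +++ (?b2 +++ ?b3)"]
    by (simp add: subset_path_image_join seg del: path_image_linepath)
  then have *: "homotopic_paths S (h \<circ> ?a) (h \<circ> (?b1 +++ (?b2 +++ ?b3)))"
    by (rule homotopic_paths_continuous_image) (use h in auto)
  have pa: "path (h \<circ> linepath x y)" "path_image (h \<circ> linepath x y) \<subseteq> S" if "x \<in> ?Q" "y \<in> ?Q" for x y
  proof -
    show "path (h \<circ> linepath x y)"
      using continuous_on_subset[OF h(1) seg[OF that]] by (intro path_continuous_image) simp_all
    show "path_image (h \<circ> linepath x y) \<subseteq> S"
      using seg[OF that] h(2) unfolding path_image_compose by blast
  qed
  have pa0: "homotopic_paths S p (h \<circ> ?a)"
    using homotopic_loops_imp_path[OF assms] homotopic_loops_imp_subset[OF assms]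
    by (intro homotopic_paths_eq) (use h(3) in \<open>auto simp: linepath_def\<close>)
  have p1: "path ?c" "path_image ?c \<subseteq> S" and p2: "path (h \<circ> ?b2)" "path_image (h \<circ> ?b2) \<subseteq> S"
    and p3: "path (h \<circ> ?b3)" "path_image (h \<circ> ?b3) \<subseteq> S"
    by (rule pa; simp)+
  have "homotopic_paths S (h \<circ> ?b2) q"
    by (rule homotopic_paths_eq[OF p2]) (use h(4) in \<open>auto simp: linepath_def\<close>)
  \<comment> \<open>Every stage of the homotopy is a loop, so the edge at parameter \<open>1\<close>
    traces the same points as the edge at parameter \<open>0\<close>, here in the opposite
    direction.\<close>
  moreover have "homotopic_paths S (h \<circ> ?b3) (reversepath ?c)"
    by (rule homotopic_paths_eq[OF p3]) (use h(5) in \<open>auto simp: linepath_def reversepath_def\<close>)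
  ultimately have "homotopic_paths S (?c +++ ((h \<circ> ?b2) +++ (h \<circ> ?b3))) (?c +++ (q +++ reversepath ?c))"
    using p1 by (intro homotopic_paths_join) (auto simp: pathstart_compose pathfinish_compose)
  then have "homotopic_paths S (h \<circ> ?a) (?c +++ (q +++ reversepath ?c))"
    using * by (auto simp: path_compose_join intro: homotopic_paths_trans)
  with pa0 have "homotopic_paths S p (?c +++ (q +++ reversepath ?c))"
    by (rule homotopic_paths_trans)
  moreover have "pathstart ?c = pathstart p" "pathfinish ?c = pathstart q"
    using h(3)[of 0] h(4)[of 0] by (auto simp: pathstart_def pathfinish_def linepath_def)
  ultimately show thesis
    by (intro that[of ?c] p1) 
qed

text \<open>Coaxiality provides free null homotopies, whereas fundamental groups use based ones. The
  trace \<open>c\<close> of the base point cancels against its reverse once the constant loop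
  between them is dropped.\<close>

lemma homotopic_loops_const_imp_homotopic_paths:
  assumes "homotopic_loops S p (\<lambda>_. a)"
  shows "homotopic_paths S p (\<lambda>_. pathstart p)"
proof -
  obtain c where c: "path c" "path_image c \<subseteq> S" "pathstart c = pathstart p" "pathfinish c = a"
    "homotopic_paths S p (c +++ ((\<lambda>_. a) +++ reversepath c))"
    using homotopic_loops_imp_conjugate[OF assms] by auto
  have "homotopic_paths S ((\<lambda>_. a) +++ reversepath c) (reversepath c)"
    by (rule homotopic_paths_left_const) (use c in auto)
  then have "homotopic_paths S (c +++ ((\<lambda>_. a) +++ reversepath c)) (c +++ reversepath c)"
    by (intro homotopic_paths_join) (use c in auto)
  also have "homotopic_paths S (c +++ reversepath c) (\<lambda>_. pathstart p)"
    by (rule homotopic_paths_right_inverse) (use c in auto)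
  finally show ?thesis
    using c(5) homotopic_paths_trans by blast
qed

section \<open>The fundamental group\<close>

definition loop_class :: "'a::topological_space set \<Rightarrow> (real \<Rightarrow> 'a) \<Rightarrow> (real \<Rightarrow> 'a) set" where
  "loop_class S p = {q. homotopic_paths S p q}"

definition is_path :: "'a::topological_space set \<Rightarrow> 'a \<Rightarrow> 'a \<Rightarrow> (real \<Rightarrow> 'a) \<Rightarrow> bool" where
  "is_path S x y p \<longleftrightarrow> path p \<and> path_image p \<subseteq> S \<and> pathstart p = x \<and> pathfinish p = y"

lemma is_path_join: "is_path S x y p \<Longrightarrow> is_path S y z q \<Longrightarrow> is_path S x z (p +++ q)"
  by (auto simp: is_path_def path_image_join)

lemma is_path_reverse: "is_path S x y p \<Longrightarrow> is_path S y x (reversepath p)"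
  by (auto simp: is_path_def)

lemma is_path_const: "x \<in> S \<Longrightarrow> is_path S x x (\<lambda>_. x)"
  by (auto simp: is_path_def)

lemma is_path_mono: "is_path S x y p \<Longrightarrow> S \<subseteq> T \<Longrightarrow> is_path T x y p"
  by (auto simp: is_path_def)

lemma is_path_restrict_path:
  assumes "path p" "p ` closed_segment s t \<subseteq> S" "s \<in> {0..1}" "t \<in> {0..1}"
  shows "is_path S (p s) (p t) (restrict_path s t p)"
proof -
  have "closed_segment s t \<subseteq> {0..1}"
    using assms(3,4) by (intro closed_segment_subset) auto
  then have "continuous_on (closed_segment s t) p"
    using assms(1) unfolding path_def by (rule continuous_on_subset[rotated])
  then have "path (p \<circ> linepath s t)"
    by (intro path_continuous_image) simp_all
  then show ?thesis
    using assms(2) by (simp add: is_path_def restrict_path_def path_image_compose pathstart_compose pathfinish_compose)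
qed

lemma is_path_mem: "is_path S x y p \<Longrightarrow> x \<in> S" "is_path S x y p \<Longrightarrow> y \<in> S"
  unfolding is_path_def using pathstart_in_path_image[of p] pathfinish_in_path_image[of p] by auto

lemma path_component_is_path: "path_component S x y \<longleftrightarrow> (\<exists>p. is_path S x y p)"
  by (auto simp: path_component_def is_path_def)

lemma is_path_homotopic: "homotopic_paths S p q \<Longrightarrow> is_path S x y p \<Longrightarrow> is_path S x y q"
  using homotopic_paths_imp_path[of S p q] homotopic_paths_imp_pathfinish[of S p q]
    homotopic_paths_imp_pathstart[of S p q] homotopic_paths_imp_subset[of S p q]
  by (simp add: is_path_def)

lemma carrier_fundamental_group:
  "carrier (fundamental_group S x) = {loop_class S p | p. is_path S x x p}"
  by (simp add: fundamental_group_def loop_class_def is_path_def)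

lemma loop_class_cong: "homotopic_paths S p q \<Longrightarrow> loop_class S p = loop_class S q"
  unfolding loop_class_def
  using homotopic_paths_trans[of S p q] homotopic_paths_trans[OF homotopic_paths_sym, of S p q] by blast

lemma loop_class_eq_iff:
  assumes "is_path S x y p"
  shows "loop_class S p = loop_class S q \<longleftrightarrow> homotopic_paths S p q"
proof
  have "p \<in> loop_class S p"
    using assms by (simp add: loop_class_def is_path_def)
  moreover assume "loop_class S p = loop_class S q"
  ultimately have "p \<in> loop_class S q"
    by simp
  then show "homotopic_paths S p q"
    by (simp add: loop_class_def homotopic_paths_sym)
qed (rule loop_class_cong)

lemma mult_loop_class:
  assumes p: "is_path S x x p" and q: "is_path S x x q"
  shows "loop_class S p \<otimes>\<^bsub>fundamental_group S x\<^esub> loop_class S q = loop_class S (p +++ q)"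
proof (intro equalityI subsetI)
  fix r assume "r \<in> loop_class S p \<otimes>\<^bsub>fundamental_group S x\<^esub> loop_class S q"
  then obtain p' q' where "homotopic_paths S p p'" "homotopic_paths S q q'" "homotopic_paths S (p' +++ q') r"
    by (auto simp: fundamental_group_def loop_class_def)
  moreover have "homotopic_paths S (p +++ q) (p' +++ q')" if "homotopic_paths S p p'" "homotopic_paths S q q'"
    using that p q by (intro homotopic_paths_join) (auto simp: is_path_def)
  ultimately show "r \<in> loop_class S (p +++ q)"
    unfolding loop_class_def mem_Collect_eq by (blast intro: homotopic_paths_trans)
next
  fix r assume "r \<in> loop_class S (p +++ q)"
  moreover have "homotopic_paths S p p" "homotopic_paths S q q"
    using p q by (auto simp: is_path_def)
  ultimately show "r \<in> loop_class S p \<otimes>\<^bsub>fundamental_group S x\<^esub> loop_class S q"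
    unfolding fundamental_group_def loop_class_def
    by (simp, intro exI[of _ p] exI[of _ q] conjI)
qed

lemma one_fundamental_group: "\<one>\<^bsub>fundamental_group S x\<^esub> = loop_class S (\<lambda>_. x)"
  by (simp add: fundamental_group_def loop_class_def)

lemma homotopic_paths_assoc_is_path:
  "is_path S x y p \<Longrightarrow> is_path S y z q \<Longrightarrow> is_path S z w r \<Longrightarrow> homotopic_paths S ((p +++ q) +++ r) (p +++ (q +++ r))"
  by (rule homotopic_paths_sym, rule homotopic_paths_assoc) (auto simp: is_path_def)

lemma group_fundamental_group:
  assumes "x \<in> S"
  shows "group (fundamental_group S x)"
proof (rule groupI)
  let ?G = "fundamental_group S x"
  show "A \<otimes>\<^bsub>?G\<^esub> B \<in> carrier ?G" if "A \<in> carrier ?G" "B \<in> carrier ?G" for A B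
    using that by (auto simp: carrier_fundamental_group mult_loop_class intro: is_path_join)
  show "\<one>\<^bsub>?G\<^esub> \<in> carrier ?G"
    using is_path_const[OF assms] by (auto simp: carrier_fundamental_group one_fundamental_group)
  show "A \<otimes>\<^bsub>?G\<^esub> B \<otimes>\<^bsub>?G\<^esub> C = A \<otimes>\<^bsub>?G\<^esub> (B \<otimes>\<^bsub>?G\<^esub> C)"
    if "A \<in> carrier ?G" "B \<in> carrier ?G" "C \<in> carrier ?G" for A B C
  proof -
    obtain p q r where A: "A = loop_class S p" "B = loop_class S q" "C = loop_class S r"
      and p: "is_path S x x p" and q: "is_path S x x q" and r: "is_path S x x r"
      using \<open>A \<in> carrier ?G\<close> \<open>B \<in> carrier ?G\<close> \<open>C \<in> carrier ?G\<close> by (auto simp: carrier_fundamental_group)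
    show ?thesis
      using homotopic_paths_assoc_is_path[OF p q r] loop_class_eq_iff[OF is_path_join[OF is_path_join[OF p q] r]]
      by (simp add: A p q r mult_loop_class is_path_join[OF p q] is_path_join[OF q r])
  qed
  show "\<one>\<^bsub>?G\<^esub> \<otimes>\<^bsub>?G\<^esub> A = A" if A: "A \<in> carrier ?G" for A
  proof -
    obtain p where p: "A = loop_class S p" "is_path S x x p"
      using A by (auto simp: carrier_fundamental_group)
    moreover have "homotopic_paths S ((\<lambda>_. x) +++ p) p"
      using p by (intro homotopic_paths_left_const) (auto simp: is_path_def)
    ultimately show ?thesis
      using loop_class_eq_iff[OF is_path_join[OF is_path_const[OF assms] p(2)]] is_path_const[OF assms]
      by (simp add: one_fundamental_group mult_loop_class)
  qed
  show "\<exists>B\<in>carrier ?G. B \<otimes>\<^bsub>?G\<^esub> A = \<one>\<^bsub>?G\<^esub>" if A: "A \<in> carrier ?G" for A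
  proof -
    obtain p where p: "A = loop_class S p" "is_path S x x p"
      using A by (auto simp: carrier_fundamental_group)
    moreover have "homotopic_paths S (reversepath p +++ p) (\<lambda>_. x)"
      using p by (intro homotopic_paths_left_inverse) (auto simp: is_path_def)
    moreover have "is_path S x x (reversepath p)"
      using p is_path_reverse by blast
    ultimately have "loop_class S (reversepath p) \<otimes>\<^bsub>?G\<^esub> A = \<one>\<^bsub>?G\<^esub>"
      using loop_class_eq_iff[OF is_path_join[OF is_path_reverse[OF p(2)] p(2)]]
      by (simp add: one_fundamental_group mult_loop_class)
    moreover have "loop_class S (reversepath p) \<in> carrier ?G"
      using \<open>is_path S x x (reversepath p)\<close> by (auto simp: carrier_fundamental_group)
    ultimately show ?thesis
      by blast
  qed
qed

section \<open>Cancellation for joined paths\<close>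

lemma homotopic_paths_cong_join:
  assumes "homotopic_paths S p p'" "homotopic_paths S q q'" "is_path S x y p" "is_path S y z q"
  shows "homotopic_paths S (p +++ q) (p' +++ q')"
  using assms by (intro homotopic_paths_join) (auto simp: is_path_def)

lemma is_path_refl_homotopic: "is_path S x y p \<Longrightarrow> homotopic_paths S p p"
  by (auto simp: is_path_def)

lemma homotopic_paths_cancel_left:
  assumes a: "is_path S x y a" and p: "is_path S y z p"
  shows "homotopic_paths S (reversepath a +++ (a +++ p)) p"
proof -
  have ra: "is_path S y x (reversepath a)"
    using a by (rule is_path_reverse)
  have "homotopic_paths S (reversepath a +++ (a +++ p)) ((reversepath a +++ a) +++ p)"
    using homotopic_paths_assoc_is_path[OF ra a p] by (rule homotopic_paths_sym)
  also have "homotopic_paths S \<dots> ((\<lambda>_. y) +++ p)"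
  proof (rule homotopic_paths_cong_join[OF _ is_path_refl_homotopic[OF p] is_path_join[OF ra a] p])
    show "homotopic_paths S (reversepath a +++ a) (\<lambda>_. y)"
      using a by (intro homotopic_paths_left_inverse) (auto simp: is_path_def)
  qed
  also have "homotopic_paths S \<dots> p"
    using p by (intro homotopic_paths_left_const) (auto simp: is_path_def)
  finally show ?thesis .
qed

lemma homotopic_paths_cancel_left':
  assumes a: "is_path S x y a" and p: "is_path S x z p"
  shows "homotopic_paths S (a +++ (reversepath a +++ p)) p"
  using homotopic_paths_cancel_left[OF is_path_reverse[OF a] p] by simp

lemma homotopic_paths_join_left_iff:
  assumes "is_path S x y a" "is_path S y z p" "is_path S y z q"
  shows "homotopic_paths S (a +++ p) (a +++ q) \<longleftrightarrow> homotopic_paths S p q"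
proof
  note ra = is_path_reverse[OF assms(1)]
  assume h: "homotopic_paths S (a +++ p) (a +++ q)"
  have "homotopic_paths S p (reversepath a +++ (a +++ p))"
    using homotopic_paths_cancel_left[OF assms(1,2)] by (rule homotopic_paths_sym)
  also have "homotopic_paths S \<dots> (reversepath a +++ (a +++ q))"
    by (rule homotopic_paths_cong_join[OF is_path_refl_homotopic[OF ra] h ra is_path_join[OF assms(1,2)]])
  also have "homotopic_paths S \<dots> q"
    using homotopic_paths_cancel_left[OF assms(1,3)] .
  finally show "homotopic_paths S p q" .
next
  assume "homotopic_paths S p q"
  then show "homotopic_paths S (a +++ p) (a +++ q)"
    by (rule homotopic_paths_cong_join[OF is_path_refl_homotopic[OF assms(1)] _ assms(1,2)])
qed

lemma homotopic_paths_join_right_iff: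
  assumes "is_path S y z a" "is_path S x y p" "is_path S x y q"
  shows "homotopic_paths S (p +++ a) (q +++ a) \<longleftrightarrow> homotopic_paths S p q"
proof -
  have "homotopic_paths S (p +++ a) (q +++ a) \<longleftrightarrow>
      homotopic_paths S (reversepath (p +++ a)) (reversepath (q +++ a))"
    by (simp add: homotopic_paths_reversepath)
  also have "\<dots> \<longleftrightarrow> homotopic_paths S (reversepath p) (reversepath q)"
    using assms homotopic_paths_join_left_iff[of S z y "reversepath a" x "reversepath p" "reversepath q"]
    by (auto simp: reversepath_joinpaths is_path_def)
  finally show ?thesis
    by (simp add: homotopic_paths_reversepath)
qed

text \<open>The inner pair \<open>reversepath b\<close>, \<open>b\<close> cancels. With base paths
  as legs this makes \<open>closed_up\<close> multiplicative, and with three equal legs it makes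
  \<open>conjugate_class\<close> a homomorphism.\<close>

lemma homotopic_paths_join_conjugates:
  assumes a: "is_path S u x a" and p: "is_path S x y p" and b: "is_path S v y b"
    and q: "is_path S y z q" and c: "is_path S w z c"
  shows "homotopic_paths S ((a +++ (p +++ reversepath b)) +++ (b +++ (q +++ reversepath c)))
    (a +++ ((p +++ q) +++ reversepath c))"
proof -
  note rb = is_path_reverse[OF b] and rc = is_path_reverse[OF c]
  have qc: "is_path S y w (q +++ reversepath c)"
    using q rc by (rule is_path_join)
  have "homotopic_paths S ((a +++ (p +++ reversepath b)) +++ (b +++ (q +++ reversepath c)))
     (a +++ ((p +++ reversepath b) +++ (b +++ (q +++ reversepath c))))"
    by (rule homotopic_paths_assoc_is_path[OF a is_path_join[OF p rb] is_path_join[OF b qc]])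
  also have "homotopic_paths S \<dots> (a +++ ((p +++ q) +++ reversepath c))"
  proof (subst homotopic_paths_join_left_iff[OF a])
    show "is_path S x w ((p +++ reversepath b) +++ b +++ q +++ reversepath c)"
      by (rule is_path_join[OF is_path_join[OF p rb] is_path_join[OF b qc]])
    show "is_path S x w ((p +++ q) +++ reversepath c)"
      by (rule is_path_join[OF is_path_join[OF p q] rc])
    have "homotopic_paths S ((p +++ reversepath b) +++ (b +++ (q +++ reversepath c)))
        (p +++ (reversepath b +++ (b +++ (q +++ reversepath c))))"
      by (rule homotopic_paths_assoc_is_path[OF p rb is_path_join[OF b qc]])
    also have "homotopic_paths S \<dots> (p +++ (q +++ reversepath c))"
      by (subst homotopic_paths_join_left_iff[OF p is_path_join[OF rb is_path_join[OF b qc]] qc])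
        (rule homotopic_paths_cancel_left[OF b qc])
    also have "homotopic_paths S \<dots> ((p +++ q) +++ reversepath c)"
      using homotopic_paths_assoc_is_path[OF p q rc] by (rule homotopic_paths_sym)
    finally show "homotopic_paths S ((p +++ reversepath b) +++ b +++ q +++ reversepath c) ((p +++ q) +++ reversepath c)" .
  qed
  finally show ?thesis .
qed

text \<open>The path from \<open>u\<close> to itself is taken to be constant, so that closing up a
  loop at \<open>u\<close> does not change its class.\<close>

definition base_path :: "'a::topological_space set \<Rightarrow> 'a \<Rightarrow> 'a \<Rightarrow> real \<Rightarrow> 'a" where
  "base_path S u x = (if x = u then (\<lambda>_. u) else (SOME p. is_path S u x p))"

text \<open>Closing paths up by chosen paths from the base point makes homotopy classes of paths, of
  arbitrary end points, elements of one group.\<close>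

definition closed_up :: "'a::topological_space set \<Rightarrow> 'a \<Rightarrow> (real \<Rightarrow> 'a) \<Rightarrow> (real \<Rightarrow> 'a) set" where
  "closed_up S u p =
     loop_class S (base_path S u (pathstart p) +++ (p +++ reversepath (base_path S u (pathfinish p))))"

lemma is_path_base_path:
  assumes "path_component S u x"
  shows "is_path S u x (base_path S u x)"
proof (cases "x = u")
  case True
  then show ?thesis
    using assms path_component_mem(1) by (fastforce simp: base_path_def intro: is_path_const)
next
  case False
  then show ?thesis
    using assms by (auto simp: base_path_def path_component_is_path intro: someI[of "is_path S u x"])
qed

lemma path_component_is_path_trans:
  "path_component S u x \<Longrightarrow> is_path S x y p \<Longrightarrow> path_component S u y"
  using path_component_is_path path_component_trans by blast

lemma is_path_closed_up:
  assumes "path_component S u x" "is_path S x y p"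
  shows "is_path S u u (base_path S u (pathstart p) +++ (p +++ reversepath (base_path S u (pathfinish p))))"
proof -
  have "pathstart p = x" "pathfinish p = y" "path_component S u y"
    using assms(2) path_component_is_path_trans[OF assms] by (auto simp: is_path_def)
  then show ?thesis
    using is_path_join[OF is_path_base_path[OF assms(1)] is_path_join[OF assms(2) is_path_reverse[OF is_path_base_path]]]
    by simp
qed

lemma closed_up_in_carrier:
  "path_component S u x \<Longrightarrow> is_path S x y p \<Longrightarrow> closed_up S u p \<in> carrier (fundamental_group S u)"
  using is_path_closed_up by (fastforce simp: closed_up_def carrier_fundamental_group)

text \<open>Attaching fixed legs is injective on homotopy classes. Homotopies of paths can thus be
  computed as equations in the group at \<open>u\<close> and translated back.\<close>

lemma closed_up_eq_iff:
  assumes u: "path_component S u x" and p: "is_path S x y p" and q: "is_path S x y q"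
  shows "closed_up S u p = closed_up S u q \<longleftrightarrow> homotopic_paths S p q"
proof -
  have e: "pathstart p = x" "pathfinish p = y" "pathstart q = x" "pathfinish q = y"
    using p q by (auto simp: is_path_def)
  have bx: "is_path S u x (base_path S u x)" and by': "is_path S y u (reversepath (base_path S u y))"
    using u p path_component_is_path_trans is_path_base_path is_path_reverse by blast+
  have "closed_up S u p = closed_up S u q \<longleftrightarrow>
     homotopic_paths S (base_path S u x +++ (p +++ reversepath (base_path S u y)))
       (base_path S u x +++ (q +++ reversepath (base_path S u y)))"
    using loop_class_eq_iff[OF is_path_closed_up[OF u p]] by (simp add: closed_up_def e)
  then show ?thesis
    using homotopic_paths_join_left_iff[OF bx is_path_join[OF p by'] is_path_join[OF q by']]
      homotopic_paths_join_right_iff[OF by' p q] by simp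
qed

lemma closed_up_join:
  assumes u: "path_component S u x" and p: "is_path S x y p" and q: "is_path S y z q"
  shows "closed_up S u (p +++ q) = closed_up S u p \<otimes>\<^bsub>fundamental_group S u\<^esub> closed_up S u q"
proof -
  have uy: "path_component S u y" and uz: "path_component S u z"
    using u p q path_component_is_path_trans by blast+
  have e: "pathstart p = x" "pathfinish p = y" "pathstart q = y" "pathfinish q = z"
    using p q by (auto simp: is_path_def)
  show ?thesis
    unfolding closed_up_def mult_loop_class[OF is_path_closed_up[OF u p] is_path_closed_up[OF uy q]]
    using loop_class_eq_iff[OF is_path_closed_up[OF u is_path_join[OF p q]]]
      homotopic_paths_join_conjugates[OF is_path_base_path[OF u] p is_path_base_path[OF uy] q is_path_base_path[OF uz]]
    by (simp add: e homotopic_paths_sym)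
qed

text \<open>The constant path is homotopic to its join with itself, and the only idempotent of a
  group is the identity.\<close>

lemma closed_up_const:
  assumes "path_component S u x"
  shows "closed_up S u (\<lambda>_. x) = \<one>\<^bsub>fundamental_group S u\<^esub>"
proof -
  interpret group "fundamental_group S u"
    by (rule group_fundamental_group[OF path_component_mem(1)[OF assms]])
  have c: "is_path S x x (\<lambda>_. x)"
    by (rule is_path_const[OF path_component_mem(2)[OF assms]])
  have "homotopic_paths S ((\<lambda>_. x) +++ (\<lambda>_. x)) (\<lambda>_. x)"
    using c by (intro homotopic_paths_left_const) (auto simp: is_path_def)
  then have "closed_up S u ((\<lambda>_. x) +++ (\<lambda>_. x)) = closed_up S u (\<lambda>_. x)"
    using closed_up_eq_iff[OF assms is_path_join[OF c c] c] by blast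
  then show ?thesis
    using closed_up_join[OF assms c c] closed_up_in_carrier[OF assms c] l_cancel_one by simp
qed

lemma closed_up_reverse:
  assumes u: "path_component S u x" and p: "is_path S x y p"
  shows "closed_up S u (reversepath p) = inv\<^bsub>fundamental_group S u\<^esub> closed_up S u p"
proof -
  interpret group "fundamental_group S u"
    by (rule group_fundamental_group[OF path_component_mem(1)[OF u]])
  have uy: "path_component S u y"
    by (rule path_component_is_path_trans[OF u p])
  have rp: "is_path S y x (reversepath p)"
    using p by (rule is_path_reverse)
  have "closed_up S u (reversepath p) \<otimes>\<^bsub>fundamental_group S u\<^esub> closed_up S u p = closed_up S u (\<lambda>_. y)"
    unfolding closed_up_join[OF uy rp p, symmetric]
      closed_up_eq_iff[OF uy is_path_join[OF rp p] is_path_const[OF is_path_mem(1)[OF rp]]]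
    using p by (intro homotopic_paths_left_inverse) (auto simp: is_path_def)
  then have "closed_up S u (reversepath p) \<otimes>\<^bsub>fundamental_group S u\<^esub> closed_up S u p = \<one>\<^bsub>fundamental_group S u\<^esub>"
    by (simp add: closed_up_const[OF uy])
  from inv_equality[OF this closed_up_in_carrier[OF u p] closed_up_in_carrier[OF uy rp]]
  show ?thesis
    by simp
qed

lemma closed_up_loop:
  assumes "is_path S u u p"
  shows "closed_up S u p = loop_class S p"
proof -
  have e: "pathstart p = u" "pathfinish p = u"
    using assms by (auto simp: is_path_def)
  have c: "is_path S u u (\<lambda>_. u)"
    using assms is_path_mem is_path_const by metis
  have "homotopic_paths S ((\<lambda>_. u) +++ (p +++ (\<lambda>_. u))) (p +++ (\<lambda>_. u))"
    using is_path_join[OF assms c] by (intro homotopic_paths_left_const) (auto simp: is_path_def)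
  also have "homotopic_paths S \<dots> p"
    using assms by (intro homotopic_paths_right_const) (auto simp: is_path_def)
  finally show ?thesis
    using loop_class_eq_iff[OF is_path_join[OF c is_path_join[OF assms c]]]
    by (simp add: closed_up_def e base_path_def)
qed

text \<open>Inclusion followed by change of base point along \<open>r\<close>. The bonding maps of
  the pro-group have this form (\<open>bond_eq\<close>).\<close>

definition conjugate_class :: "'a::topological_space set \<Rightarrow> (real \<Rightarrow> 'a) \<Rightarrow> (real \<Rightarrow> 'a) set \<Rightarrow> (real \<Rightarrow> 'a) set" where
  "conjugate_class S r A = {q. \<exists>p\<in>A. homotopic_paths S (r +++ (p +++ reversepath r)) q}"

lemma conjugate_class_loop_class:
  assumes "is_path S x y r" "is_path T y y p" "T \<subseteq> S"
  shows "conjugate_class S r (loop_class T p) = loop_class S (r +++ (p +++ reversepath r))"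
proof -
  have p: "is_path S y y p"
    using assms is_path_mono by blast
  have *: "homotopic_paths S (r +++ (p +++ reversepath r)) (r +++ (q +++ reversepath r))" if "homotopic_paths T p q" for q
  proof -
    have pq: "homotopic_paths S p q"
      using that assms(3) by (rule homotopic_paths_subset)
    note r' = is_path_reverse[OF assms(1)] and q = is_path_homotopic[OF pq p]
    show ?thesis
      using pq homotopic_paths_join_left_iff[OF assms(1) is_path_join[OF p r'] is_path_join[OF q r']]
        homotopic_paths_join_right_iff[OF r' p q] by simp
  qed
  have "homotopic_paths T p p"
    using assms by (auto simp: is_path_def)
  then show ?thesis
    unfolding conjugate_class_def loop_class_def
    by (auto intro: homotopic_paths_trans[OF *] exI[of _ p])
qed

lemma conjugate_class_hom:
  assumes r: "is_path S x y r" and T: "T \<subseteq> S"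
  shows "conjugate_class S r \<in> hom (fundamental_group T y) (fundamental_group S x)"
proof (rule homI)
  fix A assume "A \<in> carrier (fundamental_group T y)"
  then obtain p where p: "A = loop_class T p" "is_path T y y p"
    by (auto simp: carrier_fundamental_group)
  have "is_path S x x (r +++ (p +++ reversepath r))"
    by (rule is_path_join[OF r is_path_join[OF is_path_mono[OF p(2) T] is_path_reverse[OF r]]])
  then show "conjugate_class S r A \<in> carrier (fundamental_group S x)"
    unfolding p(1) conjugate_class_loop_class[OF r p(2) T] carrier_fundamental_group by blast
next
  fix A B assume "A \<in> carrier (fundamental_group T y)" "B \<in> carrier (fundamental_group T y)"
  then obtain p q where pq: "A = loop_class T p" "B = loop_class T q" "is_path T y y p" "is_path T y y q"
    by (auto simp: carrier_fundamental_group)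
  have pq': "is_path S y y p" "is_path S y y q"
    by (rule is_path_mono[OF _ T], fact)+
  have l: "is_path S x x (r +++ (p +++ reversepath r))" if "is_path S y y p" for p
    by (rule is_path_join[OF r is_path_join[OF that is_path_reverse[OF r]]])
  show "conjugate_class S r (A \<otimes>\<^bsub>fundamental_group T y\<^esub> B) =
      conjugate_class S r A \<otimes>\<^bsub>fundamental_group S x\<^esub> conjugate_class S r B"
    unfolding pq(1,2) mult_loop_class[OF pq(3,4)] conjugate_class_loop_class[OF r pq(3) T]
      conjugate_class_loop_class[OF r pq(4) T] conjugate_class_loop_class[OF r is_path_join[OF pq(3,4)] T]
      mult_loop_class[OF l[OF pq'(1)] l[OF pq'(2)]]
    by (rule loop_class_cong[OF homotopic_paths_sym[OF homotopic_paths_join_conjugates[OF r pq'(1) r pq'(2) r]]])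
qed

section \<open>Free groups as groups of reduced words\<close>

text \<open>Left multiplication by a letter, on reduced words. It is inverted by the flipped letter,
  so words act on reduced words by permutations. Associativity of the product is derived from this
  action (van der Waerden's argument) instead of from confluence of reductions.\<close>

fun push :: "'x \<times> bool \<Rightarrow> ('x \<times> bool) list \<Rightarrow> ('x \<times> bool) list" where
  "push l [] = [l]"
| "push l (m # w) = (if fst l = fst m \<and> snd l \<noteq> snd m then w else l # m # w)"

definition flip :: "'x \<times> bool \<Rightarrow> 'x \<times> bool" where
  "flip l = (fst l, \<not> snd l)"

lemma flip_flip [simp]: "flip (flip l) = l"
  by (simp add: flip_def)

lemma reduced_word_simps [simp]:
  "reduced_word []" "reduced_word [l]"
  "reduced_word (l # m # w) \<longleftrightarrow> \<not> (fst l = fst m \<and> snd l \<noteq> snd m) \<and> reduced_word (m # w)"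
  by (simp_all add: reduced_word_def)

lemma reduced_word_tl: "reduced_word (l # w) \<Longrightarrow> reduced_word w"
  by (cases w) simp_all

lemma reduced_word_push: "reduced_word w \<Longrightarrow> reduced_word (push l w)"
  by (cases w) (auto dest: reduced_word_tl)

lemma push_flip_push: "reduced_word w \<Longrightarrow> push (flip l) (push l w) = w"
proof (cases w)
  case (Cons m v)
  assume "reduced_word w"
  then show ?thesis
    using Cons by (cases v) (auto simp: flip_def prod_eq_iff)
qed (simp add: flip_def)

lemma reduced_word_foldr_push: "reduced_word w \<Longrightarrow> reduced_word (foldr push u w)"
  by (induction u) (auto intro: reduced_word_push)

lemma push_eq_Cons: "reduced_word (l # w) \<Longrightarrow> push l w = l # w"
  by (cases w) auto

lemma foldr_push_Nil: "reduced_word w \<Longrightarrow> foldr push w [] = w"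
proof (induction w)
  case (Cons l w)
  then show ?case
    using reduced_word_tl[of l w] by (simp add: push_eq_Cons)
qed simp

text \<open>If \<open>l\<close> cancels the first letter \<open>m\<close> of \<open>w\<close>, then
  \<open>l = flip m\<close>, and on the right-hand side \<open>push l\<close> undoes
  \<open>push m\<close>. Otherwise \<open>push l w\<close> is \<open>l # w\<close> and both sides
  unfold to the same.\<close>

lemma foldr_push_push:
  assumes "reduced_word w" "reduced_word v"
  shows "foldr push (push l w) v = push l (foldr push w v)"
proof (cases w)
  case (Cons m w')
  show ?thesis
  proof (cases "fst l = fst m \<and> snd l \<noteq> snd m")
    case True
    then have "l = flip m"
      by (auto simp: flip_def prod_eq_iff)
    then show ?thesis
      using Cons True push_flip_push[OF reduced_word_foldr_push[OF assms(2)]] by simp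
  next
    case False
    then have "push l w = l # w"
      using Cons by auto
    then show ?thesis
      by simp
  qed
qed simp

lemma foldr_push_assoc:
  assumes "reduced_word v" "reduced_word w"
  shows "foldr push (foldr push u v) w = foldr push u (foldr push v w)"
  by (induction u) (simp_all add: foldr_push_push reduced_word_foldr_push assms)

definition free_words :: "('x \<times> bool) list monoid" where
  "free_words = \<lparr>carrier = {w. reduced_word w}, mult = (\<lambda>u v. foldr push u v), one = []\<rparr>"

lemma free_words_simps [simp]:
  "w \<in> carrier free_words \<longleftrightarrow> reduced_word w"
  "u \<otimes>\<^bsub>free_words\<^esub> v = foldr push u v"
  "\<one>\<^bsub>free_words\<^esub> = []"
  by (simp_all add: free_words_def)

lemma foldr_push_rev_flip: "reduced_word w \<Longrightarrow> foldr push (rev (map flip w)) w = []"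
proof (induction w)
  case (Cons l w)
  then have "push (flip l) (l # w) = w"
    by (simp add: flip_def)
  then show ?case
    using Cons reduced_word_tl[of l w] by auto
qed simp

lemma group_free_words: "group free_words"
proof (rule groupI)
  fix w :: "('x \<times> bool) list" assume w: "w \<in> carrier free_words"
  let ?v = "foldr push (rev (map flip w)) []"
  have "foldr push ?v w = []"
    using foldr_push_assoc[of "[]" w "rev (map flip w)"] w by (simp add: foldr_push_rev_flip)
  then show "\<exists>v\<in>carrier free_words. v \<otimes>\<^bsub>free_words\<^esub> w = \<one>\<^bsub>free_words\<^esub>"
    by (intro bexI[of _ ?v]) (simp_all add: reduced_word_foldr_push)
qed (auto simp: foldr_push_assoc reduced_word_foldr_push)

text \<open>On reduced words this is the homomorphism out of the free group that sends the generator
  \<open>x\<close> to \<open>f x\<close>.\<close>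

definition word_eval :: "('g, 'm) monoid_scheme \<Rightarrow> ('x \<Rightarrow> 'g) \<Rightarrow> ('x \<times> bool) list \<Rightarrow> 'g" where
  "word_eval G f w = word_value G (map (map_prod f id) w)"

lemma word_eval_simps [simp]:
  "word_eval G f [] = \<one>\<^bsub>G\<^esub>"
  "word_eval G f (l # w) = (if snd l then f (fst l) else inv\<^bsub>G\<^esub> f (fst l)) \<otimes>\<^bsub>G\<^esub> word_eval G f w"
  by (simp_all add: word_eval_def)

context group
begin

lemma word_eval_closed:
  "range f \<subseteq> H \<Longrightarrow> subgroup H G \<Longrightarrow> word_eval G f w \<in> H"
  by (induction w) (auto simp: subgroup.one_closed subgroup.m_closed subgroup.m_inv_closed range_subsetD)

lemma word_eval_in_carrier: "range f \<subseteq> carrier G \<Longrightarrow> word_eval G f w \<in> carrier G"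
  using word_eval_closed[of f "carrier G"] subgroup_self by blast

lemma word_eval_push:
  assumes f: "range f \<subseteq> carrier G"
  shows "word_eval G f (push l w) = word_eval G f (l # w)"
proof (cases w)
  case (Cons m v)
  have fc: "f x \<in> carrier G" for x
    using f by auto
  then show ?thesis
    using Cons word_eval_in_carrier[OF f, of v] by (auto simp: m_assoc[symmetric])
qed simp

lemma word_eval_mult:
  assumes f: "range f \<subseteq> carrier G"
  shows "word_eval G f (foldr push u v) = word_eval G f u \<otimes> word_eval G f v"
proof (induction u)
  case (Cons l u)
  have fc: "f x \<in> carrier G" for x
    using f by auto
  show ?case
    using Cons fc word_eval_in_carrier[OF f] by (simp add: word_eval_push[OF f] m_assoc)
qed (use word_eval_in_carrier[OF f] in simp)

lemma word_eval_hom: "range f \<subseteq> carrier G \<Longrightarrow> word_eval G f \<in> hom free_words G"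
  by (rule homI) (auto simp: word_eval_in_carrier word_eval_mult)

end

text \<open>Pro-freeness is stated with groups over the element type of the fundamental groups, so the words have
  to be encoded in that type.\<close>

definition encoded_free_words :: "(('x \<times> bool) list \<Rightarrow> 'g) \<Rightarrow> 'g monoid" where
  "encoded_free_words e = \<lparr>carrier = e ` carrier free_words,
     mult = (\<lambda>a b. e (inv_into UNIV e a \<otimes>\<^bsub>free_words\<^esub> inv_into UNIV e b)), one = e \<one>\<^bsub>free_words\<^esub>\<rparr>"

context
  fixes e :: "('x \<times> bool) list \<Rightarrow> 'g"
  assumes inj: "inj e"
begin

lemma encoded_free_words_mult: "e u \<otimes>\<^bsub>encoded_free_words e\<^esub> e v = e (foldr push u v)"
  using inj by (simp add: encoded_free_words_def)

lemma encode_iso: "e \<in> iso free_words (encoded_free_words e)"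
  using inj by (auto simp: iso_def hom_def bij_betw_def encoded_free_words_mult reduced_word_foldr_push intro: inj_on_subset[OF inj])
    (auto simp: encoded_free_words_def)

lemma group_encoded_free_words: "group (encoded_free_words e)"
proof -
  interpret F: group "free_words :: ('x \<times> bool) list monoid"
    by (rule group_free_words)
  have "group (encoded_free_words e \<lparr>one := e \<one>\<^bsub>free_words\<^esub>\<rparr>)"
    by (rule F.iso_imp_img_group[OF encode_iso])
  then show ?thesis
    by (simp add: encoded_free_words_def)
qed

lemma decode_hom: "inv_into UNIV e \<in> hom (encoded_free_words e) free_words"
  using inj by (auto simp: hom_def encoded_free_words_mult reduced_word_foldr_push encoded_free_words_def)

lemma free_group_encoded_free_words: "free_group (encoded_free_words e)"
proof -
  let ?E = "encoded_free_words e"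
  interpret E: group ?E
    by (rule group_encoded_free_words)
  interpret F: group "free_words :: ('x \<times> bool) list monoid"
    by (rule group_free_words)
  interpret h: group_hom free_words ?E e
    using encode_iso by unfold_locales (auto simp: iso_def)
  let ?g = "\<lambda>x. e [(x, True)]"
  let ?S = "range ?g"
  have carr: "carrier ?E = e ` {w. reduced_word w}"
    by (auto simp: encoded_free_words_def)
  have inv_g: "inv\<^bsub>?E\<^esub> (?g x) = e [(x, False)]" for x
  proof -
    have "[(x, False)] \<otimes>\<^bsub>free_words\<^esub> [(x, True)] = \<one>\<^bsub>free_words\<^esub>"
      by simp
    then have "e [(x, False)] \<otimes>\<^bsub>?E\<^esub> ?g x = \<one>\<^bsub>?E\<^esub>"
      by (simp add: encoded_free_words_mult) (simp add: encoded_free_words_def)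
    then show ?thesis
      using E.inv_equality by (auto simp: carr)
  qed
  \<comment> \<open>Evaluating a word on the generators reduces it. On reduced words evaluation is
    therefore \<open>e\<close>, which gives existence and uniqueness of the reduced expression at
    once.\<close>
  have ev: "word_eval ?E ?g w = e (foldr push w [])" for w
  proof (induction w)
    case Nil
    then show ?case
      by (simp add: encoded_free_words_def)
  next
    case (Cons l w)
    have "(if snd l then ?g (fst l) else inv\<^bsub>?E\<^esub> (?g (fst l))) = e [l]"
      by (cases l) (auto simp: inv_g)
    then show ?case
      by (simp only: word_eval_simps Cons encoded_free_words_mult) simp
  qed
  have inj_g: "inj ?g"
    using inj by (auto simp: inj_def)
  have red: "reduced_word (map (map_prod ?g id) w) \<longleftrightarrow> reduced_word w" for w
    by (induction w rule: induct_list012) (auto simp: inj_eq[OF inj])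
  have "free_basis ?E ?S"
    unfolding free_basis_def
  proof (intro conjI ballI)
    show "?S \<subseteq> carrier ?E"
      by (auto simp: carr)
    fix a assume "a \<in> carrier ?E"
    then obtain w where w: "a = e w" "reduced_word w"
      by (auto simp: carr)
    show "\<exists>!v. fst ` set v \<subseteq> ?S \<and> reduced_word v \<and> word_value ?E v = a"
    proof (intro ex1I[of _ "map (map_prod ?g id) w"] conjI)
      show "word_value ?E (map (map_prod ?g id) w) = a"
        using ev[of w] w by (simp add: word_eval_def foldr_push_Nil)
      fix v assume v: "fst ` set v \<subseteq> ?S \<and> reduced_word v \<and> word_value ?E v = a"
      \<comment> \<open>The letters of \<open>v\<close> are pulled back along \<open>?g\<close>;
        then uniqueness of \<open>v\<close> becomes injectivity of \<open>e\<close>.\<close>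
      define u where "u = map (map_prod (inv_into UNIV ?g) id) v"
      have vu: "v = map (map_prod ?g id) u"
        unfolding u_def map_map
      proof (rule map_idI[symmetric])
        fix l assume "l \<in> set v"
        then have "fst l \<in> ?S"
          using v by auto
        then show "(map_prod ?g id \<circ> map_prod (inv_into UNIV ?g) id) l = l"
          using f_inv_into_f[of "fst l" ?g UNIV] by (cases l) simp
      qed
      have "e u = e w"
        using v ev[of u] red[of u] w unfolding vu by (simp add: word_eval_def foldr_push_Nil)
      then show "v = map (map_prod ?g id) w"
        using inj by (simp add: vu inj_eq)
    qed (use w red in auto)
  qed
  then show ?thesis
    using E.is_group by (auto simp: free_group_def)
qed

end

section \<open>Inverse sequences\<close>

lemma bonding_same [simp]: "bonding f n n = id"
  by (simp add: bonding_def)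

lemma bonding_Suc_right:
  assumes "m \<le> n"
  shows "bonding f m (Suc n) = bonding f m n \<circ> f n"
proof -
  have *: "foldr (\<lambda>i h. f i \<circ> h) xs g = foldr (\<lambda>i h. f i \<circ> h) xs id \<circ> g" for xs g
    by (induction xs) (auto simp: o_assoc)
  show ?thesis
    using assms *[of "[m..<n]" "f n"] by (simp add: bonding_def)
qed

lemma bonding_Suc [simp]: "bonding f n (Suc n) = f n"
  by (simp add: bonding_Suc_right)

lemma bonding_comp:
  assumes "l \<le> m" "m \<le> n"
  shows "bonding f l m (bonding f m n x) = bonding f l n x"
  using assms(2,1) by (induction n arbitrary: x rule: dec_induct) (simp_all add: bonding_Suc_right)

lemma bonding_hom:
  assumes "inverse_sequence G f" "m \<le> n"
  shows "bonding f m n \<in> hom (G n) (G m)"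
  using assms(2)
proof (induction n rule: dec_induct)
  case base
  then show ?case
    by (simp add: hom_def)
next
  case (step n)
  then have "bonding f m n \<circ> f n \<in> hom (G (Suc n)) (G m)"
    using assms(1) by (intro hom_compose[of _ _ "G n"]) (auto simp: inverse_sequence_def)
  then show ?case
    by (simp only: bonding_Suc_right[OF step(1)])
qed

lemma strict_mono_iterate:
  fixes s :: "nat \<Rightarrow> nat"
  assumes "\<And>n. n < s n"
  shows "strict_mono (\<lambda>i. (s ^^ i) 0)"
  using assms by (simp add: strict_mono_Suc_iff)

text \<open>The factors \<open>\<psi>\<close> and \<open>\<phi>\<close> along the subsequence
  \<open>0\<close>, \<open>s 0\<close>, \<open>s (s 0)\<close>, ... are the rungs of the ladder.
  Composing them in the other order, from \<open>F\<close> through \<open>G (a (Suc i))\<close> back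
  to \<open>F\<close>, yields the bonding maps of a sequence with constant term
  \<open>F\<close>.\<close>

lemma pro_free_if_factors_through_free:
  fixes G :: "nat \<Rightarrow> 'g monoid"
  assumes inv_seq: "inverse_sequence G f" and F: "free_group (F :: 'g monoid)"
    and fac: "\<And>n. \<exists>m>n. \<exists>\<phi> \<psi>. \<phi> \<in> hom (G m) F \<and> \<psi> \<in> hom F (G n) \<and>
      (\<forall>x\<in>carrier (G m). \<psi> (\<phi> x) = bonding f n m x)"
  shows "pro_free G f"
proof -
  obtain s \<phi> \<psi> where s: "\<And>n. n < s n"
    and \<phi>: "\<And>n. \<phi> n \<in> hom (G (s n)) F" and \<psi>: "\<And>n. \<psi> n \<in> hom F (G n)"
    and eq: "\<And>n x. x \<in> carrier (G (s n)) \<Longrightarrow> \<psi> n (\<phi> n x) = bonding f n (s n) x"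
    using fac by metis
  define a where "a = (\<lambda>i. (s ^^ i) 0)"
  have a_Suc: "a (Suc i) = s (a i)" for i
    by (simp add: a_def)
  define h where "h = (\<lambda>i. \<phi> (a i) \<circ> \<psi> (a (Suc i)))"
  have "h i \<in> hom F F" for i
    unfolding h_def using \<phi>[of "a i"] \<psi>[of "a (Suc i)"] by (intro hom_compose) (auto simp: a_Suc)
  then have "inverse_sequence (\<lambda>_. F) h"
    using F by (auto simp: inverse_sequence_def free_group_def)
  moreover have "strict_mono a"
    unfolding a_def by (rule strict_mono_iterate[OF s])
  moreover have "strict_mono (id :: nat \<Rightarrow> nat)"
    by (simp add: strict_mono_def)
  ultimately have "pro_isomorphic G f (\<lambda>_. F) h"
    unfolding pro_isomorphic_def
    using inv_seq \<phi> \<psi> eq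
    by (intro conjI exI[of _ a] exI[of _ "id :: nat \<Rightarrow> nat"] exI[of _ "\<lambda>i. \<psi> (a i)"] exI[of _ "\<lambda>i. \<phi> (a i)"])
      (auto simp: a_Suc h_def)
  then show ?thesis
    using F unfolding pro_free_def by blast
qed

text \<open>Each term of the subsequence is replaced by the image \<open>I i\<close> of the next
  one. By the choice of \<open>s\<close>, this image is already covered by the term after the next,
  whose image passes through \<open>I (Suc i)\<close>; so the bonding maps between the images are
  onto. The rungs are inclusions and bonding maps.\<close>

lemma semistable_if_Mittag_Leffler:
  fixes G :: "nat \<Rightarrow> 'g monoid"
  assumes inv_seq: "inverse_sequence G f"
    and ml: "\<And>n. \<exists>m>n. \<forall>k\<ge>m. bonding f n m ` carrier (G m) \<subseteq> bonding f n k ` carrier (G k)"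
  shows "semistable G f"
proof -
  obtain s where s: "\<And>n. n < s n"
    and sub: "\<And>n k. s n \<le> k \<Longrightarrow> bonding f n (s n) ` carrier (G (s n)) \<subseteq> bonding f n k ` carrier (G k)"
    using ml by metis
  define a where "a = (\<lambda>i. (s ^^ i) 0)"
  have a_Suc: "a (Suc i) = s (a i)" for i
    by (simp add: a_def)
  have a_le: "a i \<le> a (Suc i)" for i
    using s[of "a i"] by (simp add: a_Suc)
  have bh: "bonding f m n \<in> hom (G n) (G m)" if "m \<le> n" for m n
    using bonding_hom[OF inv_seq that] .
  have grp: "group (G n)" for n
    using inv_seq by (simp add: inverse_sequence_def)
  define I where "I = (\<lambda>i. bonding f (a i) (a (Suc i)) ` carrier (G (a (Suc i))))"
  define H where "H = (\<lambda>i. G (a i)\<lparr>carrier := I i\<rparr>)"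
  define h where "h = (\<lambda>i. bonding f (a i) (a (Suc i)))"
  have I_sub: "subgroup (I i) (G (a i))" for i
    unfolding I_def using bh[OF a_le] grp
    by (intro group_hom.img_is_subgroup group_hom.intro) (auto simp: group_hom_axioms_def)
  have I_carr: "I i \<subseteq> carrier (G (a i))" for i
    using subgroup.subset[OF I_sub] .
  have grpH: "group (H i)" for i
    unfolding H_def using subgroup.subgroup_is_group[OF I_sub grp] .
  have mono: "strict_mono a"
    unfolding a_def by (rule strict_mono_iterate[OF s])
  have img: "h i ` I (Suc i) = I i" for i
  proof
    show "h i ` I (Suc i) \<subseteq> I i"
      using I_carr[of "Suc i"] by (auto simp: h_def I_def)
    have "I i \<subseteq> bonding f (a i) (a (Suc (Suc i))) ` carrier (G (a (Suc (Suc i))))"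
      unfolding I_def a_Suc[of i] using a_le[of "Suc i"] by (intro sub) (simp add: a_Suc)
    also have "\<dots> = h i ` I (Suc i)"
      unfolding h_def I_def image_image using a_le by (simp add: bonding_comp)
    finally show "I i \<subseteq> h i ` I (Suc i)" .
  qed
  have h_hom: "h i \<in> hom (G (a (Suc i))) (G (a i))" for i
    unfolding h_def by (rule bh[OF a_le])
  have hH: "h i \<in> hom (H (Suc i)) (H i)" for i
    using h_hom[of i] img[of i] I_carr[of "Suc i"]
    by (auto simp: hom_def H_def Pi_iff subset_iff)
  have "inverse_sequence H h"
    using hH grpH by (simp add: inverse_sequence_def)
  moreover have "(\<lambda>x. x) \<in> hom (H i) (G (a i))" for i
    using I_carr[of i] by (auto simp: hom_def H_def)
  moreover have "h i \<in> hom (G (a (Suc i))) (H i)" for i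
    using h_hom[of i] by (auto simp: hom_def H_def I_def h_def)
  moreover have "strict_mono (id :: nat \<Rightarrow> nat)"
    by (simp add: strict_mono_def)
  ultimately have "pro_isomorphic G f H h"
    unfolding pro_isomorphic_def using inv_seq mono
    by (intro conjI exI[of _ a] exI[of _ "id :: nat \<Rightarrow> nat"] exI[of _ "\<lambda>i x. x"] exI[of _ h])
      (auto simp: h_def)
  moreover have "h i \<in> epi (H (Suc i)) (H i)" for i
    using hH img by (simp add: epi_def H_def)
  ultimately show ?thesis
    unfolding semistable_def by blast
qed

section \<open>Holonomy of cocycles on a cover by two open sets\<close>

definition loc_const_on :: "'b::topological_space set \<Rightarrow> ('b \<Rightarrow> 'c) \<Rightarrow> bool" where
  "loc_const_on S g \<longleftrightarrow> (\<forall>x\<in>S. \<exists>U. open U \<and> x \<in> U \<and> (\<forall>y\<in>S \<inter> U. g y = g x))"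

lemma loc_const_onI:
  "(\<And>x. x \<in> S \<Longrightarrow> \<exists>U. open U \<and> x \<in> U \<and> (\<forall>y\<in>S \<inter> U. g y = g x)) \<Longrightarrow> loc_const_on S g"
  by (simp add: loc_const_on_def)

lemma loc_const_onE:
  assumes "loc_const_on S g" "x \<in> S"
  obtains U where "open U" "x \<in> U" "\<forall>y\<in>S \<inter> U. g y = g x"
  using bspec[OF assms(1)[unfolded loc_const_on_def] assms(2)] that by blast

lemma loc_const_on_connected:
  assumes "connected S" "loc_const_on S g" "x \<in> S" "y \<in> S"
  shows "g x = g y"
proof -
  have "\<exists>T. openin (top_of_set S) T \<and> a \<in> T \<and> (\<forall>x\<in>T. g x = g a)" if a: "a \<in> S" for a
  proof -
    obtain U where U: "open U" "a \<in> U" "\<forall>y\<in>S \<inter> U. g y = g a"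
      by (rule loc_const_onE[OF assms(2) a])
    show ?thesis
      using a U(2,3) openin_open_Int[OF U(1), of S] by blast
  qed
  then have "g constant_on S"
    using assms(1) by (rule locally_constant_imp_constant[rotated])
  then show ?thesis
    using assms(3,4) by (auto simp: constant_on_def)
qed

lemma loc_const_on_subset:
  assumes "loc_const_on S g" "T \<subseteq> S"
  shows "loc_const_on T g"
proof (rule loc_const_onI)
  fix x assume "x \<in> T"
  then have "x \<in> S"
    using assms(2) by auto
  with assms(1) obtain U where "open U" "x \<in> U" "\<forall>y\<in>S \<inter> U. g y = g x"
    by (rule loc_const_onE)
  then show "\<exists>U. open U \<and> x \<in> U \<and> (\<forall>y\<in>T \<inter> U. g y = g x)"
    using assms(2) by blast
qed

lemma loc_const_on_const: "loc_const_on S (\<lambda>_. a)"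
  unfolding loc_const_on_def by auto

lemma loc_const_on_compose2:
  assumes "loc_const_on S g" "loc_const_on S h"
  shows "loc_const_on S (\<lambda>x. k (g x) (h x))"
proof (rule loc_const_onI)
  fix x assume x: "x \<in> S"
  obtain U where U: "open U" "x \<in> U" "\<forall>y\<in>S \<inter> U. g y = g x"
    using assms(1) x by (rule loc_const_onE)
  obtain V where V: "open V" "x \<in> V" "\<forall>y\<in>S \<inter> V. h y = h x"
    using assms(2) x by (rule loc_const_onE)
  show "\<exists>U. open U \<and> x \<in> U \<and> (\<forall>y\<in>S \<inter> U. k (g y) (h y) = k (g x) (h x))"
  proof (intro exI[of _ "U \<inter> V"] conjI ballI)
    fix y assume "y \<in> S \<inter> (U \<inter> V)"
    then have "g y = g x" "h y = h x"
      using U(3) V(3) by blast+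
    then show "k (g y) (h y) = k (g x) (h x)"
      by simp
  qed (use U(1,2) V(1,2) in auto)
qed

lemma loc_const_on_compose1: "loc_const_on S g \<Longrightarrow> loc_const_on S (\<lambda>x. k (g x))"
  using loc_const_on_compose2[of S g g "\<lambda>a b. k a"] by simp

lemma continuous_on_nhd:
  assumes "continuous_on T f" "x \<in> T" "open U" "f x \<in> U"
  obtains V where "open V" "x \<in> V" "\<forall>y\<in>T \<inter> V. f y \<in> U"
proof -
  obtain V where "open V" "V \<inter> T = f -` U \<inter> T"
    using assms(1,3) unfolding continuous_on_open_invariant by blast
  then show thesis
    using assms(2,4) that[of V] by blast
qed

lemma loc_const_on_continuous:
  assumes "loc_const_on S g" "continuous_on T f" "f ` T \<subseteq> S"
  shows "loc_const_on T (\<lambda>x. g (f x))"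
proof (rule loc_const_onI)
  fix x assume x: "x \<in> T"
  then have "f x \<in> S"
    using assms(3) by auto
  with assms(1) obtain U where U: "open U" "f x \<in> U" "\<forall>y\<in>S \<inter> U. g y = g (f x)"
    by (rule loc_const_onE)
  obtain V where V: "open V" "x \<in> V" "\<forall>y\<in>T \<inter> V. f y \<in> U"
    by (rule continuous_on_nhd[OF assms(2) x U(1,2)])
  show "\<exists>U. open U \<and> x \<in> U \<and> (\<forall>y\<in>T \<inter> U. g (f y) = g (f x))"
  proof (intro exI[of _ V] conjI ballI)
    fix y assume "y \<in> T \<inter> V"
    then show "g (f y) = g (f x)"
      using U(3) V(3) assms(3) by blast
  qed (use V(1,2) in auto)
qed

text \<open>A point off one of the closed pieces has a neighbourhood that misses this piece. At a
  common point the two values agree, and the two neighbourhoods can be intersected.\<close>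

lemma loc_const_on_closed_glue:
  assumes g: "loc_const_on (Q1 \<inter> A) g" and h: "loc_const_on (Q2 \<inter> A) h"
    and cl: "closed Q1" "closed Q2" and eq: "\<And>x. x \<in> Q1 \<inter> Q2 \<inter> A \<Longrightarrow> g x = h x"
  shows "loc_const_on ((Q1 \<union> Q2) \<inter> A) (\<lambda>x. if x \<in> Q1 then g x else h x)"
proof (rule loc_const_onI)
  fix x assume x: "x \<in> (Q1 \<union> Q2) \<inter> A"
  obtain U where U: "open U" "x \<in> U" "x \<in> Q1 \<Longrightarrow> \<forall>y\<in>Q1 \<inter> A \<inter> U. g y = g x"
    "x \<notin> Q1 \<Longrightarrow> U \<inter> Q1 = {}"
  proof (cases "x \<in> Q1")
    case True
    then have "x \<in> Q1 \<inter> A"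
      using x by auto
    with g obtain U where "open U" "x \<in> U" "\<forall>y\<in>Q1 \<inter> A \<inter> U. g y = g x"
      by (rule loc_const_onE)
    then show thesis
      using True that by blast
  next
    case False
    then show thesis
      using that[of "- Q1"] cl by auto
  qed
  obtain V where V: "open V" "x \<in> V" "x \<in> Q2 \<Longrightarrow> \<forall>y\<in>Q2 \<inter> A \<inter> V. h y = h x"
    "x \<notin> Q2 \<Longrightarrow> V \<inter> Q2 = {}"
  proof (cases "x \<in> Q2")
    case True
    then have "x \<in> Q2 \<inter> A"
      using x by auto
    with h obtain U where "open U" "x \<in> U" "\<forall>y\<in>Q2 \<inter> A \<inter> U. h y = h x"
      by (rule loc_const_onE)
    then show thesis
      using True that by blast
  next
    case False
    then show thesis
      using that[of "- Q2"] cl by auto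
  qed
  show "\<exists>U. open U \<and> x \<in> U \<and> (\<forall>y\<in>(Q1 \<union> Q2) \<inter> A \<inter> U. (if y \<in> Q1 then g y else h y) = (if x \<in> Q1 then g x else h x))"
  proof (intro exI[of _ "U \<inter> V"] conjI ballI)
    fix y assume y: "y \<in> (Q1 \<union> Q2) \<inter> A \<inter> (U \<inter> V)"
    consider "x \<in> Q1" "y \<in> Q1" | "x \<in> Q1" "y \<notin> Q1" "y \<in> Q2" "x \<in> Q2" | "x \<notin> Q1" "y \<notin> Q1" "y \<in> Q2" "x \<in> Q2"
      using U(4) V(4) x y by blast
    then show "(if y \<in> Q1 then g y else h y) = (if x \<in> Q1 then g x else h x)"
    proof cases
      case 1
      then have "g y = g x"
        using U(3) y by blast
      with 1 show ?thesis
        by simp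
    next
      case 2
      then have "h y = h x" "g x = h x"
        using V(3) y eq[of x] x by blast+
      with 2 show ?thesis
        by simp
    next
      case 3
      then have "h y = h x"
        using V(3) y by blast
      with 3 show ?thesis
        by simp
    qed
  qed (use U(1,2) V(1,2) in auto)
qed

context group
begin

lemma mult_inv_mult: "x \<in> carrier G \<Longrightarrow> y \<in> carrier G \<Longrightarrow> x \<otimes> (inv x \<otimes> y) = y"
  by (simp add: m_assoc[symmetric])

lemma inv_mult_mult: "x \<in> carrier G \<Longrightarrow> y \<in> carrier G \<Longrightarrow> inv x \<otimes> (x \<otimes> y) = y"
  by (simp add: m_assoc[symmetric])

end

text \<open>A locally constant function \<open>c\<close> on \<open>A \<inter> B\<close> is the transition function of a principal bundle over
  \<open>A \<union> B\<close>; \<open>trivialization f Q\<close> consists of the two components of a section of its pullback along \<open>f\<close>.\<close>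

locale two_set_cocycle = group G for G :: "('g, 'm) monoid_scheme" (structure) +
  fixes A B :: "'a::topological_space set" and c :: "'a \<Rightarrow> 'g"
  assumes open_A: "openin (top_of_set (A \<union> B)) A" and open_B: "openin (top_of_set (A \<union> B)) B"
    and loc_const: "loc_const_on (A \<inter> B) c" and c_closed: "x \<in> A \<inter> B \<Longrightarrow> c x \<in> carrier G"
begin

definition trivialization :: "('b::topological_space \<Rightarrow> 'a) \<Rightarrow> 'b set \<Rightarrow> ('b \<Rightarrow> 'g) \<Rightarrow> ('b \<Rightarrow> 'g) \<Rightarrow> bool" where
  "trivialization f Q gA gB \<longleftrightarrow>
     loc_const_on (Q \<inter> f -` A) gA \<and> loc_const_on (Q \<inter> f -` B) gB \<and>
     (\<forall>x\<in>Q. (f x \<in> A \<longrightarrow> gA x \<in> carrier G) \<and> (f x \<in> B \<longrightarrow> gB x \<in> carrier G)) \<and>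
     (\<forall>x\<in>Q. f x \<in> A \<inter> B \<longrightarrow> gB x = gA x \<otimes> c (f x))"

lemma open_nhd:
  assumes f: "continuous_on Q f" "f ` Q \<subseteq> A \<union> B" and x: "x \<in> Q"
  shows "f x \<in> A \<Longrightarrow> \<exists>U. open U \<and> x \<in> U \<and> (\<forall>y\<in>Q \<inter> U. f y \<in> A)"
    and "f x \<in> B \<Longrightarrow> \<exists>U. open U \<and> x \<in> U \<and> (\<forall>y\<in>Q \<inter> U. f y \<in> B)"
proof -
  have *: "\<exists>U. open U \<and> x \<in> U \<and> (\<forall>y\<in>Q \<inter> U. f y \<in> W)" if W: "openin (top_of_set (A \<union> B)) W" and "f x \<in> W" for W
  proof -
    obtain W' where W': "open W'" "W = (A \<union> B) \<inter> W'"
      using W by (auto simp: openin_open)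
    then have "f x \<in> W'"
      using \<open>f x \<in> W\<close> by blast
    with f(1) x W'(1) obtain V where V: "open V" "x \<in> V" "\<forall>y\<in>Q \<inter> V. f y \<in> W'"
      by (rule continuous_on_nhd)
    have "\<forall>y\<in>Q \<inter> V. f y \<in> W"
      using V(3) W'(2) f(2) by blast
    then show ?thesis
      using V(1,2) by blast
  qed
  show "f x \<in> A \<Longrightarrow> \<exists>U. open U \<and> x \<in> U \<and> (\<forall>y\<in>Q \<inter> U. f y \<in> A)"
    "f x \<in> B \<Longrightarrow> \<exists>U. open U \<and> x \<in> U \<and> (\<forall>y\<in>Q \<inter> U. f y \<in> B)"
    by (rule *[OF open_A], assumption) (rule *[OF open_B], assumption)
qed

lemma trivialization_subset:
  "trivialization f Q gA gB \<Longrightarrow> Q' \<subseteq> Q \<Longrightarrow> trivialization f Q' gA gB"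
  unfolding trivialization_def by (auto elim!: loc_const_on_subset)

lemma trivialization_compose:
  assumes "trivialization f Q gA gB" "continuous_on Q' h" "h ` Q' \<subseteq> Q"
  shows "trivialization (f \<circ> h) Q' (gA \<circ> h) (gB \<circ> h)"
proof -
  have "loc_const_on (Q' \<inter> (f \<circ> h) -` W) (g \<circ> h)" if "loc_const_on (Q \<inter> f -` W) g" for W and g :: "_ \<Rightarrow> 'g"
    unfolding o_def using that
    by (rule loc_const_on_continuous) (use assms in \<open>auto intro: continuous_on_subset\<close>)
  then show ?thesis
    using assms unfolding trivialization_def by auto
qed

lemma trivialization_cong:
  assumes "trivialization f Q gA gB" "\<And>x. x \<in> Q \<Longrightarrow> f x = f' x"
  shows "trivialization f' Q gA gB"
proof -
  have "Q \<inter> f' -` W = Q \<inter> f -` W" for W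
    using assms(2) by auto
  then show ?thesis
    using assms unfolding trivialization_def by auto
qed

lemma trivialization_translate:
  assumes "trivialization f Q gA gB" "d \<in> carrier G"
  shows "trivialization f Q (\<lambda>x. d \<otimes> gA x) (\<lambda>x. d \<otimes> gB x)"
proof -
  have "d \<otimes> gB x = d \<otimes> gA x \<otimes> c (f x)" if "x \<in> Q" "f x \<in> A \<inter> B" for x
    using assms that c_closed[of "f x"] by (auto simp: trivialization_def m_assoc image_subset_iff)
  moreover have "d \<otimes> gA x \<in> carrier G" if "x \<in> Q" "f x \<in> A" for x
    using assms that by (auto simp: trivialization_def)
  moreover have "d \<otimes> gB x \<in> carrier G" if "x \<in> Q" "f x \<in> B" for x
    using assms that by (auto simp: trivialization_def)
  ultimately show ?thesis
    using assms unfolding trivialization_def by (auto intro: loc_const_on_compose1)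
qed

text \<open>The quotients \<open>hA x \<otimes> inv (gA x)\<close> and
  \<open>hB x \<otimes> inv (gB x)\<close> agree over \<open>A \<inter> B\<close>, because the
  transition function cancels. Together they form one locally constant function on the connected set
  \<open>Q\<close>.\<close>

lemma trivialization_unique:
  assumes Q: "connected Q" "Q \<noteq> {}" and f: "continuous_on Q f" "f ` Q \<subseteq> A \<union> B"
    and g: "trivialization f Q gA gB" and h: "trivialization f Q hA hB"
  obtains d where "d \<in> carrier G" "\<forall>x\<in>Q. f x \<in> A \<longrightarrow> hA x = d \<otimes> gA x"
    "\<forall>x\<in>Q. f x \<in> B \<longrightarrow> hB x = d \<otimes> gB x"
proof -
  define D where "D = (\<lambda>x. if f x \<in> A then hA x \<otimes> inv (gA x) else hB x \<otimes> inv (gB x))"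
  have cA: "gA x \<in> carrier G" "hA x \<in> carrier G" if "x \<in> Q" "f x \<in> A" for x
    using g h that by (auto simp: trivialization_def)
  have cB: "gB x \<in> carrier G" "hB x \<in> carrier G" if "x \<in> Q" "f x \<in> B" for x
    using g h that by (auto simp: trivialization_def)
  have DA: "D x = hA x \<otimes> inv (gA x)" if "f x \<in> A" for x
    using that by (simp add: D_def)
  have DB: "D x = hB x \<otimes> inv (gB x)" if "f x \<in> B" "x \<in> Q" for x
  proof (cases "f x \<in> A")
    case True
    have e: "gB x = gA x \<otimes> c (f x)" "hB x = hA x \<otimes> c (f x)"
      using g h that True by (auto simp: trivialization_def)
    have cl: "c (f x) \<in> carrier G" "gA x \<in> carrier G" "hA x \<in> carrier G"
      using that True c_closed[of "f x"] cA by auto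
    then have "hB x \<otimes> inv (gB x) = hA x \<otimes> inv (gA x)"
      unfolding e by (simp add: inv_mult_group m_assoc mult_inv_mult)
    then show ?thesis
      by (simp add: DA[OF True])
  qed (simp add: D_def)
  have xA: "x \<in> Q \<inter> f -` A" if "x \<in> Q" "f x \<in> A" for x
    using that by blast
  have xB: "x \<in> Q \<inter> f -` B" if "x \<in> Q" "f x \<in> B" for x
    using that by blast
  have "loc_const_on Q D"
  proof (rule loc_const_onI)
    fix x assume x: "x \<in> Q"
    have lA: "loc_const_on (Q \<inter> f -` A) (\<lambda>x. hA x \<otimes> inv (gA x))"
      and lB: "loc_const_on (Q \<inter> f -` B) (\<lambda>x. hB x \<otimes> inv (gB x))"
      using g h by (auto simp: trivialization_def intro: loc_const_on_compose2)
    consider "f x \<in> A" | "f x \<in> B"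
      using f x by auto
    then show "\<exists>U. open U \<and> x \<in> U \<and> (\<forall>y\<in>Q \<inter> U. D y = D x)"
    proof cases
      case 1
      then obtain U where U: "open U" "x \<in> U" "\<forall>y\<in>Q \<inter> U. f y \<in> A"
        using open_nhd(1)[OF f x] by blast
      obtain V where V: "open V" "x \<in> V" "\<forall>y\<in>Q \<inter> f -` A \<inter> V. hA y \<otimes> inv (gA y) = hA x \<otimes> inv (gA x)"
        using loc_const_onE[OF lA xA[OF x 1]] by blast
      show ?thesis
      proof (intro exI[of _ "U \<inter> V"] conjI ballI)
        fix y assume y: "y \<in> Q \<inter> (U \<inter> V)"
        then have "f y \<in> A"
          using U(3) by blast
        moreover from this have "hA y \<otimes> inv (gA y) = hA x \<otimes> inv (gA x)"
          using V(3) y by blast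
        ultimately show "D y = D x"
          by (simp only: DA 1)
      qed (use U(1,2) V(1,2) in auto)
    next
      case 2
      then obtain U where U: "open U" "x \<in> U" "\<forall>y\<in>Q \<inter> U. f y \<in> B"
        using open_nhd(2)[OF f x] by blast
      obtain V where V: "open V" "x \<in> V" "\<forall>y\<in>Q \<inter> f -` B \<inter> V. hB y \<otimes> inv (gB y) = hB x \<otimes> inv (gB x)"
        using loc_const_onE[OF lB xB[OF x 2]] by blast
      show ?thesis
      proof (intro exI[of _ "U \<inter> V"] conjI ballI)
        fix y assume y: "y \<in> Q \<inter> (U \<inter> V)"
        then have "f y \<in> B"
          using U(3) by blast
        moreover from this have "hB y \<otimes> inv (gB y) = hB x \<otimes> inv (gB x)"
          using V(3) y by blast
        ultimately show "D y = D x"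
          using x y 2 by (simp only: DB IntD1)
      qed (use U(1,2) V(1,2) in auto)
    qed
  qed
  then have const: "D x = D y" if "x \<in> Q" "y \<in> Q" for x y
    using that by (rule loc_const_on_connected[OF Q(1)])
  obtain x0 where x0: "x0 \<in> Q"
    using Q(2) by blast
  have Dc: "D x \<in> carrier G" if "x \<in> Q" for x
    using that cA cB f by (auto simp: D_def image_subset_iff)
  show thesis
  proof (rule that[of "D x0"])
    show "D x0 \<in> carrier G"
      using Dc[OF x0] .
    show "\<forall>x\<in>Q. f x \<in> A \<longrightarrow> hA x = D x0 \<otimes> gA x"
    proof (intro ballI impI)
      fix x assume x: "x \<in> Q" "f x \<in> A"
      show "hA x = D x0 \<otimes> gA x"
        unfolding const[OF x0 x(1)] DA[OF x(2)] using cA[OF x] by (simp add: m_assoc)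
    qed
    show "\<forall>x\<in>Q. f x \<in> B \<longrightarrow> hB x = D x0 \<otimes> gB x"
    proof (intro ballI impI)
      fix x assume x: "x \<in> Q" "f x \<in> B"
      show "hB x = D x0 \<otimes> gB x"
        unfolding const[OF x0 x(1)] DB[OF x(2,1)] using cB[OF x] by (simp add: m_assoc)
    qed
  qed
qed

text \<open>On the connected overlap the two sections differ by a constant left factor, which can be
  absorbed into the second one.\<close>

lemma trivialization_glue:
  assumes "closed Q1" "closed Q2" "connected (Q1 \<inter> Q2)" "Q1 \<inter> Q2 \<noteq> {}"
    and f: "continuous_on (Q1 \<union> Q2) f" "f ` (Q1 \<union> Q2) \<subseteq> A \<union> B"
    and g: "trivialization f Q1 gA gB" and h: "trivialization f Q2 hA hB"
  shows "\<exists>kA kB. trivialization f (Q1 \<union> Q2) kA kB"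
proof -
  have "continuous_on (Q1 \<inter> Q2) f" "f ` (Q1 \<inter> Q2) \<subseteq> A \<union> B"
    using continuous_on_subset[OF f(1), of "Q1 \<inter> Q2"] f(2) by blast+
  then obtain d where d: "d \<in> carrier G" "\<forall>x\<in>Q1 \<inter> Q2. f x \<in> A \<longrightarrow> gA x = d \<otimes> hA x"
    "\<forall>x\<in>Q1 \<inter> Q2. f x \<in> B \<longrightarrow> gB x = d \<otimes> hB x"
    by (rule trivialization_unique[OF assms(3,4) _ _ trivialization_subset[OF h Int_lower2] trivialization_subset[OF g Int_lower1]])
  note h' = trivialization_translate[OF h d(1)]
  let ?kA = "\<lambda>x. if x \<in> Q1 then gA x else d \<otimes> hA x" and ?kB = "\<lambda>x. if x \<in> Q1 then gB x else d \<otimes> hB x"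
  have "trivialization f (Q1 \<union> Q2) ?kA ?kB"
    unfolding trivialization_def
  proof (intro conjI)
    show "loc_const_on ((Q1 \<union> Q2) \<inter> f -` A) ?kA"
      by (rule loc_const_on_closed_glue[OF _ _ assms(1,2)])
        (use g h' d(2) in \<open>unfold trivialization_def, blast+\<close>)
    show "loc_const_on ((Q1 \<union> Q2) \<inter> f -` B) ?kB"
      by (rule loc_const_on_closed_glue[OF _ _ assms(1,2)])
        (use g h' d(3) in \<open>unfold trivialization_def, blast+\<close>)
  qed (use g h' in \<open>auto simp: trivialization_def\<close>)
  then show ?thesis
    by blast
qed

text \<open>Over a single chart the constant \<open>\<one>\<close> is a section; the transition
  function then dictates the other component.\<close>

lemma trivialization_in_one_set:
  assumes f: "continuous_on Q f" "f ` Q \<subseteq> A \<or> f ` Q \<subseteq> B"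
  shows "\<exists>gA gB. trivialization f Q gA gB"
  using f(2)
proof
  have lc: "loc_const_on {x \<in> Q. f x \<in> A \<inter> B} (\<lambda>x. c (f x))"
    using loc_const by (rule loc_const_on_continuous) (auto intro: continuous_on_subset[OF f(1)])
  {
    assume "f ` Q \<subseteq> A"
    then have "Q \<inter> f -` B = {x \<in> Q. f x \<in> A \<inter> B}"
      by auto
    then show ?thesis
      using lc c_closed
      by (intro exI[of _ "\<lambda>_. \<one>"] exI[of _ "\<lambda>x. c (f x)"]) (auto simp: trivialization_def loc_const_on_const)
  next
    assume "f ` Q \<subseteq> B"
    then have "Q \<inter> f -` A = {x \<in> Q. f x \<in> A \<inter> B}"
      by auto
    then show ?thesis
      using loc_const_on_compose1[OF lc, of "\<lambda>x. inv x"] c_closed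
      by (intro exI[of _ "\<lambda>x. inv (c (f x))"] exI[of _ "\<lambda>x. \<one>"]) (auto simp: trivialization_def loc_const_on_const)
  }
qed

text \<open>By a Lebesgue number argument each cell of a fine grid is mapped into \<open>A\<close>
  or into \<open>B\<close>. Cells are glued to rows and rows to the square; every overlap is an
  edge, hence connected.\<close>

lemma trivialization_square:
  fixes f :: "real \<times> real \<Rightarrow> 'a"
  assumes f: "continuous_on ({0..1} \<times> {0..1}) f" "f ` ({0..1} \<times> {0..1}) \<subseteq> A \<union> B"
  shows "\<exists>gA gB. trivialization f ({0..1} \<times> {0..1}) gA gB"
proof -
  let ?Q = "{0..1::real} \<times> {0..1::real}"
  let ?T = "\<lambda>Q. \<exists>gA gB. trivialization f Q gA gB"
  \<comment> \<open>The preimages of \<open>A\<close> and \<open>B\<close> are open in the square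
    only; \<open>A0\<close> and \<open>B0\<close> extend them to open sets of the plane, to which
    the Lebesgue number lemma applies.\<close>
  obtain A0 B0 where A0: "open A0" "\<forall>z\<in>?Q. f z \<in> A \<longleftrightarrow> z \<in> A0" and B0: "open B0" "\<forall>z\<in>?Q. f z \<in> B \<longleftrightarrow> z \<in> B0"
  proof -
    have "openin (top_of_set ?Q) (?Q \<inter> f -` A)" "openin (top_of_set ?Q) (?Q \<inter> f -` B)"
      by (rule continuous_openin_preimage[OF f(1) _ open_A] continuous_openin_preimage[OF f(1) _ open_B],
          use f(2) in blast)+
    then obtain A0 B0 where "open A0" "?Q \<inter> f -` A = ?Q \<inter> A0" "open B0" "?Q \<inter> f -` B = ?Q \<inter> B0"
      unfolding openin_open by blast
    then show thesis
      by (intro that[of A0 B0]) auto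
  qed
  have cQ: "compact ?Q"
    by (intro compact_Times) auto
  have cov: "?Q \<subseteq> \<Union>{A0, B0}"
  proof
    fix z assume z: "z \<in> ?Q"
    then have "f z \<in> A \<or> f z \<in> B"
      using f(2) by blast
    then show "z \<in> \<Union>{A0, B0}"
      using z A0(2) B0(2) by auto
  qed
  have op: "open W" if "W \<in> {A0, B0}" for W
    using that A0(1) B0(1) by auto
  obtain \<delta> where \<delta>: "\<delta> > 0" "\<And>T. T \<subseteq> ?Q \<Longrightarrow> diameter T < \<delta> \<Longrightarrow> \<exists>W\<in>{A0, B0}. T \<subseteq> W"
    by (rule Lebesgue_number_lemma[OF cQ insert_not_empty cov op]) (assumption, rule that)
  \<comment> \<open>A cell of side \<open>1 / n\<close> has diameter at most \<open>2 / n\<close>,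
    by adding the differences of the two coordinates.\<close>
  obtain N where N: "2 / real (Suc N) < \<delta>"
    using reals_Archimedean[of "\<delta> / 2"] \<delta>(1) by (auto simp: inverse_eq_divide)
  define n where "n = Suc N"
  let ?I = "\<lambda>i j. {real i / n .. real j / n}"
  have sub01: "?I i j \<subseteq> {0..1}" if "j \<le> n" for i j
    using that by (auto simp: n_def divide_simps intro: order_trans)
  have le: "real i / n \<le> real j / n" if "i \<le> j" for i j
    using that by (simp add: divide_right_mono)
  have Iun: "?I i k = ?I i j \<union> ?I j k" and Iint: "?I i j \<inter> ?I j k = {real j / n}" if "i \<le> j" "j \<le> k" for i j k
    using le[OF that(1)] le[OF that(2)] by auto
  have fQ: "continuous_on Q f" "f ` Q \<subseteq> A \<union> B" if "Q \<subseteq> ?Q" for Q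
    using continuous_on_subset[OF f(1) that] f(2) that by blast+
  have glue: "?T (Q1 \<union> Q2)" if "?T Q1" "?T Q2" "closed Q1" "closed Q2" "Q1 \<inter> Q2 = R" "connected R" "R \<noteq> {}"
    "Q1 \<union> Q2 \<subseteq> ?Q" for Q1 Q2 R
    using that(1,2) trivialization_glue[OF that(3,4) _ _ fQ[OF that(8)]] that(5-7) by blast
  have cI: "closed (?I i j)" "connected (?I i j)" for i j
    by simp_all
  have cell: "?T (?I i (Suc i) \<times> ?I j (Suc j))" if "i < n" "j < n" for i j
  proof -
    let ?C = "?I i (Suc i) \<times> ?I j (Suc j)"
    have C: "?C \<subseteq> ?Q"
      using sub01[of "Suc i" i] sub01[of "Suc j" j] that by (intro Sigma_mono) auto
    have "diameter ?C \<le> 2 / n"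
    proof (rule diameter_le)
      fix x y assume "x \<in> ?C" "y \<in> ?C"
      then have "\<bar>fst x - fst y\<bar> \<le> 1 / n" "\<bar>snd x - snd y\<bar> \<le> 1 / n"
        by (auto simp: add_divide_distrib abs_le_iff)
      moreover have "norm (x - y) \<le> \<bar>fst x - fst y\<bar> + \<bar>snd x - snd y\<bar>"
        using norm_Pair_le[of "fst x - fst y" "snd x - snd y"] by (simp add: prod_eq_iff flip: minus_prod_def)
      ultimately show "norm (x - y) \<le> 2 / n"
        by linarith
    qed (simp add: n_def)
    then have "\<exists>W\<in>{A0, B0}. ?C \<subseteq> W"
      using N C by (intro \<delta>(2)) (auto simp: n_def)
    then have "f ` ?C \<subseteq> A \<or> f ` ?C \<subseteq> B"
      using A0(2) B0(2) C by (auto simp: subset_iff)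
    then show ?thesis
      using trivialization_in_one_set fQ(1)[OF C] by blast
  qed
  have row: "?T (?I 0 (Suc i) \<times> ?I j (Suc j))" if "i < n" "j < n" for i j
    using that(1)
  proof (induction i)
    case 0
    then show ?case
      using cell[of 0 j] that by simp
  next
    case (Suc i)
    let ?J = "?I j (Suc j)"
    have *: "?I 0 (Suc (Suc i)) \<times> ?J = ?I 0 (Suc i) \<times> ?J \<union> ?I (Suc i) (Suc (Suc i)) \<times> ?J"
      unfolding Iun[of 0 "Suc i" "Suc (Suc i)", OF le0 le_SucI[OF order_refl]] by blast
    have i: "(?I 0 (Suc i) \<times> ?J) \<inter> (?I (Suc i) (Suc (Suc i)) \<times> ?J) = {real (Suc i) / n} \<times> ?J"
      unfolding Times_Int_Times Iint[of 0 "Suc i" "Suc (Suc i)", OF le0 le_SucI[OF order_refl]] by simp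
    have s: "?I 0 (Suc (Suc i)) \<times> ?J \<subseteq> ?Q"
      using sub01[of "Suc (Suc i)" 0] sub01[of "Suc j" j] that Suc.prems by (intro Sigma_mono) auto
    have ih: "?T (?I 0 (Suc i) \<times> ?J)" "?T (?I (Suc i) (Suc (Suc i)) \<times> ?J)"
      using Suc.IH Suc.prems cell[OF Suc.prems that(2)] by auto
    show ?case
      unfolding *
    proof (rule glue[OF ih _ _ i])
      show "{real (Suc i) / n} \<times> ?J \<noteq> {}"
        using le[of j "Suc j"] by simp
    qed (use s * in \<open>simp_all only: closed_Times connected_Times cI connected_sing\<close>)
  qed
  have "?T (?I 0 n \<times> ?I 0 (Suc j))" if "j < n" for j
    using that
  proof (induction j)
    case 0
    then show ?case
      using row[of N 0] by (simp add: n_def)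
  next
    case (Suc j)
    let ?J = "?I 0 n"
    have *: "?J \<times> ?I 0 (Suc (Suc j)) = ?J \<times> ?I 0 (Suc j) \<union> ?J \<times> ?I (Suc j) (Suc (Suc j))"
      unfolding Iun[of 0 "Suc j" "Suc (Suc j)", OF le0 le_SucI[OF order_refl]] by blast
    have i: "(?J \<times> ?I 0 (Suc j)) \<inter> (?J \<times> ?I (Suc j) (Suc (Suc j))) = ?J \<times> {real (Suc j) / n}"
      unfolding Times_Int_Times Iint[of 0 "Suc j" "Suc (Suc j)", OF le0 le_SucI[OF order_refl]] by simp
    have s: "?J \<times> ?I 0 (Suc (Suc j)) \<subseteq> ?Q"
      using sub01[of "Suc (Suc j)" 0] sub01[of n 0] Suc.prems by (intro Sigma_mono) auto
    have ih: "?T (?J \<times> ?I 0 (Suc j))" "?T (?J \<times> ?I (Suc j) (Suc (Suc j)))"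
      using Suc.IH Suc.prems row[OF _ Suc.prems, of N] by (auto simp: n_def)
    show ?case
      unfolding *
    proof (rule glue[OF ih _ _ i])
      show "?J \<times> {real (Suc j) / n} \<noteq> {}"
        using le[of 0 n] by simp
    qed (use s * in \<open>simp_all only: closed_Times connected_Times cI connected_sing\<close>)
  qed
  from this[of N] show ?thesis
    by (simp add: n_def)
qed

end

section \<open>Holonomy along paths and its homotopy invariance\<close>

context two_set_cocycle
begin

text \<open>A path is a square that is constant in its first coordinate. A left translation
  normalizes the value at \<open>0\<close>.\<close>

lemma trivialization_path:
  assumes p: "path p" "path_image p \<subseteq> A \<union> B" and 0: "p 0 \<in> A"
  obtains gA gB where "trivialization p {0..1} gA gB" "gA 0 = \<one>"
proof -
  have "continuous_on ({0..1} \<times> {0..1}) (\<lambda>z. p (snd z :: real))"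
    using p(1) unfolding path_def by (rule continuous_on_compose2) (auto intro: continuous_intros)
  moreover have "(\<lambda>z. p (snd z)) ` ({0..1::real} \<times> {0..1}) \<subseteq> A \<union> B"
    using p(2) by (auto simp: path_image_def)
  ultimately have "\<exists>gA gB. trivialization (\<lambda>z. p (snd z)) ({0..1::real} \<times> {0..1}) gA gB"
    by (rule trivialization_square)
  then obtain gA gB where g: "trivialization (\<lambda>z. p (snd z)) ({0..1::real} \<times> {0..1}) gA gB"
    by blast
  have "trivialization ((\<lambda>z. p (snd z)) \<circ> Pair (0::real)) {0..1} (gA \<circ> Pair 0) (gB \<circ> Pair 0)"
    using g by (rule trivialization_compose) (auto intro!: continuous_intros)
  then have t: "trivialization p {0..1} (gA \<circ> Pair 0) (gB \<circ> Pair 0)"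
    by (simp add: o_def)
  then have c: "gA (0, 0) \<in> carrier G"
    using 0 by (auto simp: trivialization_def)
  show thesis
    using that[OF trivialization_translate[OF t inv_closed[OF c]]] c by simp
qed

text \<open>Parallel transport along \<open>p\<close>, read in the chart \<open>A\<close> at both
  ends. With the free group as structure group, each change from \<open>A\<close> to
  \<open>B\<close> contributes a letter and each change back an inverse letter.\<close>

definition holonomy :: "(real \<Rightarrow> 'a) \<Rightarrow> 'g" where
  "holonomy p = (SOME g. \<exists>gA gB. trivialization p {0..1} gA gB \<and> gA 0 = \<one> \<and> g = gA 1)"

lemma holonomy_eq:
  assumes p: "path p" "path_image p \<subseteq> A \<union> B" "p 0 \<in> A" "p 1 \<in> A"
    and g: "trivialization p {0..1} gA gB" "gA 0 = \<one>"
  shows "holonomy p = gA 1"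
proof -
  have "\<exists>hA hB. trivialization p {0..1} hA hB \<and> hA 0 = \<one> \<and> holonomy p = hA 1"
    unfolding holonomy_def by (rule someI_ex) (use g in blast)
  then obtain hA hB where h: "trivialization p {0..1} hA hB" "hA 0 = \<one>" "holonomy p = hA 1"
    by blast
  have "continuous_on {0..1} p" "p ` {0..1} \<subseteq> A \<union> B"
    using p by (auto simp: path_def path_image_def)
  then obtain d where d: "d \<in> carrier G" "\<forall>t\<in>{0..1}. p t \<in> A \<longrightarrow> hA t = d \<otimes> gA t"
    by (rule trivialization_unique[OF _ _ _ _ g(1) h(1), rotated 2]) auto
  have "d = \<one>"
    using d(1) bspec[OF d(2), of 0] g(2) h(2) p(3) by simp
  moreover have "gA 1 \<in> carrier G"
    using g(1) p(4) by (auto simp: trivialization_def)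
  ultimately show ?thesis
    using bspec[OF d(2), of 1] p(4) h(3) by simp
qed

lemma holonomy_closed:
  assumes p: "path p" "path_image p \<subseteq> A \<union> B" "p 0 \<in> A" "p 1 \<in> A"
  shows "holonomy p \<in> carrier G"
proof -
  obtain gA gB where g: "trivialization p {0..1} gA gB" "gA 0 = \<one>"
    by (rule trivialization_path[OF p(1-3)])
  then show ?thesis
    using holonomy_eq[OF p g] p(4) by (auto simp: trivialization_def)
qed

text \<open>The pullback along the homotopy is trivialized over the whole square. The two edges on
  which the homotopy stays at an end point are mapped to a single point of \<open>A\<close>, so
  \<open>gA\<close> is constant along them, and the holonomies at both times agree.\<close>

lemma holonomy_homotopic:
  assumes pq: "homotopic_paths (A \<union> B) p q" and A: "p 0 \<in> A" "p 1 \<in> A"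
  shows "holonomy p = holonomy q"
proof -
  let ?Q = "{0..1::real} \<times> {0..1::real}"
  obtain h where h: "continuous_on ?Q h" "h \<in> ?Q \<rightarrow> A \<union> B"
    "\<forall>x\<in>{0..1}. h (0, x) = p x" "\<forall>x\<in>{0..1}. h (1, x) = q x"
    "\<forall>t\<in>{0..1}. pathstart (h \<circ> Pair t) = pathstart p \<and> pathfinish (h \<circ> Pair t) = pathfinish p"
    using pq unfolding homotopic_paths by blast
  have e: "h (t, 0) = p 0" "h (t, 1) = p 1" if "t \<in> {0..1}" for t
    using bspec[OF h(5) that] by (auto simp: pathstart_def pathfinish_def)
  have q: "q 0 = p 0" "q 1 = p 1"
    using h(4) e[of 1] by auto
  have "\<exists>gA gB. trivialization h ?Q gA gB"
    using h(1,2) by (intro trivialization_square) auto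
  then obtain kA kB where k: "trivialization h ?Q kA kB"
    by blast
  have k0: "kA (0, 0) \<in> carrier G"
    using k A(1) e(1)[of 0] by (auto simp: trivialization_def)
  define gA where "gA = (\<lambda>z. inv (kA (0, 0)) \<otimes> kA z)"
  obtain gB where g: "trivialization h ?Q gA gB"
    using trivialization_translate[OF k inv_closed[OF k0]] by (simp add: gA_def)
  have g00: "gA (0, 0) = \<one>"
    using k0 by (simp add: gA_def)
  have edge: "gA (1, y) = gA (0, y)" if y: "y \<in> {0, 1}" for y
  proof -
    have "loc_const_on {0..1} (\<lambda>t. gA (t, y))"
    proof (rule loc_const_on_continuous)
      show "loc_const_on (?Q \<inter> h -` A) gA"
        using g by (simp add: trivialization_def)
      show "(\<lambda>t. (t, y)) ` {0..1} \<subseteq> ?Q \<inter> h -` A"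
        using y A e by auto
    qed (intro continuous_intros)
    then show ?thesis
      using loc_const_on_connected[of "{0..1::real}" "\<lambda>t. gA (t, y)" 1 0] by simp
  qed
  have P: "trivialization (h \<circ> Pair t) {0..1} (gA \<circ> Pair t) (gB \<circ> Pair t)" if "t \<in> {0..1}" for t
    using g by (rule trivialization_compose) (use that in \<open>auto intro: continuous_intros\<close>)
  have tp: "trivialization p {0..1} (gA \<circ> Pair 0) (gB \<circ> Pair 0)"
    using h(3) by (intro trivialization_cong[OF P]) auto
  have hp: "holonomy p = gA (0, 1)"
    using holonomy_eq[OF _ _ _ _ tp] homotopic_paths_imp_path[OF pq] homotopic_paths_imp_subset[OF pq] A g00
    by simp
  have tq: "trivialization q {0..1} (gA \<circ> Pair 1) (gB \<circ> Pair 1)"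
    using h(4) by (intro trivialization_cong[OF P]) auto
  have hq: "holonomy q = gA (1, 1)"
    using holonomy_eq[OF _ _ _ _ tq] homotopic_paths_imp_path[OF pq] homotopic_paths_imp_subset[OF pq] A g00 q edge[of 0]
    by simp
  show ?thesis
    using hp hq edge[of 1] by simp
qed

text \<open>A section along the joined path restricts to both halves; on the second half it has to
  be normalized by its value at the midpoint.\<close>

lemma holonomy_join:
  assumes p: "path p" "path_image p \<subseteq> A \<union> B" "p 0 \<in> A" "p 1 \<in> A"
    and q: "path q" "path_image q \<subseteq> A \<union> B" "q 0 = p 1" "q 1 \<in> A"
  shows "holonomy (p +++ q) = holonomy p \<otimes> holonomy q"
proof -
  let ?r = "p +++ q"
  have pq: "pathfinish p = pathstart q"
    using q(3) by (simp add: pathfinish_def pathstart_def)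
  have r: "path ?r" "path_image ?r \<subseteq> A \<union> B"
    using path_join_imp[OF p(1) q(1) pq] subset_path_image_join[OF p(2) q(2)] by blast+
  have re: "?r 0 = p 0" "?r 1 = q 1" "?r (1/2) = p 1"
    by (simp_all add: joinpaths_def)
  obtain gA gB where g: "trivialization ?r {0..1} gA gB" "gA 0 = \<one>"
    by (rule trivialization_path[OF r]) (use re p in auto)
  have g1: "gA (1/2) \<in> carrier G" "gA 1 \<in> carrier G"
    using g(1) re p(4) q(4) by (auto simp: trivialization_def)
  have "trivialization (?r \<circ> (\<lambda>t. t / 2)) {0..1} (gA \<circ> (\<lambda>t. t / 2)) (gB \<circ> (\<lambda>t. t / 2))"
    using g(1) by (rule trivialization_compose) (auto intro!: continuous_intros)
  then have "trivialization p {0..1} (gA \<circ> (\<lambda>t. t / 2)) (gB \<circ> (\<lambda>t. t / 2))"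
    by (rule trivialization_cong) (auto simp: joinpaths_def)
  then have hp: "holonomy p = gA (1/2)"
    using holonomy_eq[OF p] g(2) by fastforce
  have "trivialization (?r \<circ> (\<lambda>t. (t + 1) / 2)) {0..1} (gA \<circ> (\<lambda>t. (t + 1) / 2)) (gB \<circ> (\<lambda>t. (t + 1) / 2))"
    using g(1) by (rule trivialization_compose) (auto intro!: continuous_intros)
  then have "trivialization q {0..1} (gA \<circ> (\<lambda>t. (t + 1) / 2)) (gB \<circ> (\<lambda>t. (t + 1) / 2))"
    by (rule trivialization_cong) (use q(3) in \<open>auto simp: joinpaths_def field_simps\<close>)
  from holonomy_eq[OF q(1,2) _ q(4) trivialization_translate[OF this inv_closed[OF g1(1)]]]
  have "holonomy q = inv (gA (1/2)) \<otimes> gA 1"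
    using g1 q p(4) by simp
  moreover have "holonomy ?r = gA 1"
    using holonomy_eq[OF r _ _ g] re p q by simp
  ultimately show ?thesis
    using hp g1 by (simp add: mult_inv_mult)
qed

end

section \<open>Fundamental groups of a union of two open sets\<close>

lemma closed_up_restrict_path:
  assumes p: "path p" "path_image p \<subseteq> S" and u: "path_component S u (p 0)" and st: "s \<in> {0..1}" "t \<in> {0..1}"
  shows "closed_up S u (restrict_path 0 t p) =
    closed_up S u (restrict_path 0 s p) \<otimes>\<^bsub>fundamental_group S u\<^esub> closed_up S u (restrict_path s t p)"
proof -
  have seg: "p ` closed_segment a b \<subseteq> S" if "a \<in> {0..1}" "b \<in> {0..1}" for a b
    using p(2) closed_segment_subset[OF that convex_real_interval(5)] by (auto simp: path_image_def)
  have sp: "is_path S (p a) (p b) (restrict_path a b p)" if "a \<in> {0..1}" "b \<in> {0..1}" for a b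
    using is_path_restrict_path[OF p(1) seg] that by blast
  have 0: "0 \<in> {0..1::real}"
    by simp
  have "homotopic_paths S (restrict_path 0 s p +++ restrict_path s t p) (restrict_path 0 t p)"
    by (rule homotopic_paths_join_restrict_path[OF p 0 st])
  then have "closed_up S u (restrict_path 0 s p +++ restrict_path s t p) = closed_up S u (restrict_path 0 t p)"
    using closed_up_eq_iff[OF u is_path_join[OF sp[OF 0 st(1)] sp[OF st]] sp[OF 0 st(2)]] by simp
  then show ?thesis
    using closed_up_join[OF u sp[OF 0 st(1)] sp[OF st]] by simp
qed

lemma restrict_path_local:
  assumes p: "path p" "path_image p \<subseteq> Y" and W: "openin (top_of_set Y) W" "p s \<in> W" and s: "s \<in> {0..1}"
  obtains U where "open U" "s \<in> U" "\<forall>t\<in>{0..1} \<inter> U. is_path W (p s) (p t) (restrict_path s t p)"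
proof -
  obtain W' where W': "open W'" "W = Y \<inter> W'"
    using W(1) unfolding openin_open by blast
  have "continuous_on {0..1} p" "p s \<in> W'"
    using p(1) W(2) W'(2) by (auto simp: path_def)
  then obtain V where V: "open V" "s \<in> V" "\<forall>t\<in>{0..1} \<inter> V. p t \<in> W'"
    using continuous_on_nhd[of "{0..1}" p s W'] s W'(1) by blast
  obtain e where e: "e > 0" "ball s e \<subseteq> V"
    using V(1,2) by (rule openE)
  show thesis
  proof (rule that[of "ball s e"])
    show "\<forall>t\<in>{0..1} \<inter> ball s e. is_path W (p s) (p t) (restrict_path s t p)"
    proof
      fix t assume t: "t \<in> {0..1} \<inter> ball s e"
      have "closed_segment s t \<subseteq> {0..1} \<inter> ball s e"
        using t s e(1) by (intro closed_segment_subset convex_Int) auto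
      then have "p ` closed_segment s t \<subseteq> p ` ({0..1} \<inter> V)"
        using e(2) by (intro image_mono) (rule subset_trans, assumption, rule Int_mono[OF order_refl])
      also have "\<dots> \<subseteq> W"
      proof
        fix z assume "z \<in> p ` ({0..1} \<inter> V)"
        then obtain r where r: "z = p r" "r \<in> {0..1} \<inter> V"
          by blast
        have "p r \<in> path_image p"
          using r(2) by (simp add: path_image_def)
        then show "z \<in> W"
          using V(3) r p(2) W'(2) by (simp add: subset_iff)
      qed
      finally have "p ` closed_segment s t \<subseteq> W" .
      then show "is_path W (p s) (p t) (restrict_path s t p)"
        using t s by (intro is_path_restrict_path[OF p(1)]) auto
    qed
  qed (use e(1) in auto)
qed

text \<open>The loop \<open>a +++ reversepath b\<close> in \<open>A\<close> dies in
  \<open>S\<close>; cancelling the class of \<open>b\<close> in the group at \<open>x\<close> gives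
  the homotopy.\<close>

lemma null_loops_imp_homotopic:
  assumes null: "\<And>x p. is_path A x x p \<Longrightarrow> homotopic_paths S p (\<lambda>_. x)" and A: "A \<subseteq> S"
    and a: "is_path A x y a" and b: "is_path A x y b"
  shows "homotopic_paths S a b"
proof -
  have a': "is_path S x y a" and b': "is_path S x y b"
    using a b A is_path_mono by blast+
  have x: "x \<in> S"
    using is_path_mem(1)[OF a'] .
  have u: "path_component S x x"
    using x by (rule path_component_refl)
  interpret group "fundamental_group S x"
    using x by (rule group_fundamental_group)
  have "homotopic_paths S (a +++ reversepath b) (\<lambda>_. x)"
    using null[OF is_path_join[OF a is_path_reverse[OF b]]] .
  then have "closed_up S x (a +++ reversepath b) = closed_up S x (\<lambda>_. x)"
    using closed_up_eq_iff[OF u is_path_join[OF a' is_path_reverse[OF b']] is_path_const[OF x]] by blast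
  then have "closed_up S x a \<otimes>\<^bsub>fundamental_group S x\<^esub> inv\<^bsub>fundamental_group S x\<^esub> closed_up S x b = \<one>\<^bsub>fundamental_group S x\<^esub>"
    using closed_up_join[OF u a' is_path_reverse[OF b']] closed_up_reverse[OF u b'] closed_up_const[OF u] by simp
  moreover have "closed_up S x a = closed_up S x a \<otimes>\<^bsub>fundamental_group S x\<^esub>
      inv\<^bsub>fundamental_group S x\<^esub> closed_up S x b \<otimes>\<^bsub>fundamental_group S x\<^esub> closed_up S x b"
    using closed_up_in_carrier[OF u a'] closed_up_in_carrier[OF u b'] by (simp add: m_assoc)
  ultimately have "closed_up S x a = closed_up S x b"
    using closed_up_in_carrier[OF u b'] by simp
  then show ?thesis
    using closed_up_eq_iff[OF u a' b'] by blast
qed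

text \<open>Since loops in \<open>A\<close> die in \<open>S\<close>, the class in \<open>S\<close>
  of a path in \<open>A\<close> depends only on its end points, and \<open>\<alpha>\<close> is a
  primitive of this dependence. On each path component of \<open>A\<close> it is the class of a
  chosen path from a chosen point, up to the final normalization.\<close>

lemma null_loops_potential:
  assumes null: "\<And>x p. is_path A x x p \<Longrightarrow> homotopic_paths S p (\<lambda>_. x)" and A: "A \<subseteq> S"
    and pc: "\<And>x. x \<in> A \<Longrightarrow> path_component S u x" and u: "u \<in> A"
  obtains \<alpha> where "\<forall>x\<in>A. \<alpha> x \<in> carrier (fundamental_group S u)"
    "\<forall>x y p. is_path A x y p \<longrightarrow> \<alpha> y = \<alpha> x \<otimes>\<^bsub>fundamental_group S u\<^esub> closed_up S u p"
    "\<alpha> u = \<one>\<^bsub>fundamental_group S u\<^esub>"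
proof -
  interpret group "fundamental_group S u"
    using u A by (intro group_fundamental_group) blast
  \<comment> \<open>Points of one path component define the same predicate and hence receive the
    same \<open>r\<close>. So the paths \<open>\<rho>\<close> have a common start on each path
    component of \<open>A\<close>.\<close>
  define r where "r = (\<lambda>x. SOME z. path_component A x z)"
  define \<rho> where "\<rho> = (\<lambda>x. SOME p. is_path A (r x) x p)"
  have \<rho>: "is_path A (r x) x (\<rho> x)" if "x \<in> A" for x
  proof -
    have "path_component A x (r x)"
      unfolding r_def by (rule someI[of _ x]) (rule path_component_refl[OF that])
    then have "\<exists>p. is_path A (r x) x p"
      using path_component_sym path_component_is_path by blast
    then show ?thesis
      unfolding \<rho>_def by (rule someI_ex)
  qed
  have \<rho>': "is_path S (r x) x (\<rho> x)" and pr: "path_component S u (r x)" if "x \<in> A" for x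
    using is_path_mono[OF \<rho>[OF that] A] pc[OF is_path_mem(1)[OF \<rho>[OF that]]] by blast+
  define \<alpha> where "\<alpha> = (\<lambda>x. closed_up S u (\<rho> x))"
  have \<alpha>c: "\<alpha> x \<in> carrier (fundamental_group S u)" if "x \<in> A" for x
    unfolding \<alpha>_def by (rule closed_up_in_carrier[OF pr[OF that] \<rho>'[OF that]])
  have \<alpha>p: "\<alpha> y = \<alpha> x \<otimes>\<^bsub>fundamental_group S u\<^esub> closed_up S u p" if p: "is_path A x y p" for x y p
  proof -
    have xy: "x \<in> A" "y \<in> A"
      using is_path_mem[OF p] by auto
    have "path_component A x y"
      using p path_component_is_path by blast
    then have "path_component_set A x = path_component_set A y"
      by (simp add: path_component_eq)
    then have "path_component A x = path_component A y"
      by (simp add: set_eq_iff fun_eq_iff)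
    then have r: "r y = r x"
      by (simp add: r_def)
    have "homotopic_paths S (\<rho> x +++ p) (\<rho> y)"
      using null A is_path_join[OF \<rho>[OF xy(1)] p] \<rho>[OF xy(2)] unfolding r by (rule null_loops_imp_homotopic)
    then have "closed_up S u (\<rho> x +++ p) = \<alpha> y"
      using closed_up_eq_iff[OF pr[OF xy(1)] is_path_join[OF \<rho>'[OF xy(1)] is_path_mono[OF p A]], of "\<rho> y"] \<rho>'[OF xy(2)]
      by (simp add: r \<alpha>_def)
    then show ?thesis
      using closed_up_join[OF pr[OF xy(1)] \<rho>'[OF xy(1)] is_path_mono[OF p A]] by (simp add: \<alpha>_def)
  qed
  \<comment> \<open>A constant left factor preserves the path formula and normalizes the value at
    \<open>u\<close>.\<close>
  let ?\<alpha> = "\<lambda>x. inv\<^bsub>fundamental_group S u\<^esub> \<alpha> u \<otimes>\<^bsub>fundamental_group S u\<^esub> \<alpha> x"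
  show thesis
  proof (rule that[of ?\<alpha>])
    show "\<forall>x\<in>A. ?\<alpha> x \<in> carrier (fundamental_group S u)"
      using \<alpha>c u by simp
    show "\<forall>x y p. is_path A x y p \<longrightarrow> ?\<alpha> y = ?\<alpha> x \<otimes>\<^bsub>fundamental_group S u\<^esub> closed_up S u p"
    proof (intro allI impI)
      fix x y p assume p: "is_path A x y p"
      have "closed_up S u p \<in> carrier (fundamental_group S u)"
        by (rule closed_up_in_carrier[OF pc[OF is_path_mem(1)[OF p]] is_path_mono[OF p A]])
      then show "?\<alpha> y = ?\<alpha> x \<otimes>\<^bsub>fundamental_group S u\<^esub> closed_up S u p"
        using \<alpha>c[OF u] \<alpha>c[OF is_path_mem(1)[OF p]] by (simp add: \<alpha>p[OF p] m_assoc)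
    qed
    show "?\<alpha> u = \<one>\<^bsub>fundamental_group S u\<^esub>"
      using \<alpha>c[OF u] by simp
  qed
qed

text \<open>Measured against a potential on the piece containing \<open>p t\<close>, the class of the initial segment
  of \<open>p\<close> up to time \<open>t\<close> is locally constant.\<close>

lemma loc_const_on_potential:
  assumes p: "path p" "path_image p \<subseteq> X" "X \<subseteq> S" and pc: "path_component S u (p 0)"
    and A: "openin (top_of_set X) A"
    and \<alpha>: "\<forall>x\<in>A. \<alpha> x \<in> carrier (fundamental_group S u)"
      "\<forall>x y p. is_path A x y p \<longrightarrow> \<alpha> y = \<alpha> x \<otimes>\<^bsub>fundamental_group S u\<^esub> closed_up S u p"
  shows "loc_const_on ({0..1} \<inter> p -` A)
    (\<lambda>t. closed_up S u (restrict_path 0 t p) \<otimes>\<^bsub>fundamental_group S u\<^esub> inv\<^bsub>fundamental_group S u\<^esub> \<alpha> (p t))"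
proof (rule loc_const_onI)
  let ?\<Gamma> = "fundamental_group S u"
  interpret group ?\<Gamma>
    using pc path_component_mem(1) by (intro group_fundamental_group) blast
  have AX: "A \<subseteq> S"
    using openin_imp_subset[OF A] p(3) by blast
  have pS: "path_image p \<subseteq> S"
    using p by blast
  fix s assume s: "s \<in> {0..1} \<inter> p -` A"
  then have s': "s \<in> {0..1}" "p s \<in> A"
    by auto
  obtain U where U: "open U" "s \<in> U" "\<forall>t\<in>{0..1} \<inter> U. is_path A (p s) (p t) (restrict_path s t p)"
    by (rule restrict_path_local[OF p(1,2) A s'(2,1)])
  have seg: "p ` closed_segment 0 s \<subseteq> S"
    using pS s' closed_segment_subset[of 0 "{0..1}" s] by (auto simp: path_image_def)
  have 0: "is_path S (p 0) (p s) (restrict_path 0 s p)"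
    by (rule is_path_restrict_path[OF p(1) seg _ s'(1)]) simp
  have ps: "path_component S u (p s)"
    by (rule path_component_is_path_trans[OF pc 0])
  show "\<exists>U. open U \<and> s \<in> U \<and> (\<forall>t\<in>{0..1} \<inter> p -` A \<inter> U.
      closed_up S u (restrict_path 0 t p) \<otimes>\<^bsub>?\<Gamma>\<^esub> inv\<^bsub>?\<Gamma>\<^esub> \<alpha> (p t) = closed_up S u (restrict_path 0 s p) \<otimes>\<^bsub>?\<Gamma>\<^esub> inv\<^bsub>?\<Gamma>\<^esub> \<alpha> (p s))"
  proof (intro exI[of _ U] conjI ballI U(1,2))
    fix t assume t: "t \<in> {0..1} \<inter> p -` A \<inter> U"
    then have t': "t \<in> {0..1}" "is_path A (p s) (p t) (restrict_path s t p)"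
      using U(3) by blast+
    let ?c = "closed_up S u (restrict_path s t p)" and ?d = "closed_up S u (restrict_path 0 s p)"
    have cl: "?c \<in> carrier ?\<Gamma>" "?d \<in> carrier ?\<Gamma>" "\<alpha> (p s) \<in> carrier ?\<Gamma>"
      using closed_up_in_carrier[OF ps is_path_mono[OF t'(2) AX]] closed_up_in_carrier[OF pc 0] \<alpha>(1) s'(2) by blast+
    have 1: "closed_up S u (restrict_path 0 t p) = ?d \<otimes>\<^bsub>?\<Gamma>\<^esub> ?c"
      by (rule closed_up_restrict_path[OF p(1) pS pc s'(1) t'(1)])
    have 2: "\<alpha> (p t) = \<alpha> (p s) \<otimes>\<^bsub>?\<Gamma>\<^esub> ?c"
      using \<alpha>(2) t'(2) by blast
    show "closed_up S u (restrict_path 0 t p) \<otimes>\<^bsub>?\<Gamma>\<^esub> inv\<^bsub>?\<Gamma>\<^esub> \<alpha> (p t) = ?d \<otimes>\<^bsub>?\<Gamma>\<^esub> inv\<^bsub>?\<Gamma>\<^esub> \<alpha> (p s)"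
      unfolding 1 2 using cl by (simp add: inv_mult_group m_assoc mult_inv_mult)
  qed
qed

lemma is_path_image_interval: "is_path S x y p \<Longrightarrow> p 0 = x \<and> p 1 = y"
  by (auto simp: is_path_def pathstart_def pathfinish_def)

lemma subgroup_image_loops:
  assumes T: "T \<subseteq> S" "u \<in> T"
  shows "subgroup {loop_class S q | q. is_path T u u q} (fundamental_group S u)"
proof -
  let ?\<Gamma> = "fundamental_group S u"
  interpret group ?\<Gamma>
    using T by (intro group_fundamental_group) blast
  have m: "is_path S u u q" if "is_path T u u q" for q
    by (rule is_path_mono[OF that T(1)])
  have pc: "path_component S u u"
    using T by (intro path_component_refl) blast
  show ?thesis
  proof (rule subgroupI)
    show "{loop_class S q | q. is_path T u u q} \<subseteq> carrier ?\<Gamma>"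
      using m by (auto simp: carrier_fundamental_group)
    show "{loop_class S q | q. is_path T u u q} \<noteq> {}"
      using is_path_const[OF T(2)] by blast
  next
    fix a assume "a \<in> {loop_class S q | q. is_path T u u q}"
    then obtain q where q: "a = loop_class S q" "is_path T u u q"
      by blast
    have "inv\<^bsub>?\<Gamma>\<^esub> a = loop_class S (reversepath q)"
      unfolding q(1) using closed_up_reverse[OF pc m[OF q(2)]]
        closed_up_loop[OF m[OF q(2)]] closed_up_loop[OF m[OF is_path_reverse[OF q(2)]]] by simp
    then show "inv\<^bsub>?\<Gamma>\<^esub> a \<in> {loop_class S q | q. is_path T u u q}"
      using is_path_reverse[OF q(2)] by blast
  next
    fix a b assume "a \<in> {loop_class S q | q. is_path T u u q}" "b \<in> {loop_class S q | q. is_path T u u q}"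
    then obtain p q where pq: "a = loop_class S p" "is_path T u u p" "b = loop_class S q" "is_path T u u q"
      by blast
    have "a \<otimes>\<^bsub>?\<Gamma>\<^esub> b = loop_class S (p +++ q)"
      unfolding pq(1,3) by (rule mult_loop_class[OF m[OF pq(2)] m[OF pq(4)]])
    then show "a \<otimes>\<^bsub>?\<Gamma>\<^esub> b \<in> {loop_class S q | q. is_path T u u q}"
      using is_path_join[OF pq(2,4)] by blast
  qed
qed

text \<open>Two sections along a loop \<open>p\<close> of the bundle with transition function
  \<open>\<gamma>\<close> are compared. One is the image under \<open>\<psi>\<close> of a section of
  the free bundle; its final value is \<open>\<psi>\<close> of the holonomy. The other is the class
  of the initial segment of \<open>p\<close> relative to the potentials; its final value is the
  class of \<open>p\<close>.\<close>

theorem union_factors_through_free_group: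
  fixes A B S T :: "'a::topological_space set" and c :: "'a \<Rightarrow> nat"
  assumes oA: "openin (top_of_set (A \<union> B)) A" and oB: "openin (top_of_set (A \<union> B)) B"
    and S: "A \<union> B \<subseteq> S" and pc: "\<And>x. x \<in> A \<union> B \<Longrightarrow> path_component S u x"
    and nullA: "\<And>x p. is_path A x x p \<Longrightarrow> homotopic_paths S p (\<lambda>_. x)"
    and nullB: "\<And>x p. is_path B x x p \<Longrightarrow> homotopic_paths S p (\<lambda>_. x)"
    and u: "u \<in> A \<inter> B" and c: "loc_const_on (A \<inter> B) c"
    and conn: "\<And>x y. x \<in> A \<inter> B \<Longrightarrow> y \<in> A \<inter> B \<Longrightarrow> c x = c y \<Longrightarrow> path_component (A \<inter> B) x y"
    and T: "T \<subseteq> S"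
    and far: "\<And>x. x \<in> A \<inter> B \<Longrightarrow> \<exists>y\<in>A \<inter> B. c y = c x \<and> (\<exists>p. is_path (A \<inter> T) u y p) \<and> (\<exists>p. is_path (B \<inter> T) u y p)"
  obtains \<phi> \<psi> where "\<phi> \<in> hom (fundamental_group (A \<union> B) u) (free_words :: (nat \<times> bool) list monoid)"
    "\<psi> \<in> hom (free_words :: (nat \<times> bool) list monoid) (fundamental_group S u)"
    "\<forall>p. is_path (A \<union> B) u u p \<longrightarrow> \<psi> (\<phi> (loop_class (A \<union> B) p)) = loop_class S p"
    "\<forall>w. \<exists>q. is_path T u u q \<and> \<psi> w = loop_class S q"
proof -
  let ?\<Gamma> = "fundamental_group S u" and ?X = "A \<union> B"
  have uS: "u \<in> S" and uA: "u \<in> A" and uB: "u \<in> B" and AS: "A \<subseteq> S" and BS: "B \<subseteq> S"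
    using u S by auto
  interpret \<Gamma>: group ?\<Gamma>
    using uS by (rule group_fundamental_group)
  obtain \<alpha> where \<alpha>: "\<forall>x\<in>A. \<alpha> x \<in> carrier ?\<Gamma>"
    "\<forall>x y p. is_path A x y p \<longrightarrow> \<alpha> y = \<alpha> x \<otimes>\<^bsub>?\<Gamma>\<^esub> closed_up S u p" "\<alpha> u = \<one>\<^bsub>?\<Gamma>\<^esub>"
    by (rule null_loops_potential[of A S u, OF nullA AS pc[OF UnI1] uA])
  obtain \<beta> where \<beta>: "\<forall>x\<in>B. \<beta> x \<in> carrier ?\<Gamma>"
    "\<forall>x y p. is_path B x y p \<longrightarrow> \<beta> y = \<beta> x \<otimes>\<^bsub>?\<Gamma>\<^esub> closed_up S u p" "\<beta> u = \<one>\<^bsub>?\<Gamma>\<^esub>"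
    by (rule null_loops_potential[of B S u, OF nullB BS pc[OF UnI2] uB])
  \<comment> \<open>If \<open>x\<close> can be reached from \<open>u\<close> in \<open>A\<close> and
    in \<open>B\<close>, this is the class of the loop that goes to \<open>x\<close> in
    \<open>A\<close> and returns in \<open>B\<close>.\<close>
  define \<gamma> where "\<gamma> = (\<lambda>x. \<alpha> x \<otimes>\<^bsub>?\<Gamma>\<^esub> inv\<^bsub>?\<Gamma>\<^esub> \<beta> x)"
  have \<gamma>c: "\<gamma> x \<in> carrier ?\<Gamma>" if "x \<in> A \<inter> B" for x
    using that \<alpha>(1) \<beta>(1) by (simp add: \<gamma>_def)
  have \<gamma>_eq: "\<gamma> y = \<gamma> x" if xy: "x \<in> A \<inter> B" "y \<in> A \<inter> B" "c x = c y" for x y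
  proof -
    obtain q where q: "is_path (A \<inter> B) x y q"
      using conn[OF xy] path_component_is_path by blast
    have e: "\<alpha> y = \<alpha> x \<otimes>\<^bsub>?\<Gamma>\<^esub> closed_up S u q" "\<beta> y = \<beta> x \<otimes>\<^bsub>?\<Gamma>\<^esub> closed_up S u q"
      using \<alpha>(2) \<beta>(2) is_path_mono[OF q Int_lower1] is_path_mono[OF q Int_lower2] by blast+
    have "path_component S u x"
      using pc xy(1) by blast
    then have "closed_up S u q \<in> carrier ?\<Gamma>"
      using closed_up_in_carrier[OF _ is_path_mono[OF is_path_mono[OF q Int_lower1] AS]] by blast
    then show ?thesis
      using xy(1) \<alpha>(1) \<beta>(1) unfolding \<gamma>_def e by (simp add: \<Gamma>.inv_mult_group \<Gamma>.m_assoc \<Gamma>.mult_inv_mult)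
  qed
  interpret C: two_set_cocycle ?\<Gamma> A B \<gamma>
  proof (unfold_locales, rule oA, rule oB)
    show "loc_const_on (A \<inter> B) \<gamma>"
    proof (rule loc_const_onI)
      fix x assume x: "x \<in> A \<inter> B"
      obtain U where U: "open U" "x \<in> U" "\<forall>y\<in>A \<inter> B \<inter> U. c y = c x"
        by (rule loc_const_onE[OF c x])
      have "\<gamma> y = \<gamma> x" if "y \<in> A \<inter> B \<inter> U" for y
        using \<gamma>_eq[OF x, of y] bspec[OF U(3) that] that by simp
      then show "\<exists>U. open U \<and> x \<in> U \<and> (\<forall>y\<in>A \<inter> B \<inter> U. \<gamma> y = \<gamma> x)"
        using U(1,2) by blast
    qed
  qed (rule \<gamma>c)
  interpret W: group "free_words :: (nat \<times> bool) list monoid"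
    by (rule group_free_words)
  interpret F: two_set_cocycle "free_words :: (nat \<times> bool) list monoid" A B "\<lambda>x. [(c x, True)]"
    by (unfold_locales, rule oA, rule oB, rule loc_const_on_compose1[OF c]) simp
  \<comment> \<open>The value of \<open>\<gamma>\<close> on the component with number
    \<open>i\<close>. Numbers that are not attained get the unit, so that all values stay in the
    subgroup \<open>?H\<close>.\<close>
  define f where "f = (\<lambda>i. if \<exists>x. x \<in> A \<inter> B \<and> c x = i then \<gamma> (SOME x. x \<in> A \<inter> B \<and> c x = i) else \<one>\<^bsub>?\<Gamma>\<^esub>)"
  have f_eq: "f (c x) = \<gamma> x" if x: "x \<in> A \<inter> B" for x
  proof -
    have ex: "\<exists>y. y \<in> A \<inter> B \<and> c y = c x"
      using x by blast
    have "(SOME y. y \<in> A \<inter> B \<and> c y = c x) \<in> A \<inter> B \<and> c (SOME y. y \<in> A \<inter> B \<and> c y = c x) = c x"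
      by (rule someI_ex[OF ex])
    then have "\<gamma> (SOME y. y \<in> A \<inter> B \<and> c y = c x) = \<gamma> x"
      using \<gamma>_eq[OF x] by simp
    then show ?thesis
      unfolding f_def using ex by simp
  qed
  have uT: "u \<in> T"
  proof -
    obtain y p where "is_path (A \<inter> T) u y p"
      using far[OF u] by blast
    from is_path_mem(1)[OF this] show ?thesis
      by blast
  qed
  let ?H = "{loop_class S q | q. is_path T u u q}"
  have H: "subgroup ?H ?\<Gamma>"
    by (rule subgroup_image_loops[OF T uT])
  \<comment> \<open>\<open>\<gamma>\<close> is constant on the component of \<open>x\<close>, which
    by \<open>far\<close> contains a point \<open>y\<close> that can be reached from
    \<open>u\<close> on both sides inside \<open>T\<close>.\<close>
  have \<gamma>H: "\<gamma> x \<in> ?H" if x: "x \<in> A \<inter> B" for x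
  proof -
    obtain y p q where y: "y \<in> A \<inter> B" "c y = c x" and p: "is_path (A \<inter> T) u y p" and q: "is_path (B \<inter> T) u y q"
      using far[OF x] by blast
    have pS: "is_path S u y p" and qS: "is_path S u y q"
      using is_path_mono[OF p] is_path_mono[OF q] T by blast+
    have uu: "path_component S u u"
      by (rule path_component_refl[OF uS])
    have l: "is_path T u u (p +++ reversepath q)"
      by (rule is_path_join[OF is_path_mono[OF p Int_lower2] is_path_reverse[OF is_path_mono[OF q Int_lower2]]])
    have "\<alpha> y = closed_up S u p" "\<beta> y = closed_up S u q"
      using \<alpha>(2,3) \<beta>(2,3) is_path_mono[OF p Int_lower1] is_path_mono[OF q Int_lower1]
        closed_up_in_carrier[OF uu pS] closed_up_in_carrier[OF uu qS] by (metis \<Gamma>.l_one)+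
    then have "\<gamma> y = closed_up S u (p +++ reversepath q)"
      using closed_up_join[OF uu pS is_path_reverse[OF qS]] closed_up_reverse[OF uu qS] by (simp add: \<gamma>_def)
    also have "\<dots> = loop_class S (p +++ reversepath q)"
      by (rule closed_up_loop[OF is_path_mono[OF l T]])
    finally show ?thesis
      using \<gamma>_eq[OF x y(1)] y(2) l by auto
  qed
  have fH: "range f \<subseteq> ?H"
  proof
    fix a assume "a \<in> range f"
    then obtain i where i: "a = f i"
      by blast
    show "a \<in> ?H"
    proof (cases "\<exists>x. x \<in> A \<inter> B \<and> c x = i")
      case True
      then obtain x where "x \<in> A \<inter> B" "c x = i"
        by blast
      then show ?thesis
        using f_eq[of x] \<gamma>H[of x] i by simp
    next
      case False
      then have "a = \<one>\<^bsub>?\<Gamma>\<^esub>"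
        unfolding i f_def by (rule if_not_P)
      then show ?thesis
        using subgroup.one_closed[OF H] by (simp only:)
    qed
  qed
  have fc: "range f \<subseteq> carrier ?\<Gamma>"
    using fH subgroup.subset[OF H] by (rule subset_trans)
  define \<psi> where "\<psi> = word_eval ?\<Gamma> f"
  have \<psi>h: "\<psi> \<in> hom free_words ?\<Gamma>"
    unfolding \<psi>_def by (rule \<Gamma>.word_eval_hom[OF fc])
  have \<psi>c: "\<psi> w \<in> carrier ?\<Gamma>" for w
    unfolding \<psi>_def by (rule \<Gamma>.word_eval_in_carrier[OF fc])
  have \<psi>1: "\<psi> [] = \<one>\<^bsub>?\<Gamma>\<^esub>"
    by (simp add: \<psi>_def)
  have \<psi>m: "\<psi> (foldr push v w) = \<psi> v \<otimes>\<^bsub>?\<Gamma>\<^esub> \<psi> w" for v w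
    unfolding \<psi>_def by (rule \<Gamma>.word_eval_mult[OF fc])
  have \<psi>g: "\<psi> [(c x, True)] = \<gamma> x" if "x \<in> A \<inter> B" for x
    using \<gamma>c[OF that] by (simp add: \<psi>_def f_eq[OF that])
  have main: "\<psi> (F.holonomy p) = loop_class S p" if p: "is_path ?X u u p" for p
  proof -
    have pp: "path p" "path_image p \<subseteq> ?X" "p 0 = u" "p 1 = u"
      using p is_path_image_interval[OF p] by (auto simp: is_path_def)
    obtain gA gB where g: "F.trivialization p {0..1} gA gB" "gA 0 = []"
      using F.trivialization_path[OF pp(1,2)] pp(3) uA by auto
    have hol: "F.holonomy p = gA 1"
      using F.holonomy_eq[OF pp(1,2) _ _ g(1)] g(2) pp(3,4) uA by simp
    \<comment> \<open>\<open>\<psi>\<close> sends the letter of a component to the value of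
      \<open>\<gamma>\<close> there, so it maps sections of the free bundle to sections for
      \<open>\<gamma>\<close>.\<close>
    have t1: "C.trivialization p {0..1} (\<lambda>t. \<psi> (gA t)) (\<lambda>t. \<psi> (gB t))"
    proof -
      have "\<psi> (gB t) = \<psi> (gA t) \<otimes>\<^bsub>?\<Gamma>\<^esub> \<gamma> (p t)" if "t \<in> {0..1}" "p t \<in> A \<inter> B" for t
        using g(1) that \<psi>m[of "gA t" "[(c (p t), True)]"] \<psi>g[OF that(2)]
        unfolding F.trivialization_def by simp
      then show ?thesis
        using g(1) \<psi>c unfolding C.trivialization_def F.trivialization_def
        by (auto intro: loc_const_on_compose1)
    qed
    let ?l = "\<lambda>t. closed_up S u (restrict_path 0 t p)"
    have pS: "path_image p \<subseteq> S"
      using pp(2) S by blast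
    have uu: "path_component S u (p 0)"
      using path_component_refl[OF uS] pp(3) by simp
    have lc: "?l t \<in> carrier ?\<Gamma>" if t: "t \<in> {0..1}" for t
    proof -
      have "p ` closed_segment 0 t \<subseteq> S"
        using pS t closed_segment_subset[of 0 "{0..1}" t] by (auto simp: path_image_def)
      then show ?thesis
        using closed_up_in_carrier[OF uu is_path_restrict_path[OF pp(1) _ _ t]] by simp
    qed
    \<comment> \<open>The quotient of the two potentials is \<open>\<gamma>\<close>, so passing from
      one potential to the other is exactly the required transition.\<close>
    have t2: "C.trivialization p {0..1} (\<lambda>t. ?l t \<otimes>\<^bsub>?\<Gamma>\<^esub> inv\<^bsub>?\<Gamma>\<^esub> \<alpha> (p t)) (\<lambda>t. ?l t \<otimes>\<^bsub>?\<Gamma>\<^esub> inv\<^bsub>?\<Gamma>\<^esub> \<beta> (p t))"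
      unfolding C.trivialization_def
    proof (intro conjI ballI impI)
      show "loc_const_on ({0..1} \<inter> p -` A) (\<lambda>t. ?l t \<otimes>\<^bsub>?\<Gamma>\<^esub> inv\<^bsub>?\<Gamma>\<^esub> \<alpha> (p t))"
        by (rule loc_const_on_potential[OF pp(1,2) S uu oA \<alpha>(1,2)])
      show "loc_const_on ({0..1} \<inter> p -` B) (\<lambda>t. ?l t \<otimes>\<^bsub>?\<Gamma>\<^esub> inv\<^bsub>?\<Gamma>\<^esub> \<beta> (p t))"
        by (rule loc_const_on_potential[OF pp(1,2) S uu oB \<beta>(1,2)])
    next
      fix t :: real assume t: "t \<in> {0..1}" "p t \<in> A \<inter> B"
      then have cl: "?l t \<in> carrier ?\<Gamma>" "\<alpha> (p t) \<in> carrier ?\<Gamma>" "\<beta> (p t) \<in> carrier ?\<Gamma>"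
        using lc \<alpha>(1) \<beta>(1) by auto
      then show "?l t \<otimes>\<^bsub>?\<Gamma>\<^esub> inv\<^bsub>?\<Gamma>\<^esub> \<beta> (p t) = ?l t \<otimes>\<^bsub>?\<Gamma>\<^esub> inv\<^bsub>?\<Gamma>\<^esub> \<alpha> (p t) \<otimes>\<^bsub>?\<Gamma>\<^esub> \<gamma> (p t)"
        by (simp add: \<gamma>_def \<Gamma>.m_assoc \<Gamma>.inv_mult_mult)
    qed (use lc \<alpha>(1) \<beta>(1) in auto)
    have co: "continuous_on {0..1} p" "p ` {0..1} \<subseteq> A \<union> B"
      using pp by (auto simp: path_def path_image_def)
    obtain d where d: "d \<in> carrier ?\<Gamma>"
      "\<forall>t\<in>{0..1}. p t \<in> A \<longrightarrow> ?l t \<otimes>\<^bsub>?\<Gamma>\<^esub> inv\<^bsub>?\<Gamma>\<^esub> \<alpha> (p t) = d \<otimes>\<^bsub>?\<Gamma>\<^esub> \<psi> (gA t)"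
      by (rule C.trivialization_unique[OF _ _ co t1 t2]) auto
    have l0: "?l 0 = \<one>\<^bsub>?\<Gamma>\<^esub>"
      using closed_up_const[OF path_component_refl[OF uS]] pp(3) by (simp add: restrict_path_same)
    have l1: "?l 1 = loop_class S p"
      using closed_up_loop[OF is_path_mono[OF p S]] by simp
    \<comment> \<open>Both sections start with the unit and thus coincide; the claim is their
      equality at time \<open>1\<close>, where the potential at \<open>u\<close> is trivial.\<close>
    have "d = \<one>\<^bsub>?\<Gamma>\<^esub>"
      using bspec[OF d(2), of 0] d(1) uA l0 pp(3) g(2) \<psi>1 \<alpha>(3) by simp
    then show ?thesis
      using bspec[OF d(2), of 1] uA l1 lc[of 1] pp(4) \<alpha>(3) \<psi>c[of "gA 1"] by (simp add: hol)
  qed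
  define \<phi> where "\<phi> = (\<lambda>P. F.holonomy (SOME q. q \<in> P))"
  have \<phi>: "\<phi> (loop_class ?X p) = F.holonomy p" if p: "is_path ?X u u p" for p
  proof -
    have "p \<in> loop_class ?X p"
      using p by (simp add: loop_class_def is_path_def)
    then have "(SOME q. q \<in> loop_class ?X p) \<in> loop_class ?X p"
      by (rule someI[of "\<lambda>q. q \<in> loop_class ?X p"])
    then have "homotopic_paths ?X p (SOME q. q \<in> loop_class ?X p)"
      by (simp add: loop_class_def)
    from F.holonomy_homotopic[OF this] show ?thesis
      unfolding \<phi>_def using is_path_image_interval[OF p] uA by simp
  qed
  have "\<phi> \<in> hom (fundamental_group ?X u) (free_words :: (nat \<times> bool) list monoid)"
  proof (rule homI)
    fix P assume "P \<in> carrier (fundamental_group ?X u)"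
    then obtain p where p: "P = loop_class ?X p" "is_path ?X u u p"
      by (auto simp: carrier_fundamental_group)
    have "F.holonomy p \<in> carrier free_words"
      by (rule F.holonomy_closed) (use p(2) is_path_image_interval[OF p(2)] uA in \<open>auto simp: is_path_def\<close>)
    then show "\<phi> P \<in> carrier free_words"
      by (simp only: p(1) \<phi>[OF p(2)])
  next
    fix P Q assume "P \<in> carrier (fundamental_group ?X u)" "Q \<in> carrier (fundamental_group ?X u)"
    then obtain p q where p: "P = loop_class ?X p" "is_path ?X u u p" and q: "Q = loop_class ?X q" "is_path ?X u u q"
      by (auto simp: carrier_fundamental_group)
    have "F.holonomy (p +++ q) = F.holonomy p \<otimes>\<^bsub>free_words\<^esub> F.holonomy q"
      by (rule F.holonomy_join)
        (use p(2) q(2) is_path_image_interval[OF p(2)] is_path_image_interval[OF q(2)] uA in \<open>auto simp: is_path_def\<close>)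
    then show "\<phi> (P \<otimes>\<^bsub>fundamental_group ?X u\<^esub> Q) = \<phi> P \<otimes>\<^bsub>free_words\<^esub> \<phi> Q"
      by (simp only: p(1) q(1) mult_loop_class[OF p(2) q(2)] \<phi>[OF p(2)] \<phi>[OF q(2)] \<phi>[OF is_path_join[OF p(2) q(2)]])
  qed
  moreover have "\<forall>p. is_path ?X u u p \<longrightarrow> \<psi> (\<phi> (loop_class ?X p)) = loop_class S p"
    using main \<phi> by simp
  moreover have "\<exists>q. is_path T u u q \<and> \<psi> w = loop_class S q" for w
  proof -
    have "\<psi> w \<in> ?H"
      unfolding \<psi>_def by (rule \<Gamma>.word_eval_closed[OF fH H])
    then show ?thesis
      by blast
  qed
  ultimately show thesis
    using that[of \<phi> \<psi>] \<psi>h by blast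
qed

section \<open>Local properties of absolute neighbourhood retracts\<close>

lemma separable_dense_sequence:
  fixes Y :: "'a::metric_space set"
  assumes "separable_space (top_of_set Y)" "Y \<noteq> {}"
  obtains T :: "nat \<Rightarrow> 'a" where "range T \<subseteq> Y" "\<forall>x\<in>Y. \<forall>e>0. \<exists>n. dist x (T n) < e"
proof -
  obtain C where C: "countable C" "C \<subseteq> Y" "top_of_set Y closure_of C = Y"
    using assms(1) by (auto simp: separable_space_def)
  then have cl: "Y \<subseteq> closure C"
    by (auto simp: closure_of_subtopology Int_absorb1)
  then have "C \<noteq> {}"
    using assms(2) by auto
  then have r: "range (from_nat_into C) = C"
    using C(1) by (rule range_from_nat_into)
  show thesis
  proof (rule that)
    show "range (from_nat_into C) \<subseteq> Y"
      using r C(2) by simp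
    show "\<forall>x\<in>Y. \<forall>e>0. \<exists>n. dist x (from_nat_into C n) < e"
    proof (intro ballI allI impI)
    fix x and e :: real assume "x \<in> Y" "e > 0"
    then obtain c where "c \<in> C" "dist c x < e"
      using cl closure_approachable by blast
    then show "\<exists>n. dist x (from_nat_into C n) < e"
      using r by (metis dist_commute rangeE)
    qed
  qed
qed

lemma product_open_contains_cylinder:
  fixes x :: "nat \<Rightarrow> real"
  assumes "open O'" "x \<in> O'"
  obtains I e where "finite I" "e > 0" "\<And>z. (\<forall>i\<in>I. \<bar>z i - x i\<bar> < e) \<Longrightarrow> z \<in> O'"
proof -
  obtain X where X: "x \<in> (\<Pi>\<^sub>E i\<in>UNIV. X i)" "\<And>i. open (X i)" "finite {i. X i \<noteq> UNIV}" "(\<Pi>\<^sub>E i\<in>UNIV. X i) \<subseteq> O'"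
    using product_topology_open_contains_basis[of "\<lambda>_. euclidean" UNIV O' x] assms
    by (auto simp: open_fun_def)
  let ?I = "{i. X i \<noteq> UNIV}"
  have "\<exists>e>0. \<forall>r. \<bar>r - x i\<bar> < e \<longrightarrow> r \<in> X i" for i
  proof -
    have "x i \<in> X i"
      using X(1) by auto
    then show ?thesis
      using X(2)[of i] by (simp add: open_dist dist_real_def)
  qed
  then obtain e where e: "\<And>i. e i > 0" "\<And>i r. \<bar>r - x i\<bar> < e i \<Longrightarrow> r \<in> X i"
    by metis
  let ?e = "Min (insert 1 (e ` ?I))"
  show thesis
  proof (rule that[of ?I ?e])
    show "?e > 0"
      using X(3) e(1) by (subst Min_gr_iff) auto
    fix z assume z: "\<forall>i\<in>?I. \<bar>z i - x i\<bar> < ?e"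
    have "z i \<in> X i" for i
    proof (cases "X i = UNIV")
      case False
      then have "?e \<le> e i"
        using X(3) by (intro Min_le) auto
      then show ?thesis
        using z False by (intro e(2)) force
    qed simp
    then show "z \<in> O'"
      using X(4) by auto
  qed (rule X(3))
qed

text \<open>\<open>Y\<close> is a closed subset of \<open>Z = Y \<times> {0} \<union> H \<times> (0, \<infinity>)\<close>, where \<open>H\<close> is a countable product of lines
  containing \<open>Y\<close> (not necessarily as a closed subset).  In \<open>Z\<close> small sets are contracted by
  lifting them off the level \<open>0\<close>; a retraction brings this contraction back to \<open>Y\<close>.\<close>

theorem ANR_space_locally_contractible:
  fixes Y :: "'a::metric_space set"
  assumes ANR: "ANR_space (top_of_set Y)" and V: "openin (top_of_set Y) V" and y: "y \<in> V"
  obtains W H a where "openin (top_of_set Y) W" "y \<in> W" "W \<subseteq> V"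
    "continuous_on ({0..1::real} \<times> W) H" "H ` ({0..1} \<times> W) \<subseteq> V" "\<forall>x\<in>W. H (0, x) = x" "\<forall>x\<in>W. H (1, x) = a"
proof -
  have yY: "y \<in> Y"
    using V y openin_imp_subset by blast
  have "separable_space (top_of_set Y)" "Y \<noteq> {}"
    using ANR yY by (auto simp: ANR_space_def)
  then obtain T :: "nat \<Rightarrow> 'a" where "\<forall>x\<in>Y. \<forall>e>0. \<exists>n. dist x (T n) < e"
    by (rule separable_dense_sequence)
  then have T: "\<exists>n. dist x (T n) < e" if "x \<in> Y" "e > 0" for x e
    using that by blast
  \<comment> \<open>Distances to a dense sequence embed \<open>Y\<close> in a countable power of the
    line. \<open>F\<close> prepends a height coordinate, which is \<open>0\<close> on
    \<open>Y\<close>.\<close>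
  define f where "f = (\<lambda>x n. dist x (T n))"
  define F where "F = (\<lambda>x. case_nat (0::real) (f x))"
  define Z0 where "Z0 = {z :: nat \<Rightarrow> real. z 0 > 0 \<or> z \<in> F ` Y}"
  have F0: "F x 0 = 0" and FS: "F x (Suc n) = dist x (T n)" for x n
    by (simp_all add: F_def f_def)
  have contF: "continuous_on Y F"
  proof (rule continuous_on_coordinatewise_then_product)
    fix i show "continuous_on Y (\<lambda>x. F x i)"
      by (cases i) (simp_all add: F0 FS continuous_intros)
  qed
  have injF: "inj_on F Y"
  proof
    fix a b assume ab: "a \<in> Y" "b \<in> Y" "F a = F b"
    show "a = b"
    proof (rule ccontr)
      assume "a \<noteq> b"
      then obtain n where n: "dist a (T n) < dist a b / 2"
        using T[OF ab(1), of "dist a b / 2"] by auto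
      have "dist b (T n) = dist a (T n)"
        using fun_cong[OF ab(3), of "Suc n"] by (simp add: FS)
      then show False
        using n dist_triangle2[of a b "T n"] by linarith
    qed
  qed
  define g where "g = inv_into Y F"
  have gF: "g (F x) = x" if "x \<in> Y" for x
    using inv_into_f_f[OF injF that] by (simp add: g_def)
  have contg: "continuous_on (F ` Y) g"
    unfolding continuous_on_topological
  proof (intro ballI allI impI)
    fix z B assume z: "z \<in> F ` Y" and B: "open B" "g z \<in> B"
    obtain x where x: "x \<in> Y" "z = F x"
      using z by blast
    obtain e where e: "e > 0" "ball x e \<subseteq> B"
      using B x gF by (metis openE)
    \<comment> \<open>Two points within \<open>e / 2\<close> of the same \<open>T n\<close> are
      within \<open>e\<close> of each other, so a condition on one coordinate controls the distance
      to \<open>x\<close>.\<close>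
    obtain n where n: "dist x (T n) < e / 2"
      using T[OF x(1), of "e / 2"] e(1) by auto
    show "\<exists>A. open A \<and> z \<in> A \<and> (\<forall>w\<in>F ` Y. w \<in> A \<longrightarrow> g w \<in> B)"
    proof (intro exI[of _ "{w. w (Suc n) < e / 2}"] conjI ballI impI)
      show "open {w :: nat \<Rightarrow> real. w (Suc n) < e / 2}"
        by (intro open_Collect_less) (auto intro: continuous_on_const)
      show "z \<in> {w. w (Suc n) < e / 2}"
        using n by (simp add: x(2) FS)
      fix w assume "w \<in> F ` Y" and w: "w \<in> {w. w (Suc n) < e / 2}"
      then obtain b where b: "b \<in> Y" "w = F b"
        by blast
      have "dist x b < e"
        using w n dist_triangle2[of x b "T n"] by (simp add: b FS)
      then show "g w \<in> B"
        using e(2) by (auto simp: b gF)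
    qed
  qed
  let ?Z = "top_of_set Z0"
  have FZ: "F ` Y \<subseteq> Z0"
    by (auto simp: Z0_def)
  have "embedding_map (top_of_set Y) ?Z F"
    unfolding embedding_map_def homeomorphic_map_maps
  proof (intro exI[of _ g])
    have "subtopology ?Z (F ` topspace (top_of_set Y)) = top_of_set (F ` Y)"
      using FZ by (simp add: subtopology_subtopology Int_absorb1)
    then show "homeomorphic_maps (top_of_set Y) (subtopology ?Z (F ` topspace (top_of_set Y))) F g"
      using contF contg gF by (auto simp: homeomorphic_maps_def)
  qed
  moreover have "closedin ?Z (F ` topspace (top_of_set Y))"
  proof -
    have "closed {z :: nat \<Rightarrow> real. z 0 = 0}"
      by (intro closed_Collect_eq) (auto intro: continuous_on_const)
    moreover have "F ` Y = Z0 \<inter> {z. z 0 = 0}"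
      by (auto simp: Z0_def F0)
    ultimately show ?thesis
      by (simp add: closedin_closed_Int)
  qed
  moreover have "metrizable_space ?Z"
    by (intro metrizable_space_subtopology metrizable_space_euclidean)
  moreover have "separable_space ?Z"
  proof -
    obtain D where D: "countable D" "D \<subseteq> Z0" "Z0 \<subseteq> closure D"
      using separable[of Z0] by blast
    then have "?Z closure_of D = Z0"
      by (auto simp: closure_of_subtopology Int_absorb1)
    then show ?thesis
      using D by (auto simp: separable_space_def)
  qed
  ultimately obtain U where U: "openin ?Z U" "F ` Y \<subseteq> U" and ret: "(F ` Y) retract_of_space (subtopology ?Z U)"
    using ANR unfolding ANR_space_def by (metis topspace_euclidean_subtopology)
  have UZ: "U \<subseteq> Z0"
    using U(1) by (rule openin_imp_subset)
  have sub: "subtopology ?Z U = top_of_set U" "subtopology (top_of_set U) (F ` Y) = top_of_set (F ` Y)"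
    using UZ U(2) by (simp_all add: subtopology_subtopology Int_absorb1)
  obtain r where r': "continuous_map (subtopology ?Z U) (subtopology (subtopology ?Z U) (F ` Y)) r"
    and r3: "\<forall>z\<in>F ` Y. r z = z"
    using ret unfolding retract_of_space_def by blast
  have r: "continuous_on U r" "r ` U \<subseteq> F ` Y" "\<And>z. z \<in> F ` Y \<Longrightarrow> r z = z"
    using r'[unfolded sub] r3 by (auto simp: image_subset_iff_funcset)
  define k where "k = (\<lambda>z. g (r z))"
  have contk: "continuous_on U k"
    unfolding k_def using contg r(1,2) by (rule continuous_on_compose2)
  have kY: "k ` U \<subseteq> Y"
    using r(2) gF by (fastforce simp: k_def)
  have kF: "k (F x) = x" if "x \<in> Y" for x
    using that r(3) gF by (simp add: k_def)
  obtain V0 where V0: "open V0" "V = Y \<inter> V0"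
    using V unfolding openin_open by blast
  have "openin (top_of_set U) (U \<inter> k -` V0)"
    by (rule continuous_openin_preimage_gen[OF contk V0(1)])
  then have "openin ?Z (U \<inter> k -` V0)"
    using U(1) openin_trans by blast
  then obtain O' where O': "open O'" "U \<inter> k -` V0 = Z0 \<inter> O'"
    unfolding openin_open by blast
  have "F y \<in> O'"
    using O'(2) U(2) yY kF[OF yY] y V0(2) by blast
  then obtain I e where I: "finite I" "e > 0" "\<And>z. (\<forall>i\<in>I. \<bar>z i - F y i\<bar> < e) \<Longrightarrow> z \<in> O'"
    using O'(1) by (metis product_open_contains_cylinder)
  define W where "W = {x \<in> Y. \<forall>i\<in>I. \<bar>F x i - F y i\<bar> < e}"
  have oW: "openin (top_of_set Y) W"
  proof -
    have "open (\<Inter>i\<in>I. {z :: nat \<Rightarrow> real. \<bar>z i - F y i\<bar> < e})"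
      by (intro open_INT I(1) ballI open_Collect_less) (auto intro!: continuous_intros)
    then have "openin (top_of_set Y) (Y \<inter> F -` (\<Inter>i\<in>I. {z. \<bar>z i - F y i\<bar> < e}))"
      by (rule continuous_openin_preimage_gen[OF contF])
    moreover have "W = Y \<inter> F -` (\<Inter>i\<in>I. {z. \<bar>z i - F y i\<bar> < e})"
      by (auto simp: W_def)
    ultimately show ?thesis
      by simp
  qed
  \<comment> \<open>The coordinates of \<open>x\<close> move linearly to those of \<open>y\<close>.
    The intermediate values need not come from a point of \<open>Y\<close>; for \<open>s > 0\<close>
    the positive height \<open>s * e / 2\<close> keeps \<open>L\<close> in \<open>Z0\<close>, and it
    stays below \<open>e\<close>, so that \<open>L\<close> does not leave the cylinder around
    \<open>F y\<close>.\<close>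
  define L where "L = (\<lambda>q :: real \<times> 'a. case_nat (fst q * e / 2) (\<lambda>n. (1 - fst q) * dist (snd q) (T n) + fst q * dist y (T n)))"
  have L0: "L (s, x) 0 = s * e / 2" and LS: "L (s, x) (Suc n) = (1 - s) * dist x (T n) + s * dist y (T n)" for s x n
    by (simp_all add: L_def)
  have contL: "continuous_on ({0..1} \<times> W) L"
  proof (rule continuous_on_coordinatewise_then_product)
    fix i show "continuous_on ({0..1} \<times> W) (\<lambda>q. L q i)"
      by (cases i) (auto simp: L_def intro!: continuous_intros)
  qed
  have LF: "L (0, x) = F x" for x
    by (auto simp: fun_eq_iff L_def F_def f_def split: nat.split)
  have L1: "L (1, x) = case_nat (e / 2) (\<lambda>n. dist y (T n))" for x
    by (simp add: L_def)
  have LU: "L (s, x) \<in> U \<inter> k -` V0" if s: "s \<in> {0..1}" and x: "x \<in> W" for s x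
  proof -
    have "L (s, x) \<in> Z0"
    proof (cases "s = 0")
      case True
      then show ?thesis
        using x by (auto simp: LF Z0_def W_def)
    next
      case False
      then show ?thesis
        using s I(2) by (auto simp: Z0_def L0)
    qed
    moreover have "L (s, x) \<in> O'"
    proof (rule I(3), intro ballI)
      fix i assume i: "i \<in> I"
      show "\<bar>L (s, x) i - F y i\<bar> < e"
      proof (cases i)
        case 0
        have "s * e \<le> 1 * e"
          using s I(2) by (intro mult_right_mono) auto
        then show ?thesis
          using 0 s I(2) by (simp add: L0 F0)
      next
        case (Suc n)
        have "L (s, x) i - F y i = (1 - s) * (F x i - F y i)"
          by (simp add: Suc LS FS algebra_simps)
        then have "\<bar>L (s, x) i - F y i\<bar> = (1 - s) * \<bar>F x i - F y i\<bar>"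
          using s by (simp add: abs_mult)
        also have "\<dots> \<le> 1 * \<bar>F x i - F y i\<bar>"
          using s by (intro mult_right_mono) auto
        also have "\<dots> < e"
          using x i by (simp add: W_def)
        finally show ?thesis .
      qed
    qed
    ultimately show ?thesis
      using O'(2) by blast
  qed
  show thesis
  proof (rule that[of W "\<lambda>q. k (L q)" "k (case_nat (e / 2) (\<lambda>n. dist y (T n)))"])
    show "openin (top_of_set Y) W"
      by (rule oW)
    show "y \<in> W"
      using yY I(2) by (simp add: W_def)
    show "continuous_on ({0..1} \<times> W) (\<lambda>q. k (L q))"
      using contk contL by (rule continuous_on_compose2) (use LU in auto)
    show V': "(\<lambda>q. k (L q)) ` ({0..1} \<times> W) \<subseteq> V"
      using LU kY V0(2) by fastforce
    show H0: "\<forall>x\<in>W. k (L (0, x)) = x"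
      by (simp add: LF kF W_def)
    then show "W \<subseteq> V"
      using V' by (force simp: image_subset_iff)
    show "\<forall>x\<in>W. k (L (1, x)) = k (case_nat (e / 2) (\<lambda>n. dist y (T n)))"
      by (simp add: L1)
  qed
qed

text \<open>The contraction joins every point of \<open>W\<close> to the point \<open>a\<close>
  inside \<open>V\<close>. This is path connectedness im kleinen, which at all points is equivalent
  to local path connectedness.\<close>

lemma ANR_space_locally_path_connected:
  fixes Y :: "'a::metric_space set"
  assumes ANR: "ANR_space (top_of_set Y)"
  shows "locally path_connected Y"
  unfolding locally_path_connected_im_kleinen
proof (intro allI impI, elim conjE)
  fix V y assume V: "openin (top_of_set Y) V" "y \<in> V"
  obtain W H a where W: "openin (top_of_set Y) W" "y \<in> W" "W \<subseteq> V"
    and H: "continuous_on ({0..1::real} \<times> W) H" "H ` ({0..1} \<times> W) \<subseteq> V" "\<forall>x\<in>W. H (0, x) = x" "\<forall>x\<in>W. H (1, x) = a"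
    by (rule ANR_space_locally_contractible[OF ANR V])
  have P: "is_path V x a (\<lambda>s. H (s, x))" if x: "x \<in> W" for x
    unfolding is_path_def
  proof (intro conjI)
    show "path (\<lambda>s. H (s, x))"
      unfolding path_def by (rule continuous_on_compose2[OF H(1)]) (use x in \<open>auto intro: continuous_intros\<close>)
    show "path_image (\<lambda>s. H (s, x)) \<subseteq> V"
      using H(2) x by (auto simp: path_image_def)
  qed (use H(3,4) x in \<open>auto simp: pathstart_def pathfinish_def\<close>)
  have "\<exists>p. path p \<and> path_image p \<subseteq> V \<and> pathstart p = y \<and> pathfinish p = x" if "x \<in> W" for x
    using is_path_join[OF P[OF W(2)] is_path_reverse[OF P[OF that]]] unfolding is_path_def by blast
  then show "\<exists>u. openin (top_of_set Y) u \<and> y \<in> u \<and> u \<subseteq> V \<and>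
     (\<forall>x. x \<in> u \<longrightarrow> (\<exists>p. path p \<and> path_image p \<subseteq> V \<and> pathstart p = y \<and> pathfinish p = x))"
    using W by blast
qed

text \<open>Contracting all points of a loop simultaneously is a free homotopy to a constant loop,
  and hence yields a based one.\<close>

lemma ANR_space_local_null_loops:
  fixes Y :: "'a::metric_space set"
  assumes ANR: "ANR_space (top_of_set Y)" and V: "openin (top_of_set Y) V" "y \<in> V"
  obtains W where "openin (top_of_set Y) W" "y \<in> W" "W \<subseteq> V"
    "\<forall>x p. is_path W x x p \<longrightarrow> homotopic_paths V p (\<lambda>_. x)"
proof -
  obtain W H a where W: "openin (top_of_set Y) W" "y \<in> W" "W \<subseteq> V"
    and H: "continuous_on ({0..1::real} \<times> W) H" "H ` ({0..1} \<times> W) \<subseteq> V" "\<forall>x\<in>W. H (0, x) = x" "\<forall>x\<in>W. H (1, x) = a"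
    by (rule ANR_space_locally_contractible[OF ANR V])
  have "homotopic_paths V p (\<lambda>_. x)" if p: "is_path W x x p" for x p
  proof -
    have cp: "continuous_on {0..1} p"
      using p by (simp add: is_path_def path_def)
    have pW: "p t \<in> W" if "t \<in> {0..1}" for t
      using p that by (auto simp: is_path_def path_image_def)
    have "homotopic_loops V p (\<lambda>_. a)"
      unfolding homotopic_loops
    proof (intro exI[of _ "\<lambda>z. H (fst z, p (snd z))"] conjI)
      have "continuous_on ({0..1::real} \<times> {0..1}) (\<lambda>z. p (snd z))"
        by (rule continuous_on_compose2[OF cp]) (auto intro!: continuous_intros)
      then show "continuous_on ({0..1} \<times> {0..1}) (\<lambda>z. H (fst z, p (snd z)))"
        by (intro continuous_on_compose2[OF H(1)] continuous_intros) (use pW in auto)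
      show "(\<lambda>z. H (fst z, p (snd z))) \<in> {0..1} \<times> {0..1} \<rightarrow> V"
      proof
        fix z :: "real \<times> real" assume "z \<in> {0..1} \<times> {0..1}"
        then have "(fst z, p (snd z)) \<in> {0..1} \<times> W"
          using pW by auto
        then show "H (fst z, p (snd z)) \<in> V"
          using H(2) by blast
      qed
      show "\<forall>x\<in>{0..1}. H (fst (0, x), p (snd (0, x))) = p x" "\<forall>x\<in>{0..1}. H (fst (1, x), p (snd (1, x))) = a"
        using H(3,4) pW by simp_all
      have "p 1 = p 0"
        using is_path_image_interval[OF p] by simp
      then show "\<forall>t\<in>{0..1}. pathfinish ((\<lambda>z. H (fst z, p (snd z))) \<circ> Pair t) = pathstart ((\<lambda>z. H (fst z, p (snd z))) \<circ> Pair t)"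
        by (simp add: pathfinish_def pathstart_def)
    qed
    from homotopic_loops_const_imp_homotopic_paths[OF this] show ?thesis
      using p by (simp add: is_path_def)
  qed
  then show thesis
    using that W by blast
qed

section \<open>Null homotopies inside compact sets\<close>

lemma locally_compact_neighbourhood:
  fixes Y :: "'a::metric_space set"
  assumes lc: "locally compact Y" and K: "compact K" "K \<subseteq> Y"
  obtains U K' where "openin (top_of_set Y) U" "K \<subseteq> U" "U \<subseteq> K'" "compact K'" "K' \<subseteq> Y"
proof -
  have "\<exists>U K'. open U \<and> x \<in> U \<and> Y \<inter> U \<subseteq> K' \<and> compact K' \<and> K' \<subseteq> Y" if x: "x \<in> K" for x
  proof -
    have "openin (top_of_set Y) Y" "x \<in> Y"
      using x K by auto
    then obtain u v where "openin (top_of_set Y) u" "compact v" "x \<in> u" "u \<subseteq> v" "v \<subseteq> Y"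
      using lc unfolding locally_def by meson
    then show ?thesis
      unfolding openin_open by blast
  qed
  then obtain U K' where UK: "\<And>x. x \<in> K \<Longrightarrow> open (U x)" "\<And>x. x \<in> K \<Longrightarrow> x \<in> U x" "\<And>x. x \<in> K \<Longrightarrow> Y \<inter> U x \<subseteq> K' x"
    "\<And>x. x \<in> K \<Longrightarrow> compact (K' x)" "\<And>x. x \<in> K \<Longrightarrow> K' x \<subseteq> Y"
    by metis
  have "K \<subseteq> (\<Union>x\<in>K. U x)"
    using UK(2) by blast
  then obtain D where D: "D \<subseteq> K" "finite D" "K \<subseteq> (\<Union>x\<in>D. U x)"
    using compactE_image[OF K(1), of K U] UK(1) by blast
  show thesis
  proof (rule that[of "Y \<inter> (\<Union>x\<in>D. U x)" "\<Union>x\<in>D. K' x"])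
    show "openin (top_of_set Y) (Y \<inter> (\<Union>x\<in>D. U x))"
      using UK(1) D(1) by (intro openin_open_Int open_UN) blast
    show "compact (\<Union>x\<in>D. K' x)"
      using UK(4) D(1) by (intro compact_UN D(2)) (simp add: subset_iff)
    show "K \<subseteq> Y \<inter> (\<Union>x\<in>D. U x)"
      using D(3) K(2) by (rule Int_greatest[rotated])
    show "Y \<inter> (\<Union>x\<in>D. U x) \<subseteq> (\<Union>x\<in>D. K' x)"
    proof
      fix z assume "z \<in> Y \<inter> (\<Union>x\<in>D. U x)"
      then obtain x where "x \<in> D" "z \<in> Y \<inter> U x"
        by auto
      then show "z \<in> (\<Union>x\<in>D. K' x)"
        using UK(3)[of x] D(1) by (intro UN_I[of x]) (auto simp: subset_iff)
    qed
    show "(\<Union>x\<in>D. K' x) \<subseteq> Y"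
      by (rule UN_least, rule UK(5), rule subsetD[OF D(1)])
  qed
qed

text \<open>The quotient of the class of the initial segment of \<open>p\<close> by
  \<open>\<kappa>\<close> is locally constant on \<open>{0..1}\<close>, hence takes the same value
  at both ends.\<close>

lemma local_potential:
  assumes p: "path p" "path_image p \<subseteq> S" and u: "path_component S u (p 0)"
    and \<kappa>: "\<And>t. t \<in> {0..1} \<Longrightarrow> \<kappa> t \<in> carrier (fundamental_group S u)"
    and loc: "\<And>s. s \<in> {0..1} \<Longrightarrow> \<exists>U. open U \<and> s \<in> U \<and>
      (\<forall>t\<in>{0..1} \<inter> U. \<kappa> t = \<kappa> s \<otimes>\<^bsub>fundamental_group S u\<^esub> closed_up S u (restrict_path s t p))"
  shows "\<kappa> 1 = \<kappa> 0 \<otimes>\<^bsub>fundamental_group S u\<^esub> closed_up S u p"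
proof -
  let ?\<Gamma> = "fundamental_group S u"
  interpret group ?\<Gamma>
    using path_component_mem(1)[OF u] by (rule group_fundamental_group)
  have seg: "p ` closed_segment s t \<subseteq> S" if "s \<in> {0..1}" "t \<in> {0..1}" for s t
  proof -
    have "closed_segment s t \<subseteq> {0..1}"
      using that by (intro closed_segment_subset) auto
    then show ?thesis
      using p(2) by (auto simp: path_image_def)
  qed
  have sp: "is_path S (p s) (p t) (restrict_path s t p)" if "s \<in> {0..1}" "t \<in> {0..1}" for s t
    by (rule is_path_restrict_path[OF p(1) seg[OF that] that])
  let ?l = "\<lambda>t. closed_up S u (restrict_path 0 t p)"
  have pc: "path_component S u (p t)" if "t \<in> {0..1}" for t
    by (rule path_component_is_path_trans[OF u sp[of 0 t]]) (use that in auto)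
  have lc: "closed_up S u (restrict_path s t p) \<in> carrier ?\<Gamma>" if "s \<in> {0..1}" "t \<in> {0..1}" for s t
    by (rule closed_up_in_carrier[OF pc[OF that(1)] sp[OF that]])
  let ?D = "\<lambda>t. ?l t \<otimes>\<^bsub>?\<Gamma>\<^esub> inv\<^bsub>?\<Gamma>\<^esub> \<kappa> t"
  have "loc_const_on {0..1} ?D"
  proof (rule loc_const_onI)
    fix s :: real assume s: "s \<in> {0..1}"
    obtain U where U: "open U" "s \<in> U" "\<forall>t\<in>{0..1} \<inter> U. \<kappa> t = \<kappa> s \<otimes>\<^bsub>?\<Gamma>\<^esub> closed_up S u (restrict_path s t p)"
      using loc[OF s] by blast
    have "?D t = ?D s" if t: "t \<in> {0..1} \<inter> U" for t
    proof -
      have t': "t \<in> {0..1}"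
        using t by blast
      have 1: "?l t = ?l s \<otimes>\<^bsub>?\<Gamma>\<^esub> closed_up S u (restrict_path s t p)"
        by (rule closed_up_restrict_path[OF p u s t'])
      have 2: "\<kappa> t = \<kappa> s \<otimes>\<^bsub>?\<Gamma>\<^esub> closed_up S u (restrict_path s t p)"
        using U(3) t by blast
      have cl: "?l s \<in> carrier ?\<Gamma>" "\<kappa> s \<in> carrier ?\<Gamma>" "closed_up S u (restrict_path s t p) \<in> carrier ?\<Gamma>"
        using lc s t' \<kappa>[OF s] by auto
      show ?thesis
        unfolding 1 2 using cl by (simp add: inv_mult_group m_assoc mult_inv_mult)
    qed
    then show "\<exists>U. open U \<and> s \<in> U \<and> (\<forall>t\<in>{0..1} \<inter> U. ?D t = ?D s)"
      using U(1,2) by blast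
  qed
  then have "?D 1 = ?D 0"
    by (intro loc_const_on_connected[of "{0..1::real}" ?D]) auto
  moreover have "?l 0 = \<one>\<^bsub>?\<Gamma>\<^esub>"
    unfolding restrict_path_same by (rule closed_up_const[OF u])
  moreover have cl: "closed_up S u p \<in> carrier ?\<Gamma>" "\<kappa> 0 \<in> carrier ?\<Gamma>" "\<kappa> 1 \<in> carrier ?\<Gamma>"
    using lc[of 0 1] \<kappa> by auto
  ultimately have *: "closed_up S u p \<otimes>\<^bsub>?\<Gamma>\<^esub> inv\<^bsub>?\<Gamma>\<^esub> \<kappa> 1 = inv\<^bsub>?\<Gamma>\<^esub> \<kappa> 0"
    by simp
  have "closed_up S u p = closed_up S u p \<otimes>\<^bsub>?\<Gamma>\<^esub> inv\<^bsub>?\<Gamma>\<^esub> \<kappa> 1 \<otimes>\<^bsub>?\<Gamma>\<^esub> \<kappa> 1"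
    using cl by (simp add: m_assoc)
  then have "closed_up S u p = inv\<^bsub>?\<Gamma>\<^esub> \<kappa> 0 \<otimes>\<^bsub>?\<Gamma>\<^esub> \<kappa> 1"
    unfolding * .
  then show ?thesis
    using cl by (simp add: mult_inv_mult)
qed

text \<open>The compact set consists of a compact neighbourhood of \<open>K\<close> and the traces of finitely many null
  homotopies.\<close>

lemma compact_null_loops:
  fixes Y :: "'a::metric_space set"
  assumes lpc: "locally path_connected Y" and lc: "locally compact Y"
    and lsc: "\<And>V y. openin (top_of_set Y) V \<Longrightarrow> y \<in> V \<Longrightarrow>
      \<exists>W. openin (top_of_set Y) W \<and> y \<in> W \<and> W \<subseteq> V \<and> (\<forall>x p. is_path W x x p \<longrightarrow> homotopic_paths V p (\<lambda>_. x))"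
    and sc: "\<And>x y p q. is_path Y x y p \<Longrightarrow> is_path Y x y q \<Longrightarrow> homotopic_paths Y p q"
    and pcY: "path_connected Y" and K: "compact K" "K \<subseteq> Y"
  obtains L where "compact L" "L \<subseteq> Y" "\<forall>x p. is_path K x x p \<longrightarrow> homotopic_paths L p (\<lambda>_. x)"
proof (cases "K = {}")
  case True
  then show thesis
    using that[of "{}"] is_path_mem by fastforce
next
  case False
  then obtain y0 where y0: "y0 \<in> K"
    by blast
  obtain O' K' where O': "openin (top_of_set Y) O'" "K \<subseteq> O'" "O' \<subseteq> K'" "compact K'" "K' \<subseteq> Y"
    by (rule locally_compact_neighbourhood[OF lc K])
  have "\<exists>U. open U \<and> y \<in> U \<and> (\<forall>x p. is_path (Y \<inter> U) x x p \<longrightarrow> homotopic_paths K' p (\<lambda>_. x))" if y: "y \<in> K" for y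
  proof -
    have "y \<in> O'"
      using y O'(2) by blast
    then obtain W where W: "openin (top_of_set Y) W" "y \<in> W" "\<forall>x p. is_path W x x p \<longrightarrow> homotopic_paths O' p (\<lambda>_. x)"
      using lsc[OF O'(1)] by blast
    obtain U where U: "open U" "W = Y \<inter> U"
      using W(1) unfolding openin_open by blast
    have "homotopic_paths K' p (\<lambda>_. x)" if "is_path (Y \<inter> U) x x p" for x p
      using W(3) that U(2) homotopic_paths_subset[OF _ O'(3)] by simp
    then show ?thesis
      using U W(2) by blast
  qed
  then obtain U where U: "\<forall>y\<in>K. open (U y) \<and> y \<in> U y \<and> (\<forall>x p. is_path (Y \<inter> U y) x x p \<longrightarrow> homotopic_paths K' p (\<lambda>_. x))"
    by metis
  have "K \<subseteq> \<Union>(U ` K)"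
    using U by blast
  moreover have "open G" if "G \<in> U ` K" for G
    using U that by blast
  \<comment> \<open>A Lebesgue number: loops in the part of \<open>Y\<close> within
    \<open>\<delta>\<close> of a point of \<open>K\<close> are null in \<open>K'\<close>.\<close>
  ultimately obtain \<delta> where \<delta>: "\<delta> > 0" "\<And>x. x \<in> K \<Longrightarrow> \<exists>G\<in>U ` K. ball x \<delta> \<subseteq> G"
    by (rule Heine_Borel_lemma[OF K(1)]) (assumption | rule that)+
  have null: "homotopic_paths K' p (\<lambda>_. x)" if z: "z \<in> K" and p: "is_path (Y \<inter> ball z \<delta>) x x p" for z x p
  proof -
    obtain y where "y \<in> K" "ball z \<delta> \<subseteq> U y"
      using \<delta>(2)[OF z] by blast
    then have "is_path (Y \<inter> U y) x x p"
      by (intro is_path_mono[OF p]) blast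
    then show ?thesis
      using bspec[OF U \<open>y \<in> K\<close>] by blast
  qed
  \<comment> \<open>With radius \<open>\<delta> / 4\<close>, a piece and any piece meeting it lie
    together in the ball of radius \<open>\<delta>\<close> around the first centre, where loops are
    null.\<close>
  have "\<exists>W. openin (top_of_set Y) W \<and> path_connected W \<and> z \<in> W \<and> W \<subseteq> O' \<inter> ball z (\<delta> / 4)" if z: "z \<in> K" for z
  proof -
    have "openin (top_of_set Y) (O' \<inter> ball z (\<delta> / 4))"
      by (rule openin_Int_open[OF O'(1) open_ball])
    moreover have "z \<in> O' \<inter> ball z (\<delta> / 4)"
      using z O'(2) \<delta>(1) by auto
    ultimately show ?thesis
      using lpc unfolding locally_path_connected by blast
  qed
  then obtain W where W: "\<forall>z\<in>K. openin (top_of_set Y) (W z) \<and> path_connected (W z) \<and> z \<in> W z \<and> W z \<subseteq> O' \<inter> ball z (\<delta> / 4)"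
    by metis
  obtain N where N: "\<forall>z\<in>K. open (N z) \<and> W z = Y \<inter> N z"
    using W unfolding openin_open by metis
  have "K \<subseteq> (\<Union>z\<in>K. N z)"
    using W N by blast
  then obtain D where D: "D \<subseteq> K" "finite D" "K \<subseteq> (\<Union>z\<in>D. N z)"
    using compactE_image[OF K(1), of K N] N by blast
  have cover: "\<exists>z\<in>D. x \<in> W z" if "x \<in> K" for x
    using D(1,3) N K(2) that by blast
  have y0Y: "y0 \<in> Y"
    using y0 K(2) by blast
  have "\<exists>p. is_path Y y0 z p" if "z \<in> Y" for z
    using pcY y0Y that unfolding path_connected_component path_component_is_path by blast
  then obtain b where b: "\<forall>z\<in>Y. is_path Y y0 z (b z)"
    by metis
  have Wb: "W z \<subseteq> ball z (\<delta> / 4)" if "z \<in> K" for z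
    using W that by blast
  have WY: "W z \<subseteq> Y" if "z \<in> K" for z
    using N that by blast
  \<comment> \<open>For overlapping pieces the base paths to the two centres differ by a short path
    \<open>e\<close>, up to a homotopy in \<open>Y\<close>. The compact trace \<open>M\<close> of
    this homotopy goes into \<open>L\<close>, and there are only finitely many pairs.\<close>
  have "\<exists>e M. compact M \<and> M \<subseteq> Y \<and> is_path (W z \<union> W z') z z' e \<and> homotopic_paths M (b z +++ e) (b z')"
    if z: "z \<in> D" "z' \<in> D" "W z \<inter> W z' \<noteq> {}" for z z'
  proof -
    have zK: "z \<in> K" "z' \<in> K"
      using z D(1) by auto
    obtain x where x: "x \<in> W z" "x \<in> W z'"
      using z(3) by blast
    have "path_component (W z) z x" "path_component (W z') x z'"
      using W zK x unfolding path_connected_component by blast+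
    then obtain e1 e2 where e: "is_path (W z) z x e1" "is_path (W z') x z' e2"
      unfolding path_component_is_path by blast
    have e12: "is_path (W z \<union> W z') z z' (e1 +++ e2)"
      by (rule is_path_join[OF is_path_mono[OF e(1) Un_upper1] is_path_mono[OF e(2) Un_upper2]])
    have zY: "z \<in> Y" "z' \<in> Y"
      using zK K(2) by auto
    have "homotopic_paths Y (b z +++ (e1 +++ e2)) (b z')"
      using b zY is_path_mono[OF e12 Un_least[OF WY[OF zK(1)] WY[OF zK(2)]]] by (intro sc[OF is_path_join]) auto
    then obtain h where h: "continuous_on ({0..1::real} \<times> {0..1::real}) h" "h \<in> {0..1} \<times> {0..1} \<rightarrow> Y"
      and h': "\<forall>x\<in>{0..1}. h (0, x) = (b z +++ (e1 +++ e2)) x" "\<forall>x\<in>{0..1}. h (1, x) = b z' x"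
      "\<forall>t\<in>{0..1}. pathstart (h \<circ> Pair t) = pathstart (b z +++ (e1 +++ e2)) \<and> pathfinish (h \<circ> Pair t) = pathfinish (b z +++ (e1 +++ e2))"
      unfolding homotopic_paths by blast
    let ?M = "h ` ({0..1} \<times> {0..1})"
    have "compact ?M"
      by (rule compact_continuous_image[OF h(1)]) (intro compact_Times compact_Icc)
    moreover have "?M \<subseteq> Y"
      using h(2) by blast
    moreover have "homotopic_paths ?M (b z +++ (e1 +++ e2)) (b z')"
      unfolding homotopic_paths using h(1) h' by (intro exI[of _ h] conjI) auto
    ultimately show ?thesis
      using e12 by blast
  qed
  then obtain e M where eM: "\<And>z z'. z \<in> D \<Longrightarrow> z' \<in> D \<Longrightarrow> W z \<inter> W z' \<noteq> {} \<Longrightarrow>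
      compact (M z z') \<and> M z z' \<subseteq> Y \<and> is_path (W z \<union> W z') z z' (e z z') \<and> homotopic_paths (M z z') (b z +++ e z z') (b z')"
    by metis
  let ?P = "{(z, z'). z \<in> D \<and> z' \<in> D \<and> W z \<inter> W z' \<noteq> {}}"
  define L where "L = K' \<union> (\<Union>(z, z')\<in>?P. M z z')"
  have "finite ?P"
    by (rule finite_subset[of _ "D \<times> D"]) (use D(2) in auto)
  then have cL: "compact L"
    unfolding L_def using eM O'(4) by (intro compact_Un compact_UN) auto
  have LY: "L \<subseteq> Y"
    unfolding L_def using eM O'(5) by (intro Un_least UN_least) auto
  have MsubL: "M z z' \<subseteq> L" if "z \<in> D" "z' \<in> D" "W z \<inter> W z' \<noteq> {}" for z z'
    unfolding L_def using that by blast
  have K'L: "K' \<subseteq> L"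
    unfolding L_def by blast
  have WL: "W z \<subseteq> L" if "z \<in> D" for z
    using W D(1) that O'(3) K'L by blast
  have KL: "K \<subseteq> L"
    using O'(2,3) K'L by blast
  have y0L: "path_component L y0 y0"
    using y0 KL by (intro path_component_refl) blast
  have Wne: "W z \<inter> W z \<noteq> {}" if "z \<in> D" for z
    using W D(1) that by blast
  \<comment> \<open>The pair \<open>(z, z)\<close> is among those used for \<open>L\<close>, and its
    homotopy ends in \<open>b z\<close>.\<close>
  have bL: "is_path L y0 z (b z)" if z: "z \<in> D" for z
  proof -
    have h: "homotopic_paths L (b z +++ e z z) (b z)"
      using eM[OF z z Wne[OF z]] homotopic_paths_subset[OF _ MsubL[OF z z Wne[OF z]]] by blast
    have "z \<in> Y"
      using z D(1) K(2) by blast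
    then have "is_path Y y0 z (b z)"
      using b by blast
    then show ?thesis
      using homotopic_paths_imp_subset[OF h] by (simp add: is_path_def)
  qed
  let ?\<Gamma> = "fundamental_group L y0"
  interpret \<Gamma>: group ?\<Gamma>
    using y0 KL by (intro group_fundamental_group) blast
  define i where "i = (\<lambda>x. SOME z. z \<in> D \<and> x \<in> W z)"
  have i: "i x \<in> D" "x \<in> W (i x)" if "x \<in> K" for x
  proof -
    have "\<exists>z. z \<in> D \<and> x \<in> W z"
      using cover[OF that] by blast
    from someI_ex[OF this] show "i x \<in> D" "x \<in> W (i x)"
      by (auto simp: i_def)
  qed
  define w where "w = (\<lambda>x. SOME p. is_path (W (i x)) (i x) x p)"
  have w: "is_path (W (i x)) (i x) x (w x)" if "x \<in> K" for x
  proof -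
    have "path_component (W (i x)) (i x) x"
      using W i[OF that] D(1) unfolding path_connected_component by blast
    then have "\<exists>p. is_path (W (i x)) (i x) x p"
      unfolding path_component_is_path .
    from someI_ex[OF this] show ?thesis
      by (simp add: w_def)
  qed
  define \<beta> where "\<beta> = (\<lambda>z. closed_up L y0 (b z))"
  define \<omega> where "\<omega> = (\<lambda>x. closed_up L y0 (w x))"
  \<comment> \<open>The class of the path to \<open>x\<close> through the chosen centre
    \<open>i x\<close>. By \<open>step\<close> it changes along a short path by the class of that
    path. So by \<open>local_potential\<close> a loop in \<open>K\<close>, along which it returns to
    its first value, has trivial class.\<close>
  define \<kappa> where "\<kappa> = (\<lambda>x. \<beta> (i x) \<otimes>\<^bsub>?\<Gamma>\<^esub> \<omega> x)"
  have pz: "path_component L y0 z" if "z \<in> D" for z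
    by (rule path_component_is_path_trans[OF y0L bL[OF that]])
  have wL: "is_path L (i x) x (w x)" if "x \<in> K" for x
    by (rule is_path_mono[OF w[OF that] WL[OF i(1)[OF that]]])
  have \<beta>c: "\<beta> z \<in> carrier ?\<Gamma>" if "z \<in> D" for z
    unfolding \<beta>_def by (rule closed_up_in_carrier[OF y0L bL[OF that]])
  have \<omega>c: "\<omega> x \<in> carrier ?\<Gamma>" if "x \<in> K" for x
    unfolding \<omega>_def by (rule closed_up_in_carrier[OF pz[OF i(1)[OF that]] wL[OF that]])
  have \<kappa>c: "\<kappa> x \<in> carrier ?\<Gamma>" if "x \<in> K" for x
    unfolding \<kappa>_def using \<beta>c[OF i(1)[OF that]] \<omega>c[OF that] by simp
  have step: "\<kappa> x' = \<kappa> x \<otimes>\<^bsub>?\<Gamma>\<^esub> closed_up L y0 s" if x: "x \<in> K" and x': "x' \<in> K" and s: "is_path (W (i x)) x x' s" for x x' s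
  proof -
    have ix: "i x \<in> D" "i x' \<in> D" "i x \<in> K"
      using i x x' D(1) by blast+
    have ne: "W (i x) \<inter> W (i x') \<noteq> {}"
      using is_path_mem(2)[OF s] i(2)[OF x'] by blast
    let ?e = "e (i x) (i x')" and ?U = "W (i x) \<union> W (i x')"
    have e: "is_path ?U (i x) (i x') ?e" "homotopic_paths L (b (i x) +++ ?e) (b (i x'))"
      using eM[OF ix(1,2) ne] homotopic_paths_subset[OF _ MsubL[OF ix(1,2) ne]] by blast+
    have UL: "?U \<subseteq> L"
      using WL ix by blast
    have eL: "is_path L (i x) (i x') ?e" and sL: "is_path L x x' s"
      using is_path_mono[OF e(1) UL] is_path_mono[OF s WL[OF ix(1)]] by blast+
    let ?E = "closed_up L y0 ?e" and ?S = "closed_up L y0 s"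
    have Ec: "?E \<in> carrier ?\<Gamma>"
      by (rule closed_up_in_carrier[OF pz[OF ix(1)] eL])
    have px: "path_component L y0 x"
      by (rule path_component_is_path_trans[OF pz[OF ix(1)] wL[OF x]])
    have Sc: "?S \<in> carrier ?\<Gamma>"
      by (rule closed_up_in_carrier[OF px sL])
    have "closed_up L y0 (b (i x) +++ ?e) = \<beta> (i x')"
      unfolding \<beta>_def using closed_up_eq_iff[OF y0L is_path_join[OF bL[OF ix(1)] eL] bL[OF ix(2)]] e(2) by simp
    then have 1: "\<beta> (i x') = \<beta> (i x) \<otimes>\<^bsub>?\<Gamma>\<^esub> ?E"
      using closed_up_join[OF y0L bL[OF ix(1)] eL] by (simp add: \<beta>_def)
    have "?U \<subseteq> Y \<inter> ball (i x) \<delta>"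
    proof
      fix v assume v: "v \<in> ?U"
      have W1: "dist (i x) v' < \<delta> / 4" if "v' \<in> W (i x)" for v'
        using subsetD[OF Wb[OF ix(3)] that] by simp
      have W2: "dist (i x') v' < \<delta> / 4" if "v' \<in> W (i x')" for v'
        using subsetD[OF Wb[OF subsetD[OF D(1) ix(2)]] that] by simp
      have "dist (i x) v < \<delta>"
      proof (cases "v \<in> W (i x)")
        case True
        then show ?thesis
          using W1[of v] \<delta>(1) by linarith
      next
        case False
        then have "dist (i x') v < \<delta> / 4" "dist (i x') x' < \<delta> / 4" "dist (i x) x' < \<delta> / 4"
          using W1[OF is_path_mem(2)[OF s]] W2[OF i(2)[OF x']] W2[of v] v by auto
        then show ?thesis
          using dist_triangle[of "i x" v "x'"] dist_triangle3[of x' v "i x'"] \<delta>(1) by linarith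
      qed
      then show "v \<in> Y \<inter> ball (i x) \<delta>"
        using UL LY v by auto
    qed
    then have nullU: "homotopic_paths L p (\<lambda>_. a)" if "is_path ?U a a p" for a p
      using null[OF ix(3) is_path_mono[OF that]] homotopic_paths_subset[OF _ K'L] by blast
    have l: "is_path ?U (i x) x' (w x +++ s)" and r: "is_path ?U (i x) x' (?e +++ w x')"
      by (rule is_path_join[OF is_path_mono[OF w[OF x] Un_upper1] is_path_mono[OF s Un_upper1]])
        (rule is_path_join[OF e(1) is_path_mono[OF w[OF x'] Un_upper2]])
    have "homotopic_paths L (w x +++ s) (?e +++ w x')"
      by (rule null_loops_imp_homotopic[OF nullU UL l r])
    then have "closed_up L y0 (w x +++ s) = closed_up L y0 (?e +++ w x')"
      using closed_up_eq_iff[OF pz[OF ix(1)] is_path_mono[OF l UL] is_path_mono[OF r UL]] by simp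
    then have 2: "\<omega> x \<otimes>\<^bsub>?\<Gamma>\<^esub> ?S = ?E \<otimes>\<^bsub>?\<Gamma>\<^esub> \<omega> x'"
      using closed_up_join[OF pz[OF ix(1)] wL[OF x] sL] closed_up_join[OF pz[OF ix(1)] eL wL[OF x']]
      by (simp add: \<omega>_def)
    show ?thesis
      using \<beta>c[OF ix(1)] \<omega>c[OF x] \<omega>c[OF x'] Ec Sc by (simp add: \<kappa>_def 1 2 \<Gamma>.m_assoc)
  qed
  have "homotopic_paths L p (\<lambda>_. x)" if p: "is_path K x x p" for x p
  proof -
    have pp: "path p" "path_image p \<subseteq> K" "p 0 = x" "p 1 = x"
      using p is_path_image_interval[OF p] by (auto simp: is_path_def)
    have x: "x \<in> K"
      using is_path_mem(1)[OF p] .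
    have pK: "p t \<in> K" if "t \<in> {0..1}" for t
      using pp(2) that by (auto simp: path_image_def)
    have px: "path_component L y0 x"
      by (rule path_component_is_path_trans[OF pz[OF i(1)[OF x]] wL[OF x]])
    have "\<kappa> (p 1) = \<kappa> (p 0) \<otimes>\<^bsub>?\<Gamma>\<^esub> closed_up L y0 p"
    proof (rule local_potential[where \<kappa> = "\<lambda>t. \<kappa> (p t)", OF pp(1) subset_trans[OF pp(2) KL]])
      show "path_component L y0 (p 0)"
        using px pp(3) by simp
      show "\<kappa> (p t) \<in> carrier ?\<Gamma>" if "t \<in> {0..1}" for t
        by (rule \<kappa>c[OF pK[OF that]])
      fix s :: real assume s: "s \<in> {0..1}"
      have "openin (top_of_set Y) (W (i (p s)))"
        using W i(1)[OF pK[OF s]] D(1) by blast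
      then obtain V where V: "open V" "s \<in> V" "\<forall>t\<in>{0..1} \<inter> V. is_path (W (i (p s))) (p s) (p t) (restrict_path s t p)"
        using restrict_path_local[OF pp(1) subset_trans[OF pp(2) K(2)] _ i(2)[OF pK[OF s]] s] by blast
      have "\<kappa> (p t) = \<kappa> (p s) \<otimes>\<^bsub>?\<Gamma>\<^esub> closed_up L y0 (restrict_path s t p)" if t: "t \<in> {0..1} \<inter> V" for t
        using step[OF pK[OF s] pK] V(3) t by blast
      then show "\<exists>V. open V \<and> s \<in> V \<and> (\<forall>t\<in>{0..1} \<inter> V. \<kappa> (p t) = \<kappa> (p s) \<otimes>\<^bsub>?\<Gamma>\<^esub> closed_up L y0 (restrict_path s t p))"
        using V(1,2) by blast
    qed
    then have "closed_up L y0 p = \<one>\<^bsub>?\<Gamma>\<^esub>"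
      using \<kappa>c[OF x] closed_up_in_carrier[OF px is_path_mono[OF p KL]] pp(3,4) by simp
    then show ?thesis
      using closed_up_eq_iff[OF px is_path_mono[OF p KL] is_path_const[of x L]] closed_up_const[OF px] x KL by auto
  qed
  then show thesis
    using that[OF cL LY] by blast
qed

section \<open>Complements of compact sets and ends\<close>

definition bounded_in :: "'a::topological_space set \<Rightarrow> 'a set \<Rightarrow> bool" where
  "bounded_in Y U \<longleftrightarrow> (\<exists>K. compact K \<and> K \<subseteq> Y \<and> U \<subseteq> K)"

lemma bounded_in_subset: "bounded_in Y V \<Longrightarrow> U \<subseteq> V \<Longrightarrow> bounded_in Y U"
  unfolding bounded_in_def by (meson subset_trans)

lemma bounded_in_compact: "compact K \<Longrightarrow> K \<subseteq> Y \<Longrightarrow> bounded_in Y K"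
  unfolding bounded_in_def by blast

lemma bounded_in_Un: "bounded_in Y U \<Longrightarrow> bounded_in Y V \<Longrightarrow> bounded_in Y (U \<union> V)"
  unfolding bounded_in_def by (meson compact_Un Un_mono Un_least)

lemma bounded_in_Union:
  assumes "finite \<V>" "\<And>V. V \<in> \<V> \<Longrightarrow> bounded_in Y V"
  shows "bounded_in Y (\<Union>\<V>)"
  using assms
proof (induction \<V>)
  case empty
  then show ?case
    using bounded_in_compact[of "{}" Y] by simp
next
  case (insert V \<V>)
  then show ?case
    using bounded_in_Un[of Y V "\<Union>\<V>"] by simp
qed

lemma component_openin:
  assumes "locally path_connected Y" "openin (top_of_set Y) W" "V \<in> components W"
  shows "openin (top_of_set Y) V"
  using assms locally_path_connected_imp_locally_connected[OF assms(1)] locally_connected_open_component by blast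

lemma path_component_open_eq:
  assumes "locally path_connected Y" "openin (top_of_set Y) W"
  shows "path_component W x y \<longleftrightarrow> connected_component W x y"
  using path_component_eq_connected_component[OF locally_open_subset[OF assms]] by simp

text \<open>The components are open and disjoint, so a finite subcover of \<open>Q\<close> by
  components contains all components that meet \<open>Q\<close>.\<close>

lemma finite_components_meeting_compact:
  fixes Y :: "'a::metric_space set"
  assumes lpc: "locally path_connected Y" and W: "openin (top_of_set Y) W" and Q: "compact Q" "Q \<subseteq> W"
  shows "finite {V \<in> components W. V \<inter> Q \<noteq> {}}"
proof -
  have "\<forall>V\<in>components W. \<exists>N. open N \<and> V = Y \<inter> N"
    using component_openin[OF lpc W] unfolding openin_open by blast
  then obtain N where N: "\<forall>V\<in>components W. open (N V) \<and> V = Y \<inter> N V"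
    by metis
  have cov: "Q \<subseteq> (\<Union>V\<in>components W. N V)"
  proof
    fix x assume "x \<in> Q"
    then have "x \<in> \<Union>(components W)"
      using Q(2) by (simp add: Union_components subset_iff)
    then obtain V where "V \<in> components W" "x \<in> V"
      by blast
    then show "x \<in> (\<Union>V\<in>components W. N V)"
      using N by blast
  qed
  obtain \<D> where \<D>: "\<D> \<subseteq> components W" "finite \<D>" "Q \<subseteq> (\<Union>V\<in>\<D>. N V)"
    by (rule compactE_image[OF Q(1) _ cov]) (use N in blast)+
  have "{V \<in> components W. V \<inter> Q \<noteq> {}} \<subseteq> \<D>"
  proof
    fix V assume "V \<in> {V \<in> components W. V \<inter> Q \<noteq> {}}"
    then obtain x where x: "V \<in> components W" "x \<in> V" "x \<in> Q"
      by blast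
    then obtain V' where V': "V' \<in> \<D>" "x \<in> N V'"
      using \<D>(3) by blast
    have "x \<in> Y"
      using N x by blast
    then have "x \<in> V'"
      using N V' \<D>(1) by blast
    then have "V \<inter> V' \<noteq> {}"
      using x(2) by blast
    then have "V = V'"
      using components_eq[OF x(1), of V'] V'(1) \<D>(1) by blast
    then show "V \<in> \<D>"
      using V'(1) by simp
  qed
  then show ?thesis
    using \<D>(2) finite_subset by blast
qed

text \<open>Otherwise \<open>V \<inter> R\<close> is clopen in \<open>V\<close>, hence empty or all
  of \<open>V\<close>. The latter is excluded by assumption. In the former case \<open>V\<close>
  misses a neighbourhood of \<open>P\<close> and is clopen in the connected set
  \<open>Y\<close>.\<close>

lemma component_meets_frontier:
  fixes Y :: "'a::metric_space set"
  assumes lpc: "locally path_connected Y" and con: "connected Y"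
    and P: "closedin (top_of_set Y) P" "P \<noteq> {}" and R: "openin (top_of_set Y) R" "P \<subseteq> R"
    and V: "V \<in> components (Y - P)" "\<not> V \<subseteq> R"
  shows "\<exists>x\<in>V. x \<in> closure R - R"
proof (rule ccontr)
  assume neg: "\<not> (\<exists>x\<in>V. x \<in> closure R - R)"
  have W: "openin (top_of_set Y) (Y - P)"
    using P(1) by (simp add: closedin_def)
  have oV: "openin (top_of_set Y) V"
    by (rule component_openin[OF lpc W V(1)])
  have VP: "V \<subseteq> Y - P" and cV: "connected V" and nV: "V \<noteq> {}"
    using V(1) in_components_subset in_components_connected in_components_nonempty by blast+
  show False
  proof (cases "V \<inter> R = {}")
    case True
    have "closedin (top_of_set (Y - P)) V"
      by (rule closedin_component[OF V(1)])
    then have "openin (top_of_set (Y - P)) (Y - P - V)"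
      by (simp add: closedin_def)
    then have "openin (top_of_set Y) (Y - P - V)"
      using openin_trans W by blast
    then have "openin (top_of_set Y) ((Y - P - V) \<union> R)"
      using R(1) by (rule openin_Un)
    moreover have "(Y - P - V) \<union> R = Y - V"
      using True R openin_imp_subset[OF R(1)] by blast
    ultimately have "closedin (top_of_set Y) V"
      using VP by (auto simp: closedin_def)
    then have "V = {} \<or> V = Y"
      using con oV unfolding connected_clopen by blast
    then show False
      using nV VP P openin_imp_subset[OF R(1)] R(2) by blast
  next
    case False
    have "openin (top_of_set V) (V \<inter> R)"
      using R(1) VP openin_subtopology_Int2[of euclidean] unfolding openin_open by blast
    moreover have "V \<inter> R = V \<inter> closure R"
      using neg closure_subset[of R] by blast
    then have "closedin (top_of_set V) (V \<inter> R)"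
      using closedin_closed_Int[of "closure R" V] by simp
    ultimately have "V \<inter> R = V"
      using cV False unfolding connected_clopen by blast
    then show False
      using V(2) by blast
  qed
qed

text \<open>A component that leaves \<open>R\<close> meets the frontier of \<open>R\<close>, which
  lies in the compact set \<open>K' - R\<close>.\<close>

lemma finite_components_leaving:
  fixes Y :: "'a::metric_space set"
  assumes lpc: "locally path_connected Y" and con: "connected Y"
    and K: "compact K" "K \<subseteq> Y" "K \<noteq> {}" and R: "openin (top_of_set Y) R" "K \<subseteq> R" "R \<subseteq> K'" "compact K'" "K' \<subseteq> Y"
  shows "finite {V \<in> components (Y - K). \<not> V \<subseteq> R}"
proof -
  have cK: "closedin (top_of_set Y) K"
    using K by (simp add: closed_subset compact_imp_closed)
  then have W: "openin (top_of_set Y) (Y - K)"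
    by (simp add: closedin_def)
  obtain R' where R': "open R'" "R = Y \<inter> R'"
    using R(1) unfolding openin_open by blast
  have "K' - R = K' - R'"
    using R'(2) R(5) by blast
  then have "compact (K' - R)"
    using compact_diff[OF R(4) R'(1)] by simp
  moreover have "K' - R \<subseteq> Y - K"
    using R by blast
  ultimately have "finite {V \<in> components (Y - K). V \<inter> (K' - R) \<noteq> {}}"
    by (rule finite_components_meeting_compact[OF lpc W])
  moreover have "{V \<in> components (Y - K). \<not> V \<subseteq> R} \<subseteq> {V \<in> components (Y - K). V \<inter> (K' - R) \<noteq> {}}"
  proof
    fix V assume "V \<in> {V \<in> components (Y - K). \<not> V \<subseteq> R}"
    then have V: "V \<in> components (Y - K)" "\<not> V \<subseteq> R"
      by auto
    obtain x where x: "x \<in> V" "x \<in> closure R - R"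
      using component_meets_frontier[OF lpc con cK K(3) R(1,2) V] by blast
    have "closure R \<subseteq> K'"
      using R(3) compact_imp_closed[OF R(4)] by (rule closure_minimal)
    then show "V \<in> {V \<in> components (Y - K). V \<inter> (K' - R) \<noteq> {}}"
      using x V(1) by blast
  qed
  ultimately show ?thesis
    by (rule finite_subset[rotated])
qed

lemma clopen_contains_component:
  assumes U: "openin (top_of_set W) U" "closedin (top_of_set W) U" and V: "V \<in> components W" "V \<inter> U \<noteq> {}"
  shows "V \<subseteq> U"
proof -
  have VW: "V \<subseteq> W" and cV: "connected V"
    using V(1) in_components_subset in_components_connected by blast+
  have "openin (top_of_set V) (V \<inter> U)" "closedin (top_of_set V) (V \<inter> U)"
    using U VW by (auto simp: openin_open closedin_closed)
  then have "V \<inter> U = V"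
    using cV V(2) unfolding connected_clopen by blast
  then show ?thesis
    by blast
qed

text \<open>All but finitely many components of \<open>Y - K\<close> lie in the bounded set
  \<open>R\<close>. If the remaining ones inside \<open>U\<close> were bounded too, then so would be
  \<open>U\<close>.\<close>

lemma unbounded_component:
  fixes Y :: "'a::metric_space set"
  assumes lpc: "locally path_connected Y" and con: "connected Y" and lc: "locally compact Y"
    and K: "compact K" "K \<subseteq> Y" and U: "openin (top_of_set (Y - K)) U" "closedin (top_of_set (Y - K)) U" "\<not> bounded_in Y U"
  shows "\<exists>V\<in>components (Y - K). V \<subseteq> U \<and> \<not> bounded_in Y V"
proof (cases "K = {}")
  \<comment> \<open>Only a nonempty set has a frontier that components must meet; here connectedness
    of \<open>Y\<close> decides.\<close>
  case True
  have "U = {} \<or> U = Y"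
    using con U(1,2) True unfolding connected_clopen by simp
  moreover have "U \<noteq> {}"
    using U(3) bounded_in_compact[of "{}" Y] by auto
  ultimately have "U = Y" "U \<noteq> {}"
    by auto
  then have "components (Y - K) = {U}"
    using True con components_eq_sing_iff[of Y] by simp
  then show ?thesis
    using U(3) by auto
next
  case False
  obtain R K' where R: "openin (top_of_set Y) R" "K \<subseteq> R" "R \<subseteq> K'" "compact K'" "K' \<subseteq> Y"
    by (rule locally_compact_neighbourhood[OF lc K])
  let ?\<V> = "{V \<in> components (Y - K). \<not> V \<subseteq> R}"
  have fin: "finite ?\<V>"
    by (rule finite_components_leaving[OF lpc con K False R])
  show ?thesis
  proof (rule ccontr)
    assume neg: "\<not> ?thesis"
    let ?\<U> = "{V \<in> ?\<V>. V \<subseteq> U}"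
    have "bounded_in Y (\<Union>?\<U>)"
      using neg by (intro bounded_in_Union finite_subset[OF _ fin]) auto
    then have "bounded_in Y (K' \<union> \<Union>?\<U>)"
      using bounded_in_Un bounded_in_compact[OF R(4,5)] by blast
    moreover have "U \<subseteq> K' \<union> \<Union>?\<U>"
    proof
      fix z assume z: "z \<in> U"
      then have "z \<in> Y - K"
        using openin_imp_subset[OF U(1)] by blast
      then obtain V where V: "V \<in> components (Y - K)" "z \<in> V"
        using Union_components[of "Y - K"] by blast
      have "V \<subseteq> U"
        by (rule clopen_contains_component[OF U(1,2) V(1)]) (use z V(2) in blast)
      then show "z \<in> K' \<union> \<Union>?\<U>"
        using V R(3) by blast
    qed
    ultimately show False
      using U(3) bounded_in_subset by blast
  qed
qed

text \<open>Dependent choice yields nested unbounded components of the complements of an exhaustion,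
  starting inside \<open>U\<close>; they determine an end.\<close>

lemma end_in_unbounded_set:
  fixes Y :: "'a::metric_space set"
  assumes lpc: "locally path_connected Y" and con: "connected Y" and lc: "locally compact Y"
    and E: "compact_exhaustion Y E"
    and K: "compact K" "K \<subseteq> Y" and U: "openin (top_of_set (Y - K)) U" "closedin (top_of_set (Y - K)) U" "\<not> bounded_in Y U"
  shows "\<exists>e\<in>ends Y. e K \<subseteq> U"
proof -
  \<comment> \<open>With \<open>K\<close> contained in every stage, all complements are parts of
    \<open>Y - K\<close>, and the nested components can be chosen inside \<open>U\<close>.\<close>
  define X where "X = (\<lambda>n. K \<union> E n)"
  have X: "compact (X n)" "X n \<subseteq> Y" "X n \<subseteq> X (Suc n)" for n
    using E K unfolding X_def compact_exhaustion_def by (auto intro: compact_Un)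
  have Xe: "\<exists>n. C \<subseteq> X n" if "compact C" "C \<subseteq> Y" for C
    using E that unfolding X_def compact_exhaustion_def by (meson le_supI2)
  have Xmono: "X m \<subseteq> X n" if "m \<le> n" for m n
    using lift_Suc_mono_le[of X, OF X(3) that] .
  have shrink: "\<exists>V'\<in>components (Y - C'). V' \<subseteq> V \<and> \<not> bounded_in Y V'"
    if C: "C \<subseteq> C'" "compact C'" "C' \<subseteq> Y" and V: "openin (top_of_set (Y - C)) V" "closedin (top_of_set (Y - C)) V" "\<not> bounded_in Y V"
    for C C' V
  proof -
    have "Y - C' \<subseteq> Y - C"
      using C(1) by blast
    then have "openin (top_of_set (Y - C')) ((Y - C') \<inter> V)" "closedin (top_of_set (Y - C')) ((Y - C') \<inter> V)"
      using V(1,2) unfolding openin_open closedin_closed by blast+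
    moreover have "\<not> bounded_in Y ((Y - C') \<inter> V)"
    proof
      assume "bounded_in Y ((Y - C') \<inter> V)"
      then have "bounded_in Y (C' \<union> ((Y - C') \<inter> V))"
        using bounded_in_Un bounded_in_compact[OF C(2,3)] by blast
      moreover have "V \<subseteq> C' \<union> ((Y - C') \<inter> V)"
        using openin_imp_subset[OF V(1)] by blast
      ultimately show False
        using V(3) bounded_in_subset by blast
    qed
    ultimately show ?thesis
      using unbounded_component[OF lpc con lc C(2,3)] by blast
  qed
  have clopen: "openin (top_of_set (Y - C)) V" "closedin (top_of_set (Y - C)) V" if "compact C" "V \<in> components (Y - C)" for C V
  proof -
    have "openin (top_of_set Y) (Y - C)"
      using that(1) compact_imp_closed by (metis Diff_eq openin_open_Int open_Compl)
    then have "openin (top_of_set Y) V"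
      using component_openin[OF lpc _ that(2)] by blast
    then show "openin (top_of_set (Y - C)) V"
      using in_components_subset[OF that(2)] by (rule openin_subset_trans) blast
    show "closedin (top_of_set (Y - C)) V"
      by (rule closedin_component[OF that(2)])
  qed
  have "\<exists>f. \<forall>n. (f n \<in> components (Y - X n) \<and> f n \<subseteq> U \<and> \<not> bounded_in Y (f n)) \<and> f (Suc n) \<subseteq> f n"
  proof (rule dependent_nat_choice)
    have "K \<subseteq> X 0"
      by (simp add: X_def)
    from shrink[OF this X(1,2) U]
    show "\<exists>V. V \<in> components (Y - X 0) \<and> V \<subseteq> U \<and> \<not> bounded_in Y V"
      by blast
  next
    fix V n assume V: "V \<in> components (Y - X n) \<and> V \<subseteq> U \<and> \<not> bounded_in Y V"
    then have V1: "V \<in> components (Y - X n)" and V2: "\<not> bounded_in Y V"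
      by auto
    from shrink[OF X(3) X(1,2) clopen[OF X(1) V1] V2]
    show "\<exists>V'. (V' \<in> components (Y - X (Suc n)) \<and> V' \<subseteq> U \<and> \<not> bounded_in Y V') \<and> V' \<subseteq> V"
      using V by blast
  qed
  then obtain f where f: "\<And>n. f n \<in> components (Y - X n)" "\<And>n. f n \<subseteq> U" "\<And>n. f (Suc n) \<subseteq> f n"
    by blast
  have fmono: "f n \<subseteq> f m" if "m \<le> n" for m n
    using lift_Suc_antimono_le[of f, OF f(3) that] .
  have "\<exists>x. x \<in> f n" for n
    using in_components_nonempty[OF f(1)] by blast
  then obtain pt where pt: "\<And>n. pt n \<in> f n"
    by metis
  \<comment> \<open>An end has a value on every compact set, while the components \<open>f n\<close>
    exist along the exhaustion only. The value on \<open>C\<close> is the component of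
    \<open>Y - C\<close> that contains the connected set \<open>f (\<nu> C)\<close>.\<close>
  define \<nu> where "\<nu> = (\<lambda>C. LEAST n. C \<subseteq> X n)"
  have \<nu>: "C \<subseteq> X (\<nu> C)" if "compact C" "C \<subseteq> Y" for C
    unfolding \<nu>_def using Xe[OF that] by (rule LeastI_ex)
  define cc where "cc = (\<lambda>C. connected_component_set (Y - C) (pt (\<nu> C)))"
  define e where "e = (\<lambda>C\<in>{C. compact C \<and> C \<subseteq> Y}. cc C)"
  have f_sub: "f n \<subseteq> Y - C" if "C \<subseteq> X n" for n C
    using in_components_subset[OF f(1)[of n]] that by blast
  have cc_comp: "cc C \<in> components (Y - C)" if "compact C" "C \<subseteq> Y" for C
    unfolding cc_def using pt f_sub[OF \<nu>[OF that]] by (intro componentsI) blast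
  have cc_mono: "cc D \<subseteq> cc C" if "compact C" "compact D" "C \<subseteq> D" "D \<subseteq> Y" for C D
  proof -
    have CY: "C \<subseteq> Y"
      using that by blast
    have "C \<subseteq> X (\<nu> D)"
      using \<nu>[OF that(2,4)] that(3) by blast
    then have "(LEAST n. C \<subseteq> X n) \<le> \<nu> D"
      by (rule Least_le)
    moreover have "\<nu> C = (LEAST n. C \<subseteq> X n)"
      by (simp only: \<nu>_def)
    ultimately have "\<nu> C \<le> \<nu> D"
      by simp
    then have "pt (\<nu> D) \<in> f (\<nu> C)"
      using pt[of "\<nu> D"] fmono[of "\<nu> C" "\<nu> D"] by (simp add: subset_iff)
    then have "connected_component (Y - C) (pt (\<nu> C)) (pt (\<nu> D))"
      unfolding connected_component_def
      by (intro exI[of _ "f (\<nu> C)"] conjI in_components_connected[OF f(1)] f_sub \<nu> that CY pt)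
    then have "connected_component_set (Y - C) (pt (\<nu> D)) = cc C"
      unfolding cc_def by (intro connected_component_eq) simp
    moreover have "cc D \<subseteq> connected_component_set (Y - C) (pt (\<nu> D))"
      unfolding cc_def using that(3) by (intro connected_component_mono) blast
    ultimately show ?thesis
      by simp
  qed
  have "e \<in> ends Y"
    unfolding ends_def
  proof (intro CollectI conjI allI impI)
    show "e \<in> (\<Pi>\<^sub>E C\<in>{C. compact C \<and> C \<subseteq> Y}. components (Y - C))"
      unfolding e_def using cc_comp by auto
    fix C D assume CD: "compact C \<and> compact D \<and> C \<subseteq> D \<and> D \<subseteq> Y"
    then have "C \<subseteq> Y"
      by blast
    then show "e D \<subseteq> e C"
      using CD cc_mono by (simp add: e_def)
  qed
  moreover have "e K \<subseteq> U"
  proof -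
    have "pt (\<nu> K) \<in> cc K"
      using pt f_sub[OF \<nu>[OF K]] unfolding cc_def by (simp add: subset_iff)
    then have "cc K \<subseteq> U"
      using pt f(2) by (intro clopen_contains_component[OF U(1,2) cc_comp[OF K]]) blast
    then show ?thesis
      using K by (simp add: e_def)
  qed
  ultimately show ?thesis
    by blast
qed

text \<open>If both sets were unbounded, the value at \<open>K\<close> of the only end would lie in
  each of them.\<close>

lemma one_end_imp_bounded:
  fixes Y :: "'a::metric_space set"
  assumes lpc: "locally path_connected Y" and con: "connected Y" and lc: "locally compact Y"
    and E: "compact_exhaustion Y E" and e: "ends Y = {e}"
    and K: "compact K" "K \<subseteq> Y" and U: "openin (top_of_set (Y - K)) U" "closedin (top_of_set (Y - K)) U"
    and V: "openin (top_of_set (Y - K)) V" "closedin (top_of_set (Y - K)) V" and dis: "U \<inter> V = {}"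
  shows "bounded_in Y U \<or> bounded_in Y V"
proof (rule ccontr)
  assume neg: "\<not> ?thesis"
  have "e K \<subseteq> U" "e K \<subseteq> V"
    using end_in_unbounded_set[OF lpc con lc E K U] end_in_unbounded_set[OF lpc con lc E K V] neg e by auto
  then have "e K = {}"
    using dis by blast
  moreover have "e \<in> ends Y"
    using e by simp
  then have "e K \<in> components (Y - K)"
    using K unfolding ends_def by auto
  ultimately show False
    using in_components_nonempty by blast
qed

text \<open>\<open>L\<close> absorbs a compact neighbourhood of \<open>K\<close> and the finitely
  many bounded components that leave it. The points outside \<open>L\<close> then lie in unbounded
  components, of which a space with one end has only one.\<close>

lemma one_end_imp_joined_outside:
  fixes Y :: "'a::metric_space set"
  assumes lpc: "locally path_connected Y" and con: "connected Y" and lc: "locally compact Y"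
    and E: "compact_exhaustion Y E" and e: "ends Y = {e}" and K: "compact K" "K \<subseteq> Y"
  obtains L where "compact L" "K \<subseteq> L" "L \<subseteq> Y" "\<forall>x\<in>Y - L. \<forall>y\<in>Y - L. path_component (Y - K) x y"
proof -
  obtain y where y: "y \<in> Y"
  proof -
    have "e \<in> ends Y"
      using e by simp
    then have "e {} \<in> components Y"
      unfolding ends_def by (auto simp: PiE_iff)
    then show thesis
      using that in_components_nonempty in_components_subset by blast
  qed
  \<comment> \<open>The additional point makes the removed set nonempty, as
    \<open>finite_components_leaving\<close> requires.\<close>
  define K1 where "K1 = insert y K"
  have K1: "compact K1" "K1 \<subseteq> Y" "K1 \<noteq> {}"
    using K y by (auto simp: K1_def)
  obtain R K' where R: "openin (top_of_set Y) R" "K1 \<subseteq> R" "R \<subseteq> K'" "compact K'" "K' \<subseteq> Y"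
    by (rule locally_compact_neighbourhood[OF lc K1(1,2)])
  let ?\<V> = "{V \<in> components (Y - K1). \<not> V \<subseteq> R}"
  have fin: "finite ?\<V>"
    by (rule finite_components_leaving[OF lpc con K1 R])
  have W: "openin (top_of_set Y) (Y - K1)"
    using K1(1) compact_imp_closed by (metis Diff_eq openin_open_Int open_Compl)
  have clopen: "openin (top_of_set (Y - K1)) V" "closedin (top_of_set (Y - K1)) V" if "V \<in> components (Y - K1)" for V
    using component_openin[OF lpc W that] in_components_subset[OF that] closedin_component[OF that]
      openin_subset_trans[of Y V "Y - K1"] by auto
  let ?\<B> = "{V \<in> ?\<V>. bounded_in Y V}"
  have "bounded_in Y (\<Union>?\<B>)"
    by (intro bounded_in_Union finite_subset[OF _ fin]) auto
  then have "\<exists>M. compact M \<and> M \<subseteq> Y \<and> \<Union>?\<B> \<subseteq> M"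
    by (rule bounded_in_def[THEN iffD1])
  then obtain M where M: "compact M" "M \<subseteq> Y" "\<Union>?\<B> \<subseteq> M"
    by (elim exE conjE)
  show thesis
  proof (rule that[of "K' \<union> M"])
    show "compact (K' \<union> M)"
      using R(4) M(1) by (rule compact_Un)
    show "K \<subseteq> K' \<union> M"
      using R(2,3) by (auto simp: K1_def)
    show "K' \<union> M \<subseteq> Y"
      using R(5) M(2) by blast
    have far: "\<exists>V\<in>components (Y - K1). x \<in> V \<and> \<not> bounded_in Y V" if x: "x \<in> Y - (K' \<union> M)" for x
    proof -
      have "x \<in> Y - K1"
        using x R(2,3) by blast
      then obtain V where V: "V \<in> components (Y - K1)" "x \<in> V"
        using Union_components[of "Y - K1"] by blast
      then have "\<not> V \<subseteq> R"
        using x R(3) by blast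
      then have "\<not> bounded_in Y V"
        using V x UnionI[of V ?\<B> x] subsetD[OF M(3), of x] by auto
      then show ?thesis
        using V by blast
    qed
    show "\<forall>x\<in>Y - (K' \<union> M). \<forall>y\<in>Y - (K' \<union> M). path_component (Y - K) x y"
    proof (intro ballI)
      fix a b assume "a \<in> Y - (K' \<union> M)" "b \<in> Y - (K' \<union> M)"
      then obtain V V' where V: "V \<in> components (Y - K1)" "a \<in> V" "\<not> bounded_in Y V"
        and V': "V' \<in> components (Y - K1)" "b \<in> V'" "\<not> bounded_in Y V'"
        using far[of a] far[of b] by blast
      have "V \<inter> V' \<noteq> {}"
        using one_end_imp_bounded[OF lpc con lc E e K1(1,2) clopen[OF V(1)] clopen[OF V'(1)]] V(3) V'(3) by blast
      then have "V' = V"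
        using components_eq[OF V(1) V'(1)] by blast
      then have "connected_component (Y - K1) a b"
        using V(1,2) V'(2) in_components_connected[OF V(1)] in_components_subset[OF V(1)]
        unfolding connected_component_def by blast
      then have "path_component (Y - K1) a b"
        using path_component_open_eq[OF lpc W] by simp
      then show "path_component (Y - K) a b"
        by (rule path_component_of_subset[rotated]) (auto simp: K1_def)
    qed
  qed
qed

section \<open>Proper actions of the integers\<close>

text \<open>The assumptions are symmetric under \<open>m \<mapsto> - m\<close>, so results about the
  upper part of \<open>Y\<close> transfer to the lower part by \<open>inverse_action\<close>. The
  ANR property enters through \<open>lpc\<close> and \<open>lsc\<close>, the single end through
  \<open>one_end\<close> and \<open>joined_outside\<close>, the covering action through
  \<open>proper\<close>.\<close>

locale Z_space =
  fixes Y :: "'a::metric_space set" and J :: "int \<Rightarrow> 'a \<Rightarrow> 'a"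
  assumes lpc: "locally path_connected Y" and lc: "locally compact Y" and pcY: "path_connected Y"
    and sc: "\<And>x y p q. is_path Y x y p \<Longrightarrow> is_path Y x y q \<Longrightarrow> homotopic_paths Y p q"
    and lsc: "\<And>V y. openin (top_of_set Y) V \<Longrightarrow> y \<in> V \<Longrightarrow>
      \<exists>W. openin (top_of_set Y) W \<and> y \<in> W \<and> W \<subseteq> V \<and> (\<forall>x p. is_path W x x p \<longrightarrow> homotopic_paths V p (\<lambda>_. x))"
    and one_end: "\<And>K U V. compact K \<Longrightarrow> K \<subseteq> Y \<Longrightarrow> openin (top_of_set (Y - K)) U \<Longrightarrow> closedin (top_of_set (Y - K)) U \<Longrightarrow>
      openin (top_of_set (Y - K)) V \<Longrightarrow> closedin (top_of_set (Y - K)) V \<Longrightarrow> U \<inter> V = {} \<Longrightarrow> bounded_in Y U \<or> bounded_in Y V"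
    and joined_outside: "\<And>K. compact K \<Longrightarrow> K \<subseteq> Y \<Longrightarrow> \<exists>L. compact L \<and> K \<subseteq> L \<and> L \<subseteq> Y \<and>
      (\<forall>x\<in>Y - L. \<forall>y\<in>Y - L. path_component (Y - K) x y)"
    and J_zero: "\<And>y. y \<in> Y \<Longrightarrow> J 0 y = y"
    and J_add: "\<And>m n y. y \<in> Y \<Longrightarrow> J (m + n) y = J m (J n y)"
    and J_closed: "\<And>m y. y \<in> Y \<Longrightarrow> J m y \<in> Y"
    and J_cont: "\<And>m. continuous_on Y (J m)"
    and proper: "\<And>K. compact K \<Longrightarrow> K \<subseteq> Y \<Longrightarrow> finite {m. J m ` K \<inter> K \<noteq> {}}"
begin

lemma inverse_action: "Z_space Y (\<lambda>m. J (- m))"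
proof (rule Z_space.intro)
  show "locally path_connected Y" "locally compact Y" "path_connected Y"
    by (rule lpc lc pcY)+
  show "homotopic_paths Y p q" if "is_path Y x y p" "is_path Y x y q" for x y p q
    using that by (rule sc)
  show "\<exists>W. openin (top_of_set Y) W \<and> y \<in> W \<and> W \<subseteq> V \<and> (\<forall>x p. is_path W x x p \<longrightarrow> homotopic_paths V p (\<lambda>_. x))"
    if "openin (top_of_set Y) V" "y \<in> V" for V y
    using that by (rule lsc)
  show "bounded_in Y U \<or> bounded_in Y V"
    if "compact K" "K \<subseteq> Y" "openin (top_of_set (Y - K)) U" "closedin (top_of_set (Y - K)) U"
      "openin (top_of_set (Y - K)) V" "closedin (top_of_set (Y - K)) V" "U \<inter> V = {}" for K U V
    using that by (rule one_end)
  show "\<exists>L. compact L \<and> K \<subseteq> L \<and> L \<subseteq> Y \<and> (\<forall>x\<in>Y - L. \<forall>y\<in>Y - L. path_component (Y - K) x y)"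
    if "compact K" "K \<subseteq> Y" for K
    using that by (rule joined_outside)
  show "finite {m. J (- m) ` K \<inter> K \<noteq> {}}" if "compact K" "K \<subseteq> Y" for K
  proof -
    have "finite (uminus -` {m. J m ` K \<inter> K \<noteq> {}})"
      by (rule finite_vimageI[OF proper[OF that]]) (simp add: inj_def)
    then show ?thesis
      by (simp add: vimage_def)
  qed
  show "J (- (m + n)) y = J (- m) (J (- n) y)" if "y \<in> Y" for m n y
    using J_add[OF that, of "- m" "- n"] by simp
qed (simp_all add: J_zero J_closed J_cont)

lemma conY: "connected Y"
  using pcY by (rule path_connected_imp_connected)

lemma J_inverse: "y \<in> Y \<Longrightarrow> J (- m) (J m y) = y" "y \<in> Y \<Longrightarrow> J m (J (- m) y) = y"
  using J_add[of y "- m" m] J_add[of y m "- m"] J_zero by simp_all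

lemma J_image_image:
  assumes "X \<subseteq> Y"
  shows "J m ` J n ` X = J (m + n) ` X"
proof -
  have "J (m + n) x = J m (J n x)" if "x \<in> X" for x
    using J_add that assms by blast
  then have "J (m + n) ` X = (\<lambda>x. J m (J n x)) ` X"
    by (rule image_cong[OF refl])
  then show ?thesis
    by (simp only: image_image)
qed

lemma J_zero_image:
  assumes "X \<subseteq> Y"
  shows "J 0 ` X = X"
proof -
  have "J 0 x = x" if "x \<in> X" for x
    using J_zero that assms by blast
  then have "J 0 ` X = (\<lambda>x. x) ` X"
    by (rule image_cong[OF refl])
  then show ?thesis
    by simp
qed

lemma J_image_subset:
  assumes "X \<subseteq> Y"
  shows "J m ` X \<subseteq> Y"
proof (rule image_subsetI)
  fix x assume "x \<in> X"
  then have "x \<in> Y"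
    using assms by (rule subsetD[rotated])
  then show "J m x \<in> Y"
    by (rule J_closed)
qed

lemma J_image_iff:
  assumes "X \<subseteq> Y" "y \<in> Y"
  shows "y \<in> J m ` X \<longleftrightarrow> J (- m) y \<in> X"
proof
  assume "y \<in> J m ` X"
  then obtain x where x: "x \<in> X" "y = J m x"
    by (rule imageE)
  have "x \<in> Y"
    using assms(1) x(1) by (rule subsetD)
  then have "J (- m) y = x"
    unfolding x(2) by (rule J_inverse(1))
  then show "J (- m) y \<in> X"
    using x(1) by simp
next
  assume a: "J (- m) y \<in> X"
  have "y = J m (J (- m) y)"
    using J_inverse(2)[OF assms(2)] by simp
  then show "y \<in> J m ` X"
    using a by (rule image_eqI)
qed

lemma J_compact: "compact K \<Longrightarrow> K \<subseteq> Y \<Longrightarrow> compact (J m ` K)"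
  by (rule compact_continuous_image[OF continuous_on_subset[OF J_cont]])

lemma J_openin:
  assumes "openin (top_of_set Y) U"
  shows "openin (top_of_set Y) (J m ` U)"
proof -
  have U: "U \<subseteq> Y"
    using assms by (rule openin_imp_subset)
  have "openin (top_of_set Y) (Y \<inter> J (- m) -` U)"
    by (rule continuous_openin_preimage[OF J_cont _ assms]) (use J_closed in auto)
  moreover have "Y \<inter> J (- m) -` U = J m ` U"
    using J_image_iff[OF U] J_image_subset[OF U] by blast
  ultimately show ?thesis
    by simp
qed

lemma J_path: "is_path X x y p \<Longrightarrow> X \<subseteq> Y \<Longrightarrow> is_path (J m ` X) (J m x) (J m y) (J m \<circ> p)"
  unfolding is_path_def
  by (auto simp: path_image_compose pathstart_compose pathfinish_compose
      intro!: path_continuous_image continuous_on_subset[OF J_cont])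

section \<open>Translates of compact sets\<close>

lemma finite_meeting:
  assumes "compact K" "K \<subseteq> Y" "compact L" "L \<subseteq> Y"
  shows "finite {m. J m ` K \<inter> L \<noteq> {}}"
  by (rule finite_subset[OF _ proper[of "K \<union> L"]]) (use assms in auto)

lemma meeting_bound:
  assumes "compact K" "K \<subseteq> Y" "compact L" "L \<subseteq> Y"
  obtains N where "N \<ge> 0" "\<forall>m. J m ` K \<inter> L \<noteq> {} \<longrightarrow> \<bar>m\<bar> \<le> N"
proof -
  have "finite (abs ` {m. J m ` K \<inter> L \<noteq> {}})"
    using finite_meeting[OF assms] by simp
  then obtain N where "\<forall>n\<in>abs ` {m. J m ` K \<inter> L \<noteq> {}}. n \<le> N"
    by (meson bdd_above.E bdd_above_finite)
  then show thesis
    by (intro that[of "max 0 N"]) (auto simp: le_max_iff_disj)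
qed

lemma closedin_translates:
  assumes D: "compact D" "D \<subseteq> Y"
  shows "closedin (top_of_set Y) (\<Union>m\<in>M. J m ` D)"
proof -
  have sub: "(\<Union>m\<in>M. J m ` D) \<subseteq> Y"
    using J_image_subset[OF D(2)] by blast
  have "openin (top_of_set Y) (Y - (\<Union>m\<in>M. J m ` D))"
  proof (subst openin_subopen, intro ballI)
    fix y assume y: "y \<in> Y - (\<Union>m\<in>M. J m ` D)"
    obtain R K where R: "openin (top_of_set Y) R" "{y} \<subseteq> R" "R \<subseteq> K" "compact K" "K \<subseteq> Y"
      by (rule locally_compact_neighbourhood[OF lc, of "{y}"]) (use y in auto)
    let ?F = "{m \<in> M. J m ` D \<inter> K \<noteq> {}}"
    have F: "finite ?F"
      by (rule finite_subset[OF _ finite_meeting[OF D R(4,5)]]) blast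
    have "compact (\<Union>m\<in>?F. J m ` D)"
      using F J_compact[OF D] by (intro compact_UN) auto
    then have "open (- (\<Union>m\<in>?F. J m ` D))"
      by (intro open_Compl compact_imp_closed)
    then have "openin (top_of_set Y) (R \<inter> - (\<Union>m\<in>?F. J m ` D))"
      using R(1) by (rule openin_Int_open[rotated])
    moreover have "y \<in> R \<inter> - (\<Union>m\<in>?F. J m ` D)"
      using R(2) y by blast
    moreover have "R \<inter> - (\<Union>m\<in>?F. J m ` D) \<subseteq> Y - (\<Union>m\<in>M. J m ` D)"
      using R(3,5) by blast
    ultimately show "\<exists>T. openin (top_of_set Y) T \<and> y \<in> T \<and> T \<subseteq> Y - (\<Union>m\<in>M. J m ` D)"
      by blast
  qed
  then show ?thesis
    using sub by (simp add: closedin_def)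
qed

definition orb :: "'a set \<Rightarrow> 'a set" where
  "orb D = (\<Union>m. J m ` D)"

lemma orb_subset: "D \<subseteq> Y \<Longrightarrow> orb D \<subseteq> Y"
  unfolding orb_def using J_image_subset by blast

lemma subset_orb: "D \<subseteq> Y \<Longrightarrow> D \<subseteq> orb D"
  unfolding orb_def using J_zero_image[of D] by blast

lemma orb_mono: "D \<subseteq> E \<Longrightarrow> orb D \<subseteq> orb E"
  unfolding orb_def by blast

lemma orb_Un: "orb (D \<union> E) = orb D \<union> orb E"
  unfolding orb_def by blast

lemma J_orb_iff:
  assumes "D \<subseteq> Y" "y \<in> Y"
  shows "J m y \<in> orb D \<longleftrightarrow> y \<in> orb D"
proof -
  have *: "J m y \<in> orb D" if y: "y \<in> Y" "y \<in> orb D" for m y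
  proof -
    obtain n d where d: "d \<in> D" "y = J n d"
      using y(2) unfolding orb_def by blast
    then have "J m y = J (m + n) d"
      using assms(1) by (simp add: J_add subset_iff)
    then show ?thesis
      using d(1) unfolding orb_def by blast
  qed
  show ?thesis
    using *[of y m] *[of "J m y" "- m"] assms(2) J_closed J_inverse(1) by auto
qed

lemma J_image_orb: "D \<subseteq> Y \<Longrightarrow> J m ` orb D = orb D"
proof
  assume D: "D \<subseteq> Y"
  show "J m ` orb D \<subseteq> orb D"
    using J_orb_iff[OF D] orb_subset[OF D] by blast
  show "orb D \<subseteq> J m ` orb D"
  proof
    fix y assume y: "y \<in> orb D"
    then have "y \<in> Y"
      using orb_subset[OF D] by blast
    then show "y \<in> J m ` orb D"
      using y J_orb_iff[OF D, of y "- m"] J_inverse(2)[of y m] by (metis imageI)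
  qed
qed

lemma closedin_orb: "compact D \<Longrightarrow> D \<subseteq> Y \<Longrightarrow> closedin (top_of_set Y) (orb D)"
  unfolding orb_def by (rule closedin_translates)

lemma openin_compl_orb: "compact D \<Longrightarrow> D \<subseteq> Y \<Longrightarrow> openin (top_of_set Y) (Y - orb D)"
  using closedin_orb by (simp add: closedin_def)

lemma openin_orb: "openin (top_of_set Y) U \<Longrightarrow> openin (top_of_set Y) (orb U)"
  unfolding orb_def by (intro openin_Union) (auto intro: J_openin)

lemma J_image_component:
  assumes W: "W \<subseteq> Y" "\<And>m. J m ` W \<subseteq> W" and x: "x \<in> W"
  shows "J m ` connected_component_set W x = connected_component_set W (J m x)"
proof -
  have *: "J m ` connected_component_set W x \<subseteq> connected_component_set W (J m x)" if x: "x \<in> W" for m x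
  proof (rule connected_component_maximal)
    have sub: "connected_component_set W x \<subseteq> W"
      by (rule connected_component_subset)
    show "J m x \<in> J m ` connected_component_set W x"
      using x by simp
    show "connected (J m ` connected_component_set W x)"
      by (rule connected_continuous_image[OF continuous_on_subset[OF J_cont] connected_connected_component])
        (use sub W(1) in blast)
    show "J m ` connected_component_set W x \<subseteq> W"
      using sub W(2)[of m] by blast
  qed
  have xY: "x \<in> Y" and JxW: "J m x \<in> W"
    using x W by auto
  have "connected_component_set W (J m x) = J m ` J (- m) ` connected_component_set W (J m x)"
    using J_image_image[of "connected_component_set W (J m x)" m "- m"] J_zero_image[of "connected_component_set W (J m x)"]
      connected_component_subset[of W "J m x"] W(1) by simp
  also have "\<dots> \<subseteq> J m ` connected_component_set W x"
    using *[OF JxW, of "- m"] J_inverse(1)[OF xY] by (intro image_mono) simp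
  finally show ?thesis
    using *[OF x] by blast
qed

end

lemma compact_homotopy:
  fixes Y :: "'a::topological_space set"
  assumes "homotopic_paths Y p q"
  obtains M where "compact M" "M \<subseteq> Y" "homotopic_paths M p q"
proof -
  obtain h where h: "continuous_on ({0..1::real} \<times> {0..1::real}) h" "h \<in> {0..1} \<times> {0..1} \<rightarrow> Y"
    and h': "\<forall>x\<in>{0..1}. h (0, x) = p x" "\<forall>x\<in>{0..1}. h (1, x) = q x"
    "\<forall>t\<in>{0..1}. pathstart (h \<circ> Pair t) = pathstart p \<and> pathfinish (h \<circ> Pair t) = pathfinish p"
    using assms unfolding homotopic_paths by blast
  let ?M = "h ` ({0..1} \<times> {0..1})"
  have "compact ?M"
    by (rule compact_continuous_image[OF h(1)]) (intro compact_Times compact_Icc)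
  moreover have "?M \<subseteq> Y"
    using h(2) by blast
  moreover have "homotopic_paths ?M p q"
    unfolding homotopic_paths using h(1) h' by (intro exI[of _ h] conjI) auto
  ultimately show thesis
    by (rule that)
qed

section \<open>Deep components, and loops pushed along the powers of the generator\<close>

context Z_space
begin

lemma J_commute: "y \<in> Y \<Longrightarrow> J m (J n y) = J n (J m y)"
  using J_add[of y m n] J_add[of y n m] by (simp add: add.commute)

text \<open>If all translates of a component \<open>V\<close> of \<open>Y - orb D0\<close> are distinct then only finitely many of them
  meet a given compact set, so \<open>V - orb D\<close> is separated from the rest of \<open>Y\<close> by a compact set, and so is
  its translate; as \<open>Y\<close> has one end, one of the two is bounded.\<close>

lemma deep_translates:
  assumes D0: "compact D0" "D0 \<subseteq> Y" "D0 \<noteq> {}" and K0: "compact K0" "K0 \<subseteq> Y"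
  obtains D1 k where "compact D1" "D1 \<subseteq> Y" "D0 \<union> K0 \<subseteq> D1" "(0::int) < k"
    "\<forall>x\<in>Y - orb D1. path_component (Y - orb D0) x (J k x)"
    "\<forall>x\<in>Y - orb D1. \<forall>K. compact K \<longrightarrow> K \<subseteq> Y \<longrightarrow> \<not> connected_component_set (Y - orb D0) x \<subseteq> orb K"
proof -
  let ?W = "Y - orb D0" and ?cc = "\<lambda>x. connected_component_set (Y - orb D0) x"
  have oW: "openin (top_of_set Y) ?W"
    by (rule openin_compl_orb[OF D0(1,2)])
  have JW: "J m x \<in> ?W" if "x \<in> ?W" for m x
    using that J_closed J_orb_iff[OF D0(2)] by simp
  have Jcc: "J m ` ?cc x = ?cc (J m x)" if "x \<in> ?W" for m x
    by (rule J_image_component[OF _ _ that]) (use JW in auto)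
  have Jcc_mem: "J m z \<in> ?cc (J m x)" if "x \<in> ?W" "z \<in> ?cc x" for m x z
    unfolding Jcc[OF that(1), symmetric] by (rule imageI[OF that(2)])
  have ccW: "?cc x \<subseteq> ?W" for x
    by (rule connected_component_subset)
  have self: "x \<in> ?cc x" if "x \<in> ?W" for x
    using that by simp
  obtain O' Dn where O': "openin (top_of_set Y) O'" "D0 \<subseteq> O'" "O' \<subseteq> Dn" "compact Dn" "Dn \<subseteq> Y"
    by (rule locally_compact_neighbourhood[OF lc D0(1,2)])
  have O'Y: "O' \<subseteq> Y"
    using O'(3,5) by blast
  \<comment> \<open>An invariant neighbourhood of \<open>orb D0\<close> whose frontier in
    \<open>Y\<close> lies in \<open>orb Dn\<close>. Every component of \<open>?W\<close> that leaves
    \<open>R\<close> meets this frontier.\<close>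
  define R where "R = orb O'"
  have R: "openin (top_of_set Y) R" "orb D0 \<subseteq> R" "R \<subseteq> orb Dn"
    unfolding R_def by (rule openin_orb[OF O'(1)]) (rule orb_mono[OF O'(2)], rule orb_mono[OF O'(3)])
  have clR: "z \<in> orb Dn" if "z \<in> closure R" "z \<in> Y" for z
  proof -
    obtain C where C: "closed C" "orb Dn = Y \<inter> C"
      using closedin_orb[OF O'(4,5)] unfolding closedin_closed by blast
    have "closure R \<subseteq> C"
      using R(3) C by (intro closure_minimal) blast+
    then show ?thesis
      using that C(2) by blast
  qed
  \<comment> \<open>A compact set whose translates cover \<open>orb Dn - R\<close>, by invariance of
    \<open>R\<close>. Hence every component that leaves \<open>R\<close> has a translate among the
    finitely many members of \<open>\<V>\<close>.\<close>
  define Q where "Q = Dn - R"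
  obtain R' where R': "open R'" "R = Y \<inter> R'"
    using R(1) unfolding openin_open by blast
  have "Q = Dn - R'"
    using R'(2) O'(5) unfolding Q_def by blast
  then have Q: "compact Q" "Q \<subseteq> ?W"
    using compact_diff[OF O'(4) R'(1)] R(2) O'(5) unfolding Q_def by auto
  define \<V> where "\<V> = {V \<in> components ?W. V \<inter> Q \<noteq> {}}"
  have fin: "finite \<V>"
    unfolding \<V>_def by (rule finite_components_meeting_compact[OF lpc oW Q])
  have inV: "?cc x \<in> \<V>" if "x \<in> ?W" "d \<in> ?cc x" "d \<in> Q" for x d
    unfolding \<V>_def using that componentsI[OF that(1)] by blast
  have pulled_back: "\<exists>n d. z = J n d \<and> d \<in> Q \<and> d \<in> ?cc (J (- n) x)" if x: "x \<in> ?W" "z \<in> ?cc x" and z: "z \<in> orb Dn" "z \<notin> R" for x z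
  proof -
    obtain n d where d: "d \<in> Dn" "z = J n d"
      using z(1) unfolding orb_def by blast
    have dY: "d \<in> Y"
      using d(1) O'(5) by blast
    have "d \<notin> R"
      using z(2) J_orb_iff[OF O'Y dY] unfolding d(2) R_def by simp
    moreover have "J (- n) z = d"
      unfolding d(2) by (rule J_inverse(1)[OF dY])
    ultimately show ?thesis
      using Jcc_mem[OF x, of "- n"] d by (intro exI[of _ n] exI[of _ d]) (auto simp: Q_def)
  qed
  have exits: "\<exists>m. ?cc (J m x) \<in> \<V>" if x: "x \<in> ?W" "\<not> ?cc x \<subseteq> R" for x
  proof -
    have "\<exists>z\<in>?cc x. z \<in> closure R - R"
    proof (rule component_meets_frontier[OF lpc conY closedin_orb[OF D0(1,2)] _ R(1,2) _ x(2)])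
      show "orb D0 \<noteq> {}"
        using subset_orb[OF D0(2)] D0(3) by blast
      show "?cc x \<in> components ?W"
        by (rule componentsI[OF x(1)])
    qed
    then obtain z where z: "z \<in> ?cc x" "z \<in> closure R" "z \<notin> R"
      by blast
    have "z \<in> Y"
      using z(1) ccW[of x] by blast
    then obtain n d where d: "d \<in> Q" "d \<in> ?cc (J (- n) x)"
      using pulled_back[OF x(1) z(1) clR[OF z(2)] z(3)] by blast
    have "?cc (J (- n) x) \<in> \<V>"
      by (rule inV[OF JW[OF x(1)] d(2,1)])
    then show ?thesis
      by blast
  qed
  \<comment> \<open>Boundedness modulo the action.\<close>
  define contained where "contained = (\<lambda>V. \<exists>K. compact K \<and> K \<subseteq> Y \<and> V \<subseteq> orb K)"
  have containedI: "contained V" if "compact K" "K \<subseteq> Y" "V \<subseteq> orb K" for K V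
    unfolding contained_def using that by blast
  have contained_J: "contained (?cc (J m x))" if c: "contained (?cc x)" and x: "x \<in> ?W" for m x
  proof -
    obtain K where K: "compact K" "K \<subseteq> Y" "?cc x \<subseteq> orb K"
      using c unfolding contained_def by blast
    have "J m ` ?cc x \<subseteq> J m ` orb K"
      by (rule image_mono[OF K(3)])
    then have "?cc (J m x) \<subseteq> orb K"
      by (simp only: Jcc[OF x] J_image_orb[OF K(2)])
    then show ?thesis
      by (rule containedI[OF K(1,2)])
  qed
  have contained_J': "contained (?cc x)" if c: "contained (?cc (J m x))" and x: "x \<in> ?W" for m x
    using contained_J[OF c JW[OF x], of "- m"] J_inverse(1)[of x m] x by simp
  \<comment> \<open>The compact set is the part of \<open>?cc w\<close> that lies in
    \<open>orb Dn\<close> but off \<open>R\<close>. It is compact because only finitely many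
    translates of \<open>?cc w\<close> meet \<open>Q\<close>. Once it is removed, the rest of
    \<open>?cc w\<close> inside \<open>orb Dn\<close> lies in the open set \<open>R\<close>.\<close>
  have separated: "\<exists>S. compact S \<and> S \<subseteq> orb Dn \<and> closedin (top_of_set (Y - S)) (?cc w - orb Dn)"
    if w: "w \<in> ?W" and M: "finite {m. ?cc (J m w) \<in> \<V>}" for w
  proof -
    let ?M = "{m. ?cc (J m w) \<in> \<V>}"
    let ?S = "\<Union>m\<in>?M. J (- m) ` (?cc (J m w) \<inter> Q)"
    have "compact (?cc (J m w) \<inter> Q)" for m
    proof -
      have "closedin (top_of_set ?W) (?cc (J m w))"
        by (rule closedin_component[OF componentsI[OF JW[OF w]]])
      then obtain C where "closed C" "?cc (J m w) = ?W \<inter> C"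
        unfolding closedin_closed by blast
      then have "?cc (J m w) \<inter> Q = Q \<inter> C"
        using Q(2) by blast
      then show ?thesis
        using compact_Int_closed[OF Q(1) \<open>closed C\<close>] by simp
    qed
    moreover have "?cc (J m w) \<inter> Q \<subseteq> Y" for m
      using Q(2) by blast
    ultimately have cS: "compact ?S"
      by (intro compact_UN M J_compact)
    have "J (- m) ` (?cc (J m w) \<inter> Q) \<subseteq> orb Dn" for m
    proof -
      have "?cc (J m w) \<inter> Q \<subseteq> Dn"
        unfolding Q_def by blast
      then have "J (- m) ` (?cc (J m w) \<inter> Q) \<subseteq> J (- m) ` Dn"
        by (rule image_mono)
      then show ?thesis
        unfolding orb_def by blast
    qed
    then have Sorb: "?S \<subseteq> orb Dn"
      by (rule UN_least)
    have "closedin (top_of_set ?W) (?cc w)"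
      by (rule closedin_component[OF componentsI[OF w]])
    then have "openin (top_of_set ?W) (?W - ?cc w)"
      by (simp add: closedin_def)
    then have "openin (top_of_set Y) (?W - ?cc w)"
      using oW by (rule openin_trans)
    then have "openin (top_of_set Y) ((?W - ?cc w) \<union> R)"
      using R(1) by (rule openin_Un)
    then obtain T where T: "open T" "(?W - ?cc w) \<union> R = Y \<inter> T"
      unfolding openin_open by blast
    have "(Y - ?S) - (?cc w - orb Dn) = (Y - ?S) \<inter> T"
    proof (intro equalityI subsetI)
      fix z assume z: "z \<in> (Y - ?S) - (?cc w - orb Dn)"
      have "z \<in> (?W - ?cc w) \<union> R"
      proof (rule ccontr)
        assume neg: "z \<notin> (?W - ?cc w) \<union> R"
        then have zR: "z \<notin> R" and zc: "z \<in> ?cc w"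
          using z R(2) by auto
        then have "z \<in> orb Dn"
          using z by blast
        then obtain n d where d: "z = J n d" "d \<in> Q" "d \<in> ?cc (J (- n) w)"
          using pulled_back[OF w zc _ zR] by blast
        have "- n \<in> ?M"
          using inV[OF JW[OF w] d(3,2)] by simp
        moreover have "z \<in> J (- (- n)) ` (?cc (J (- n) w) \<inter> Q)"
          unfolding d(1) using d(2,3) by simp
        ultimately have "z \<in> ?S"
          by (rule UN_I)
        then show False
          using z by blast
      qed
      then show "z \<in> (Y - ?S) \<inter> T"
        using z T(2) by blast
    next
      fix z assume z: "z \<in> (Y - ?S) \<inter> T"
      then have "z \<in> (?W - ?cc w) \<union> R"
        using T(2) by blast
      then show "z \<in> (Y - ?S) - (?cc w - orb Dn)"
        using z R(3) by blast
    qed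
    then have "openin (top_of_set (Y - ?S)) ((Y - ?S) - (?cc w - orb Dn))"
      using T(1) by (simp add: openin_open_Int)
    moreover have "?cc w - orb Dn \<subseteq> Y - ?S"
      using ccW[of w] Sorb by blast
    ultimately have "closedin (top_of_set (Y - ?S)) (?cc w - orb Dn)"
      unfolding closedin_def by simp
    then show ?thesis
      using cS Sorb by (intro exI[of _ ?S] conjI)
  qed
  have stab: "\<exists>m>0. ?cc (J m v) = ?cc v" if v: "v \<in> ?W" and nc: "\<not> contained (?cc v)" for v
  proof (rule ccontr)
    assume neg: "\<not> ?thesis"
    have vY: "v \<in> Y"
      using v by blast
    have lt: "?cc (J m v) \<noteq> ?cc (J n v)" if "m < n" for m n
    proof
      assume e: "?cc (J m v) = ?cc (J n v)"
      have "J (- m) ` ?cc (J m v) = J (- m) ` ?cc (J n v)"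
        by (simp only: e)
      then have "?cc (J (- m) (J m v)) = ?cc (J (- m) (J n v))"
        unfolding Jcc[OF JW[OF v]] .
      moreover have "J (- m) (J n v) = J (n - m) v"
        using J_add[OF vY, of "- m" n] by simp
      ultimately have "?cc (J (n - m) v) = ?cc v"
        by (simp only: J_inverse(1)[OF vY])
      moreover have "n - m > 0"
        using that by simp
      ultimately show False
        using neg by blast
    qed
    have inj: "inj (\<lambda>m. ?cc (J m v))"
      using lt by (intro linorder_injI) blast
    have f1: "finite {m. ?cc (J m v) \<in> \<V>}"
      using finite_vimageI[OF fin inj] by (simp add: vimage_def)
    have f2: "finite {m. ?cc (J m (J 1 v)) \<in> \<V>}"
    proof -
      have "finite ((\<lambda>m. m + 1) -` {m. ?cc (J m v) \<in> \<V>})"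
        by (rule finite_vimageI[OF f1]) (simp add: inj_def)
      then show ?thesis
        using J_add[OF vY, of _ 1] by (simp add: vimage_def)
    qed
    obtain S1 where S1: "compact S1" "S1 \<subseteq> orb Dn" "closedin (top_of_set (Y - S1)) (?cc v - orb Dn)"
      using separated[OF v f1] by blast
    obtain S2 where S2: "compact S2" "S2 \<subseteq> orb Dn" "closedin (top_of_set (Y - S2)) (?cc (J 1 v) - orb Dn)"
      using separated[OF JW[OF v] f2] by blast
    let ?S = "S1 \<union> S2"
    have SY: "?S \<subseteq> Y" and cS: "compact ?S"
      using S1(2) S2(2) orb_subset[OF O'(5)] compact_Un[OF S1(1) S2(1)] by auto
    have cl: "closedin (top_of_set (Y - ?S)) (?cc w - orb Dn)" if "closedin (top_of_set (Y - S')) (?cc w - orb Dn)" "S' \<subseteq> ?S" for S' w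
    proof -
      obtain C where C: "closed C" "?cc w - orb Dn = (Y - S') \<inter> C"
        using \<open>closedin (top_of_set (Y - S')) (?cc w - orb Dn)\<close> unfolding closedin_closed by blast
      have "?cc w - orb Dn = (Y - ?S) \<inter> C"
        using C(2) ccW[of w] S1(2) S2(2) \<open>S' \<subseteq> ?S\<close> by blast
      then show ?thesis
        using C(1) by (simp add: closedin_closed_Int)
    qed
    have op: "openin (top_of_set (Y - ?S)) (?cc w - orb Dn)" if "w \<in> ?W" for w
    proof (rule openin_subset_trans)
      have "openin (top_of_set Y) (?cc w)"
        by (rule component_openin[OF lpc oW componentsI[OF that]])
      then have "openin (top_of_set Y) (?cc w \<inter> (Y - orb Dn))"
        using openin_compl_orb[OF O'(4,5)] by (rule openin_Int)
      moreover have "?cc w \<inter> (Y - orb Dn) = ?cc w - orb Dn"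
        using ccW[of w] by blast
      ultimately show "openin (top_of_set Y) (?cc w - orb Dn)"
        by simp
    qed (use ccW[of w] S1(2) S2(2) in blast)+
    have "?cc (J 0 v) \<noteq> ?cc (J 1 v)"
      by (rule lt) simp
    then have "?cc v \<noteq> ?cc (J 1 v)"
      by (simp add: J_zero[OF vY])
    then have "?cc v \<inter> ?cc (J 1 v) = {}"
      using components_eq[OF componentsI[OF v] componentsI[OF JW[OF v, of 1]]] by blast
    then have dis: "(?cc v - orb Dn) \<inter> (?cc (J 1 v) - orb Dn) = {}"
      by blast
    have "bounded_in Y (?cc v - orb Dn) \<or> bounded_in Y (?cc (J 1 v) - orb Dn)"
      by (rule one_end[OF cS SY op[OF v] cl[OF S1(3) Un_upper1] op[OF JW[OF v]] cl[OF S2(3) Un_upper2] dis])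
    moreover have "contained (?cc w)" if b: "bounded_in Y (?cc w - orb Dn)" for w
    proof -
      obtain K where K: "compact K" "K \<subseteq> Y" "?cc w - orb Dn \<subseteq> K"
        using b unfolding bounded_in_def by blast
      have "?cc w \<subseteq> orb (Dn \<union> K)"
        using K(3) subset_orb[OF K(2)] unfolding orb_Un by blast
      then show ?thesis
        using containedI[OF compact_Un[OF O'(4) K(1)]] O'(5) K(2) by blast
    qed
    ultimately show False
      using nc contained_J'[OF _ v, of 1] by blast
  qed
  have stab': "\<exists>m>0. J m ` V = V" if V: "V \<in> \<V>" "\<not> contained V" for V
  proof -
    obtain v where v: "v \<in> ?W" "V = ?cc v"
      using V(1) unfolding \<V>_def components_iff by blast
    show ?thesis
      using stab[OF v(1)] V(2) unfolding v(2) Jcc[OF v(1)] by blast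
  qed
  then obtain \<mu> where \<mu>: "\<And>V. V \<in> \<V> \<Longrightarrow> \<not> contained V \<Longrightarrow> \<mu> V > 0 \<and> J (\<mu> V) ` V = V"
    by metis
  let ?\<U> = "{V \<in> \<V>. \<not> contained V}"
  \<comment> \<open>The product of the periods is a common period of the finitely many components
    concerned, so one power of the generator serves all of them.\<close>
  define k where "k = (\<Prod>V\<in>?\<U>. \<mu> V)"
  have k0: "k > 0"
    unfolding k_def using \<mu> by (intro prod_pos) blast
  have kV: "J k ` V = V" if V: "V \<in> \<V>" "\<not> contained V" for V
  proof -
    have VY: "V \<subseteq> Y"
      using V(1) in_components_subset[of V ?W] unfolding \<V>_def by blast
    have "\<mu> V dvd k"
      unfolding k_def using V fin by (intro dvd_prodI) auto
    then obtain q where q: "k = \<mu> V * q"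
      by (rule dvdE)
    have m0: "\<mu> V > 0" and mV: "J (\<mu> V) ` V = V"
      using \<mu>[OF V] by auto
    then have "q > 0"
      using k0 unfolding q by (simp add: zero_less_mult_iff)
    have "J (\<mu> V * int n) ` V = V" for n
    proof (induction n)
      case 0
      show ?case
        by (simp add: J_zero_image[OF VY])
    next
      case (Suc n)
      have "J (\<mu> V * int (Suc n)) ` V = J (\<mu> V) ` J (\<mu> V * int n) ` V"
        unfolding J_image_image[OF VY] by (simp add: algebra_simps)
      then show ?case
        by (simp only: Suc mV)
    qed
    from this[of "nat q"] show ?thesis
      using \<open>q > 0\<close> by (simp add: q)
  qed
  have "\<exists>K. compact K \<and> K \<subseteq> Y \<and> V \<subseteq> orb K" if "contained V" for V
    using that unfolding contained_def .
  then obtain \<K> where \<K>: "\<And>V. contained V \<Longrightarrow> compact (\<K> V) \<and> \<K> V \<subseteq> Y \<and> V \<subseteq> orb (\<K> V)"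
    by metis
  let ?B = "\<Union>V\<in>{V \<in> \<V>. contained V}. \<K> V"
  \<comment> \<open>Off \<open>orb Dn\<close> a point lies outside \<open>R\<close>, so its
    component leaves \<open>R\<close> and has a translate in \<open>\<V>\<close>. The sets
    \<open>\<K> V\<close> exclude those points for which this translate is bounded modulo the
    action.\<close>
  define D1 where "D1 = K0 \<union> Dn \<union> ?B"
  have cB: "compact ?B"
    using fin \<K> by (intro compact_UN) auto
  have BY: "?B \<subseteq> Y"
    by (rule UN_least) (use \<K> in blast)
  have D1: "compact D1" "D1 \<subseteq> Y" "D0 \<union> K0 \<subseteq> D1"
    unfolding D1_def using K0 O' cB BY by (auto intro!: compact_Un)
  have main: "x \<in> ?W \<and> (\<exists>m. ?cc (J m x) \<in> \<V> \<and> \<not> contained (?cc (J m x)))" if x: "x \<in> Y - orb D1" for x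
  proof -
    have "orb Dn \<subseteq> orb D1"
      by (rule orb_mono) (auto simp: D1_def)
    then have xn: "x \<notin> orb Dn"
      using x by blast
    then have xW: "x \<in> ?W"
      using x R(2,3) by blast
    have "\<not> ?cc x \<subseteq> R"
      using self[OF xW] xn R(3) by blast
    then obtain m where m: "?cc (J m x) \<in> \<V>"
      using exits[OF xW] by blast
    have "\<not> contained (?cc (J m x))"
    proof
      assume c: "contained (?cc (J m x))"
      have "J m x \<in> orb (\<K> (?cc (J m x)))"
        using \<K>[OF c] self[OF JW[OF xW]] by blast
      moreover have "\<K> (?cc (J m x)) \<subseteq> D1"
        unfolding D1_def using m c by blast
      ultimately have "J m x \<in> orb D1"
        using orb_mono by blast
      then show False
        using J_orb_iff[OF D1(2)] x by simp
    qed
    then show ?thesis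
      using xW m by blast
  qed
  show thesis
  proof (rule that[OF D1 k0]; intro ballI)
    fix x assume x: "x \<in> Y - orb D1"
    obtain m where m: "?cc (J m x) \<in> \<V>" "\<not> contained (?cc (J m x))" and xW: "x \<in> ?W"
      using main[OF x] by blast
    have xY: "x \<in> Y"
      using x by blast
    have "J k (J m x) \<in> J k ` ?cc (J m x)"
      using self[OF JW[OF xW]] by (rule imageI)
    then have "J m (J k x) \<in> ?cc (J m x)"
      unfolding kV[OF m] J_commute[OF xY, of m k] .
    then have "J (- m) (J m (J k x)) \<in> ?cc (J (- m) (J m x))"
      by (rule Jcc_mem[OF JW[OF xW]])
    then have "J k x \<in> ?cc x"
      using J_inverse(1)[OF xY] J_inverse(1)[OF J_closed[OF xY]] by simp
    then show "path_component ?W x (J k x)"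
      using path_component_open_eq[OF lpc oW] by simp
    show "\<forall>K. compact K \<longrightarrow> K \<subseteq> Y \<longrightarrow> \<not> ?cc x \<subseteq> orb K"
      using contained_J[OF _ xW, of m] m(2) containedI[of _ "?cc x"] by blast
  qed
qed

lemma J_null_loops:
  assumes null: "\<forall>x p. is_path L x x p \<longrightarrow> homotopic_paths M p (\<lambda>_. x)" and L: "L \<subseteq> Y" and M: "M \<subseteq> Y"
    and p: "is_path (J m ` L) x x p"
  shows "homotopic_paths (J m ` M) p (\<lambda>_. x)"
proof -
  have xL: "x \<in> J m ` L"
    by (rule is_path_mem(1)[OF p])
  have xY: "x \<in> Y"
    using xL J_image_subset[OF L] by blast
  have "J (- m) ` J m ` L = L"
    by (simp add: J_image_image[OF L] J_zero_image[OF L])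
  then have "is_path L (J (- m) x) (J (- m) x) (J (- m) \<circ> p)"
    using J_path[OF p J_image_subset[OF L], of "- m"] by simp
  then have "homotopic_paths M (J (- m) \<circ> p) (\<lambda>_. J (- m) x)"
    using null by blast
  then have h1: "homotopic_paths (J m ` M) (J m \<circ> (J (- m) \<circ> p)) (J m \<circ> (\<lambda>_. J (- m) x))"
    by (rule homotopic_paths_continuous_image[OF _ continuous_on_subset[OF J_cont M]]) auto
  have e: "J m \<circ> (\<lambda>_. J (- m) x) = (\<lambda>_. x)"
    using J_inverse(2)[OF xY] by (simp add: fun_eq_iff)
  have h2: "homotopic_paths (J m ` M) (J m \<circ> (J (- m) \<circ> p)) p"
  proof (rule homotopic_paths_eq)
    show "path (J m \<circ> (J (- m) \<circ> p))" "path_image (J m \<circ> (J (- m) \<circ> p)) \<subseteq> J m ` M"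
      using homotopic_paths_imp_path[OF h1] homotopic_paths_imp_subset[OF h1] by auto
    fix t :: real assume "t \<in> {0..1}"
    then have "p t \<in> path_image p"
      by (simp add: path_image_def)
    then have "p t \<in> Y"
      using p J_image_subset[OF L, of m] unfolding is_path_def by blast
    then show "(J m \<circ> (J (- m) \<circ> p)) t = p t"
      using J_inverse(2) by simp
  qed
  show ?thesis
    using homotopic_paths_trans[OF homotopic_paths_sym[OF h2] h1] by (simp only: e)
qed

text \<open>A short path \<open>q\<close> from \<open>z\<close> to a nearby point \<open>z'\<close>
  turns the track \<open>\<tau>\<close> of \<open>z\<close> into one of \<open>z'\<close>: back
  along \<open>q\<close>, along \<open>\<tau>\<close>, then along the translate of \<open>q\<close>.
  All these tracks stay in one compact set.\<close>

lemma tracks_near_point: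
  assumes V: "openin (top_of_set Y) V" "z \<in> V" "V \<subseteq> X" "J k ` V \<subseteq> X" and X: "X \<subseteq> Y" and \<tau>: "is_path X z (J k z) \<tau>"
  shows "\<exists>N M. open N \<and> z \<in> N \<and> compact M \<and> M \<subseteq> Y \<and> (\<forall>z'\<in>Y \<inter> N. z' \<in> V \<and> (\<exists>p. is_path (X \<inter> M) z' (J k z') p))"
proof -
  have zY: "z \<in> Y"
    using V(1,2) openin_imp_subset by blast
  obtain U K where U: "openin (top_of_set Y) U" "{z} \<subseteq> U" "U \<subseteq> K" "compact K" "K \<subseteq> Y"
    by (rule locally_compact_neighbourhood[OF lc, of "{z}"]) (use zY in auto)
  have "openin (top_of_set Y) (V \<inter> U)" "z \<in> V \<inter> U"
    using openin_Int[OF V(1) U(1)] V(2) U(2) by auto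
  then obtain W where W: "openin (top_of_set Y) W" "path_connected W" "z \<in> W" "W \<subseteq> V \<inter> U"
    using lpc unfolding locally_path_connected by blast
  obtain N where N: "open N" "W = Y \<inter> N"
    using W(1) unfolding openin_open by blast
  have WY: "W \<subseteq> Y"
    using N(2) by blast
  let ?M = "K \<union> path_image \<tau> \<union> J k ` K"
  have "path \<tau>" "path_image \<tau> \<subseteq> X"
    using \<tau> by (auto simp: is_path_def)
  then have M: "compact ?M" "?M \<subseteq> Y"
    using U(4,5) J_compact[OF U(4,5)] J_image_subset[OF U(5)] X by (auto intro!: compact_Un compact_path_image)
  have W1: "W \<subseteq> X \<inter> ?M"
    using W(4) V(3) U(3) by blast
  have W2: "J k ` W \<subseteq> X \<inter> ?M"
  proof -
    have "J k ` W \<subseteq> J k ` V" "J k ` W \<subseteq> J k ` K"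
      using W(4) U(3) by (intro image_mono; blast)+
    then show ?thesis
      using V(4) by blast
  qed
  have t: "is_path (X \<inter> ?M) z (J k z) \<tau>"
    using \<tau> by (auto simp: is_path_def)
  have "z' \<in> V \<and> (\<exists>p. is_path (X \<inter> ?M) z' (J k z') p)" if z': "z' \<in> Y \<inter> N" for z'
  proof -
    have "path_component W z z'"
      using W(2,3) z' N(2) unfolding path_connected_component by blast
    then obtain q where q: "is_path W z z' q"
      unfolding path_component_is_path by blast
    have "is_path (X \<inter> ?M) z' (J k z') (reversepath q +++ (\<tau> +++ (J k \<circ> q)))"
      by (rule is_path_join[OF is_path_mono[OF is_path_reverse[OF q] W1] is_path_join[OF t is_path_mono[OF J_path[OF q WY] W2]]])
    then show ?thesis
      using z' N(2) W(4) by blast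
  qed
  then show ?thesis
    using N W(3) M by (intro exI[of _ N] exI[of _ ?M]) auto
qed

text \<open>A loop above the translates \<open>J m ` D'\<close> with \<open>m \<le> N\<close> is freely homotopic, off \<open>C\<close>, to its translate
  under \<open>J k\<close>: join each of its points \<open>y\<close> to \<open>J k y\<close> by a path which avoids \<open>orb D0\<close> if \<open>y\<close> is off
  \<open>orb D'\<close>, and which stays close to \<open>y\<close> otherwise.  Repeating this moves the loop away from \<open>C\<close> so far
  that a null homotopy in \<open>Y\<close> avoids \<open>C\<close>.\<close>

lemma null_above:
  assumes C: "compact C" "C \<subseteq> Y" and D0: "compact D0" "D0 \<subseteq> Y" "C \<subseteq> orb D0"
    and null0: "\<And>x p. is_path (Y - orb D0) x x p \<Longrightarrow> homotopic_paths (Y - C) p (\<lambda>_. x)"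
    and k: "k > 0" and tracks: "\<forall>x\<in>Y - orb D1. path_component (Y - orb D0) x (J k x)"
    and O2: "openin (top_of_set Y) O2" "D1 \<subseteq> O2" "D0 \<subseteq> D1" and D': "compact D'" "D' \<subseteq> Y" "orb O2 \<subseteq> orb D'"
  obtains N0 where "\<forall>N\<ge>N0. \<forall>x p. is_path (Y - (\<Union>m\<in>{..N}. J m ` D')) x x p \<longrightarrow> homotopic_paths (Y - C) p (\<lambda>_. x)"
proof -
  let ?W = "Y - orb D0" and ?S = "Y - C"
  have O2Y: "O2 \<subseteq> Y"
    using O2(1) by (rule openin_imp_subset)
  have orbs: "orb D0 \<subseteq> orb D1" "orb D1 \<subseteq> orb O2" "orb O2 \<subseteq> orb D'"
    using orb_mono[OF O2(3)] orb_mono[OF O2(2)] D'(3) by auto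
  have WS: "?W \<subseteq> ?S"
    using D0(3) by blast
  have JW: "J m x \<in> ?W" if "x \<in> ?W" for m x
    using that J_closed J_orb_iff[OF D0(2)] by simp
  have JWsub: "J m ` ?W \<subseteq> ?W" for m
    using JW by (intro image_subsetI)
  obtain O'' D'' where D'': "openin (top_of_set Y) O''" "D' \<subseteq> O''" "O'' \<subseteq> D''" "compact D''" "D'' \<subseteq> Y"
    by (rule locally_compact_neighbourhood[OF lc D'(1,2)])
  \<comment> \<open>Near \<open>orb O2\<close> any track in \<open>Y\<close> is accepted. A point
    off \<open>orb O2\<close> is off \<open>orb D1\<close> and has a track off
    \<open>orb D0\<close>; nearby points inherit it.\<close>
  have nbhd: "\<exists>N M. open N \<and> z \<in> N \<and> compact M \<and> M \<subseteq> Y \<and>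
      (\<forall>z'\<in>Y \<inter> N. \<exists>p. is_path M z' (J k z') p \<and> (z' \<notin> orb O2 \<longrightarrow> is_path ?W z' (J k z') p))" if z: "z \<in> D''" for z
  proof (cases "z \<in> orb O2")
    case True
    have zY: "z \<in> Y"
      using z D''(5) by blast
    obtain \<tau> where \<tau>: "is_path Y z (J k z) \<tau>"
      using pcY zY J_closed[OF zY] unfolding path_connected_component path_component_is_path by blast
    obtain N M where NM: "open N" "z \<in> N" "compact M" "M \<subseteq> Y"
      "\<forall>z'\<in>Y \<inter> N. z' \<in> orb O2 \<and> (\<exists>p. is_path (Y \<inter> M) z' (J k z') p)"
      using tracks_near_point[OF openin_orb[OF O2(1)] True orb_subset[OF O2Y] J_image_subset[OF orb_subset[OF O2Y]] order_refl \<tau>]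
      by blast
    have "\<exists>p. is_path M z' (J k z') p \<and> (z' \<notin> orb O2 \<longrightarrow> is_path ?W z' (J k z') p)" if zN: "z' \<in> Y \<inter> N" for z'
    proof -
      obtain p where p: "z' \<in> orb O2" "is_path (Y \<inter> M) z' (J k z') p"
        using bspec[OF NM(5) zN] by (elim conjE exE)
      show ?thesis
        using is_path_mono[OF p(2) Int_lower2] p(1) by (intro exI[of _ p]) simp
    qed
    then show ?thesis
      using NM(1-4) by (intro exI[of _ N] exI[of _ M]) simp
  next
    case False
    have z': "z \<in> Y - orb D1" "z \<in> ?W"
      using z D''(5) False orbs by blast+
    obtain \<tau> where \<tau>: "is_path ?W z (J k z) \<tau>"
      using tracks z'(1) unfolding path_component_is_path by blast
    obtain N M where NM: "open N" "z \<in> N" "compact M" "M \<subseteq> Y"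
      "\<forall>z'\<in>Y \<inter> N. z' \<in> ?W \<and> (\<exists>p. is_path (?W \<inter> M) z' (J k z') p)"
      using tracks_near_point[OF openin_compl_orb[OF D0(1,2)] z'(2) order_refl JWsub Diff_subset \<tau>]
      by blast
    have "\<exists>p. is_path M z' (J k z') p \<and> (z' \<notin> orb O2 \<longrightarrow> is_path ?W z' (J k z') p)" if zN: "z' \<in> Y \<inter> N" for z'
    proof -
      obtain p where p: "is_path (?W \<inter> M) z' (J k z') p"
        using bspec[OF NM(5) zN] by (elim conjE exE)
      show ?thesis
        using is_path_mono[OF p Int_lower2] is_path_mono[OF p Int_lower1] by (intro exI[of _ p]) simp
    qed
    then show ?thesis
      using NM(1-4) by (intro exI[of _ N] exI[of _ M]) simp
  qed
  then obtain N M where NM: "\<And>z. z \<in> D'' \<Longrightarrow> open (N z) \<and> z \<in> N z \<and> compact (M z) \<and> M z \<subseteq> Y \<and>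
      (\<forall>z'\<in>Y \<inter> N z. \<exists>p. is_path (M z) z' (J k z') p \<and> (z' \<notin> orb O2 \<longrightarrow> is_path ?W z' (J k z') p))"
    by metis
  have "D'' \<subseteq> (\<Union>z\<in>D''. N z)"
    using NM by blast
  then obtain F where F: "F \<subseteq> D''" "finite F" "D'' \<subseteq> (\<Union>z\<in>F. N z)"
    using compactE_image[OF D''(4), of D'' N] NM by blast
  \<comment> \<open>By compactness of \<open>D''\<close> the tracks of all its points fit into one
    compact set; translates of these tracks serve all points of \<open>orb D''\<close>.\<close>
  define L1 where "L1 = (\<Union>z\<in>F. M z)"
  have L1: "compact L1" "L1 \<subseteq> Y"
    unfolding L1_def using NM F(1) by (auto intro!: compact_UN F(2))
  have track1: "\<exists>p. is_path L1 z (J k z) p \<and> (z \<notin> orb O2 \<longrightarrow> is_path ?W z (J k z) p)" if z: "z \<in> D''" for z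
  proof -
    obtain w where w: "w \<in> F" "z \<in> N w"
      using F(3) z by blast
    have "z \<in> Y \<inter> N w" "w \<in> D''"
      using z w D''(5) F(1) by blast+
    have "\<exists>p. is_path (M w) z (J k z) p \<and> (z \<notin> orb O2 \<longrightarrow> is_path ?W z (J k z) p)"
      using NM[OF \<open>w \<in> D''\<close>] \<open>z \<in> Y \<inter> N w\<close> by (elim conjE) (rule bspec)
    then obtain p where p: "is_path (M w) z (J k z) p" "z \<notin> orb O2 \<longrightarrow> is_path ?W z (J k z) p"
      by (elim conjE exE)
    have "M w \<subseteq> L1"
      unfolding L1_def using w(1) by blast
    then show ?thesis
      using is_path_mono[OF p(1)] p(2) by (intro exI[of _ p]) simp
  qed
  \<comment> \<open>Two indices that move the same point into \<open>D''\<close> differ by at most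
    \<open>R\<close>. Tracks that were chosen in different translates of \<open>L1\<close> therefore
    fit into one translate of \<open>L2\<close>.\<close>
  obtain R where R: "R \<ge> 0" "\<forall>m. J m ` D'' \<inter> D'' \<noteq> {} \<longrightarrow> \<bar>m\<bar> \<le> R"
    by (rule meeting_bound[OF D''(4,5) D''(4,5)])
  define L2 where "L2 = (\<Union>i\<in>{-R..R}. J i ` L1) \<union> D'' \<union> J k ` D''"
  have "(\<Union>i\<in>{-R..R}. J i ` L1) \<subseteq> Y"
    using J_image_subset[OF L1(2)] by (intro UN_least)
  then have L2: "compact L2" "L2 \<subseteq> Y"
    unfolding L2_def using J_compact[OF L1] J_compact[OF D''(4,5)] D''(4,5) J_image_subset[OF D''(5)]
    by (auto intro!: compact_UN compact_Un)
  obtain L3 where L3: "compact L3" "L3 \<subseteq> Y" "\<forall>x p. is_path L2 x x p \<longrightarrow> homotopic_paths L3 p (\<lambda>_. x)"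
    by (rule compact_null_loops[OF lpc lc lsc sc pcY L2])
  define X where "X = L2 \<union> L3 \<union> D'"
  have X: "compact X" "X \<subseteq> Y"
    unfolding X_def using L2 L3(1,2) D'(1,2) by (auto intro: compact_Un)
  \<comment> \<open>Translates of \<open>L2\<close> and \<open>L3\<close> with index above
    \<open>N0\<close> miss \<open>C\<close>, so that null homotopies of local loops can be carried
    out there off \<open>C\<close>.\<close>
  obtain N0 where N0: "N0 \<ge> 0" "\<forall>m. J m ` X \<inter> C \<noteq> {} \<longrightarrow> \<bar>m\<bar> \<le> N0"
    by (rule meeting_bound[OF X C])
  have off: "J m ` X' \<subseteq> ?S" if "m > N0" "X' \<subseteq> X" for m X'
  proof -
    have "J m ` X \<inter> C = {}"
      using N0 that(1) by (metis abs_ge_self leD le_less_trans)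
    moreover have "J m ` X' \<subseteq> J m ` X"
      by (rule image_mono[OF that(2)])
    moreover have "J m ` X \<subseteq> Y"
      by (rule J_image_subset[OF X(2)])
    ultimately show ?thesis
      by blast
  qed
  have L1L2: "J i ` L1 \<subseteq> L2" if "\<bar>i\<bar> \<le> R" for i
    unfolding L2_def using that by (intro le_supI1 UN_upper) auto
  have L1L2': "L1 \<subseteq> L2"
    using L1L2[of 0] R(1) J_zero_image[OF L1(2)] by simp
  show thesis
  proof (rule that[of N0], intro allI impI)
    fix N x\<^sub>0 p\<^sub>0 assume N: "N \<ge> N0" and p\<^sub>0': "is_path (Y - (\<Union>m\<in>{..N}. J m ` D')) x\<^sub>0 x\<^sub>0 p\<^sub>0"
    define A where "A = Y - (\<Union>m\<in>{..N}. J m ` D')"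
    have A_iff: "y \<in> A \<longleftrightarrow> y \<in> Y \<and> (\<forall>m\<le>N. y \<notin> J m ` D')" for y
      by (auto simp: A_def)
    have AY: "A \<subseteq> Y"
      by (auto simp: A_iff)
    have p\<^sub>0: "is_path A x\<^sub>0 x\<^sub>0 p\<^sub>0"
      using p\<^sub>0' by (simp add: A_def)
    have AD': "\<exists>m. m > N \<and> J (- m) y \<in> D'" if y: "y \<in> A" "y \<in> orb D'" for y
    proof -
      obtain m where m: "y \<in> J m ` D'"
        using y(2) unfolding orb_def by blast
      then have "\<not> m \<le> N"
        using y(1) A_iff by blast
      then have "m > N"
        by simp
      then show ?thesis
        using m J_image_iff[OF D'(2) subsetD[OF AY y(1)], of m] by blast
    qed
    have JA: "J m y \<in> A" if y: "y \<in> A" and m: "m \<ge> 0" for m y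
    proof -
      have yY: "y \<in> Y"
        using y AY by blast
      have "J m y \<notin> J i ` D'" if i: "i \<le> N" for i
      proof
        assume "J m y \<in> J i ` D'"
        then have "J (- i) (J m y) \<in> D'"
          using J_image_iff[OF D'(2) J_closed[OF yY]] by blast
        then have "J (- (i - m)) y \<in> D'"
          using J_add[OF yY, of "- i" m] by (simp add: algebra_simps)
        then have "y \<in> J (i - m) ` D'"
          using J_image_iff[OF D'(2) yY] by blast
        moreover have "i - m \<le> N"
          using i m by simp
        ultimately show False
          using y A_iff by blast
      qed
      then show ?thesis
        using J_closed[OF yY] A_iff by blast
    qed
    have AS: "A \<subseteq> ?S"
    proof
      fix y assume y: "y \<in> A"
      have "y \<notin> C"
      proof
        assume yC: "y \<in> C"
        then have "y \<in> orb D'"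
          using D0(3) orbs by blast
        then obtain m where m: "m > N" "J (- m) y \<in> D'"
          using AD'[OF y] by blast
        then have "y \<in> J m ` D'"
          using J_image_iff[OF D'(2) subsetD[OF AY y], of m] by blast
        moreover have "J m ` D' \<subseteq> ?S"
          using off[of m D'] m(1) N unfolding X_def by auto
        ultimately show False
          using yC by blast
      qed
      then show "y \<in> ?S"
        using y AY by blast
    qed
    \<comment> \<open>There are three kinds of points. In \<open>orb D'\<close> the track lies in a
      high translate of \<open>L1\<close>. In \<open>orb D''\<close> but off \<open>orb D'\<close>
      it lies in a translate of \<open>L1\<close> and also off \<open>orb D0\<close>, so that it
      fits to both neighbouring kinds. Elsewhere it is any track off \<open>orb D0\<close>.\<close>
    have "\<exists>\<tau>. is_path ?S y (J k y) \<tau> \<and> (y \<notin> orb D' \<longrightarrow> is_path ?W y (J k y) \<tau>) \<and>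
        (y \<in> orb D'' \<longrightarrow> (\<exists>m. J (- m) y \<in> D'' \<and> is_path (J m ` L1) y (J k y) \<tau>))" if y: "y \<in> A" for y
    proof -
      have yY: "y \<in> Y"
        using y AY by blast
      have move: "is_path (J m ` L1) y (J k y) (J m \<circ> p)" if "is_path L1 (J (- m) y) (J k (J (- m) y)) p" for m p
        using J_path[OF that L1(2), of m] J_inverse(2)[OF yY, of m] J_commute[OF J_closed[OF yY], of m k "- m"] by simp
      consider "y \<in> orb D'" | "y \<notin> orb D'" "y \<in> orb D''" | "y \<notin> orb D'" "y \<notin> orb D''"
        by blast
      then show ?thesis
      proof cases
        case 1
        then obtain m where m: "m > N" "J (- m) y \<in> D'"
          using AD'[OF y] by blast
        then have mD'': "J (- m) y \<in> D''"
          using D''(2,3) by blast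
        obtain p where p: "is_path L1 (J (- m) y) (J k (J (- m) y)) p"
          using track1[OF mD''] by blast
        have "J m ` L1 \<subseteq> ?S"
          using off[of m L1] m(1) N L1L2' unfolding X_def by auto
        then have "is_path ?S y (J k y) (J m \<circ> p)"
          by (rule is_path_mono[OF move[OF p]])
        then show ?thesis
          using move[OF p] 1 mD'' by blast
      next
        case 2
        obtain m d where d: "d \<in> D''" "y = J m d"
          using 2(2) unfolding orb_def by blast
        have dY: "d \<in> Y"
          using d(1) D''(5) by blast
        have dm: "J (- m) y = d"
          unfolding d(2) by (rule J_inverse(1)[OF dY])
        have "d \<notin> orb O2"
          using 2(1) orbs(3) J_orb_iff[OF D'(2) dY, of m] unfolding d(2) by blast
        then obtain p where p: "is_path L1 d (J k d) p" "is_path ?W d (J k d) p"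
          using track1[OF d(1)] by blast
        have m1: "is_path (J m ` L1) y (J k y) (J m \<circ> p)"
          using move[of m p] p(1) unfolding dm by blast
        have "is_path (J m ` ?W) (J m d) (J m (J k d)) (J m \<circ> p)"
          by (rule J_path[OF p(2) Diff_subset])
        then have "is_path ?W y (J k y) (J m \<circ> p)"
          unfolding d(2) J_commute[OF dY, of m k] by (rule is_path_mono[OF _ JWsub])
        then show ?thesis
          using m1 is_path_mono[OF _ WS] d(1) dm by blast
      next
        case 3
        then have "y \<in> Y - orb D1"
          using yY orbs by blast
        then obtain \<tau> where "is_path ?W y (J k y) \<tau>"
          using tracks unfolding path_component_is_path by blast
        then show ?thesis
          using 3 is_path_mono[OF _ WS] by blast
      qed
    qed
    then obtain \<tau> where \<tau>: "\<And>y. y \<in> A \<Longrightarrow> is_path ?S y (J k y) (\<tau> y)"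
      "\<And>y. y \<in> A \<Longrightarrow> y \<notin> orb D' \<Longrightarrow> is_path ?W y (J k y) (\<tau> y)"
      "\<And>y. y \<in> A \<Longrightarrow> y \<in> orb D'' \<Longrightarrow> \<exists>m. J (- m) y \<in> D'' \<and> is_path (J m ` L1) y (J k y) (\<tau> y)"
      by metis
    have step: "homotopic_paths ?S p (\<lambda>_. x)"
      if p: "is_path A x x p" and n: "homotopic_paths ?S (J k \<circ> p) (\<lambda>_. J k x)" for x p
    proof -
      let ?\<Gamma> = "fundamental_group ?S x"
      have xA: "x \<in> A"
        by (rule is_path_mem(1)[OF p])
      have xS: "x \<in> ?S"
        using xA AS by blast
      interpret \<Gamma>: group ?\<Gamma>
        by (rule group_fundamental_group[OF xS])
      have pp: "path p" "path_image p \<subseteq> A" "p 0 = x" "p 1 = x"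
        using p is_path_image_interval[OF p] by (auto simp: is_path_def)
      have pS: "path_image p \<subseteq> ?S" and pY: "path_image p \<subseteq> Y"
        by (rule subset_trans[OF pp(2) AS], rule subset_trans[OF pp(2) AY])
      have pt: "p t \<in> A" if "t \<in> {0..1}" for t
        using subsetD[OF pp(2), of "p t"] that by (simp add: path_image_def)
      let ?q = "J k \<circ> p"
      have qS: "is_path ?S (J k x) (J k x) ?q"
      proof (rule is_path_mono[OF J_path[OF p AY]])
        show "J k ` A \<subseteq> ?S"
          by (rule image_subsetI, rule subsetD[OF AS], rule JA) (use k in simp_all)
      qed
      have qq: "path ?q" "path_image ?q \<subseteq> ?S" "?q 0 = J k x"
        using qS pp(3) by (auto simp: is_path_def)
      have pcx: "path_component ?S x (p 0)" and pcq: "path_component ?S x (?q 0)"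
        using path_component_refl[OF xS] path_component_is_path \<tau>(1)[OF xA] pp(3) qq(3) by auto
      have seg: "is_path ?S (r s) (r t) (restrict_path s t r)" if "s \<in> {0..1}" "t \<in> {0..1}" "path r" "path_image r \<subseteq> ?S" for s t r
      proof (rule is_path_restrict_path[OF that(3) _ that(1,2)])
        have "closed_segment s t \<subseteq> {0..1}"
          using that(1,2) by (intro closed_segment_subset) auto
        then have "r ` closed_segment s t \<subseteq> path_image r"
          unfolding path_image_def by (rule image_mono)
        then show "r ` closed_segment s t \<subseteq> ?S"
          using that(4) by (rule subset_trans)
      qed
      have 01: "0 \<in> {0..1::real}" "1 \<in> {0..1::real}"
        by auto
      let ?c = "closed_up ?S x"
      let ?l1 = "\<lambda>t. ?c (restrict_path 0 t p)" and ?l2 = "\<lambda>t. ?c (restrict_path 0 t ?q)"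
      let ?T = "\<lambda>t. ?c (\<tau> (p t))"
      have pcp: "path_component ?S x (p t)" if "t \<in> {0..1}" for t
        by (rule path_component_is_path_trans[OF pcx seg[OF 01(1) that pp(1) pS]])
      have pcqt: "path_component ?S x (?q t)" if "t \<in> {0..1}" for t
        by (rule path_component_is_path_trans[OF pcq seg[OF 01(1) that qq(1,2)]])
      have c1: "?c (restrict_path s t p) \<in> carrier ?\<Gamma>" if "s \<in> {0..1}" "t \<in> {0..1}" for s t
        by (rule closed_up_in_carrier[OF pcp[OF that(1)] seg[OF that pp(1) pS]])
      have c2: "?c (restrict_path s t ?q) \<in> carrier ?\<Gamma>" if "s \<in> {0..1}" "t \<in> {0..1}" for s t
        by (rule closed_up_in_carrier[OF pcqt[OF that(1)] seg[OF that qq(1,2)]])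
      have cT: "?T t \<in> carrier ?\<Gamma>" if "t \<in> {0..1}" for t
        by (rule closed_up_in_carrier[OF pcp[OF that] \<tau>(1)[OF pt[OF that]]])
      have square: "?c (restrict_path s t p) \<otimes>\<^bsub>?\<Gamma>\<^esub> ?T t = ?T s \<otimes>\<^bsub>?\<Gamma>\<^esub> ?c (restrict_path s t ?q)"
        if st: "s \<in> {0..1}" "t \<in> {0..1}" and Z: "Z \<subseteq> ?S" "\<And>a r. is_path Z a a r \<Longrightarrow> homotopic_paths ?S r (\<lambda>_. a)"
          and r: "is_path Z (p s) (p t) (restrict_path s t p)" "is_path Z (p t) (J k (p t)) (\<tau> (p t))"
            "is_path Z (p s) (J k (p s)) (\<tau> (p s))" "is_path Z (J k (p s)) (J k (p t)) (restrict_path s t ?q)" for s t Z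
      proof -
        have "homotopic_paths ?S (restrict_path s t p +++ \<tau> (p t)) (\<tau> (p s) +++ restrict_path s t ?q)"
          by (rule null_loops_imp_homotopic[OF Z(2,1) is_path_join[OF r(1,2)] is_path_join[OF r(3,4)]])
        then have "?c (restrict_path s t p +++ \<tau> (p t)) = ?c (\<tau> (p s) +++ restrict_path s t ?q)"
          using closed_up_eq_iff[OF pcp[OF st(1)] is_path_mono[OF is_path_join[OF r(1,2)] Z(1)] is_path_mono[OF is_path_join[OF r(3,4)] Z(1)]]
          by blast
        then show ?thesis
          using closed_up_join[OF pcp[OF st(1)] is_path_mono[OF r(1) Z(1)] is_path_mono[OF r(2) Z(1)]]
            closed_up_join[OF pcp[OF st(1)] is_path_mono[OF r(3) Z(1)] is_path_mono[OF r(4) Z(1)]] by simp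
      qed
      have Jseg: "is_path (J k ` Z) (J k (p s)) (J k (p t)) (restrict_path s t ?q)"
        if "is_path Z (p s) (p t) (restrict_path s t p)" "Z \<subseteq> Y" for s t Z
        using J_path[OF that, of k] by (simp add: restrict_path_def o_assoc)
      \<comment> \<open>The square formed by two tracks and short pieces of \<open>p\<close> and its
        translate lies in a set whose loops die off \<open>C\<close>: the complement of
        \<open>orb D0\<close> near a time when \<open>p\<close> is off \<open>orb D'\<close>, a high
        translate of \<open>L2\<close> otherwise.\<close>
      have local_square: "\<exists>U. open U \<and> s \<in> U \<and> (\<forall>t\<in>{0..1} \<inter> U.
          ?c (restrict_path s t p) \<otimes>\<^bsub>?\<Gamma>\<^esub> ?T t = ?T s \<otimes>\<^bsub>?\<Gamma>\<^esub> ?c (restrict_path s t ?q))" if s: "s \<in> {0..1}" for s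
      proof (cases "p s \<in> orb D'")
        case False
        have psV: "p s \<in> Y - orb D'"
          using False pt[OF s] AY by blast
        obtain U where U: "open U" "s \<in> U" "\<forall>t\<in>{0..1} \<inter> U. is_path (Y - orb D') (p s) (p t) (restrict_path s t p)"
          by (rule restrict_path_local[OF pp(1) pY openin_compl_orb[OF D'(1,2)] psV s])
        have sub: "Y - orb D' \<subseteq> ?W"
          using orbs by blast
        have "?c (restrict_path s t p) \<otimes>\<^bsub>?\<Gamma>\<^esub> ?T t = ?T s \<otimes>\<^bsub>?\<Gamma>\<^esub> ?c (restrict_path s t ?q)" if t: "t \<in> {0..1} \<inter> U" for t
        proof -
          have t': "t \<in> {0..1}"
            using t by blast
          have r: "is_path (Y - orb D') (p s) (p t) (restrict_path s t p)"
            using U(3) t by blast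
          have r1: "is_path ?W (p s) (p t) (restrict_path s t p)"
            by (rule is_path_mono[OF r sub])
          show ?thesis
          proof (rule square[OF s t' WS null0 r1])
            show "is_path ?W (p t) (J k (p t)) (\<tau> (p t))" "is_path ?W (p s) (J k (p s)) (\<tau> (p s))"
              using \<tau>(2)[OF pt[OF t']] \<tau>(2)[OF pt[OF s]] is_path_mem[OF r] by blast+
            show "is_path ?W (J k (p s)) (J k (p t)) (restrict_path s t ?q)"
              by (rule is_path_mono[OF Jseg[OF r1 Diff_subset] JWsub])
          qed
        qed
        then show ?thesis
          using U(1,2) by blast
      next
        case True
        obtain m where m: "m > N" "J (- m) (p s) \<in> D'"
          using AD'[OF pt[OF s] True] by blast
        have O''Y: "O'' \<subseteq> Y"
          using D''(3,5) by blast
        have "p s \<in> Y" "J (- m) (p s) \<in> O''"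
          using pt[OF s] AY m(2) D''(2) by blast+
        then have psV: "p s \<in> J m ` O''"
          using J_image_iff[OF O''Y] by blast
        obtain U where U: "open U" "s \<in> U" "\<forall>t\<in>{0..1} \<inter> U. is_path (J m ` O'') (p s) (p t) (restrict_path s t p)"
          by (rule restrict_path_local[OF pp(1) pY J_openin[OF D''(1)] psV s])
        let ?Z = "J m ` L2"
        have ZS: "?Z \<subseteq> ?S"
          using off[of m L2] m(1) N unfolding X_def by auto
        have Znull: "homotopic_paths ?S r (\<lambda>_. a)" if "is_path ?Z a a r" for a r
        proof -
          have "J m ` L3 \<subseteq> ?S"
            using off[of m L3] m(1) N unfolding X_def by auto
          then show ?thesis
            using J_null_loops[OF L3(3) L2(2) L3(2) that] by (rule homotopic_paths_subset[rotated])
        qed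
        have near: "is_path ?Z (p t) (J k (p t)) (\<tau> (p t))" if t: "t \<in> {0..1}" "p t \<in> J m ` O''" for t
        proof -
          have ptY: "p t \<in> Y"
            using pt[OF t(1)] AY by blast
          have a: "J (- m) (p t) \<in> D''"
            using t(2) J_image_iff[OF O''Y ptY] D''(3) by blast
          then have "p t \<in> J m ` D''"
            using J_image_iff[OF D''(5) ptY] by blast
          then have "p t \<in> orb D''"
            unfolding orb_def by blast
          then obtain i where i: "J (- i) (p t) \<in> D''" "is_path (J i ` L1) (p t) (J k (p t)) (\<tau> (p t))"
            using \<tau>(3)[OF pt[OF t(1)]] by blast
          have "J (- m) (p t) = J (i - m) (J (- i) (p t))"
            using J_add[OF ptY, of "i - m" "- i"] by simp
          then have "J (- m) (p t) \<in> J (i - m) ` D''"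
            using i(1) by simp
          then have "\<bar>i - m\<bar> \<le> R"
            using a R(2) by blast
          then have "J (i - m) ` L1 \<subseteq> L2"
            by (rule L1L2)
          then have "J m ` J (i - m) ` L1 \<subseteq> ?Z"
            by (rule image_mono)
          then have "J i ` L1 \<subseteq> ?Z"
            unfolding J_image_image[OF L1(2)] by simp
          then show ?thesis
            by (rule is_path_mono[OF i(2)])
        qed
        have O''L2: "O'' \<subseteq> L2" "J k ` O'' \<subseteq> L2"
          using D''(3) image_mono[OF D''(3), of "J k"] unfolding L2_def by blast+
        have "?c (restrict_path s t p) \<otimes>\<^bsub>?\<Gamma>\<^esub> ?T t = ?T s \<otimes>\<^bsub>?\<Gamma>\<^esub> ?c (restrict_path s t ?q)" if t: "t \<in> {0..1} \<inter> U" for t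
        proof -
          have t': "t \<in> {0..1}"
            using t by blast
          have r: "is_path (J m ` O'') (p s) (p t) (restrict_path s t p)"
            using U(3) t by blast
          show ?thesis
          proof (rule square[OF s t' ZS Znull])
            show "is_path ?Z (p s) (p t) (restrict_path s t p)"
              by (rule is_path_mono[OF r image_mono[OF O''L2(1)]])
            show "is_path ?Z (p t) (J k (p t)) (\<tau> (p t))"
              by (rule near[OF t' is_path_mem(2)[OF r]])
            show "is_path ?Z (p s) (J k (p s)) (\<tau> (p s))"
              by (rule near[OF s is_path_mem(1)[OF r]])
            have "J k ` J m ` O'' = J m ` J k ` O''"
              by (simp add: J_image_image[OF O''Y] add.commute)
            then have "J k ` J m ` O'' \<subseteq> ?Z"
              using image_mono[OF O''L2(2), of "J m"] by simp
            then show "is_path ?Z (J k (p s)) (J k (p t)) (restrict_path s t ?q)"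
              by (rule is_path_mono[OF Jseg[OF r J_image_subset[OF O''Y]]])
          qed
        qed
        then show ?thesis
          using U(1,2) by blast
      qed
      \<comment> \<open>The class of the path that follows \<open>p\<close> to time
        \<open>t\<close>, then the track, then \<open>?q\<close> back to its start. The local
        squares make it locally constant. Its equality at \<open>0\<close> and \<open>1\<close> says
        that \<open>p\<close> is conjugate to \<open>?q\<close> by the track of
        \<open>x\<close>.\<close>
      let ?D = "\<lambda>t. ?l1 t \<otimes>\<^bsub>?\<Gamma>\<^esub> (?T t \<otimes>\<^bsub>?\<Gamma>\<^esub> inv\<^bsub>?\<Gamma>\<^esub> ?l2 t)"
      have "loc_const_on {0..1} ?D"
      proof (rule loc_const_onI)
        fix s :: real assume s: "s \<in> {0..1}"
        obtain U where U: "open U" "s \<in> U" "\<forall>t\<in>{0..1} \<inter> U.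
          ?c (restrict_path s t p) \<otimes>\<^bsub>?\<Gamma>\<^esub> ?T t = ?T s \<otimes>\<^bsub>?\<Gamma>\<^esub> ?c (restrict_path s t ?q)"
          using local_square[OF s] by blast
        have "?D t = ?D s" if t: "t \<in> {0..1} \<inter> U" for t
        proof -
          have t': "t \<in> {0..1}"
            using t by blast
          let ?a = "?c (restrict_path s t p)" and ?b = "?c (restrict_path s t ?q)"
          have 1: "?l1 t = ?l1 s \<otimes>\<^bsub>?\<Gamma>\<^esub> ?a"
            by (rule closed_up_restrict_path[OF pp(1) pS pcx s t'])
          have 2: "?l2 t = ?l2 s \<otimes>\<^bsub>?\<Gamma>\<^esub> ?b"
            by (rule closed_up_restrict_path[OF qq(1,2) pcq s t'])
          have 3: "?a \<otimes>\<^bsub>?\<Gamma>\<^esub> ?T t = ?T s \<otimes>\<^bsub>?\<Gamma>\<^esub> ?b"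
            using U(3) t by blast
          note cl = c1[OF 01(1) s] c1[OF s t'] c2[OF 01(1) s] c2[OF s t'] cT[OF s] cT[OF t']
          have "?D t = ?l1 s \<otimes>\<^bsub>?\<Gamma>\<^esub> ((?a \<otimes>\<^bsub>?\<Gamma>\<^esub> ?T t) \<otimes>\<^bsub>?\<Gamma>\<^esub> (inv\<^bsub>?\<Gamma>\<^esub> ?b \<otimes>\<^bsub>?\<Gamma>\<^esub> inv\<^bsub>?\<Gamma>\<^esub> ?l2 s))"
            unfolding 1 2 using cl by (simp add: \<Gamma>.inv_mult_group \<Gamma>.m_assoc)
          also have "\<dots> = ?D s"
            unfolding 3 using cl by (simp add: \<Gamma>.m_assoc \<Gamma>.mult_inv_mult)
          finally show ?thesis .
        qed
        then show "\<exists>U. open U \<and> s \<in> U \<and> (\<forall>t\<in>{0..1} \<inter> U. ?D t = ?D s)"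
          using U(1,2) by blast
      qed
      then have D10: "?D 1 = ?D 0"
        by (intro loc_const_on_connected[of "{0..1::real}" ?D]) auto
      have one: "?l1 0 = \<one>\<^bsub>?\<Gamma>\<^esub>" "?l2 0 = \<one>\<^bsub>?\<Gamma>\<^esub>"
        unfolding restrict_path_same by (rule closed_up_const[OF pcx], rule closed_up_const[OF pcq])
      have pJ: "path_component ?S x (J k x)"
        using pcq qq(3) by simp
      have "?c ?q = \<one>\<^bsub>?\<Gamma>\<^esub>"
        using closed_up_eq_iff[OF pJ qS is_path_const[OF is_path_mem(1)[OF qS]]] n closed_up_const[OF pJ] by simp
      then have "?c p \<otimes>\<^bsub>?\<Gamma>\<^esub> ?T 1 = ?T 0"
        using D10 one cT[OF 01(1)] cT[OF 01(2)] c1[OF 01] by simp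
      then have "?c p = \<one>\<^bsub>?\<Gamma>\<^esub>"
        using cT[OF 01(1)] c1[OF 01] pp(3,4) \<Gamma>.r_cancel_one[of "?T 0" "?c p"] by simp
      then show ?thesis
        using closed_up_eq_iff[OF path_component_refl[OF xS] is_path_mono[OF p AS] is_path_const[OF xS]]
          closed_up_const[OF path_component_refl[OF xS]] by simp
    qed
    have Jk: "is_path A (J m x\<^sub>0) (J m x\<^sub>0) (J m \<circ> p\<^sub>0)" if "m \<ge> 0" for m
      using JA[OF _ that] by (intro is_path_mono[OF J_path[OF p\<^sub>0 AY]] image_subsetI)
    have iter: "homotopic_paths ?S p\<^sub>0 (\<lambda>_. x\<^sub>0)"
      if "homotopic_paths ?S (J (k * int n) \<circ> p\<^sub>0) (\<lambda>_. J (k * int n) x\<^sub>0)" for n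
      using that
    proof (induction n)
      case 0
      have x0: "x\<^sub>0 \<in> Y"
        using is_path_mem(1)[OF p\<^sub>0] AY by blast
      have "homotopic_paths ?S p\<^sub>0 (J 0 \<circ> p\<^sub>0)"
      proof (rule homotopic_paths_eq)
        show "path p\<^sub>0" "path_image p\<^sub>0 \<subseteq> ?S"
          using is_path_mono[OF p\<^sub>0 AS] by (auto simp: is_path_def)
        fix t :: real assume "t \<in> {0..1}"
        then have "p\<^sub>0 t \<in> path_image p\<^sub>0"
          by (simp add: path_image_def)
        moreover have "path_image p\<^sub>0 \<subseteq> A"
          using p\<^sub>0 by (simp add: is_path_def)
        ultimately have "p\<^sub>0 t \<in> Y"
          using AY by blast
        then show "p\<^sub>0 t = (J 0 \<circ> p\<^sub>0) t"
          by (simp add: J_zero)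
      qed
      moreover have "homotopic_paths ?S (J 0 \<circ> p\<^sub>0) (\<lambda>_. x\<^sub>0)"
        using 0 J_zero[OF x0] by (simp add: o_def)
      ultimately show ?case
        by (rule homotopic_paths_trans)
    next
      case (Suc n)
      let ?m = "k * int n"
      have m0: "?m \<ge> 0"
        using k by simp
      have x0: "x\<^sub>0 \<in> Y"
        using is_path_mem(1)[OF p\<^sub>0] AY by blast
      have add: "J (k * int (Suc n)) y = J k (J ?m y)" if "y \<in> Y" for y
        using J_add[OF that, of k ?m] by (simp add: algebra_simps)
      have "homotopic_paths ?S (J k \<circ> (J ?m \<circ> p\<^sub>0)) (J (k * int (Suc n)) \<circ> p\<^sub>0)"
      proof (rule homotopic_paths_eq)
        have "is_path ?S (J k (J ?m x\<^sub>0)) (J k (J ?m x\<^sub>0)) (J k \<circ> (J ?m \<circ> p\<^sub>0))"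
        proof (rule is_path_mono[OF J_path[OF Jk[OF m0] AY]])
          show "J k ` A \<subseteq> ?S"
            by (rule image_subsetI, rule subsetD[OF AS], rule JA) (use k in simp_all)
        qed
        then show "path (J k \<circ> (J ?m \<circ> p\<^sub>0))" "path_image (J k \<circ> (J ?m \<circ> p\<^sub>0)) \<subseteq> ?S"
          by (auto simp: is_path_def)
        fix t :: real assume "t \<in> {0..1}"
        then have "p\<^sub>0 t \<in> path_image p\<^sub>0"
          by (simp add: path_image_def)
        moreover have "path_image p\<^sub>0 \<subseteq> A"
          using p\<^sub>0 by (simp add: is_path_def)
        ultimately have "p\<^sub>0 t \<in> Y"
          using AY by blast
        then show "(J k \<circ> (J ?m \<circ> p\<^sub>0)) t = (J (k * int (Suc n)) \<circ> p\<^sub>0) t"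
          by (simp only: o_apply add)
      qed
      also have "homotopic_paths ?S \<dots> (\<lambda>_. J k (J ?m x\<^sub>0))"
        using Suc.prems by (simp only: add[OF x0])
      finally have "homotopic_paths ?S (J ?m \<circ> p\<^sub>0) (\<lambda>_. J ?m x\<^sub>0)"
        by (rule step[OF Jk[OF m0]])
      then show ?case
        by (rule Suc.IH)
    qed
    \<comment> \<open>A null homotopy in \<open>Y\<close> has compact trace, which a high power of
      \<open>J k\<close> moves off \<open>C\<close>. The translated loop is thus null off
      \<open>C\<close>, and \<open>iter\<close> carries this back to the loop itself.\<close>
    have p0Y: "is_path Y x\<^sub>0 x\<^sub>0 p\<^sub>0"
      by (rule is_path_mono[OF p\<^sub>0 AY])
    have "homotopic_paths Y p\<^sub>0 (\<lambda>_. x\<^sub>0)"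
      by (rule sc[OF p0Y is_path_const[OF is_path_mem(1)[OF p0Y]]])
    then obtain Mh where Mh: "compact Mh" "Mh \<subseteq> Y" "homotopic_paths Mh p\<^sub>0 (\<lambda>_. x\<^sub>0)"
      by (rule compact_homotopy)
    obtain N1 where N1: "N1 \<ge> 0" "\<forall>m. J m ` Mh \<inter> C \<noteq> {} \<longrightarrow> \<bar>m\<bar> \<le> N1"
      by (rule meeting_bound[OF Mh(1,2) C])
    define n where "n = nat (N1 + 1)"
    have "k * int n \<ge> 1 * int n"
      using k by (intro mult_right_mono) auto
    moreover have "int n = N1 + 1"
      using N1(1) by (simp add: n_def)
    ultimately have "k * int n > N1"
      by linarith
    then have "\<not> \<bar>k * int n\<bar> \<le> N1"
      by simp
    then have "J (k * int n) ` Mh \<inter> C = {}"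
      using N1(2) by blast
    then have MS: "J (k * int n) ` Mh \<subseteq> ?S"
      using J_image_subset[OF Mh(2), of "k * int n"] by blast
    have "homotopic_paths ?S (J (k * int n) \<circ> p\<^sub>0) (J (k * int n) \<circ> (\<lambda>_. x\<^sub>0))"
      by (rule homotopic_paths_continuous_image[OF Mh(3) continuous_on_subset[OF J_cont Mh(2)]]) (use MS in blast)
    then show "homotopic_paths ?S p\<^sub>0 (\<lambda>_. x\<^sub>0)"
      by (intro iter[of n]) (simp add: o_def)
  qed
qed

end

section \<open>The two sides of the removed translates and the factorization\<close>

context Z_space
begin

lemma orb_inverse: "Z_space.orb (\<lambda>m. J (- m)) D = orb D"
proof -
  have "(\<Union>m. J (- m) ` D) = (\<Union>m. J m ` D)"
  proof (intro equalityI UN_least)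
    show "J (- m) ` D \<subseteq> (\<Union>m. J m ` D)" for m
      by (rule UN_upper) simp
    show "J m ` D \<subseteq> (\<Union>m. J (- m) ` D)" for m
      using UN_upper[of "- m" UNIV "\<lambda>m. J (- m) ` D"] by simp
  qed
  then show ?thesis
    unfolding Z_space.orb_def[OF inverse_action] orb_def .
qed

lemma inverse_tracks:
  assumes "D1 \<subseteq> Y" and t: "\<forall>x\<in>Y - orb D1. path_component W x (J k x)"
  shows "\<forall>x\<in>Y - orb D1. path_component W x (J (- k) x)"
proof
  fix x assume x: "x \<in> Y - orb D1"
  then have "J (- k) x \<in> Y - orb D1"
    using J_closed J_orb_iff[OF assms(1)] by simp
  then have "path_component W (J (- k) x) (J k (J (- k) x))"
    using t by blast
  then show "path_component W x (J (- k) x)"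
    using J_inverse(2)[of x k] x by (simp add: path_component_sym)
qed

lemma far_above:
  assumes D: "compact D" "D \<subseteq> Y" and M: "compact M" "M \<subseteq> Y"
  obtains N1 where "\<forall>m>N1. J m ` M \<subseteq> Y - (\<Union>i\<in>{..N}. J i ` D)"
proof -
  obtain R where R: "R \<ge> 0" "\<forall>m. J m ` M \<inter> D \<noteq> {} \<longrightarrow> \<bar>m\<bar> \<le> R"
    by (rule meeting_bound[OF M D])
  show thesis
  proof (rule that[of "N + R"], intro allI impI image_subsetI)
    fix m x assume m: "m > N + R" and x: "x \<in> M"
    have xY: "x \<in> Y"
      using x M(2) by blast
    have "J m x \<notin> J i ` D" if i: "i \<le> N" for i
    proof
      assume "J m x \<in> J i ` D"
      then have "J (- i) (J m x) \<in> D"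
        using J_image_iff[OF D(2) J_closed[OF xY]] by blast
      then have "J (m - i) x \<in> D"
        using J_add[OF xY, of "- i" m] by simp
      then have "J (m - i) ` M \<inter> D \<noteq> {}"
        using x by blast
      then have "\<bar>m - i\<bar> \<le> R"
        using R(2) by blast
      then show False
        using m i by linarith
    qed
    then show "J m x \<in> Y - (\<Union>i\<in>{..N}. J i ` D)"
      using J_closed[OF xY] by blast
  qed
qed

text \<open>Both points are pushed up by a high power of \<open>J k\<close> along tracks off
  \<open>orb D0\<close>. There the translate of any path between them avoids \<open>C\<close> and
  the translates of \<open>D\<close> with index at most \<open>N\<close>.\<close>

lemma joined_above:
  assumes D: "compact D" "D \<subseteq> Y" and C: "compact C" "C \<subseteq> Y" and CD: "C \<union> D \<subseteq> D0" "D0 \<subseteq> Y"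
    and k: "k > 0" and D1: "D1 \<subseteq> Y" and tracks: "\<forall>x\<in>Y - orb D1. path_component (Y - orb D0) x (J k x)"
    and xy: "x \<in> Y - orb D1" "y \<in> Y - orb D1"
  shows "path_component ((Y - (\<Union>i\<in>{..N}. J i ` D)) \<inter> (Y - C)) x y"
proof -
  let ?A = "(Y - (\<Union>i\<in>{..N}. J i ` D)) \<inter> (Y - C)"
  have sub: "Y - orb D0 \<subseteq> ?A"
  proof -
    have "(\<Union>i\<in>{..N}. J i ` D) \<subseteq> orb D"
      unfolding orb_def by (rule UN_mono) auto
    moreover have "orb D \<subseteq> orb D0" "C \<subseteq> orb D0"
      using orb_mono[of D D0] CD subset_orb[OF CD(2)] by auto
    ultimately show ?thesis
      by blast
  qed
  have up: "path_component (Y - orb D0) z (J (k * int n) z)" if z: "z \<in> Y - orb D1" for z n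
  proof (induction n)
    case 0
    have "z \<in> Y - orb D0"
      using tracks z path_component_mem(1) by blast
    then show ?case
      using J_zero[of z] by (simp add: path_component_refl)
  next
    case (Suc n)
    have "J (k * int n) z \<in> Y - orb D1"
      using z J_closed J_orb_iff[OF D1] by simp
    then have "path_component (Y - orb D0) (J (k * int n) z) (J k (J (k * int n) z))"
      using tracks by blast
    moreover have "J k (J (k * int n) z) = J (k * int (Suc n)) z"
      using J_add[of z k "k * int n"] z by (simp add: algebra_simps)
    ultimately show ?case
      using path_component_trans[OF Suc] by simp
  qed
  have xyY: "x \<in> Y" "y \<in> Y"
    using xy by auto
  obtain \<gamma> where \<gamma>: "is_path Y x y \<gamma>"
    using pcY xyY unfolding path_connected_component path_component_is_path by blast
  have M: "compact (path_image \<gamma>)" "path_image \<gamma> \<subseteq> Y"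
    using \<gamma> by (auto simp: is_path_def compact_path_image)
  obtain N1 where N1: "\<forall>m>N1. J m ` path_image \<gamma> \<subseteq> Y - (\<Union>i\<in>{..N}. J i ` D)"
    by (rule far_above[OF D M])
  obtain N2 where N2: "N2 \<ge> 0" "\<forall>m. J m ` path_image \<gamma> \<inter> C \<noteq> {} \<longrightarrow> \<bar>m\<bar> \<le> N2"
    by (rule meeting_bound[OF M C])
  define n where "n = nat (max N1 N2 + 1)"
  have "1 * int n \<le> k * int n"
    using k by (intro mult_right_mono) auto
  moreover have "int n = max N1 N2 + 1"
    using N2(1) by (simp add: n_def)
  ultimately have n: "k * int n > N1" "k * int n > N2"
    by linarith+
  then have "\<not> \<bar>k * int n\<bar> \<le> N2"
    by simp
  then have "J (k * int n) ` path_image \<gamma> \<inter> C = {}"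
    using N2(2) by blast
  then have MA: "J (k * int n) ` path_image \<gamma> \<subseteq> ?A"
    using N1 n(1) by blast
  have "is_path (path_image \<gamma>) x y \<gamma>"
    using \<gamma> by (simp add: is_path_def)
  from is_path_mono[OF J_path[OF this M(2)] MA]
  have "is_path ?A (J (k * int n) x) (J (k * int n) y) (J (k * int n) \<circ> \<gamma>)" .
  then have "path_component ?A (J (k * int n) x) (J (k * int n) y)"
    unfolding path_component_is_path by blast
  moreover have "path_component ?A x (J (k * int n) x)" "path_component ?A y (J (k * int n) y)"
    using path_component_of_subset[OF sub up] xy by blast+
  ultimately show ?thesis
    using path_component_trans path_component_sym by meson
qed

text \<open>\<open>A\<close> and \<open>B\<close> are the parts of \<open>Y\<close> above and below the translates \<open>J m ` D'\<close> with \<open>\<bar>m\<bar> \<le> N\<close>;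
  \<open>A \<inter> B = Y - orb D'\<close> is the union of the components of \<open>Y - orb D2\<close> which are unbounded modulo \<open>J\<close>.\<close>

theorem far_loops_factor_through_free_group:
  fixes T :: "nat \<Rightarrow> 'a"
  assumes coax: "\<And>C. compact C \<Longrightarrow> C \<subseteq> Y \<Longrightarrow> \<exists>D. compact D \<and> C \<subseteq> D \<and> D \<subseteq> Y \<and>
      (\<forall>x p. is_path (Y - orb D) x x p \<longrightarrow> homotopic_paths (Y - C) p (\<lambda>_. x))"
    and T: "range T \<subseteq> Y" "\<forall>x\<in>Y. \<forall>e>0. \<exists>n. dist x (T n) < e" and y0: "y0 \<in> Y"
    and C: "compact C" "C \<subseteq> Y"
  obtains E where "compact E" "C \<subseteq> E" "E \<subseteq> Y"
    "\<forall>C'. compact C' \<and> E \<subseteq> C' \<and> C' \<subseteq> Y \<longrightarrow> (\<exists>u \<phi> \<psi>. u \<in> Y - C' \<and>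
       \<phi> \<in> hom (fundamental_group (Y - E) u) (free_words :: (nat \<times> bool) list monoid) \<and>
       \<psi> \<in> hom (free_words :: (nat \<times> bool) list monoid) (fundamental_group (Y - C) u) \<and>
       (\<forall>p. is_path (Y - E) u u p \<longrightarrow> \<psi> (\<phi> (loop_class (Y - E) p)) = loop_class (Y - C) p) \<and>
       (\<forall>w. \<exists>q. is_path (Y - C') u u q \<and> \<psi> w = loop_class (Y - C) q))"
proof -
  interpret inv: Z_space Y "\<lambda>m. J (- m)"
    by (rule inverse_action)
  obtain L where L: "compact L" "C \<subseteq> L" "L \<subseteq> Y" "\<forall>x\<in>Y - L. \<forall>y\<in>Y - L. path_component (Y - C) x y"
    using joined_outside[OF C] by blast
  \<comment> \<open>Points outside \<open>L\<close> can be joined off \<open>C\<close>, which will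
    place \<open>Y - E\<close> in one path component of \<open>Y - C\<close>. The point
    \<open>y0\<close> makes the set nonempty, as \<open>deep_translates\<close> requires.\<close>
  define C1 where "C1 = insert y0 L"
  have C1: "compact C1" "C1 \<subseteq> Y" "L \<subseteq> C1" "C1 \<noteq> {}"
    using L y0 by (auto simp: C1_def)
  obtain D0 where D0: "compact D0" "C1 \<subseteq> D0" "D0 \<subseteq> Y"
    and null0: "\<forall>x p. is_path (Y - orb D0) x x p \<longrightarrow> homotopic_paths (Y - C1) p (\<lambda>_. x)"
    using coax[OF C1(1,2)] by blast
  have D0ne: "D0 \<noteq> {}"
    using D0(2) C1(4) by blast
  obtain D1 k where D1: "compact D1" "D1 \<subseteq> Y" "D0 \<union> D0 \<subseteq> D1" and k: "0 < k"
    and tracks: "\<forall>x\<in>Y - orb D1. path_component (Y - orb D0) x (J k x)"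
    by (rule deep_translates[OF D0(1,3) D0ne D0(1,3)])
  have D01: "D0 \<subseteq> D1"
    using D1(3) by blast
  obtain O2 D2 where O2: "openin (top_of_set Y) O2" "D1 \<subseteq> O2" "O2 \<subseteq> D2" and D2: "compact D2" "D2 \<subseteq> Y"
    by (rule locally_compact_neighbourhood[OF lc D1(1,2)])
  have D2ne: "D2 \<noteq> {}"
    using D0ne D01 O2(2,3) by blast
  \<comment> \<open>This second application, to the thickened set \<open>D2\<close>, is for the last
    conclusion: points off \<open>orb D3\<close> lie in components of \<open>Y - orb D2\<close> that
    are unbounded modulo the action.\<close>
  obtain D3 k3 where D3: "compact D3" "D3 \<subseteq> Y" "D2 \<union> D2 \<subseteq> D3"
    and deep: "\<forall>x\<in>Y - orb D3. \<forall>K. compact K \<longrightarrow> K \<subseteq> Y \<longrightarrow> \<not> connected_component_set (Y - orb D2) x \<subseteq> orb K"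
    by (rule deep_translates[OF D2 D2ne D2])
  let ?W = "Y - orb D2" and ?cc = "\<lambda>x. connected_component_set (Y - orb D2) x"
  have oW: "openin (top_of_set Y) ?W"
    by (rule openin_compl_orb[OF D2])
  have JW: "J m x \<in> ?W" if "x \<in> ?W" for m x
    using that J_closed J_orb_iff[OF D2(2)] by simp
  define G where "G = {x \<in> ?W. \<forall>K. compact K \<longrightarrow> K \<subseteq> Y \<longrightarrow> \<not> ?cc x \<subseteq> orb K}"
  have GW: "G \<subseteq> ?W" and GY: "G \<subseteq> Y"
    by (auto simp: G_def)
  have ccG: "?cc x \<subseteq> G" if x: "x \<in> G" for x
  proof
    fix z assume z: "z \<in> ?cc x"
    then have "?cc z = ?cc x"
      by (rule connected_component_eq)
    moreover have "z \<in> ?W"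
      using z connected_component_subset by blast
    ultimately show "z \<in> G"
      using x by (simp add: G_def)
  qed
  have oG: "openin (top_of_set Y) G"
  proof (subst openin_subopen, intro ballI)
    fix x assume x: "x \<in> G"
    then have xW: "x \<in> ?W"
      using GW by blast
    have "openin (top_of_set Y) (?cc x)"
      by (rule component_openin[OF lpc oW componentsI[OF xW]])
    then show "\<exists>U. openin (top_of_set Y) U \<and> x \<in> U \<and> U \<subseteq> G"
      using ccG[OF x] xW by (intro exI[of _ "?cc x"]) simp
  qed
  have JG: "J m x \<in> G" if x: "x \<in> G" for m x
  proof -
    have xW: "x \<in> ?W" and xY: "x \<in> Y"
      using x GW by auto
    have "\<not> ?cc (J m x) \<subseteq> orb K" if K: "compact K" "K \<subseteq> Y" for K
    proof
      assume a: "?cc (J m x) \<subseteq> orb K"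
      have "J (- m) ` ?cc (J m x) = ?cc (J (- m) (J m x))"
        by (rule J_image_component[OF _ _ JW[OF xW]]) (use JW in auto)
      then have "?cc x = J (- m) ` ?cc (J m x)"
        by (simp only: J_inverse(1)[OF xY])
      also have "\<dots> \<subseteq> J (- m) ` orb K"
        using a by (rule image_mono)
      also have "\<dots> = orb K"
        by (rule J_image_orb[OF K(2)])
      finally show False
        using x K by (simp add: G_def)
    qed
    then show ?thesis
      using JW[OF xW] by (simp add: G_def)
  qed
  have deepG: "x \<in> G" if x: "x \<in> Y - orb D3" for x
  proof -
    have "orb D2 \<subseteq> orb D3"
      using D3(3) by (intro orb_mono) blast
    then show ?thesis
      using x deep by (auto simp: G_def)
  qed
  \<comment> \<open>Cutting the invariant open set \<open>G\<close> out of \<open>D3\<close> leaves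
    a compact set whose translates cover exactly \<open>Y - G\<close>. Components bounded modulo the
    action thus belong to \<open>orb D'\<close>, and every component of the complement contains
    points off the orbit of any given compact set.\<close>
  define D' where "D' = D3 - G"
  have D': "compact D'" "D' \<subseteq> Y"
  proof -
    obtain G' where G': "open G'" "G = Y \<inter> G'"
      using oG unfolding openin_open by blast
    then have "D' = D3 - G'"
      using D3(2) by (auto simp: D'_def)
    then show "compact D'"
      using compact_diff[OF D3(1) G'(1)] by simp
    show "D' \<subseteq> Y"
      using D3(2) by (auto simp: D'_def)
  qed
  have orbD': "orb D' = Y - G"
  proof (intro equalityI subsetI)
    fix y assume y: "y \<in> orb D'"
    then obtain m d where d: "d \<in> D'" "y = J m d"
      unfolding orb_def by blast
    have dY: "d \<in> Y"
      using d(1) D'(2) by blast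
    have "y \<notin> G"
    proof
      assume "y \<in> G"
      then have "J (- m) y \<in> G"
        by (rule JG)
      then show False
        using d J_inverse(1)[OF dY] by (simp add: D'_def)
    qed
    then show "y \<in> Y - G"
      using J_closed[OF dY] d(2) by simp
  next
    fix y assume y: "y \<in> Y - G"
    then have "y \<in> orb D3"
      using deepG by blast
    then obtain m d where d: "d \<in> D3" "y = J m d"
      unfolding orb_def by blast
    then have "d \<notin> G"
      using JG[of d m] y by blast
    then have "d \<in> D'"
      using d(1) by (simp add: D'_def)
    then show "y \<in> orb D'"
      unfolding d(2) orb_def by blast
  qed
  then have compl: "Y - orb D' = G"
    using GY by blast
  have orbO2: "orb O2 \<subseteq> orb D'"
    using orb_mono[OF O2(3)] orb_subset[OF D2(2)] GW unfolding orbD' by blast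
  have C1orb: "C1 \<subseteq> orb D0"
    using D0(2) subset_orb[OF D0(3)] by blast
  obtain Np where Np: "\<forall>N\<ge>Np. \<forall>x p. is_path (Y - (\<Union>m\<in>{..N}. J m ` D')) x x p \<longrightarrow> homotopic_paths (Y - C1) p (\<lambda>_. x)"
    by (rule null_above[OF C1(1,2) D0(1,3) C1orb _ k tracks O2(1,2) D01 D' orbO2]) (use null0 in blast)
  obtain Nm where Nm: "\<forall>N\<ge>Nm. \<forall>x p. is_path (Y - (\<Union>m\<in>{..N}. J (- m) ` D')) x x p \<longrightarrow> homotopic_paths (Y - C1) p (\<lambda>_. x)"
    by (rule inv.null_above[OF C1(1,2) D0(1,3), unfolded orb_inverse, OF C1orb _ k inverse_tracks[OF D1(2) tracks] O2(1,2) D01 D' orbO2])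
      (use null0 in blast)
  obtain NC where NC: "NC \<ge> 0" "\<forall>m. J m ` D' \<inter> C1 \<noteq> {} \<longrightarrow> \<bar>m\<bar> \<le> NC"
    by (rule meeting_bound[OF D' C1(1,2)])
  \<comment> \<open>\<open>Np\<close> and \<open>Nm\<close> make loops in \<open>A\<close> and in
    \<open>B\<close> null off \<open>C1\<close>. \<open>NC\<close> bounds the indices of the
    translates of \<open>D'\<close> that meet \<open>C1\<close>, which puts \<open>C1\<close> inside
    \<open>E\<close>.\<close>
  define N where "N = max (max Np Nm) NC"
  have N: "Np \<le> N" "Nm \<le> N" "NC \<le> N" "0 \<le> N"
    using NC(1) by (auto simp: N_def)
  define A where "A = Y - (\<Union>m\<in>{..N}. J m ` D')"
  define B where "B = Y - (\<Union>m\<in>{..N}. J (- m) ` D')"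
  have A_iff: "y \<in> A \<longleftrightarrow> y \<in> Y \<and> (\<forall>m\<le>N. y \<notin> J m ` D')" for y
    by (auto simp: A_def)
  have B_iff: "y \<in> B \<longleftrightarrow> y \<in> Y \<and> (\<forall>m\<le>N. y \<notin> J (- m) ` D')" for y
    by (auto simp: B_def)
  have AB: "A \<inter> B = G"
  proof -
    have "y \<in> A \<inter> B \<longleftrightarrow> y \<in> Y - orb D'" for y
    proof
      assume y: "y \<in> A \<inter> B"
      have "y \<notin> J m ` D'" for m
      proof (cases "m \<le> N")
        case False
        then have "- m \<le> N"
          using N(4) by simp
        then have "y \<notin> J (- (- m)) ` D'"
          using y B_iff by blast
        then show ?thesis
          by simp
      qed (use y A_iff in blast)
      then show "y \<in> Y - orb D'"
        using y A_iff unfolding orb_def by blast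
    next
      assume "y \<in> Y - orb D'"
      then show "y \<in> A \<inter> B"
        unfolding orb_def Int_iff A_iff B_iff by blast
    qed
    then have "A \<inter> B = Y - orb D'"
      by auto
    then show ?thesis
      by (simp only: compl)
  qed
  have oA: "openin (top_of_set Y) A" and oB: "openin (top_of_set Y) B"
    using closedin_translates[OF D', of "{..N}"] inv.closedin_translates[OF D', of "{..N}"]
    by (simp_all add: A_def B_def closedin_def)
  define E where "E = Y - (A \<union> B)"
  have EY: "E \<subseteq> Y"
    by (auto simp: E_def)
  have compl_E: "Y - E = A \<union> B"
    using openin_imp_subset[OF oA] openin_imp_subset[OF oB] by (auto simp: E_def)
  obtain R where R: "R \<ge> 0" "\<forall>m. J m ` D' \<inter> D' \<noteq> {} \<longrightarrow> \<bar>m\<bar> \<le> R"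
    by (rule meeting_bound[OF D' D'])
  \<comment> \<open>A point of \<open>E\<close> lies in the translate of \<open>D'\<close> with some
    index \<open>m \<le> N\<close> and in that with index \<open>- n\<close> for some
    \<open>n \<le> N\<close>. Properness bounds \<open>m + n\<close> by \<open>R\<close>, which
    bounds \<open>m\<close> from below.\<close>
  have cE: "compact E"
  proof -
    let ?M = "\<Union>m\<in>{- N - R..N}. J m ` D'"
    have cM: "compact ?M"
      by (intro compact_UN J_compact D') simp
    have "E \<subseteq> ?M"
    proof
      fix y assume y: "y \<in> E"
      then have yY: "y \<in> Y"
        using EY by blast
      obtain m where m: "m \<le> N" "y \<in> J m ` D'"
        using y A_iff unfolding E_def by blast
      obtain n where n: "n \<le> N" "y \<in> J (- n) ` D'"
        using y B_iff unfolding E_def by blast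
      have a: "J (- m) y \<in> D'" "J n y \<in> D'"
        using m(2) n(2) J_image_iff[OF D'(2) yY, of m] J_image_iff[OF D'(2) yY, of "- n"] by auto
      have "J n y = J (m + n) (J (- m) y)"
        using J_add[OF yY, of "m + n" "- m"] by simp
      then have "J (m + n) ` D' \<inter> D' \<noteq> {}"
        using a by (metis disjoint_iff imageI)
      then have "\<bar>m + n\<bar> \<le> R"
        using R(2) by blast
      then have "m \<in> {- N - R..N}"
        using m(1) n(1) by auto
      then show "y \<in> ?M"
        using m(2) by blast
    qed
    moreover have "closedin (top_of_set Y) E"
      using openin_Un[OF oA oB] unfolding E_def by (simp add: closedin_diff)
    then obtain Z where "closed Z" "E = Y \<inter> Z"
      unfolding closedin_closed by blast
    moreover have "?M \<subseteq> Y"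
      using J_image_subset[OF D'(2)] by (intro UN_least)
    ultimately have "E = ?M \<inter> Z"
      by blast
    then show ?thesis
      using compact_Int_closed[OF cM \<open>closed Z\<close>] by simp
  qed
  have C1E: "C1 \<subseteq> E"
  proof
    fix y assume y: "y \<in> C1"
    have "D0 \<subseteq> O2"
      using D01 O2(2) by blast
    then have "y \<in> orb D'"
      using y C1orb orb_mono orbO2 by blast
    then obtain m where m: "y \<in> J m ` D'"
      unfolding orb_def by blast
    then have "\<bar>m\<bar> \<le> N"
      using NC(2) N(3) y by fastforce
    then have "m \<le> N" "- m \<le> N" "y \<in> J (- (- m)) ` D'"
      using m by auto
    then have "y \<notin> A" "y \<notin> B"
      using m A_iff B_iff by blast+
    then show "y \<in> E"
      using y C1(2) by (auto simp: E_def)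
  qed
  have CE: "C \<subseteq> E"
    using C1E C1(3) L(2) by blast
  have sub1: "Y - C1 \<subseteq> Y - C"
    using L(2) C1(3) by (meson Diff_mono order_refl subset_trans)
  have nullA: "homotopic_paths (Y - C) p (\<lambda>_. x)" if "is_path A x x p" for x p
    by (rule homotopic_paths_subset[OF Np[rule_format, OF N(1) that[unfolded A_def]] sub1])
  have nullB: "homotopic_paths (Y - C) p (\<lambda>_. x)" if "is_path B x x p" for x p
    by (rule homotopic_paths_subset[OF Nm[rule_format, OF N(2) that[unfolded B_def]] sub1])
  have pc: "path_component (Y - C) x y" if "x \<in> Y - E" "y \<in> Y - E" for x y
  proof -
    have "L \<subseteq> E"
      by (rule subset_trans[OF C1(3) C1E])
    then show ?thesis
      using L(4) that by (meson DiffD1 DiffD2 DiffI subsetD)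
  qed
  have oA': "openin (top_of_set (A \<union> B)) A" and oB': "openin (top_of_set (A \<union> B)) B"
    using openin_subset_trans[OF oA Un_upper1] openin_subset_trans[OF oB Un_upper2]
      openin_imp_subset[OF oA] openin_imp_subset[OF oB] by auto
  obtain x0 where x0: "x0 \<in> G"
  proof -
    \<comment> \<open>Otherwise \<open>A\<close> and \<open>B\<close> would be disjoint clopen parts
      of \<open>Y - E\<close>, both unbounded because they contain all sufficiently high or low
      translates of \<open>y0\<close>; this contradicts the single end.\<close>
    have "G \<noteq> {}"
    proof
      assume "G = {}"
      then have dis: "A \<inter> B = {}"
        using AB by simp
      have "(A \<union> B) - A = B" "(A \<union> B) - B = A"
        using dis by auto
      then have cl: "closedin (top_of_set (A \<union> B)) A" "closedin (top_of_set (A \<union> B)) B"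
        using oA' oB' by (auto simp: closedin_def)
      have sy: "compact {y0}" "{y0} \<subseteq> Y"
        using y0 by auto
      have not: "\<not> bounded_in Y X" if X: "\<forall>m>n. J (s * m) y0 \<in> X" and s: "s = 1 \<or> s = - 1" for X n s
      proof
        assume "bounded_in Y X"
        then obtain K where K: "compact K" "K \<subseteq> Y" "X \<subseteq> K"
          unfolding bounded_in_def by blast
        obtain r where r: "r \<ge> 0" "\<forall>m. J m ` {y0} \<inter> K \<noteq> {} \<longrightarrow> \<bar>m\<bar> \<le> r"
          by (rule meeting_bound[OF sy K(1,2)])
        define m where "m = max n r + 1"
        have "J (s * m) y0 \<in> K"
          using X K(3) unfolding m_def by force
        then have "\<bar>s * m\<bar> \<le> r"
          using r(2) by simp
        then show False
          using r(1) s by (auto simp: m_def)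
      qed
      obtain n1 where "\<forall>m>n1. J m ` {y0} \<subseteq> A"
        unfolding A_def by (rule far_above[OF D' sy])
      then have uA: "\<not> bounded_in Y A"
        using not[of n1 1 A] by simp
      obtain n2 where "\<forall>m>n2. J (- m) ` {y0} \<subseteq> B"
        unfolding B_def by (rule inv.far_above[OF D' sy])
      then have uB: "\<not> bounded_in Y B"
        using not[of n2 "- 1" B] by simp
      have "bounded_in Y A \<or> bounded_in Y B"
        by (rule one_end[OF cE EY, unfolded compl_E, OF oA' cl(1) oB' cl(2) dis])
      then show False
        using uA uB by blast
    qed
    then show thesis
      using that by blast
  qed
  have pcG: "path_component G x y" if x: "x \<in> G" and y: "y \<in> ?cc x" for x y
  proof -
    have "x \<in> ?cc x"
      using x GW by (simp add: subset_iff)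
    then have "connected_component G x y"
      using ccG[OF x] y connected_connected_component[of ?W x] unfolding connected_component_def by blast
    then show ?thesis
      using path_component_open_eq[OF lpc oG] by simp
  qed
  \<comment> \<open>Path components of \<open>G\<close> are open, so each contains a member of the
    dense sequence and can be numbered by the first one.\<close>
  define c where "c = (\<lambda>x. LEAST n. path_component G x (T n))"
  have c: "path_component G x (T (c x))" if x: "x \<in> G" for x
  proof -
    have "openin (top_of_set Y) (path_component_set G x)"
      by (rule locally_path_connected_2[OF lpc oG x])
    then obtain U where U: "open U" "path_component_set G x = Y \<inter> U"
      unfolding openin_open by blast
    have "x \<in> path_component_set G x"
      using x by (simp add: path_component_refl)
    then have xU: "x \<in> U" "x \<in> Y"
      using U(2) by blast+
    obtain e where e: "e > 0" "ball x e \<subseteq> U"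
      using U(1) xU(1) by (rule openE)
    obtain n where n: "dist x (T n) < e"
      using T(2) xU(2) e(1) by blast
    have "T n \<in> Y \<inter> U"
      using T(1) n e(2) by auto
    then have "path_component G x (T n)"
      using U(2) by blast
    then show ?thesis
      unfolding c_def by (rule LeastI)
  qed
  have c_eq: "c x = c y" if "path_component G x y" for x y
  proof -
    have "path_component G x z \<longleftrightarrow> path_component G y z" for z
      using that path_component_sym path_component_trans by meson
    then show ?thesis
      by (simp add: c_def)
  qed
  have c_conn: "path_component (A \<inter> B) x y" if "x \<in> A \<inter> B" "y \<in> A \<inter> B" "c x = c y" for x y
    using c[of x] c[of y] that path_component_sym path_component_trans unfolding AB by metis
  have c_loc: "loc_const_on (A \<inter> B) c"
    unfolding AB
  proof (rule loc_const_onI)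
    fix x assume x: "x \<in> G"
    have "openin (top_of_set Y) (path_component_set G x)"
      by (rule locally_path_connected_2[OF lpc oG x])
    then obtain U where U: "open U" "path_component_set G x = Y \<inter> U"
      unfolding openin_open by blast
    have "x \<in> path_component_set G x"
      using x by (simp add: path_component_refl)
    then have "x \<in> U"
      using U(2) by blast
    moreover have "c y = c x" if "y \<in> G \<inter> U" for y
    proof -
      have "y \<in> path_component_set G x"
        using that U(2) GY by blast
      then show ?thesis
        using c_eq[of x y] by simp
    qed
    ultimately show "\<exists>U. open U \<and> x \<in> U \<and> (\<forall>y\<in>G \<inter> U. c y = c x)"
      using U(1) by blast
  qed
  have main: "\<exists>u \<phi> \<psi>. u \<in> Y - C' \<and>
       \<phi> \<in> hom (fundamental_group (Y - E) u) (free_words :: (nat \<times> bool) list monoid) \<and>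
       \<psi> \<in> hom (free_words :: (nat \<times> bool) list monoid) (fundamental_group (Y - C) u) \<and>
       (\<forall>p. is_path (Y - E) u u p \<longrightarrow> \<psi> (\<phi> (loop_class (Y - E) p)) = loop_class (Y - C) p) \<and>
       (\<forall>w. \<exists>q. is_path (Y - C') u u q \<and> \<psi> w = loop_class (Y - C) q)"
    if C': "compact C'" "E \<subseteq> C'" "C' \<subseteq> Y" for C'
  proof -
    \<comment> \<open>Tracks off \<open>orb D5\<close> stay in \<open>A \<inter> B\<close> and avoid
      \<open>C'\<close>. Points off \<open>orb D4\<close> have such tracks in both directions, so
      they can be joined off \<open>C'\<close> in \<open>A\<close> and in \<open>B\<close>.\<close>
    define D5 where "D5 = C' \<union> D'"
    have D5: "compact D5" "D5 \<subseteq> Y" "D5 \<noteq> {}"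
      using C' D' compact_Un C1(4) C1E unfolding D5_def by auto
    obtain D4 k4 where D4: "compact D4" "D4 \<subseteq> Y" "D5 \<union> D5 \<subseteq> D4" and k4: "0 < k4"
      and tracks4: "\<forall>x\<in>Y - orb D4. path_component (Y - orb D5) x (J k4 x)"
      by (rule deep_translates[OF D5 D5(1,2)])
    have far: "\<exists>y\<in>G. path_component G x y \<and> y \<in> Y - orb D4" if x: "x \<in> G" for x
    proof -
      have "\<not> ?cc x \<subseteq> orb D4"
        using x D4(1,2) by (simp add: G_def)
      then obtain y where y: "y \<in> ?cc x" "y \<notin> orb D4"
        by blast
      have "y \<in> G"
        using ccG[OF x] y(1) by blast
      then show ?thesis
        using pcG[OF x y(1)] y(2) GY by blast
    qed
    obtain u where u: "u \<in> G" "u \<in> Y - orb D4"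
      using far[OF x0] by blast
    have "C' \<subseteq> D4"
      using D4(3) unfolding D5_def by blast
    then have uC': "u \<in> Y - C'"
      using u(2) subset_orb[OF D4(2)] by blast
    have sub: "C' \<union> D' \<subseteq> D5"
      by (simp add: D5_def)
    have far': "\<exists>y\<in>A \<inter> B. c y = c x \<and> (\<exists>p. is_path (A \<inter> (Y - C')) u y p) \<and> (\<exists>p. is_path (B \<inter> (Y - C')) u y p)"
      if x: "x \<in> A \<inter> B" for x
    proof -
      obtain y where y: "y \<in> G" "path_component G x y" "y \<in> Y - orb D4"
        using far x unfolding AB by blast
      have "path_component (A \<inter> (Y - C')) u y"
        unfolding A_def by (rule joined_above[OF D' C'(1,3) sub D5(2) k4 D4(2) tracks4 u(2) y(3)])
      moreover have "path_component (B \<inter> (Y - C')) u y"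
        unfolding B_def
        by (rule inv.joined_above[OF D' C'(1,3) sub D5(2) k4 D4(2), unfolded orb_inverse, OF inverse_tracks[OF D4(2) tracks4] u(2) y(3)])
      ultimately show ?thesis
        using y(1) c_eq[OF y(2)] unfolding AB path_component_is_path by auto
    qed
    have S: "A \<union> B \<subseteq> Y - C"
      using compl_E CE by blast
    have TS: "Y - C' \<subseteq> Y - C"
      using CE C'(2) by blast
    have uAB: "u \<in> A \<inter> B"
      using u(1) AB by simp
    have pcu: "path_component (Y - C) u x" if "x \<in> A \<union> B" for x
      using pc[of u x] that uAB unfolding compl_E by blast
    obtain \<phi> \<psi> where "\<phi> \<in> hom (fundamental_group (A \<union> B) u) (free_words :: (nat \<times> bool) list monoid)"
      "\<psi> \<in> hom (free_words :: (nat \<times> bool) list monoid) (fundamental_group (Y - C) u)"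
      "\<forall>p. is_path (A \<union> B) u u p \<longrightarrow> \<psi> (\<phi> (loop_class (A \<union> B) p)) = loop_class (Y - C) p"
      "\<forall>w. \<exists>q. is_path (Y - C') u u q \<and> \<psi> w = loop_class (Y - C) q"
      by (rule union_factors_through_free_group[OF oA' oB' S pcu nullA nullB uAB c_loc c_conn TS far'])
    then show ?thesis
      using uC' unfolding compl_E by blast
  qed
  show thesis
    by (rule that[OF cE CE EY]) (use main in blast)
qed

end

section \<open>The fundamental pro-group at infinity\<close>

abbreviation conj_path :: "(real \<Rightarrow> 'a::topological_space) \<Rightarrow> (real \<Rightarrow> 'a) \<Rightarrow> real \<Rightarrow> 'a" where
  "conj_path r p \<equiv> r +++ (p +++ reversepath r)"

lemma is_path_conj: "is_path S x y r \<Longrightarrow> is_path S y y p \<Longrightarrow> is_path S x x (conj_path r p)"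
  by (intro is_path_join is_path_reverse)

lemma conj_path_cong:
  assumes r: "is_path S x y r" and p: "is_path S y y p" and e: "homotopic_paths S p q"
  shows "homotopic_paths S (conj_path r p) (conj_path r q)"
proof -
  note rr = is_path_reverse[OF r]
  have "homotopic_paths S (p +++ reversepath r) (q +++ reversepath r)"
    by (rule homotopic_paths_cong_join[OF e is_path_refl_homotopic[OF rr] p rr])
  then show ?thesis
    by (rule homotopic_paths_cong_join[OF is_path_refl_homotopic[OF r] _ r is_path_join[OF p rr]])
qed

lemma conj_path_join:
  assumes a: "is_path S x y a" and b: "is_path S y z b" and p: "is_path S z z p"
  shows "homotopic_paths S (conj_path (a +++ b) p) (conj_path a (conj_path b p))"
proof -
  note ra = is_path_reverse[OF a] and rb = is_path_reverse[OF b]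
  have rev: "reversepath (a +++ b) = reversepath b +++ reversepath a"
    by (rule reversepath_joinpaths) (use a b in \<open>simp add: is_path_def\<close>)
  note pb = is_path_join[OF p rb] and ba = is_path_join[OF rb ra]
  note pba = is_path_join[OF p ba]
  have 1: "homotopic_paths S ((a +++ b) +++ (p +++ (reversepath b +++ reversepath a)))
      (a +++ (b +++ (p +++ (reversepath b +++ reversepath a))))"
    by (rule homotopic_paths_assoc_is_path[OF a b pba])
  have "homotopic_paths S (p +++ (reversepath b +++ reversepath a)) ((p +++ reversepath b) +++ reversepath a)"
    by (rule homotopic_paths_sym[OF homotopic_paths_assoc_is_path[OF p rb ra]])
  then have "homotopic_paths S (b +++ (p +++ (reversepath b +++ reversepath a))) (b +++ ((p +++ reversepath b) +++ reversepath a))"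
    by (rule homotopic_paths_cong_join[OF is_path_refl_homotopic[OF b] _ b pba])
  also have "homotopic_paths S \<dots> ((b +++ (p +++ reversepath b)) +++ reversepath a)"
    by (rule homotopic_paths_sym[OF homotopic_paths_assoc_is_path[OF b pb ra]])
  finally have 2: "homotopic_paths S (b +++ (p +++ (reversepath b +++ reversepath a)))
    ((b +++ (p +++ reversepath b)) +++ reversepath a)" .
  have "homotopic_paths S (a +++ (b +++ (p +++ (reversepath b +++ reversepath a))))
      (a +++ ((b +++ (p +++ reversepath b)) +++ reversepath a))"
    by (rule homotopic_paths_cong_join[OF is_path_refl_homotopic[OF a] 2 a is_path_join[OF b pba]])
  then show ?thesis
    unfolding rev by (rule homotopic_paths_trans[OF 1])
qed

lemma conj_path_reversepath:
  assumes r: "is_path S x y r" and p: "is_path S x x p"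
  shows "homotopic_paths S (conj_path r (conj_path (reversepath r) p)) p"
proof -
  note rr = is_path_reverse[OF r]
  have pr: "is_path S x y (p +++ r)"
    by (rule is_path_join[OF p r])
  have 0: "homotopic_paths S (r +++ ((reversepath r +++ (p +++ r)) +++ reversepath r))
      ((r +++ (reversepath r +++ (p +++ r))) +++ reversepath r)"
    by (rule homotopic_paths_sym[OF homotopic_paths_assoc_is_path[OF r is_path_join[OF rr pr] rr]])
  have c: "homotopic_paths S (r +++ (reversepath r +++ (p +++ r))) (p +++ r)"
    by (rule homotopic_paths_cancel_left'[OF r pr])
  have 1: "homotopic_paths S ((r +++ (reversepath r +++ (p +++ r))) +++ reversepath r) ((p +++ r) +++ reversepath r)"
    by (rule homotopic_paths_cong_join[OF c is_path_refl_homotopic[OF rr] is_path_join[OF r is_path_join[OF rr pr]] rr])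
  have 2: "homotopic_paths S ((p +++ r) +++ reversepath r) (p +++ (r +++ reversepath r))"
    by (rule homotopic_paths_assoc_is_path[OF p r rr])
  have 3: "homotopic_paths S (p +++ (r +++ reversepath r)) (p +++ (\<lambda>_. x))"
    by (rule homotopic_paths_cong_join[OF is_path_refl_homotopic[OF p] _ p is_path_join[OF r rr]])
      (use r in \<open>auto simp: is_path_def intro: homotopic_paths_right_inverse\<close>)
  have 4: "homotopic_paths S (p +++ (\<lambda>_. x)) p"
    using p homotopic_paths_right_const[of p S] by (auto simp: is_path_def)
  show ?thesis
    using homotopic_paths_trans[OF homotopic_paths_trans[OF homotopic_paths_trans[OF homotopic_paths_trans[OF 0 1] 2] 3] 4]
    by simp
qed

section \<open>The inverse sequence of a given exhaustion and ray\<close>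

context
  fixes Y :: "'a::metric_space set" and C :: "nat \<Rightarrow> 'a set" and \<omega> :: "real \<Rightarrow> 'a"
  assumes exh: "compact_exhaustion Y C" and ray: "adapted_ray Y C \<omega>"
begin

private lemma C_mono: "m \<le> n \<Longrightarrow> C m \<subseteq> C n"
  by (rule lift_Suc_mono_le) (use exh in \<open>simp_all add: compact_exhaustion_def\<close>)

private lemma C_compact: "compact (C n)" "C n \<subseteq> Y"
  using exh unfolding compact_exhaustion_def by auto

private lemma C_swallow: "compact K \<Longrightarrow> K \<subseteq> Y \<Longrightarrow> \<exists>n\<ge>m. K \<subseteq> C n"
proof -
  assume "compact K" "K \<subseteq> Y"
  then obtain n where "K \<subseteq> C n"
    using exh unfolding compact_exhaustion_def by blast
  then have "K \<subseteq> C (max m n)"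
    using C_mono[of n "max m n"] by auto
  then show ?thesis
    by (intro exI[of _ "max m n"]) simp
qed

private lemma ray_segment_path: "is_path (Y - C n) (\<omega> (real n)) (\<omega> (real (Suc n))) (ray_segment \<omega> n)"
proof -
  have "continuous_on {0..} \<omega>"
    using ray unfolding adapted_ray_def proper_ray_def by blast
  then have "continuous_on ((\<lambda>t. real n + t) ` {0..1}) \<omega>"
    by (rule continuous_on_subset) auto
  then have "continuous_on {0..1} (\<omega> \<circ> (\<lambda>t. real n + t))"
    by (intro continuous_on_compose continuous_intros)
  moreover have "ray_segment \<omega> n ` {0..1} \<subseteq> \<omega> ` {real n..real (Suc n)}"
    unfolding ray_segment_def by (rule image_subsetI, rule imageI) auto
  then have "ray_segment \<omega> n ` {0..1} \<subseteq> Y - C n"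
    by (rule subset_trans) (use ray in \<open>simp add: adapted_ray_def\<close>)
  ultimately show ?thesis
    unfolding is_path_def path_def path_image_def pathstart_def pathfinish_def
    by (simp add: ray_segment_def o_def add.commute)
qed

private lemma bond_eq: "pi1_at_infinity_bond Y C \<omega> n = conjugate_class (Y - C n) (ray_segment \<omega> n)"
  by (intro ext) (simp add: pi1_at_infinity_bond_def conjugate_class_def)

private lemma inverse_sequence_pi1: "inverse_sequence (pi1_at_infinity Y C \<omega>) (pi1_at_infinity_bond Y C \<omega>)"
  unfolding inverse_sequence_def pi1_at_infinity_def bond_eq
proof (intro allI conjI)
  fix n
  show "group (fundamental_group (Y - C n) (\<omega> (real n)))"
    by (rule group_fundamental_group[OF is_path_mem(1)[OF ray_segment_path]])
  show "conjugate_class (Y - C n) (ray_segment \<omega> n)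
      \<in> hom (fundamental_group (Y - C (Suc n)) (\<omega> (real (Suc n)))) (fundamental_group (Y - C n) (\<omega> (real n)))"
    by (rule conjugate_class_hom[OF ray_segment_path]) (use C_mono[of n "Suc n"] in auto)
qed

text \<open>Concatenated ray segments serve as \<open>r\<close>. Afterwards the composite bonding
  map is used only as conjugation by some path off \<open>C n\<close>.\<close>

private lemma bonding_loop_class:
  assumes "n \<le> m"
  obtains r where "is_path (Y - C n) (\<omega> (real n)) (\<omega> (real m)) r"
    "\<forall>p. is_path (Y - C m) (\<omega> (real m)) (\<omega> (real m)) p \<longrightarrow>
      bonding (pi1_at_infinity_bond Y C \<omega>) n m (loop_class (Y - C m) p) = loop_class (Y - C n) (conj_path r p)"
proof -
  have "\<exists>r. is_path (Y - C n) (\<omega> (real n)) (\<omega> (real m)) r \<and>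
    (\<forall>p. is_path (Y - C m) (\<omega> (real m)) (\<omega> (real m)) p \<longrightarrow>
      bonding (pi1_at_infinity_bond Y C \<omega>) n m (loop_class (Y - C m) p) = loop_class (Y - C n) (conj_path r p))"
    using assms
  proof (induction m rule: dec_induct)
    case base
    let ?x = "\<omega> (real n)"
    have x: "?x \<in> Y - C n"
      by (rule is_path_mem(1)[OF ray_segment_path])
    note c = is_path_const[OF x]
    have "loop_class (Y - C n) p = loop_class (Y - C n) (conj_path (\<lambda>_. ?x) p)" if p: "is_path (Y - C n) ?x ?x p" for p
    proof -
      have p': "path p" "path_image p \<subseteq> Y - C n" "pathstart p = ?x" "pathfinish p = ?x"
        using p by (auto simp: is_path_def)
      have 1: "homotopic_paths (Y - C n) (p +++ (\<lambda>_. ?x)) p"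
        using homotopic_paths_right_const[OF p'(1,2)] p'(4) by simp
      have "homotopic_paths (Y - C n) ((\<lambda>_. ?x) +++ (p +++ (\<lambda>_. ?x))) ((\<lambda>_. ?x) +++ p)"
        by (rule homotopic_paths_cong_join[OF is_path_refl_homotopic[OF c] 1 c is_path_join[OF p c]])
      moreover have "homotopic_paths (Y - C n) ((\<lambda>_. ?x) +++ p) p"
        using homotopic_paths_left_const[OF p'(1,2)] p'(3) by simp
      ultimately have "homotopic_paths (Y - C n) (conj_path (\<lambda>_. ?x) p) p"
        unfolding reversepath_const by (rule homotopic_paths_trans)
      then show ?thesis
        using loop_class_cong by metis
    qed
    then show ?case
      by (intro exI[of _ "\<lambda>_. ?x"]) (simp add: c)
  next
    case (step m)
    obtain r where r: "is_path (Y - C n) (\<omega> (real n)) (\<omega> (real m)) r"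
      and e: "\<forall>p. is_path (Y - C m) (\<omega> (real m)) (\<omega> (real m)) p \<longrightarrow>
        bonding (pi1_at_infinity_bond Y C \<omega>) n m (loop_class (Y - C m) p) = loop_class (Y - C n) (conj_path r p)"
      using step.IH by blast
    let ?s = "ray_segment \<omega> m"
    have sub: "Y - C m \<subseteq> Y - C n" "Y - C (Suc m) \<subseteq> Y - C m"
      using C_mono[of n m] C_mono[of m "Suc m"] step.hyps by auto
    note s = is_path_mono[OF ray_segment_path sub(1)]
    have "bonding (pi1_at_infinity_bond Y C \<omega>) n (Suc m) (loop_class (Y - C (Suc m)) p) = loop_class (Y - C n) (conj_path (r +++ ?s) p)"
      if p: "is_path (Y - C (Suc m)) (\<omega> (real (Suc m))) (\<omega> (real (Suc m))) p" for p
    proof -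
      note p' = is_path_mono[OF p sub(2)]
      have "bonding (pi1_at_infinity_bond Y C \<omega>) n (Suc m) (loop_class (Y - C (Suc m)) p)
        = bonding (pi1_at_infinity_bond Y C \<omega>) n m (conjugate_class (Y - C m) ?s (loop_class (Y - C (Suc m)) p))"
        by (simp only: bonding_Suc_right[OF step.hyps(1)] o_apply bond_eq)
      also have "\<dots> = bonding (pi1_at_infinity_bond Y C \<omega>) n m (loop_class (Y - C m) (conj_path ?s p))"
        by (simp only: conjugate_class_loop_class[OF ray_segment_path p sub(2)])
      also have "\<dots> = loop_class (Y - C n) (conj_path r (conj_path ?s p))"
        using e is_path_conj[OF ray_segment_path p'] by blast
      also have "\<dots> = loop_class (Y - C n) (conj_path (r +++ ?s) p)"
        by (rule loop_class_cong[OF homotopic_paths_sym[OF conj_path_join[OF r s is_path_mono[OF p' sub(1)]]]])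
      finally show ?thesis .
    qed
    then show ?case
      using is_path_join[OF r s] by blast
  qed
  then show thesis
    using that by blast
qed

context
  assumes joined: "\<And>K. compact K \<Longrightarrow> K \<subseteq> Y \<Longrightarrow> \<exists>L. compact L \<and> K \<subseteq> L \<and> L \<subseteq> Y \<and>
      (\<forall>x\<in>Y - L. \<forall>y\<in>Y - L. path_component (Y - K) x y)"
    and far: "\<And>C. compact C \<Longrightarrow> C \<subseteq> Y \<Longrightarrow> \<exists>E. compact E \<and> C \<subseteq> E \<and> E \<subseteq> Y \<and>
      (\<forall>C'. compact C' \<and> E \<subseteq> C' \<and> C' \<subseteq> Y \<longrightarrow> (\<exists>u \<phi> \<psi>. u \<in> Y - C' \<and>
       \<phi> \<in> hom (fundamental_group (Y - E) u) (free_words :: (nat \<times> bool) list monoid) \<and>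
       \<psi> \<in> hom (free_words :: (nat \<times> bool) list monoid) (fundamental_group (Y - C) u) \<and>
       (\<forall>p. is_path (Y - E) u u p \<longrightarrow> \<psi> (\<phi> (loop_class (Y - E) p)) = loop_class (Y - C) p) \<and>
       (\<forall>w. \<exists>q. is_path (Y - C') u u q \<and> \<psi> w = loop_class (Y - C) q)))"
begin

text \<open>A loop at stage \<open>m\<close> is conjugated to the far base point \<open>u\<close>,
  where the factorization replaces it, off \<open>C n\<close>, by a loop \<open>q\<close> off
  \<open>C l\<close>. Brought back along \<open>\<kappa>\<close> to the ray, \<open>q\<close>
  represents an element of stage \<open>k\<close> with the same image in stage
  \<open>n\<close>.\<close>

lemma semistable_pi1_at_infinity_sequence:
  "semistable (pi1_at_infinity Y C \<omega>) (pi1_at_infinity_bond Y C \<omega>)"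
proof (rule semistable_if_Mittag_Leffler[OF inverse_sequence_pi1])
  fix n
  let ?f = "pi1_at_infinity_bond Y C \<omega>"
  obtain E where E: "compact E" "C n \<subseteq> E" "E \<subseteq> Y"
    and fac: "\<forall>C'. compact C' \<and> E \<subseteq> C' \<and> C' \<subseteq> Y \<longrightarrow> (\<exists>u \<phi> \<psi>. u \<in> Y - C' \<and>
       \<phi> \<in> hom (fundamental_group (Y - E) u) (free_words :: (nat \<times> bool) list monoid) \<and>
       \<psi> \<in> hom (free_words :: (nat \<times> bool) list monoid) (fundamental_group (Y - C n) u) \<and>
       (\<forall>p. is_path (Y - E) u u p \<longrightarrow> \<psi> (\<phi> (loop_class (Y - E) p)) = loop_class (Y - C n) p) \<and>
       (\<forall>w. \<exists>q. is_path (Y - C') u u q \<and> \<psi> w = loop_class (Y - C n) q))"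
    using far[OF C_compact(1)[of n] C_compact(2)[of n]] by (elim exE conjE) (rule that)
  obtain m where m: "m \<ge> Suc n" "E \<subseteq> C m"
    using C_swallow[OF E(1,3), of "Suc n"] by blast
  have nm: "n \<le> m"
    using m(1) by simp
  show "\<exists>m>n. \<forall>k\<ge>m. bonding ?f n m ` carrier (pi1_at_infinity Y C \<omega> m) \<subseteq> bonding ?f n k ` carrier (pi1_at_infinity Y C \<omega> k)"
  proof (intro exI[of _ m] conjI allI impI image_subsetI)
    show "m > n"
      using m(1) by simp
    fix k A assume k: "m \<le> k" and A: "A \<in> carrier (pi1_at_infinity Y C \<omega> m)"
    let ?m = "\<omega> (real m)" and ?k = "\<omega> (real k)"
    obtain p where p: "A = loop_class (Y - C m) p" "is_path (Y - C m) ?m ?m p"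
      using A unfolding pi1_at_infinity_def carrier_fundamental_group by blast
    obtain r where r: "is_path (Y - C n) (\<omega> (real n)) ?m r"
      and br: "\<forall>p. is_path (Y - C m) ?m ?m p \<longrightarrow> bonding ?f n m (loop_class (Y - C m) p) = loop_class (Y - C n) (conj_path r p)"
      by (rule bonding_loop_class[OF nm])
    obtain r' where r': "is_path (Y - C m) ?m ?k r'"
      and br': "\<forall>p. is_path (Y - C k) ?k ?k p \<longrightarrow> bonding ?f m k (loop_class (Y - C k) p) = loop_class (Y - C m) (conj_path r' p)"
      by (rule bonding_loop_class[OF k])
    obtain L where L: "compact L" "C k \<subseteq> L" "L \<subseteq> Y" "\<forall>x\<in>Y - L. \<forall>y\<in>Y - L. path_component (Y - C k) x y"
      using joined[OF C_compact(1)[of k] C_compact(2)[of k]] by (elim exE conjE) (rule that)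
    \<comment> \<open>The stage \<open>l\<close> leaves room for the connecting path: a point of the
      ray and \<open>u\<close>, both off \<open>C l\<close>, are joined off
      \<open>C k\<close>.\<close>
    obtain l where l: "k \<le> l" "L \<subseteq> C l"
      using C_swallow[OF L(1,3), of k] by blast
    obtain r'' where r'': "is_path (Y - C k) ?k (\<omega> (real l)) r''"
      by (rule bonding_loop_class[OF l(1)])
    have mk: "C m \<subseteq> C k" and kl: "C k \<subseteq> C l"
      using C_mono[OF k] C_mono[OF l(1)] .
    have El: "E \<subseteq> C l"
      by (rule subset_trans[OF m(2) subset_trans[OF mk kl]])
    obtain u \<phi> \<psi> where u: "u \<in> Y - C l"
      and \<psi>: "\<forall>p. is_path (Y - E) u u p \<longrightarrow> \<psi> (\<phi> (loop_class (Y - E) p)) = loop_class (Y - C n) p"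
        "\<forall>w. \<exists>q. is_path (Y - C l) u u q \<and> (\<psi> :: (nat \<times> bool) list \<Rightarrow> _) w = loop_class (Y - C n) q"
      using fac[THEN spec, THEN mp, OF conjI[OF C_compact(1) conjI[OF El C_compact(2)]]]
      by (elim exE conjE) (rule that)
    have "\<omega> (real l) \<in> Y - C l"
      by (rule is_path_mem(1)[OF ray_segment_path])
    then have "path_component (Y - C k) (\<omega> (real l)) u"
      using L(4) u l(2) by (meson DiffD1 DiffD2 DiffI subsetD)
    then obtain d where "is_path (Y - C k) (\<omega> (real l)) u d"
      unfolding path_component_is_path by blast
    then have \<kappa>: "is_path (Y - C k) ?k u (r'' +++ d)"
      by (rule is_path_join[OF r''])
    define \<kappa> where "\<kappa> = r'' +++ d"
    note \<kappa> = \<kappa>[folded \<kappa>_def]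
    have sub: "Y - C k \<subseteq> Y - C m" "Y - C m \<subseteq> Y - E" "Y - E \<subseteq> Y - C n" "Y - C l \<subseteq> Y - C k"
      using mk kl m(2) E(2) by auto
    note sub' = subset_trans[OF sub(2) sub(3)]
    define \<eta> where "\<eta> = r' +++ \<kappa>"
    have \<eta>: "is_path (Y - E) ?m u \<eta>"
      unfolding \<eta>_def by (rule is_path_mono[OF is_path_join[OF r' is_path_mono[OF \<kappa> sub(1)]] sub(2)])
    have p': "is_path (Y - E) u u (conj_path (reversepath \<eta>) p)"
      by (rule is_path_conj[OF is_path_reverse[OF \<eta>] is_path_mono[OF p(2) sub(2)]])
    obtain q where q: "is_path (Y - C l) u u q"
      "\<psi> (\<phi> (loop_class (Y - E) (conj_path (reversepath \<eta>) p))) = loop_class (Y - C n) q"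
      using \<psi>(2) by blast
    have "loop_class (Y - C n) (conj_path (reversepath \<eta>) p) = loop_class (Y - C n) q"
      using \<psi>(1) p' q(2) by metis
    then have h: "homotopic_paths (Y - C n) (conj_path (reversepath \<eta>) p) q"
      using loop_class_eq_iff[OF is_path_mono[OF p' sub(3)]] by blast
    note qk = is_path_mono[OF q(1) sub(4)]
    note qm = is_path_mono[OF qk sub(1)] and km = is_path_mono[OF \<kappa> sub(1)]
    note qn = is_path_mono[OF qm sub'] and kn = is_path_mono[OF km sub']
    note \<eta>n = is_path_mono[OF \<eta> sub(3)] and pn = is_path_mono[OF p(2) sub'] and rn' = is_path_mono[OF r' sub']
    have s: "is_path (Y - C k) ?k ?k (conj_path \<kappa> q)"
      by (rule is_path_conj[OF \<kappa> qk])
    have t: "is_path (Y - C m) ?m ?m (conj_path r' (conj_path \<kappa> q))"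
      by (rule is_path_conj[OF r' is_path_conj[OF km qm]])
    have "bonding ?f n k (loop_class (Y - C k) (conj_path \<kappa> q))
        = bonding ?f n m (bonding ?f m k (loop_class (Y - C k) (conj_path \<kappa> q)))"
      by (simp only: bonding_comp[OF nm k])
    also have "\<dots> = bonding ?f n m (loop_class (Y - C m) (conj_path r' (conj_path \<kappa> q)))"
      by (simp only: br'[rule_format, OF s])
    also have "\<dots> = loop_class (Y - C n) (conj_path r (conj_path r' (conj_path \<kappa> q)))"
      by (rule br[rule_format, OF t])
    also have "\<dots> = loop_class (Y - C n) (conj_path r p)"
    proof (rule loop_class_cong, rule conj_path_cong[OF r is_path_mono[OF t sub']])
      have 1: "homotopic_paths (Y - C n) (conj_path r' (conj_path \<kappa> q)) (conj_path \<eta> q)"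
        unfolding \<eta>_def by (rule homotopic_paths_sym[OF conj_path_join[OF rn' kn qn]])
      have 2: "homotopic_paths (Y - C n) (conj_path \<eta> q) (conj_path \<eta> (conj_path (reversepath \<eta>) p))"
        by (rule conj_path_cong[OF \<eta>n qn homotopic_paths_sym[OF h]])
      show "homotopic_paths (Y - C n) (conj_path r' (conj_path \<kappa> q)) p"
        by (rule homotopic_paths_trans[OF homotopic_paths_trans[OF 1 2] conj_path_reversepath[OF \<eta>n pn]])
    qed
    also have "\<dots> = bonding ?f n m A"
      by (simp only: p(1) br[rule_format, OF p(2)])
    finally have "bonding ?f n m A = bonding ?f n k (loop_class (Y - C k) (conj_path \<kappa> q))"
      by (rule sym)
    moreover have "loop_class (Y - C k) (conj_path \<kappa> q) \<in> carrier (pi1_at_infinity Y C \<omega> k)"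
      unfolding pi1_at_infinity_def carrier_fundamental_group using s by blast
    ultimately show "bonding ?f n m A \<in> bonding ?f n k ` carrier (pi1_at_infinity Y C \<omega> k)"
      by (rule image_eqI)
  qed
qed

text \<open>The factorization at \<open>u\<close> is moved to the ray by conjugation: along
  \<open>reversepath \<eta>\<close> before \<open>\<phi>\<close> and along
  \<open>r +++ \<eta>\<close> after \<open>\<psi>\<close>. The two occurrences of
  \<open>\<eta>\<close> cancel, which leaves conjugation by \<open>r\<close>, the bonding
  map.\<close>

lemma pro_free_pi1_at_infinity_sequence:
  assumes inf: "infinite Y"
  shows "pro_free (pi1_at_infinity Y C \<omega>) (pi1_at_infinity_bond Y C \<omega>)"
proof -
  obtain g :: "nat \<Rightarrow> 'a" where g: "inj g"
    using infinite_countable_subset[OF inf] by blast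
  \<comment> \<open>Any injection of words into the element type of the groups will do; singletons
    of constant maps supply one, as \<open>Y\<close> is infinite.\<close>
  define e :: "(nat \<times> bool) list \<Rightarrow> (real \<Rightarrow> 'a) set" where "e = (\<lambda>w. {\<lambda>_. g (to_nat w)})"
  have e: "inj e"
  proof (rule injI)
    fix v w assume "e v = e w"
    then have "g (to_nat v) = g (to_nat w)"
      unfolding e_def by (metis singleton_inject)
    then have "to_nat v = to_nat w"
      by (rule injD[OF g])
    then show "v = w"
      by simp
  qed
  show ?thesis
  proof (rule pro_free_if_factors_through_free[OF inverse_sequence_pi1 free_group_encoded_free_words[OF e]])
    fix n
    let ?f = "pi1_at_infinity_bond Y C \<omega>"
    obtain E where E: "compact E" "C n \<subseteq> E" "E \<subseteq> Y"
      and fac: "\<forall>C'. compact C' \<and> E \<subseteq> C' \<and> C' \<subseteq> Y \<longrightarrow> (\<exists>u \<phi> \<psi>. u \<in> Y - C' \<and>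
         \<phi> \<in> hom (fundamental_group (Y - E) u) (free_words :: (nat \<times> bool) list monoid) \<and>
         \<psi> \<in> hom (free_words :: (nat \<times> bool) list monoid) (fundamental_group (Y - C n) u) \<and>
         (\<forall>p. is_path (Y - E) u u p \<longrightarrow> \<psi> (\<phi> (loop_class (Y - E) p)) = loop_class (Y - C n) p) \<and>
         (\<forall>w. \<exists>q. is_path (Y - C') u u q \<and> \<psi> w = loop_class (Y - C n) q))"
      using far[OF C_compact(1)[of n] C_compact(2)[of n]] by (elim exE conjE) (rule that)
    obtain L where L: "compact L" "E \<subseteq> L" "L \<subseteq> Y" "\<forall>x\<in>Y - L. \<forall>y\<in>Y - L. path_component (Y - E) x y"
      using joined[OF E(1,3)] by (elim exE conjE) (rule that)
    obtain m where m: "m \<ge> Suc n" "L \<subseteq> C m"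
      using C_swallow[OF L(1,3), of "Suc n"] by blast
    have nm: "n \<le> m" and Em: "E \<subseteq> C m"
      using m L(2) by auto
    let ?m = "\<omega> (real m)"
    obtain u \<phi> \<psi> where u: "u \<in> Y - C m"
      and \<phi>: "\<phi> \<in> hom (fundamental_group (Y - E) u) (free_words :: (nat \<times> bool) list monoid)"
      and \<psi>: "\<psi> \<in> hom (free_words :: (nat \<times> bool) list monoid) (fundamental_group (Y - C n) u)"
        "\<forall>p. is_path (Y - E) u u p \<longrightarrow> \<psi> (\<phi> (loop_class (Y - E) p)) = loop_class (Y - C n) p"
      using fac[THEN spec, THEN mp, OF conjI[OF C_compact(1) conjI[OF Em C_compact(2)]]]
      by (elim exE conjE) (rule that)
    obtain r where r: "is_path (Y - C n) (\<omega> (real n)) ?m r"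
      and br: "\<forall>p. is_path (Y - C m) ?m ?m p \<longrightarrow> bonding ?f n m (loop_class (Y - C m) p) = loop_class (Y - C n) (conj_path r p)"
      by (rule bonding_loop_class[OF nm])
    have "?m \<in> Y - C m"
      by (rule is_path_mem(1)[OF ray_segment_path])
    then have "path_component (Y - E) ?m u"
      using L(4) u m(2) by (meson DiffD1 DiffD2 DiffI subsetD)
    then obtain \<eta> where \<eta>: "is_path (Y - E) ?m u \<eta>"
      unfolding path_component_is_path by blast
    have sub: "Y - C m \<subseteq> Y - E" "Y - E \<subseteq> Y - C n"
      using Em E(2) by auto
    note r\<eta> = is_path_reverse[OF \<eta>] and \<eta>n = is_path_mono[OF \<eta> sub(2)]
    define \<phi>' where "\<phi>' = (e \<circ> (\<phi> \<circ> conjugate_class (Y - E) (reversepath \<eta>)))"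
    define \<psi>' where "\<psi>' = (conjugate_class (Y - C n) (r +++ \<eta>) \<circ> (\<psi> \<circ> inv_into UNIV e))"
    have "\<phi>' \<in> hom (pi1_at_infinity Y C \<omega> m) (encoded_free_words e)"
      unfolding \<phi>'_def pi1_at_infinity_def
      by (rule hom_compose[OF hom_compose[OF conjugate_class_hom[OF r\<eta> sub(1)] \<phi>] iso_imp_homomorphism[OF encode_iso[OF e]]])
    moreover have "\<psi>' \<in> hom (encoded_free_words e) (pi1_at_infinity Y C \<omega> n)"
      unfolding \<psi>'_def pi1_at_infinity_def
      by (rule hom_compose[OF hom_compose[OF decode_hom[OF e] \<psi>(1)] conjugate_class_hom[OF is_path_join[OF r \<eta>n] order_refl]])
    moreover have "\<psi>' (\<phi>' A) = bonding ?f n m A" if A: "A \<in> carrier (pi1_at_infinity Y C \<omega> m)" for A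
    proof -
      obtain p where p: "A = loop_class (Y - C m) p" "is_path (Y - C m) ?m ?m p"
        using A unfolding pi1_at_infinity_def carrier_fundamental_group by blast
      note pE = is_path_mono[OF p(2) sub(1)]
      note pn = is_path_mono[OF pE sub(2)]
      have p': "is_path (Y - E) u u (conj_path (reversepath \<eta>) p)"
        by (rule is_path_conj[OF r\<eta> pE])
      note pn' = is_path_mono[OF p' sub(2)]
      have "\<psi>' (\<phi>' A) = conjugate_class (Y - C n) (r +++ \<eta>) (\<psi> (\<phi> (conjugate_class (Y - E) (reversepath \<eta>) A)))"
        by (simp only: \<psi>'_def \<phi>'_def o_apply inv_into_f_f[OF e UNIV_I])
      also have "conjugate_class (Y - E) (reversepath \<eta>) A = loop_class (Y - E) (conj_path (reversepath \<eta>) p)"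
        unfolding p(1) by (rule conjugate_class_loop_class[OF r\<eta> p(2) sub(1)])
      also have "\<psi> (\<phi> \<dots>) = loop_class (Y - C n) (conj_path (reversepath \<eta>) p)"
        by (rule \<psi>(2)[rule_format, OF p'])
      also have "conjugate_class (Y - C n) (r +++ \<eta>) \<dots> = loop_class (Y - C n) (conj_path (r +++ \<eta>) (conj_path (reversepath \<eta>) p))"
        by (rule conjugate_class_loop_class[OF is_path_join[OF r \<eta>n] pn' order_refl])
      also have "\<dots> = loop_class (Y - C n) (conj_path r (conj_path \<eta> (conj_path (reversepath \<eta>) p)))"
        by (rule loop_class_cong[OF conj_path_join[OF r \<eta>n pn']])
      also have "\<dots> = loop_class (Y - C n) (conj_path r p)"
        by (rule loop_class_cong[OF conj_path_cong[OF r is_path_conj[OF \<eta>n pn'] conj_path_reversepath[OF \<eta>n pn]]])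
      also have "\<dots> = bonding ?f n m A"
        by (simp only: p(1) br[rule_format, OF p(2)])
      finally show ?thesis .
    qed
    moreover have "m > n"
      using m(1) by simp
    ultimately show "\<exists>m>n. \<exists>\<phi> \<psi>. \<phi> \<in> hom (pi1_at_infinity Y C \<omega> m) (encoded_free_words e) \<and>
        \<psi> \<in> hom (encoded_free_words e) (pi1_at_infinity Y C \<omega> n) \<and>
        (\<forall>x\<in>carrier (pi1_at_infinity Y C \<omega> m). \<psi> (\<phi> x) = bonding ?f n m x)"
      by blast
  qed
qed

end

end

section \<open>Infinite cyclic groups of covering transformations\<close>

lemma simply_connected_path_connected:
  fixes Y :: "'a::topological_space set"
  assumes "simply_connected Y"
  shows "path_connected Y"
  unfolding path_connected_component
proof (intro ballI)
  fix x y assume xy: "x \<in> Y" "y \<in> Y"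
  have "homotopic_loops Y (\<lambda>_. x) (\<lambda>_. y)"
    using assms xy unfolding simply_connected_def by simp
  then show "path_component Y x y"
    using homotopic_loops_imp_path_component_value[of Y "\<lambda>_. x" "\<lambda>_. y" 0] by simp
qed

lemma simply_connected_homotopic_paths:
  fixes Y :: "'a::topological_space set"
  assumes Y: "simply_connected Y" and p: "is_path Y x y p" and q: "is_path Y x y q"
  shows "homotopic_paths Y p q"
proof (rule null_loops_imp_homotopic[OF _ order_refl p q])
  fix z r assume r: "is_path Y z z r"
  then have "homotopic_loops Y r (\<lambda>_. z)"
    using Y is_path_mem(1)[OF r] unfolding simply_connected_def is_path_def by simp
  then show "homotopic_paths Y r (\<lambda>_. z)"
    using homotopic_loops_const_imp_homotopic_paths r unfolding is_path_def by metis
qed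

text \<open>The group consists of the powers of \<open>restrict j Y\<close>, and since it is
  infinite they are pairwise distinct. Freeness, which is stated for group elements, thereby becomes
  an equation of exponents.\<close>

lemma cyclic_covering_action:
  fixes Y :: "'a::metric_space set"
  assumes j: "homeomorphic_map (top_of_set Y) (top_of_set Y) j"
    and inf: "infinite (carrier (group_generated_by Y j))"
    and cov: "acts_by_covering_transformations (group_generated_by Y j) Y (\<lambda>g. g)"
  obtains J :: "int \<Rightarrow> 'a \<Rightarrow> 'a" where "carrier (group_generated_by Y j) = range J"
    "\<forall>y\<in>Y. J 0 y = y" "\<forall>m n. \<forall>y\<in>Y. J (m + n) y = J m (J n y)" "\<forall>m. \<forall>y\<in>Y. J m y \<in> Y"
    "\<forall>m. continuous_on Y (J m)" "\<forall>m n. \<forall>y\<in>Y. J m y = J n y \<longrightarrow> m = n"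
proof -
  interpret B: group "BijGroup Y"
    by (rule group_BijGroup)
  define j' where "j' = restrict j Y"
  have "inj_on j Y" "j ` Y = Y"
    using homeomorphic_imp_injective_map[OF j] homeomorphic_imp_surjective_map[OF j] by auto
  then have "bij_betw j' Y Y"
    unfolding j'_def bij_betw_def by (simp add: inj_on_restrict_eq)
  then have j': "j' \<in> carrier (BijGroup Y)"
    unfolding BijGroup_def Bij_def j'_def by simp
  define J where "J = (\<lambda>m::int. j' [^]\<^bsub>BijGroup Y\<^esub> m)"
  have range: "carrier (group_generated_by Y j) = range J"
    unfolding group_generated_by_def J_def j'_def[symmetric] by (rule B.carrier_subgroup_generated_by_singleton[OF j'])
  have Bij: "J m \<in> Bij Y" for m
  proof -
    have "J m \<in> carrier (BijGroup Y)"
      unfolding J_def by (rule B.int_pow_closed[OF j'])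
    then show ?thesis
      by (simp add: BijGroup_def)
  qed
  have closed: "J m y \<in> Y" if "y \<in> Y" for m y
    using Bij_imp_funcset[OF Bij[of m]] that by (rule funcset_mem)
  have zero: "J 0 = (\<lambda>y\<in>Y. y)"
  proof -
    have "J 0 = \<one>\<^bsub>BijGroup Y\<^esub>"
      unfolding J_def by (rule int_pow_0)
    then show ?thesis
      by (simp add: BijGroup_def)
  qed
  have add: "J (m + n) y = J m (J n y)" if y: "y \<in> Y" for m n y
  proof -
    have "J (m + n) = J m \<otimes>\<^bsub>BijGroup Y\<^esub> J n"
      unfolding J_def by (rule B.int_pow_mult[OF j'])
    also have "\<dots> = compose Y (J m) (J n)"
      using Bij by (simp add: BijGroup_def)
    finally show ?thesis
      using y by (simp add: compose_def)
  qed
  have "infinite (carrier (subgroup_generated (BijGroup Y) {j'}))"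
    using inf unfolding group_generated_by_def j'_def .
  then have "\<forall>m n. J m = J n \<longrightarrow> m = n"
    unfolding J_def by (rule iffD1[OF B.infinite_cyclic_subgroup_int[OF j']])
  then have inj: "m = n" if "J m = J n" for m n
    using that by blast
  have mem: "J m \<in> carrier (group_generated_by Y j)" for m
    unfolding range by simp
  have "continuous_on Y (J m)" for m
  proof -
    have "homeomorphic_map (top_of_set Y) (top_of_set Y) (J m)"
      using cov mem unfolding acts_by_covering_transformations_def by blast
    then show ?thesis
      using homeomorphic_imp_continuous_map[of "top_of_set Y" "top_of_set Y" "J m"] by (simp add: continuous_map_in_subtopology)
  qed
  moreover have "m = n" if y: "y \<in> Y" and e: "J m y = J n y" for m n y
  proof -
    have "J (m - n) (J n y) = J n y"
      using add[OF y, of "m - n" n] e by simp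
    then have "J (m - n) = \<one>\<^bsub>group_generated_by Y j\<^esub>"
      using cov mem closed[OF y] unfolding acts_by_covering_transformations_def by blast
    also have "\<dots> = J 0"
      by (simp add: group_generated_by_def zero BijGroup_def)
    finally show ?thesis
      using inj by fastforce
  qed
  ultimately show thesis
    using that[OF range] zero add closed by simp
qed

text \<open>If infinitely many translates of \<open>K\<close> met \<open>K\<close>, some points
  \<open>x i\<close> and their translates by distinct \<open>s i\<close> would subconverge to
  \<open>z\<close> and \<open>z'\<close>. As the orbit space is Hausdorff, \<open>z' = J a z\<close>
  for some \<open>a\<close>. Eventually \<open>x i\<close> and its translate by
  \<open>s i - a\<close> lie in one sheet around \<open>z\<close>, where the projection is
  injective; by freeness \<open>s i = a\<close>, against distinctness.\<close>

lemma covering_action_proper: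
  fixes Y :: "'a::metric_space set" and J :: "int \<Rightarrow> 'a \<Rightarrow> 'a"
  assumes cov: "acts_by_covering_transformations G Y (\<lambda>g. g)" and range: "carrier G = range J"
    and zero: "\<forall>y\<in>Y. J 0 y = y" and add: "\<forall>m n. \<forall>y\<in>Y. J (m + n) y = J m (J n y)"
    and closed: "\<forall>m. \<forall>y\<in>Y. J m y \<in> Y" and cont: "\<forall>m. continuous_on Y (J m)"
    and free: "\<forall>m n. \<forall>y\<in>Y. J m y = J n y \<longrightarrow> m = n" and K: "compact K" "K \<subseteq> Y"
  shows "finite {m. J m ` K \<inter> K \<noteq> {}}"
proof (rule ccontr)
  assume "infinite {m. J m ` K \<inter> K \<noteq> {}}"
  then obtain s :: "nat \<Rightarrow> int" where s: "inj s" "range s \<subseteq> {m. J m ` K \<inter> K \<noteq> {}}"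
    using infinite_countable_subset by blast
  have "\<exists>x. x \<in> K \<and> J (s i) x \<in> K" for i
    using s(2) by blast
  then obtain x where x: "\<And>i. x i \<in> K" "\<And>i. J (s i) (x i) \<in> K"
    by metis
  let ?O = "orbit G (\<lambda>g. g)" and ?Q = "orbit_space G Y (\<lambda>g. g)"
  have cp: "covering_projection (top_of_set Y) ?O ?Q" and Q: "metrizable_space ?Q"
    using cov unfolding acts_by_covering_transformations_def by blast+
  have orbit: "?O y = {J m y | m. True}" for y
    unfolding orbit_def range by auto
  have orbit_J: "?O (J m y) = ?O y" if y: "y \<in> Y" for m y
  proof -
    have 1: "J k (J m y) = J (k + m) y" for k
      using add y by simp
    have 2: "J k y = J (k - m) (J m y)" for k
      using add[rule_format, OF y, of "k - m" m] by simp
    show ?thesis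
    proof (intro equalityI subsetI)
      fix w assume "w \<in> ?O (J m y)"
      then obtain k where "w = J k (J m y)"
        unfolding orbit by blast
      then have "w = J (k + m) y"
        by (simp only: 1)
      then show "w \<in> ?O y"
        unfolding orbit by blast
    next
      fix w assume "w \<in> ?O y"
      then obtain k where "w = J k y"
        unfolding orbit by blast
      then have "w = J (k - m) (J m y)"
        using 2[of k] by simp
      then show "w \<in> ?O (J m y)"
        unfolding orbit by blast
    qed
  qed
  have top: "?O y \<in> topspace ?Q" if "y \<in> Y" for y
    using cp that unfolding covering_projection_def by auto
  let ?KK = "K \<times> K"
  have "seq_compact ?KK"
    using compact_Times[OF K(1) K(1)] compact_eq_seq_compact_metric by blast
  moreover have "\<forall>i. (x i, J (s i) (x i)) \<in> ?KK"
    using x by simp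
  ultimately obtain l r where l: "l \<in> ?KK" "strict_mono r" "((\<lambda>i. (x i, J (s i) (x i))) \<circ> r) \<longlonglongrightarrow> l"
    by (rule seq_compactE)
  define z z' where "z = fst l" and "z' = snd l"
  have z: "z \<in> Y" "z' \<in> Y"
    using l(1) K(2) unfolding z_def z'_def by auto
  have lim: "(\<lambda>i. x (r i)) \<longlonglongrightarrow> z" "(\<lambda>i. J (s (r i)) (x (r i))) \<longlonglongrightarrow> z'"
    using tendsto_fst[OF l(3)] tendsto_snd[OF l(3)] by (simp_all add: z_def z'_def o_def)
  have xY: "x i \<in> Y" "J (s i) (x i) \<in> Y" for i
    using x K(2) by auto
  have ev: "\<forall>\<^sub>F i in sequentially. f i \<in> U" if U: "openin (top_of_set Y) U" "a \<in> U" and f: "f \<longlonglongrightarrow> a" "\<And>i. f i \<in> Y"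
    for U a and f :: "nat \<Rightarrow> 'a"
  proof -
    obtain V where V: "open V" "U = Y \<inter> V"
      using U(1) unfolding openin_open by blast
    then have "\<forall>\<^sub>F i in sequentially. f i \<in> V"
      using topological_tendstoD[OF f(1)] U(2) by blast
    then show ?thesis
      using f(2) V(2) by simp
  qed
  have "?O z = ?O z'"
  proof (rule ccontr)
    assume neq: "?O z \<noteq> ?O z'"
    obtain U U' where U: "openin ?Q U" "openin ?Q U'" "?O z \<in> U" "?O z' \<in> U'" "disjnt U U'"
      using metrizable_imp_Hausdorff_space[OF Q, unfolded Hausdorff_space_def, rule_format, OF conjI[OF top[OF z(1)] conjI[OF top[OF z(2)] neq]]]
      by (elim exE conjE) (rule that)
    have o: "openin (top_of_set Y) {y \<in> Y. ?O y \<in> U}" "openin (top_of_set Y) {y \<in> Y. ?O y \<in> U'}"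
      using U(1,2) unfolding openin_orbit_space by auto
    have "\<forall>\<^sub>F i in sequentially. x (r i) \<in> {y \<in> Y. ?O y \<in> U}"
      by (rule ev[OF o(1) _ lim(1) xY(1)]) (use z U(3) in simp)
    moreover have "\<forall>\<^sub>F i in sequentially. J (s (r i)) (x (r i)) \<in> {y \<in> Y. ?O y \<in> U'}"
      by (rule ev[OF o(2) _ lim(2) xY(2)]) (use z U(4) in simp)
    ultimately have "\<forall>\<^sub>F i in sequentially. False"
      by eventually_elim (use orbit_J[OF xY(1)] U(5) in \<open>auto simp: disjnt_iff\<close>)
    then show False
      by simp
  qed
  moreover have "z' \<in> ?O z'"
    unfolding orbit using zero z(2) by (metis (mono_tags, lifting) mem_Collect_eq)
  ultimately obtain a where a: "z' = J a z"
    unfolding orbit by blast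
  have a': "J (- a) (J a y) = y" if "y \<in> Y" for y
    using add[rule_format, OF that, of "- a" a] zero that by simp
  obtain U \<V> where U: "?O z \<in> U" "\<Union>\<V> = {y \<in> Y. ?O y \<in> U}" "\<forall>V\<in>\<V>. openin (top_of_set Y) V"
    and hom: "\<forall>V\<in>\<V>. homeomorphic_map (subtopology (top_of_set Y) V) (subtopology ?Q U) ?O"
  proof -
    have "\<forall>b\<in>topspace ?Q. \<exists>U. b \<in> U \<and> openin ?Q U \<and>
        (\<exists>\<V>. \<Union>\<V> = {x \<in> Y. ?O x \<in> U} \<and> (\<forall>V\<in>\<V>. openin (top_of_set Y) V) \<and> pairwise disjnt \<V> \<and>
             (\<forall>V\<in>\<V>. homeomorphic_map (subtopology (top_of_set Y) V) (subtopology ?Q U) ?O))"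
      using cp unfolding covering_projection_def by simp
    from bspec[OF this top[OF z(1)]] show thesis
      by (elim exE conjE) (rule that)
  qed
  obtain V where V: "V \<in> \<V>" "z \<in> V"
    using U(1,2) z(1) by blast
  have oV: "openin (top_of_set Y) V" and VY: "V \<subseteq> Y"
    using U(3) V(1) openin_imp_subset by blast+
  have injV: "inj_on ?O V"
    using homeomorphic_imp_injective_map[OF hom[rule_format, OF V(1)]] VY by (simp add: Int_absorb1)
  have "(\<lambda>i. J (- a) (J (s (r i)) (x (r i)))) \<longlonglongrightarrow> J (- a) z'"
    using continuous_on_tendsto_compose[OF cont[rule_format, of "- a"] lim(2) z(2)] xY(2) by simp
  then have lim3: "(\<lambda>i. J (- a) (J (s (r i)) (x (r i)))) \<longlonglongrightarrow> z"
    using a a'[OF z(1)] by simp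
  have JY: "J (- a) (J (s (r i)) (x (r i))) \<in> Y" for i
    using closed xY(2) by simp
  have "\<forall>\<^sub>F i in sequentially. x (r i) \<in> V"
    by (rule ev[OF oV V(2) lim(1) xY(1)])
  moreover have "\<forall>\<^sub>F i in sequentially. J (- a) (J (s (r i)) (x (r i))) \<in> V"
    by (rule ev[OF oV V(2) lim3 JY])
  ultimately have "\<forall>\<^sub>F i in sequentially. s (r i) = a"
  proof eventually_elim
    case (elim i)
    have "?O (J (- a) (J (s (r i)) (x (r i)))) = ?O (x (r i))"
      by (simp only: orbit_J[OF xY(2)] orbit_J[OF xY(1)])
    then have "J (- a) (J (s (r i)) (x (r i))) = x (r i)"
      by (rule inj_onD[OF injV _ elim(2,1)])
    then have "J (- a + s (r i)) (x (r i)) = J 0 (x (r i))"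
      using add[rule_format, OF xY(1)[of "r i"], of "- a" "s (r i)"] zero xY(1)[of "r i"] by simp
    then have "- a + s (r i) = 0"
      using free[rule_format, OF xY(1)[of "r i"]] by blast
    then show ?case
      by simp
  qed
  then obtain N where N: "\<forall>i\<ge>N. s (r i) = a"
    unfolding eventually_sequentially by blast
  have "s (r N) = s (r (Suc N))"
    using N by simp
  then have "r N = r (Suc N)"
    by (rule injD[OF s(1)])
  then show False
    using strict_monoD[OF l(2), of N "Suc N"] by simp
qed

lemma coaxial_null_loops:
  fixes Y :: "'a::metric_space set"
  assumes "coaxial Y j" "compact C" "C \<subseteq> Y"
  obtains D where "compact D" "C \<subseteq> D" "D \<subseteq> Y"
    "\<forall>x p. is_path (Y - translates (group_generated_by Y j) D) x x p \<longrightarrow> homotopic_paths (Y - C) p (\<lambda>_. x)"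
proof -
  obtain D where D: "compact D" "C \<subseteq> D" "D \<subseteq> Y"
    and null: "\<forall>p. path p \<and> pathfinish p = pathstart p \<and> path_image p \<subseteq> Y - translates (group_generated_by Y j) D \<longrightarrow>
      (\<exists>a. homotopic_loops (Y - C) p (\<lambda>_. a))"
    using assms(1)[unfolded coaxial_def, THEN spec, THEN mp, OF conjI[OF assms(2,3)]] by (elim exE conjE) (rule that)
  have "homotopic_paths (Y - C) p (\<lambda>_. x)" if p: "is_path (Y - translates (group_generated_by Y j) D) x x p" for x p
  proof -
    have p': "path p \<and> pathfinish p = pathstart p \<and> path_image p \<subseteq> Y - translates (group_generated_by Y j) D" "pathstart p = x"
      using p by (simp_all add: is_path_def)
    obtain a where "homotopic_loops (Y - C) p (\<lambda>_. a)"
      using null[THEN spec, THEN mp, OF p'(1)] by (elim exE)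
    then show ?thesis
      using homotopic_loops_const_imp_homotopic_paths p'(2) by metis
  qed
  then show thesis
    using that D by blast
qed

theorem corollary0p2:
  fixes Y :: "'a::metric_space set" and j :: "'a \<Rightarrow> 'a"
  assumes "separable_space (top_of_set Y)"
    and "simply_connected Y"
    and "locally compact Y"
    and "ANR_space (top_of_set Y)"
    and "\<exists>e. ends Y = {e}"
    and "homeomorphic_map (top_of_set Y) (top_of_set Y) j"
    and "infinite (carrier (group_generated_by Y j))"
    and "acts_by_covering_transformations (group_generated_by Y j) Y (\<lambda>g. g)"
    and "coaxial Y j"
  shows "semistable_pi1_at_infinity Y \<and> pro_free_pi1_at_infinity Y"
proof -
  note sep = assms(1) and sconn = assms(2) and lc = assms(3) and ANR = assms(4)
    and homeo = assms(6) and inf = assms(7) and cov = assms(8) and coax = assms(9)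
  obtain e where e: "ends Y = {e}"
    using assms(5) by blast
  have lpc: "locally path_connected Y"
    by (rule ANR_space_locally_path_connected[OF ANR])
  have pc: "path_connected Y" and con: "connected Y"
    using simply_connected_path_connected[OF sconn] path_connected_imp_connected by blast+
  obtain J :: "int \<Rightarrow> 'a \<Rightarrow> 'a" where J: "carrier (group_generated_by Y j) = range J"
    "\<forall>y\<in>Y. J 0 y = y" "\<forall>m n. \<forall>y\<in>Y. J (m + n) y = J m (J n y)" "\<forall>m. \<forall>y\<in>Y. J m y \<in> Y"
    "\<forall>m. continuous_on Y (J m)" "\<forall>m n. \<forall>y\<in>Y. J m y = J n y \<longrightarrow> m = n"
    by (rule cyclic_covering_action[OF homeo inf cov])
  \<comment> \<open>The given exhaustion is what the arguments about ends use, and the ray supplies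
    a point of \<open>Y\<close>.\<close>
  have result: "semistable (pi1_at_infinity Y C \<omega>) (pi1_at_infinity_bond Y C \<omega>) \<and>
      pro_free (pi1_at_infinity Y C \<omega>) (pi1_at_infinity_bond Y C \<omega>)"
    if exh: "compact_exhaustion Y C" and ray: "adapted_ray Y C \<omega>" for C \<omega>
  proof -
    have joined: "\<exists>L. compact L \<and> K \<subseteq> L \<and> L \<subseteq> Y \<and> (\<forall>x\<in>Y - L. \<forall>y\<in>Y - L. path_component (Y - K) x y)"
      if K: "compact K" "K \<subseteq> Y" for K
      by (rule one_end_imp_joined_outside[OF lpc con lc exh e K]) blast
    interpret Z_space Y J
    proof
      show "\<exists>W. openin (top_of_set Y) W \<and> y \<in> W \<and> W \<subseteq> V \<and> (\<forall>x p. is_path W x x p \<longrightarrow> homotopic_paths V p (\<lambda>_. x))"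
        if "openin (top_of_set Y) V" "y \<in> V" for V y
        by (rule ANR_space_local_null_loops[OF ANR that]) blast
      show "homotopic_paths Y p q" if "is_path Y x y p" "is_path Y x y q" for x y p q
        by (rule simply_connected_homotopic_paths[OF sconn that])
      show "bounded_in Y U \<or> bounded_in Y V"
        if "compact K" "K \<subseteq> Y" "openin (top_of_set (Y - K)) U" "closedin (top_of_set (Y - K)) U"
          "openin (top_of_set (Y - K)) V" "closedin (top_of_set (Y - K)) V" "U \<inter> V = {}" for K U V
        by (rule one_end_imp_bounded[OF lpc con lc exh e that])
      show "finite {m. J m ` K \<inter> K \<noteq> {}}" if "compact K" "K \<subseteq> Y" for K
        by (rule covering_action_proper[OF cov J that])
      show "\<exists>L. compact L \<and> K \<subseteq> L \<and> L \<subseteq> Y \<and> (\<forall>x\<in>Y - L. \<forall>y\<in>Y - L. path_component (Y - K) x y)"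
        if "compact K" "K \<subseteq> Y" for K
        by (rule joined[OF that])
      show "locally path_connected Y" "locally compact Y" "path_connected Y"
        by (rule lpc lc pc)+
    qed (use J in auto)
    have trans: "translates (group_generated_by Y j) D = orb D" for D
      unfolding translates_def orb_def J(1) by simp
    obtain y0 where y0: "y0 \<in> Y"
    proof -
      have "\<omega> 0 \<in> Y"
        using ray unfolding adapted_ray_def proper_ray_def by auto
      then show thesis
        by (rule that)
    qed
    obtain T :: "nat \<Rightarrow> 'a" where T: "range T \<subseteq> Y" "\<forall>x\<in>Y. \<forall>e>0. \<exists>n. dist x (T n) < e"
      by (rule separable_dense_sequence[OF sep]) (use y0 in auto)
    have coax': "\<exists>D. compact D \<and> C \<subseteq> D \<and> D \<subseteq> Y \<and> (\<forall>x p. is_path (Y - orb D) x x p \<longrightarrow> homotopic_paths (Y - C) p (\<lambda>_. x))"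
      if "compact C" "C \<subseteq> Y" for C
      by (rule coaxial_null_loops[OF coax that, unfolded trans]) blast
    have far: "\<exists>E. compact E \<and> C \<subseteq> E \<and> E \<subseteq> Y \<and>
      (\<forall>C'. compact C' \<and> E \<subseteq> C' \<and> C' \<subseteq> Y \<longrightarrow> (\<exists>u \<phi> \<psi>. u \<in> Y - C' \<and>
       \<phi> \<in> hom (fundamental_group (Y - E) u) (free_words :: (nat \<times> bool) list monoid) \<and>
       \<psi> \<in> hom (free_words :: (nat \<times> bool) list monoid) (fundamental_group (Y - C) u) \<and>
       (\<forall>p. is_path (Y - E) u u p \<longrightarrow> \<psi> (\<phi> (loop_class (Y - E) p)) = loop_class (Y - C) p) \<and>
       (\<forall>w. \<exists>q. is_path (Y - C') u u q \<and> \<psi> w = loop_class (Y - C) q)))"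
      if C: "compact C" "C \<subseteq> Y" for C
      by (rule far_loops_factor_through_free_group[OF _ T y0 C], erule (1) coax') (intro exI conjI)
    have "inj (\<lambda>m. J m y0)"
      using J(6) y0 by (intro injI) blast
    then have "infinite (range (\<lambda>m. J m y0))"
      by (simp add: finite_image_iff infinite_UNIV_int)
    moreover have "range (\<lambda>m. J m y0) \<subseteq> Y"
      using J(4) y0 by blast
    ultimately have "infinite Y"
      using infinite_super by blast
    then show ?thesis
      using semistable_pi1_at_infinity_sequence[OF exh ray joined far]
        pro_free_pi1_at_infinity_sequence[OF exh ray joined far] by simp
  qed
  then show ?thesis
    unfolding semistable_pi1_at_infinity_def pro_free_pi1_at_infinity_def by simp
qed

end
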